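(* Let $m\in\mathbb N$ and let $\mathcal G=\{[a_i,b_i),h_i,\Gamma_i;\ i\le m\}$ be a differential grid of dimension $m$. Let $f^n=(f^n_1,\dots,f^n_m)$, $n\ge1$, and $f=(f_1,\dots,f_m)$ be $\mathbb R^m$-valued random vectors on $(\Omega,\mathcal F,P)$ all of whose components are $L_m$-differentiable with respect to $\mathcal G$. Suppose that $$f^n_j\to f_j,\qquad D_i^{\mathcal G}f^n_j\to D_i^{\mathcal G}f_j\quad\text{in }L_m,\ n\to+\infty,\qquad i,j=1,\dots,m.$$ Let $\mathcal N(f,\mathcal G)=\{\omega:\ \text{the matrix }(D_i^{\mathcal G}f_j(\omega))_{i,j=1}^m\text{ is non-degenerate}\}$. Then for every measurable $A\subset\mathcal N(f,\mathcal G)$, $$P\big|_A\circ[f^n]^{-1}\to P\big|_A\circ f^{-1},\qquad n\to+\infty,$$ in variation.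
   Context: Probability space. $\mathbb R^+=[0,\infty)$; $\mathbb U$ is a locally compact metric space and $\Pi$ is a $\sigma$-finite measure on its Borel $\sigma$-algebra $\mathcal B(\mathbb U)$ which is finite on bounded Borel sets. $\Omega$ is the space of configurations (locally finite subsets) of $\mathbb R^+\times\mathbb U$ with the vague topology (the weakest topology making $\varpi\mapsto\sum_{(t,u)\in\varpi}f(t,u)$ continuous for every continuous $f$ with bounded support), $\mathcal F$ is its Borel $\sigma$-algebra, and $P$ is the law of the Poisson point measure $\nu$ on $\mathbb R^+\times\mathbb U$ with intensity measure $dt\,\Pi(du)$; $\nu(\omega)=\omega$. Time stretching transformations. $H_0=L_\infty(\mathbb R^+)\cap L_2(\mathbb R^+)$, $Jh(t)=\int_0^t h(s)\,ds$. For $h\in H_0$, $T_hx$ is the value at $s=1$ of the solution of $z'(s)=Jh(z(s))$, $z(0)=x$ ($x\in\mathbb R^+$). $\mathbb U_{fin}$ is the family of bounded Borel subsets of $\mathbb U$. For $h\in H_0$, $\Gamma\in\mathbb U_{fin}$, the bijection $T_h^\Gamma:\Omega\to\Omega$ replaces each point $(\tau,u)$ of the configuration with $u\in\Gamma$ by $(T_{-h}\tau,u)$ and leaves the points with $u\notin\Gamma$ unchanged. It acts on random variables by $T_h^\Gamma f(\omega)=f(T_h^\Gamma\omega)$. Derivatives. For $p\in[1,\infty)$, $f\in L_p(\Omega,\mathcal F,P)$ is $L_p$-differentiable in direction $(h,\Gamma)$ with derivative $D_h^\Gamma f$ if $\varepsilon^{-1}(T_{\varepsilon h}^\Gamma f-f)\to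 D_h^\Gamma f$ in $L_p$ as $\varepsilon\to0$. Grid. A differential grid of dimension $m$ is a family $\mathcal G=\{[a_i,b_i)\subset\mathbb R^+,\ h_i\in H_0,\ \Gamma_i\in\mathbb U_{fin};\ i\le m\}$ such that (i) the sets $[a_i,b_i)\times\Gamma_i$ are pairwise disjoint; (ii) for every $i\le m$, $Jh_i>0$ on $(a_i,b_i)$ and $Jh_i=0$ outside $(a_i,b_i)$. A functional is $L_p$-differentiable w.r.t. $\mathcal G$ if it is $L_p$-differentiable in every direction $(h_i,\Gamma_i)$, $i=1,\dots,m$; $D_i^{\mathcal G}f=D_{h_i}^{\Gamma_i}f$. Notation. $P|_A\circ f^{-1}(B)=P(A\cap\{f\in B\})$, $B\in\mathcal B(\mathbb R^m)$; convergence in variation is convergence in total variation norm.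
   Formalization: Added: Π is carried by the closure of a countable set (automatic for separable 𝕌 or Radon Π). Without it, if real-valued measurable cardinals exist, Poisson counts do not determine P on the vague Borel sets and the claim can fail. *)

theory Defs
  imports "HOL-Probability.Probability"
begin

section \<open>Configurations on \<open>[0, \<infinity>) \<times> \<U>\<close>\<close>

text \<open>The mark space \<open>\<U>\<close> is the whole of a type of class \<^class>\<open>metric_space\<close>; the half-line is
  the subset \<open>{0..}\<close> of \<open>\<real>\<close>. A configuration is locally finite in the sense that it has finitely many
  points in every bounded set, which is what makes the sums defining the vague topology (test
  functions of bounded support) finite.\<close>

type_synonym 'u config = "(real \<times> 'u) set"

definition configs :: "'u::metric_space config set" where
  "configs = {\<omega>. \<omega> \<subseteq> {0..} \<times> UNIV \<and> (\<forall>B. bounded B \<longrightarrow> finite (\<omega> \<inter> B))}"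

definition test_fun :: "(real \<times> 'u::metric_space \<Rightarrow> real) \<Rightarrow> bool" where
  "test_fun \<phi> \<longleftrightarrow>
     continuous_on ({0..} \<times> UNIV) \<phi> \<and> bounded {x \<in> {0..} \<times> UNIV. \<phi> x \<noteq> 0}"

text \<open>The sum runs over the finitely many points with \<open>\<phi> x \<noteq> 0\<close> only, because \<^const>\<open>sum\<close> over
  an infinite set is \<open>0\<close> by convention.\<close>

definition config_sum :: "(real \<times> 'u \<Rightarrow> real) \<Rightarrow> 'u config \<Rightarrow> real" where
  "config_sum \<phi> \<omega> = (\<Sum>x\<in>{x \<in> \<omega>. \<phi> x \<noteq> 0}. \<phi> x)"

definition vague_topology :: "'u::metric_space config topology" where
  "vague_topology =
     topology_generated_by {{\<omega> \<in> configs. config_sum \<phi> \<omega> \<in> V} |\<phi> V. test_fun \<phi> \<and> open V}"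

definition vague_sets :: "'u::metric_space config set set" where
  "vague_sets = sigma_sets configs {W. openin vague_topology W}"

definition mark_measure :: "'u::metric_space measure \<Rightarrow> bool" where
  "mark_measure \<mu> \<longleftrightarrow>
     sets \<mu> = sets borel \<and> sigma_finite_measure \<mu> \<and>
     (\<forall>B\<in>sets borel. bounded B \<longrightarrow> emeasure \<mu> B < \<infinity>)"

text \<open>Automatic if \<open>\<U>\<close> is separable, and also if \<open>\<mu>\<close> is Radon (then \<open>\<mu>\<close>, being
  \<open>\<sigma>\<close>-finite, is carried by a \<open>\<sigma>\<close>-compact set). For non-separable \<open>\<U>\<close> it excludes only measures
  whose existence needs a real-valued measurable cardinal; for those the vague Borel
  \<open>\<sigma>\<close>-algebra is too large for the Poisson counts to determine a law on it.\<close>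

definition separably_supported :: "'u::metric_space measure \<Rightarrow> bool" where
  "separably_supported \<mu> \<longleftrightarrow> (\<exists>C. countable C \<and> (AE u in \<mu>. u \<in> closure C))"

definition intensity :: "'u::metric_space measure \<Rightarrow> (real \<times> 'u) measure" where
  "intensity \<mu> = restrict_space lborel {0..} \<Otimes>\<^sub>M \<mu>"

text \<open>\<open>P\<close> is the law of the Poisson point measure: under \<open>P\<close> the canonical counts
  \<open>\<omega> \<mapsto> card (\<omega> \<inter> B)\<close> are Poisson with parameter \<open>(dt \<times> \<mu>) B\<close> and independent over
  disjoint \<open>B\<close>. The sets \<open>B\<close> are bounded, so the cardinalities are genuine. As \<open>\<real>\<close> is second
  countable, the product \<open>\<sigma>\<close>-algebra used here is the Borel \<open>\<sigma>\<close>-algebra of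
  \<open>[0, \<infinity>) \<times> \<U>\<close>.\<close>

definition poisson_law :: "'u::metric_space measure \<Rightarrow> 'u config measure \<Rightarrow> bool" where
  "poisson_law \<mu> P \<longleftrightarrow>
     prob_space P \<and> space P = configs \<and> sets P = vague_sets \<and>
     (\<forall>B\<in>sets (intensity \<mu>). bounded B \<longrightarrow>
        (\<forall>k. measure P {\<omega> \<in> space P. card (\<omega> \<inter> B) = k} =
             measure (intensity \<mu>) B ^ k / fact k * exp (- measure (intensity \<mu>) B))) \<and>
     (\<forall>\<B>. finite \<B> \<and> disjoint \<B> \<and> (\<forall>B\<in>\<B>. B \<in> sets (intensity \<mu>) \<and> bounded B) \<longrightarrow>
        prob_space.indep_vars P (\<lambda>_. count_space UNIV) (\<lambda>B \<omega>. card (\<omega> \<inter> B)) \<B>)"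


section \<open>Time stretching\<close>

text \<open>\<open>L\<^sub>\<infinity>(\<real>\<^sup>+) \<inter> L\<^sub>2(\<real>\<^sup>+)\<close>; only the values on \<open>[0, \<infinity>)\<close> matter.\<close>

definition H0 :: "(real \<Rightarrow> real) set" where
  "H0 = {h. set_borel_measurable lborel {0..} h \<and>
            (\<exists>C. AE t in lborel. t \<ge> 0 \<longrightarrow> \<bar>h t\<bar> \<le> C) \<and>
            set_integrable lborel {0..} (\<lambda>t. (h t)\<^sup>2)}"

definition J :: "(real \<Rightarrow> real) \<Rightarrow> real \<Rightarrow> real" where
  "J h t = (LINT s:{0..t}|lborel. h s)"

text \<open>For \<open>h \<in> H0\<close> and \<open>x \<ge> 0\<close> the solution on \<open>[0, 1]\<close> exists and is unique, as \<open>J h\<close> is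
  Lipschitz on \<open>[0, \<infinity>)\<close> and vanishes at \<open>0\<close>.\<close>

definition stretch :: "(real \<Rightarrow> real) \<Rightarrow> real \<Rightarrow> real" where
  "stretch h x = (THE y. \<exists>z. z 0 = x \<and> z 1 = y \<and>
     (\<forall>s\<in>{0..1}. z s \<ge> 0 \<and> (z has_real_derivative J h (z s)) (at s within {0..1})))"

definition U_fin :: "'u::metric_space set set" where
  "U_fin = {\<Gamma>. \<Gamma> \<in> sets borel \<and> bounded \<Gamma>}"

definition config_stretch :: "(real \<Rightarrow> real) \<Rightarrow> 'u set \<Rightarrow> 'u config \<Rightarrow> 'u config" where
  "config_stretch h \<Gamma> \<omega> =
     (\<lambda>(\<tau>, u). (if u \<in> \<Gamma> then stretch (\<lambda>t. - h t) \<tau> else \<tau>, u)) ` \<omega>"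


section \<open>Differentiability in \<open>L\<^sub>p\<close>\<close>

definition Lp :: "'a measure \<Rightarrow> real \<Rightarrow> ('a \<Rightarrow> real) set" where
  "Lp M p = {f. f \<in> borel_measurable M \<and> integrable M (\<lambda>x. \<bar>f x\<bar> powr p)}"

definition Lp_norm :: "'a measure \<Rightarrow> real \<Rightarrow> ('a \<Rightarrow> real) \<Rightarrow> real" where
  "Lp_norm M p f = (LINT x|M. \<bar>f x\<bar> powr p) powr (1 / p)"

definition Lp_tendsto ::
  "'a measure \<Rightarrow> real \<Rightarrow> ('i \<Rightarrow> 'a \<Rightarrow> real) \<Rightarrow> ('a \<Rightarrow> real) \<Rightarrow> 'i filter \<Rightarrow> bool" where
  "Lp_tendsto M p X g F \<longleftrightarrow>
     g \<in> Lp M p \<and> (\<forall>\<^sub>F i in F. X i \<in> Lp M p) \<and>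
     ((\<lambda>i. Lp_norm M p (\<lambda>x. X i x - g x)) \<longlongrightarrow> 0) F"

text \<open>A relation rather than a function, since the derivative is determined only up to
  \<open>P\<close>-null sets: \<open>g\<close> is a version of \<open>D\<^sub>h\<^sup>\<Gamma> f\<close>.\<close>

definition has_Lp_derivative ::
  "'u config measure \<Rightarrow> real \<Rightarrow> (real \<Rightarrow> real) \<Rightarrow> 'u set \<Rightarrow>
   ('u config \<Rightarrow> real) \<Rightarrow> ('u config \<Rightarrow> real) \<Rightarrow> bool" where
  "has_Lp_derivative P p h \<Gamma> f g \<longleftrightarrow>
     f \<in> Lp P p \<and>
     Lp_tendsto P p
       (\<lambda>\<epsilon> \<omega>. (f (config_stretch (\<lambda>t. \<epsilon> * h t) \<Gamma> \<omega>) - f \<omega>) / \<epsilon>) g (at 0)"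

definition differential_grid ::
  "('m \<Rightarrow> real) \<Rightarrow> ('m \<Rightarrow> real) \<Rightarrow> ('m \<Rightarrow> real \<Rightarrow> real) \<Rightarrow> ('m \<Rightarrow> 'u::metric_space set) \<Rightarrow> bool" where
  "differential_grid a b h \<Gamma> \<longleftrightarrow>
     (\<forall>i. {a i..<b i} \<subseteq> {0..} \<and> h i \<in> H0 \<and> \<Gamma> i \<in> U_fin) \<and>
     (\<forall>i j. i \<noteq> j \<longrightarrow> ({a i..<b i} \<times> \<Gamma> i) \<inter> ({a j..<b j} \<times> \<Gamma> j) = {}) \<and>
     (\<forall>i. (\<forall>t\<in>{a i<..<b i}. J (h i) t > 0) \<and> (\<forall>t\<in>{0..} - {a i<..<b i}. J (h i) t = 0))"

text \<open>The matrix \<open>(D\<^sub>i f\<^sub>j)\<close> is given by versions \<open>Df i j\<close> of its entries.\<close>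

definition nondegenerate_set ::
  "'u::metric_space config measure \<Rightarrow> ('m::finite \<Rightarrow> 'm \<Rightarrow> 'u config \<Rightarrow> real) \<Rightarrow> 'u config set" where
  "nondegenerate_set P Df = {\<omega> \<in> space P. invertible ((\<chi> i j. Df i j \<omega>) :: real^'m^'m)}"


section \<open>Convergence in variation\<close>

definition image_on :: "'a measure \<Rightarrow> 'a set \<Rightarrow> ('a \<Rightarrow> 'b) \<Rightarrow> 'b set \<Rightarrow> real" where
  "image_on P A f B = measure P (A \<inter> {\<omega> \<in> space P. f \<omega> \<in> B})"

text \<open>Total variation norm of a signed Borel measure, given as a set function.\<close>

definition variation_norm :: "('b::topological_space set \<Rightarrow> real) \<Rightarrow> ennreal" where
  "variation_norm \<sigma> =
     (SUP \<P>\<in>{\<P>. finite \<P> \<and> disjoint \<P> \<and> \<P> \<subseteq> sets borel}. \<Sum>B\<in>\<P>. ennreal \<bar>\<sigma> B\<bar>)"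

definition tendsto_in_variation ::
  "(nat \<Rightarrow> 'b::topological_space set \<Rightarrow> real) \<Rightarrow> ('b set \<Rightarrow> real) \<Rightarrow> bool" where
  "tendsto_in_variation S T \<longleftrightarrow>
     (\<lambda>n. variation_norm (\<lambda>B. S n B - T B)) \<longlonglongrightarrow> 0"

end

theory Submission
  imports Defs
begin

text \<open>Disjointness of the cells \<open>(a\<^sub>i, b\<^sub>i) \<times> \<Gamma>\<^sub>i\<close> makes the stretchings of the grid commute, so that
  they generate an action \<open>\<theta>\<close> of \<open>\<real>\<^sup>m\<close> on configurations under which \<open>P\<close> is quasi-invariant. By Fubini,
  along almost every orbit \<open>s \<mapsto> f (\<theta> s \<omega>)\<close> is a local Sobolev map with exponent \<open>m\<close> on
  \<open>\<real>\<^sup>m\<close> whose Jacobian matrix is \<open>(D\<^sub>i f\<^sub>j)\<close>, and the problem becomes one about such maps \<open>F\<^sub>n \<rightarrow> F\<close>.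

  Write \<open>G\<^sub>n\<close> for the Jacobian matrix of \<open>F\<^sub>n\<close> and let \<open>\<xi>\<close> be a cut-off function. The cofactor matrix of a
  gradient is divergence free, so integration by parts gives
  \<open>\<integral> \<xi> (\<partial>\<^sub>k\<phi>)(F\<^sub>n) det G\<^sub>n = - \<integral> \<phi>(F\<^sub>n) E\<^sub>k\<close>, where \<open>E\<^sub>k\<close> arises from \<open>det G\<^sub>n\<close> on replacing row \<open>k\<close>
  by the gradient of \<open>\<xi>\<close>. Hence the image of \<open>\<xi> det G\<^sub>n dx\<close> under \<open>F\<^sub>n\<close> changes in variation by at most
  a constant times \<open>\<bar>v\<bar>\<close> under translation by \<open>v\<close>, uniformly in \<open>n\<close>. Test functions with \<open>\<bar>\<phi>\<bar> \<le> 1\<close>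
  may therefore be mollified at a fixed scale, where they become equicontinuous and \<open>F\<^sub>n \<rightarrow> F\<close>
  suffices. Convergence of the derivatives in \<open>L\<^sub>m\<close> is exactly what gives \<open>det G\<^sub>n \<rightarrow> det G\<close> in \<open>L\<^sub>1\<close>, and
  on the non-degenerate set any density can be approximated by \<open>\<xi> det G\<close>.\<close>

section \<open>Mollification on Euclidean space\<close>

text \<open>The total variation norm is approached by test functions that may change with
  \<open>n\<close>, so each estimate has to be uniform over functions bounded by \<open>1\<close>;
  this is why a bound on translations is sought that does not see the gradient of the test function.
  To return from orbits to configurations, the integral over \<open>A\<close> is averaged over
  \<open>s\<close> in the unit ball: by quasi-invariance the expectation of
  \<open>\<rho> s \<omega> * X (\<theta> s \<omega>)\<close> is that of \<open>X\<close> for every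
  \<open>s\<close>, so Fubini turns it into orbit integrals weighted by \<open>\<rho>\<close> on the
  visits to \<open>A\<close>. Convergence in \<open>L\<^sub>m\<close> over configurations reaches
  almost every orbit only along a subsequence with summable errors; hence the sequential notion of
  derivative and the subsequence principle at the end. The other obstacle is measurability: the
  Poisson law is computable on the events \<open>void B\<close>, while the action must respect all
  vague Borel sets. On configurations with marks in a separable closed set both give the same
  traces. There the law is determined by its void probabilities, and quasi-invariance reduces to the
  generating functional of the Poisson law.\<close>

lemma L1_approx_continuous:
  fixes M :: "'a::euclidean_space measure" and g :: "'a \<Rightarrow> real"
  assumes fin: "finite_measure M" and sets: "sets M = sets borel"
    and g: "integrable M g" and "e > 0"
  shows "\<exists>\<psi>. continuous_on UNIV \<psi> \<and> bounded (range \<psi>) \<and> (\<integral>x. \<bar>g x - \<psi> x\<bar> \<partial>M) < e"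
  using g \<open>e > 0\<close>
proof (induction arbitrary: e rule: integrable_induct)
  interpret finite_measure M by (rule fin)
  case (base A c)
  have A: "A \<in> sets borel" using base sets by simp
  have spM: "space M = UNIV" using sets_eq_imp_space_eq[OF sets] by simp
  \<comment> \<open>Two errors are kept below \<open>d\<close>: replacing \<open>A\<close> by a
    compact subset, and replacing that subset by a continuous function. Both get multiplied by
    \<open>\<bar>c\<bar>\<close>; the \<open>+ 1\<close> keeps the quotient defined for
    \<open>c = 0\<close>.\<close>
  define d where "d = e / (2 * (\<bar>c\<bar> + 1))"
  have d: "d > 0" using base by (simp add: d_def add_pos_nonneg)
  have dc: "d * (2 * (\<bar>c\<bar> + 1)) = e" by (simp add: d_def add_pos_nonneg order_less_imp_not_eq2)
  have fin': "emeasure M (space M) \<noteq> \<infinity>" by simp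
  have sup: "emeasure M A = (SUP K\<in>{K. K \<subseteq> A \<and> compact K}. emeasure M K)"
    by (rule inner_regular[OF sets fin' A])
  have "\<exists>K. K \<subseteq> A \<and> compact K \<and> measure M A < measure M K + d"
  proof (cases "measure M A < d")
    case True
    then show ?thesis by (intro exI[of _ "{}"]) auto
  next
    case False
    then have "ennreal (measure M A - d) < emeasure M A"
      using d by (simp add: emeasure_eq_measure ennreal_lessI)
    then obtain K where "K \<subseteq> A" "compact K" "ennreal (measure M A - d) < emeasure M K"
      unfolding sup less_SUP_iff by auto
    with False show ?thesis by (intro exI[of _ K]) (auto simp: emeasure_eq_measure ennreal_less_iff)
  qed
  then obtain K where K: "K \<subseteq> A" "compact K" "measure M A < measure M K + d"
    by auto
  have Ks: "K \<in> sets M" using K sets by (simp add: compact_imp_closed)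
  have AK: "measure M (A - K) < d"
    using K Ks A sets by (simp add: finite_measure_Diff)
  show ?case
  proof (cases "K = {}")
    case True
    have "(\<integral>x. \<bar>indicat_real A x *\<^sub>R c - 0\<bar> \<partial>M) = (\<integral>x. indicat_real A x * \<bar>c\<bar> \<partial>M)"
      by (simp add: abs_mult)
    also have "\<dots> = measure M A * \<bar>c\<bar>"
      using A sets spM by simp
    also have "\<dots> \<le> d * (\<bar>c\<bar> + 1)" using AK True K d by (intro mult_mono) auto
    also have "\<dots> < d * (2 * (\<bar>c\<bar> + 1))" using d by (intro mult_strict_left_mono) auto
    also note dc
    finally show ?thesis by (intro exI[of _ "\<lambda>_. 0"]) auto
  next
    case False
    \<comment> \<open>Tents of slope \<open>n\<close> over \<open>K\<close>; they decrease to the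
      indicator of \<open>K\<close> because points off a closed set have positive distance to it.
      The case \<open>K = {}\<close> is separate since \<open>infdist\<close> to the empty set is
      \<open>0\<close>, which would make every tent equal to \<open>1\<close>.\<close>
    define s where "s n x = max 0 (1 - real n * infdist x K)" for n x
    have s_cont: "continuous_on UNIV (s n)" for n
      unfolding s_def by (intro continuous_intros)
    have s01: "0 \<le> s n x" "s n x \<le> 1" for n x
      by (auto simp: s_def infdist_nonneg)
    have le2: "\<bar>indicator K x - s n x\<bar> \<le> 2" for n x
      using s01[of n x] by (auto simp: indicator_def abs_le_iff split: if_splits)
    have s_lim: "(\<lambda>n. s n x) \<longlonglongrightarrow> indicator K x" for x
    proof (cases "x \<in> K")
      case True then show ?thesis by (simp add: s_def)
    next
      case False
      then have pos: "infdist x K > 0"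
        using K \<open>K \<noteq> {}\<close> by (metis compact_imp_closed in_closed_iff_infdist_zero infdist_nonneg less_eq_real_def)
      obtain N :: nat where N: "real N > 1 / infdist x K" using reals_Archimedean2 by blast
      have "s n x = 0" if "n \<ge> N" for n
      proof -
        have "real n * infdist x K \<ge> real N * infdist x K" using that pos by (intro mult_right_mono) auto
        moreover have "real N * infdist x K > 1" using N pos by (simp add: field_simps)
        ultimately show ?thesis by (simp add: s_def)
      qed
      then have "eventually (\<lambda>n. s n x = indicator K x) sequentially"
        using False by (auto simp: eventually_sequentially)
      then show ?thesis by (rule tendsto_eventually)
    qed
    have meas: "s n \<in> borel_measurable M" for n
      using borel_measurable_continuous_onI[OF s_cont] measurable_cong_sets[OF sets refl] by blast
    have "(\<lambda>n. \<integral>x. \<bar>indicator K x - s n x\<bar> \<partial>M) \<longlonglongrightarrow> (\<integral>x. 0 \<partial>M)"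
    proof (rule integral_dominated_convergence[where w="\<lambda>_. 2"])
      show "AE x in M. (\<lambda>n. \<bar>indicator K x - s n x\<bar>) \<longlonglongrightarrow> 0"
      proof (rule AE_I2)
        fix x
        have "(\<lambda>n. indicator K x - s n x) \<longlonglongrightarrow> indicator K x - indicator K x"
          by (intro tendsto_intros s_lim)
        then show "(\<lambda>n. \<bar>indicator K x - s n x\<bar>) \<longlonglongrightarrow> 0" by (intro tendsto_rabs_zero) simp
      qed
      show "AE x in M. norm \<bar>indicator K x - s n x\<bar> \<le> 2" for n
        by (rule AE_I2) (simp add: le2)
    qed (use meas Ks in auto)
    then have "eventually (\<lambda>n. (\<integral>x. \<bar>indicator K x - s n x\<bar> \<partial>M) < d) sequentially"
      using d by (intro order_tendstoD) auto
    then obtain n where n: "(\<integral>x. \<bar>indicator K x - s n x\<bar> \<partial>M) < d" by (auto simp: eventually_sequentially)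
    have int: "integrable M (\<lambda>x. \<bar>indicator K x - s n x\<bar>)"
      by (rule integrable_const_bound[where B=2]) (use meas Ks le2 in auto)
    have int2: "integrable M (\<lambda>x. indicat_real (A - K) x)" using A Ks sets by (auto simp: emeasure_eq_measure)
    have "(\<integral>x. \<bar>indicat_real A x *\<^sub>R c - c * s n x\<bar> \<partial>M) \<le> (\<integral>x. \<bar>c\<bar> * (indicat_real (A - K) x + \<bar>indicator K x - s n x\<bar>) \<partial>M)"
    proof (rule integral_mono)
      fix x
      have "\<bar>indicat_real A x *\<^sub>R c - c * s n x\<bar> = \<bar>c\<bar> * \<bar>indicat_real A x - s n x\<bar>"
        by (simp flip: abs_mult) (simp add: algebra_simps)
      also have "\<dots> \<le> \<bar>c\<bar> * (indicat_real (A - K) x + \<bar>indicator K x - s n x\<bar>)"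
        using K by (intro mult_left_mono) (auto simp: indicator_def)
      finally show "\<bar>indicat_real A x *\<^sub>R c - c * s n x\<bar> \<le> \<bar>c\<bar> * (indicat_real (A - K) x + \<bar>indicator K x - s n x\<bar>)" .
    next
      show "integrable M (\<lambda>x. \<bar>indicat_real A x *\<^sub>R c - c * s n x\<bar>)"
      proof (intro integrable_abs Bochner_Integration.integrable_diff)
        show "integrable M (\<lambda>x. indicat_real A x *\<^sub>R c)" using A sets by (auto simp: emeasure_eq_measure)
        show "integrable M (\<lambda>x. c * s n x)"
          by (rule integrable_const_bound[where B="\<bar>c\<bar>"]) (use s01[of n] meas in \<open>auto simp: abs_mult intro!: mult_left_le\<close>)
      qed
    qed (use int int2 in auto)
    also have "\<dots> = \<bar>c\<bar> * (measure M (A - K) + (\<integral>x. \<bar>indicator K x - s n x\<bar> \<partial>M))"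
      using int int2 by (simp add: Bochner_Integration.integral_add A Ks sets spM)
    also have "\<dots> \<le> \<bar>c\<bar> * (d + d)" using n AK by (intro mult_left_mono) auto
    also have "\<dots> < e" using dc d by (simp add: algebra_simps)
    finally have "(\<integral>x. \<bar>indicat_real A x *\<^sub>R c - c * s n x\<bar> \<partial>M) < e" .
    moreover have "continuous_on UNIV (\<lambda>x. c * s n x)" by (intro continuous_intros s_cont)
    moreover have "bounded (range (\<lambda>x. c * s n x))"
      by (rule boundedI[of _ "\<bar>c\<bar>"]) (use s01[of n] in \<open>auto simp: abs_mult intro!: mult_left_le\<close>)
    ultimately show ?thesis by blast
  qed
next
  case (add f g)
  have e2: "e / 2 > 0" using add by simp
  obtain \<psi> \<xi> where 1: "continuous_on UNIV \<psi>" "bounded (range \<psi>)" "(\<integral>x. \<bar>f x - \<psi> x\<bar> \<partial>M) < e/2"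
    "continuous_on UNIV \<xi>" "bounded (range \<xi>)" "(\<integral>x. \<bar>g x - \<xi> x\<bar> \<partial>M) < e/2"
    using add(3,4)[OF e2] by blast
  interpret finite_measure M by (rule fin)
  have int: "integrable M \<psi>" if c: "continuous_on UNIV \<psi>" and b: "bounded (range \<psi>)" for \<psi> :: "'a \<Rightarrow> real"
  proof -
    obtain B where "\<And>x. norm (\<psi> x) \<le> B" using b by (auto simp: bounded_iff)
    moreover have "\<psi> \<in> borel_measurable M"
      using borel_measurable_continuous_onI[OF c] measurable_cong_sets[OF sets refl] by blast
    ultimately show ?thesis by (intro integrable_const_bound[where B=B]) auto
  qed
  have "(\<integral>x. \<bar>(f x + g x) - (\<psi> x + \<xi> x)\<bar> \<partial>M) \<le> (\<integral>x. \<bar>f x - \<psi> x\<bar> + \<bar>g x - \<xi> x\<bar> \<partial>M)"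
    using add int 1 by (intro integral_mono) auto
  also have "\<dots> = (\<integral>x. \<bar>f x - \<psi> x\<bar> \<partial>M) + (\<integral>x. \<bar>g x - \<xi> x\<bar> \<partial>M)"
    using add int 1 by (intro Bochner_Integration.integral_add) auto
  also have "\<dots> < e" using 1 by simp
  finally show ?case using 1 by (intro exI[of _ "\<lambda>x. \<psi> x + \<xi> x"]) (auto intro!: continuous_intros bounded_plus_comp)
next
  case (lim f s)
  interpret finite_measure M by (rule fin)
  have "(\<lambda>i. \<integral>x. \<bar>f x - s i x\<bar> \<partial>M) \<longlonglongrightarrow> (\<integral>x. 0 \<partial>M)"
  proof (rule integral_dominated_convergence[where w="\<lambda>x. 3 * norm (f x)"])
    show "AE x in M. (\<lambda>i. \<bar>f x - s i x\<bar>) \<longlonglongrightarrow> 0"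
    proof (rule AE_I2)
      fix x assume "x \<in> space M"
      then have "(\<lambda>i. f x - s i x) \<longlonglongrightarrow> f x - f x"
        by (intro tendsto_intros lim)
      then show "(\<lambda>i. \<bar>f x - s i x\<bar>) \<longlonglongrightarrow> 0" by (intro tendsto_rabs_zero) simp
    qed
    show "AE x in M. norm \<bar>f x - s i x\<bar> \<le> 3 * norm (f x)" for i
    proof (rule AE_I2)
      fix x assume "x \<in> space M"
      then have "norm (s i x) \<le> 2 * norm (f x)" using lim by blast
      then show "norm \<bar>f x - s i x\<bar> \<le> 3 * norm (f x)" by simp
    qed
  qed (use lim in auto)
  then have "eventually (\<lambda>n. (\<integral>x. \<bar>f x - s n x\<bar> \<partial>M) < e/2) sequentially"
    using lim by (intro order_tendstoD) auto
  then obtain n where n: "(\<integral>x. \<bar>f x - s n x\<bar> \<partial>M) < e/2" by (auto simp: eventually_sequentially)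
  have "e/2 > 0" using lim by simp
  then obtain \<psi> where 1: "continuous_on UNIV \<psi>" "bounded (range \<psi>)" "(\<integral>x. \<bar>s n x - \<psi> x\<bar> \<partial>M) < e/2"
    using lim(5) by blast
  obtain B where "\<And>x. norm (\<psi> x) \<le> B" using 1(2) by (auto simp: bounded_iff)
  moreover have "\<psi> \<in> borel_measurable M"
    using borel_measurable_continuous_onI[OF 1(1)] measurable_cong_sets[OF sets refl] by blast
  ultimately have int: "integrable M \<psi>" by (intro integrable_const_bound[where B=B]) auto
  have "(\<integral>x. \<bar>f x - \<psi> x\<bar> \<partial>M) \<le> (\<integral>x. \<bar>f x - s n x\<bar> + \<bar>s n x - \<psi> x\<bar> \<partial>M)"
    using lim int by (intro integral_mono) auto
  also have "\<dots> = (\<integral>x. \<bar>f x - s n x\<bar> \<partial>M) + (\<integral>x. \<bar>s n x - \<psi> x\<bar> \<partial>M)"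
    using lim int by (intro Bochner_Integration.integral_add) auto
  also have "\<dots> < e" using 1 n by simp
  finally show ?case using 1 by blast
qed

text \<open>The indices are chosen so that the integrals stay below a geometric sequence. The sum of
  the series is then a single integrable function that yields both pointwise convergence to
  \<open>0\<close> and a majorant, and that can be restricted to almost every orbit.\<close>

lemma nn_integral_subseq_summable:
  fixes Z :: "nat \<Rightarrow> 'a \<Rightarrow> ennreal"
  assumes [measurable]: "\<And>n. Z n \<in> borel_measurable M"
    and lim: "(\<lambda>n. \<integral>\<^sup>+x. Z n x \<partial>M) \<longlonglongrightarrow> 0"
  shows "\<exists>r. strict_mono r \<and> (\<integral>\<^sup>+x. (\<Sum>n. Z (r n) x) \<partial>M) < \<infinity>"
proof -
  have ev: "eventually (\<lambda>k. (\<integral>\<^sup>+x. Z k x \<partial>M) < ennreal ((1/2)^n)) sequentially" for n :: nat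
    using lim by (rule order_tendstoD) simp
  have "\<exists>r. \<forall>n::nat. (\<integral>\<^sup>+x. Z (r n) x \<partial>M) < ennreal ((1/2)^n) \<and> r n < r (Suc n)"
  proof (rule dependent_nat_choice)
    show "\<exists>k. (\<integral>\<^sup>+x. Z k x \<partial>M) < ennreal ((1/2)^0)" using ev[of 0] by (auto simp: eventually_sequentially)
    fix x n :: nat
    from eventually_conj[OF ev[of "Suc n"] eventually_gt_at_top[of x]]
    show "\<exists>y. (\<integral>\<^sup>+xa. Z y xa \<partial>M) < ennreal ((1/2)^Suc n) \<and> x < y" 
      by (auto simp: eventually_sequentially)
  qed
  then obtain r where r: "\<And>n. (\<integral>\<^sup>+x. Z (r n) x \<partial>M) < ennreal ((1/2)^n)" "\<And>n. r n < r (Suc n)" by blast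
  have "(\<integral>\<^sup>+x. (\<Sum>n. Z (r n) x) \<partial>M) = (\<Sum>n. \<integral>\<^sup>+x. Z (r n) x \<partial>M)"
    by (rule nn_integral_suminf) simp
  also have "\<dots> \<le> (\<Sum>n. ennreal ((1/2)^n))"
    using r by (intro suminf_le) (auto intro: less_imp_le)
  also have "\<dots> = ennreal (\<Sum>n. (1/2)^n)"
    by (rule suminf_ennreal2) (auto intro!: summable_geometric)
  also have "\<dots> < \<infinity>" by simp
  finally show ?thesis using r(2) by (intro exI[of _ r]) (auto intro: strict_monoI_Suc)
qed

lemma ennreal_suminf_finite_tendsto_0:
  fixes a :: "nat \<Rightarrow> ennreal"
  assumes "(\<Sum>n. a n) < \<infinity>"
  shows "a \<longlonglongrightarrow> 0" "a n \<le> (\<Sum>n. a n)"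
proof -
  have le: "a n \<le> (\<Sum>n. a n)" for n
    using sum_le_suminf[of a "{n}"] by simp
  then show "a n \<le> (\<Sum>n. a n)" .
  have fin: "a n < \<infinity>" for n using le[of n] assms by (rule le_less_trans)
  define b where "b n = enn2real (a n)" for n
  have ab: "a n = ennreal (b n)" for n using fin[of n] by (simp add: b_def)
  have "summable b"
    by (rule summable_suminf_not_top) (use assms in \<open>simp_all add: ab[symmetric], simp add: b_def\<close>)
  then have "b \<longlonglongrightarrow> 0" by (rule summable_LIMSEQ_zero)
  from tendsto_ennrealI[OF this] have "(\<lambda>n. ennreal (b n)) \<longlonglongrightarrow> 0" by simp
  then show "a \<longlonglongrightarrow> 0" unfolding ab[symmetric] .
qed

section \<open>Translations of Lebesgue measure and local integrability\<close>

lemma ball_in_borel[measurable, simp]: "ball c r \<in> sets (borel :: 'a::euclidean_space measure)"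
  by (rule borel_open) simp

lemma lborel_nn_integral_translation:
  fixes f :: "'a::euclidean_space \<Rightarrow> ennreal"
  assumes [measurable]: "f \<in> borel_measurable borel"
  shows "(\<integral>\<^sup>+x. f (a + x) \<partial>lborel) = (\<integral>\<^sup>+x. f x \<partial>lborel)"
proof -
  have "(\<integral>\<^sup>+x. f x \<partial>lborel) = (\<integral>\<^sup>+x. f x \<partial>distr lborel borel ((+) a))"
    by (subst lborel_distr_plus) simp
  also have "\<dots> = (\<integral>\<^sup>+x. f (a + x) \<partial>lborel)" by (subst nn_integral_distr) auto
  finally show ?thesis ..
qed

lemma lborel_integral_translation:
  fixes f :: "'a::euclidean_space \<Rightarrow> real"
  assumes [measurable]: "f \<in> borel_measurable borel"
  shows "(\<integral>x. f (a + x) \<partial>lborel) = (\<integral>x. f x \<partial>lborel)"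
proof -
  have "(\<integral>x. f x \<partial>lborel) = (\<integral>x. f x \<partial>distr lborel borel ((+) a))"
    by (subst lborel_distr_plus) simp
  also have "\<dots> = (\<integral>x. f (a + x) \<partial>lborel)" by (subst integral_distr) auto
  finally show ?thesis ..
qed

lemma lborel_integrable_translation:
  fixes f :: "'a::euclidean_space \<Rightarrow> real"
  assumes [measurable]: "f \<in> borel_measurable borel"
  shows "integrable lborel (\<lambda>x. f (a + x)) \<longleftrightarrow> integrable lborel f"
proof -
  have "integrable lborel f \<longleftrightarrow> integrable (distr lborel borel ((+) a)) f"
    by (subst lborel_distr_plus) simp
  also have "\<dots> \<longleftrightarrow> integrable lborel (\<lambda>x. f (a + x))" by (subst integrable_distr_eq) auto
  finally show ?thesis ..
qed

definition locint :: "('a::euclidean_space \<Rightarrow> real) \<Rightarrow> bool" where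
  "locint f \<longleftrightarrow> f \<in> borel_measurable borel \<and> (\<forall>R. integrable lborel (\<lambda>x. indicator (ball 0 R) x * f x))"

lemma locint_measurable[measurable_dest]: "locint f \<Longrightarrow> f \<in> borel_measurable borel"
  by (simp add: locint_def)

lemma locintD: "locint f \<Longrightarrow> integrable lborel (\<lambda>x. indicator (ball 0 R) x * f x)"
  by (simp add: locint_def)

lemma locint_iff_nn:
  "locint f \<longleftrightarrow> f \<in> borel_measurable borel \<and> (\<forall>R. (\<integral>\<^sup>+x. indicator (ball 0 R) x * ennreal \<bar>f x\<bar> \<partial>lborel) < \<infinity>)"
proof -
  have "(\<integral>\<^sup>+x. ennreal (norm (indicator (ball 0 R) x * f x)) \<partial>lborel) = (\<integral>\<^sup>+x. indicator (ball 0 R) x * ennreal \<bar>f x\<bar> \<partial>lborel)" for R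
    by (intro nn_integral_cong) (auto simp: indicator_def)
  then show ?thesis
    unfolding locint_def integrable_iff_bounded by (auto intro!: borel_measurable_times borel_measurable_indicator)
qed

section \<open>Convolution with a continuous kernel of bounded support\<close>

lemma integrable_continuous_bounded_support:
  fixes K :: "'a::euclidean_space \<Rightarrow> real"
  assumes c: "continuous_on UNIV K" and z: "\<And>z. norm z \<ge> r \<Longrightarrow> K z = 0"
  shows "\<exists>C\<ge>0. \<forall>z. \<bar>K z\<bar> \<le> C" "integrable lborel K"
proof -
  have "compact (K ` cball 0 (max 0 r))"
    by (intro compact_continuous_image compact_cball continuous_on_subset[OF c]) auto
  then have "bounded (K ` cball 0 (max 0 r))" by (rule compact_imp_bounded)
  then obtain C where C: "\<And>x. x \<in> cball 0 (max 0 r) \<Longrightarrow> norm (K x) \<le> C" unfolding bounded_iff by blast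
  have "\<bar>K x\<bar> \<le> \<bar>C\<bar>" for x
    using C[of x] z[of x] by (cases "norm x \<ge> r") fastforce+
  then show ex: "\<exists>C\<ge>0. \<forall>z. \<bar>K z\<bar> \<le> C" by (intro exI[of _ "\<bar>C\<bar>"]) auto
  then obtain B where B: "B \<ge> 0" "\<And>x. \<bar>K x\<bar> \<le> B" by auto
  have "integrable lborel (\<lambda>x. B * indicator (ball 0 r) x)"
    by (intro integrable_mult_right) (auto intro!: integrable_real_indicator emeasure_lborel_ball_finite)
  then show "integrable lborel K"
  proof (rule Bochner_Integration.integrable_bound)
    show "K \<in> borel_measurable lborel" using borel_measurable_continuous_onI[OF c] by simp
    show "AE x in lborel. norm (K x) \<le> norm (B * indicator (ball 0 r) x)"
      using B z by (intro AE_I2) (auto simp: indicator_def not_less)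
  qed
qed

text \<open>The kernel is evaluated at \<open>z - x\<close>, so this is convolution with the
  reflected kernel; differentiation in \<open>x\<close> therefore produces the minus sign of
  \<open>conv_deriv\<close>. For an even kernel such as \<open>ker\<close> it is the usual
  convolution.\<close>

definition conv :: "('a::euclidean_space \<Rightarrow> real) \<Rightarrow> ('a \<Rightarrow> real) \<Rightarrow> 'a \<Rightarrow> real" where
  "conv K f x = (\<integral>z. K (z - x) * f z \<partial>lborel)"

context
  fixes K :: "'a::euclidean_space \<Rightarrow> real" and r :: real
  assumes c: "continuous_on UNIV K" and z: "\<And>z. norm z \<ge> r \<Longrightarrow> K z = 0"
begin

lemma kernel_meas[measurable]: "K \<in> borel_measurable borel"
  using borel_measurable_continuous_onI[OF c] by simp

lemma conv_integrable:
  assumes f: "locint f"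
  shows "integrable lborel (\<lambda>z. K (z - x) * f z)"
proof -
  note [measurable] = locint_measurable[OF f]
  obtain C where C: "C \<ge> 0" "\<And>z. \<bar>K z\<bar> \<le> C" using integrable_continuous_bounded_support(1)[OF c z] by blast
  show ?thesis
  proof (rule Bochner_Integration.integrable_bound)
    show "integrable lborel (\<lambda>z. C * (indicator (ball 0 (norm x + r)) z * f z))"
      by (intro integrable_mult_right locintD f)
    show "AE z in lborel. norm (K (z - x) * f z) \<le> norm (C * (indicator (ball 0 (norm x + r)) z * f z))"
    proof (rule AE_I2)
      fix y
      have "y \<in> ball 0 (norm x + r) \<or> norm (y - x) \<ge> r"
        using norm_triangle_ineq[of "y - x" x] by auto
      then show "norm (K (y - x) * f y) \<le> norm (C * (indicator (ball 0 (norm x + r)) y * f y))"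
        using C z by (auto simp: abs_mult indicator_def intro!: mult_right_mono)
    qed
  qed simp
qed

lemma conv_shift:
  assumes f: "locint f"
  shows "conv K f x = (\<integral>y. K y * f (x + y) \<partial>lborel)" "integrable lborel (\<lambda>y. K y * f (x + y))"
proof -
  note [measurable] = locint_measurable[OF f]
  show "conv K f x = (\<integral>y. K y * f (x + y) \<partial>lborel)"
    unfolding conv_def using lborel_integral_translation[of "\<lambda>z. K (z - x) * f z" x] by simp
  show "integrable lborel (\<lambda>y. K y * f (x + y))"
    using lborel_integrable_translation[of "\<lambda>z. K (z - x) * f z" x] conv_integrable[OF f, of x] by simp
qed

lemma conv_continuous:
  assumes f: "locint f"
  shows "continuous_on UNIV (conv K f)"
proof (intro continuous_at_imp_continuous_on ballI)
  note [measurable] = locint_measurable[OF f]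
  fix x
  obtain C where C: "C \<ge> 0" "\<And>z. \<bar>K z\<bar> \<le> C" using integrable_continuous_bounded_support(1)[OF c z] by blast
  have "(conv K f \<longlongrightarrow> conv K f x) (at x within ball x 1)"
    unfolding tendsto_at_iff_sequentially
  proof (intro allI impI)
    fix X assume X: "\<forall>i. X i \<in> ball x 1 - {x}" "X \<longlonglongrightarrow> x"
    show "(conv K f \<circ> X) \<longlonglongrightarrow> conv K f x"
      unfolding conv_def comp_def
    proof (rule integral_dominated_convergence[where w="\<lambda>z. C * \<bar>indicator (ball 0 (norm x + 1 + r)) z * f z\<bar>"])
      show "AE z in lborel. (\<lambda>i. K (z - X i) * f z) \<longlonglongrightarrow> K (z - x) * f z"
      proof (intro AE_I2 tendsto_intros)
        fix y
        show "(\<lambda>i. K (y - X i)) \<longlonglongrightarrow> K (y - x)"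
          by (rule continuous_on_tendsto_compose[OF c]) (auto intro!: tendsto_intros X)
      qed
      show "integrable lborel (\<lambda>z. C * \<bar>indicator (ball 0 (norm x + 1 + r)) z * f z\<bar>)"
        by (intro integrable_mult_right integrable_abs locintD f)
      show "AE z in lborel. norm (K (z - X i) * f z) \<le> C * \<bar>indicator (ball 0 (norm x + 1 + r)) z * f z\<bar>" for i
      proof (rule AE_I2)
        fix y
        have "X i \<in> ball x 1" using X by blast
        then have "norm (X i - x) < 1" by (simp add: dist_norm norm_minus_commute)
        then have "y \<in> ball 0 (norm x + 1 + r) \<or> norm (y - X i) \<ge> r"
          using norm_triangle_ineq[of "y - X i" "X i"] norm_triangle_ineq[of "X i - x" x] by auto
        then show "norm (K (y - X i) * f y) \<le> C * \<bar>indicator (ball 0 (norm x + 1 + r)) y * f y\<bar>"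
          using C z by (auto simp: abs_mult indicator_def intro!: mult_right_mono)
      qed
    qed simp_all
  qed
  then show "isCont (conv K f) x"
    unfolding isCont_def by (simp add: at_within_open[OF _ open_ball])
qed

text \<open>Differentiation falls on the kernel alone, so \<open>f\<close> need only be locally
  integrable. The mean value bound \<open>lip\<close> dominates the difference quotients of the
  kernel.\<close>

lemma conv_deriv:
  assumes f: "locint f"
    and c': "continuous_on UNIV K'" and z': "\<And>z. norm z \<ge> r \<Longrightarrow> K' z = 0"
    and d: "\<And>z. ((\<lambda>t. K (z + t *\<^sub>R v)) has_real_derivative K' z) (at 0)"
  shows "((\<lambda>t. conv K f (x + t *\<^sub>R v)) has_real_derivative - conv K' f x) (at 0)"
proof -
  note [measurable] = locint_measurable[OF f]
  have [measurable]: "K' \<in> borel_measurable borel"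
    using borel_measurable_continuous_onI[OF c'] by simp
  obtain C where C: "C \<ge> 0" "\<And>z. \<bar>K' z\<bar> \<le> C" using integrable_continuous_bounded_support(1)[OF c' z'] by blast
  have d': "((\<lambda>t. K (y + t *\<^sub>R v)) has_real_derivative K' (y + t *\<^sub>R v)) (at t)" for y t
  proof -
    have "((\<lambda>s. K ((y + t *\<^sub>R v) + s *\<^sub>R v)) has_real_derivative K' (y + t *\<^sub>R v)) (at 0)" by (rule d)
    then show ?thesis
      using DERIV_shift[of "\<lambda>s. K (y + s *\<^sub>R v)" "K' (y + t *\<^sub>R v)" 0 t]
      by (simp add: algebra_simps)
  qed
  have lip: "\<bar>K (y + t *\<^sub>R v) - K y\<bar> \<le> C * \<bar>t\<bar>" for y t
    using field_differentiable_bound[of UNIV "\<lambda>t. K (y + t *\<^sub>R v)" "\<lambda>t. K' (y + t *\<^sub>R v)" C t 0] d' C by simp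
  \<comment> \<open>Steps shorter than \<open>\<delta>\<close> displace the argument by at most
    \<open>1\<close>, so the supports of all shifted kernels lie in one ball and a single majorant
    serves.\<close>
  define \<delta> where "\<delta> = 1 / (norm v + 1)"
  have \<delta>: "\<delta> > 0" by (simp add: \<delta>_def add_nonneg_pos)
  have \<delta>v: "norm (t *\<^sub>R v) \<le> 1" if "\<bar>t\<bar> < \<delta>" for t
  proof -
    have "\<bar>t\<bar> * norm v \<le> \<delta> * (norm v + 1)" using that \<delta> by (intro mult_mono) auto
    also have "\<dots> = 1" by (simp add: \<delta>_def add_nonneg_eq_0_iff)
    finally show ?thesis by simp
  qed
  have "((\<lambda>t. (conv K f (x + t *\<^sub>R v) - conv K f x) / t) \<longlongrightarrow> - conv K' f x) (at 0 within ball 0 \<delta>)"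
    unfolding tendsto_at_iff_sequentially
  proof (intro allI impI)
    fix X assume X: "\<forall>i. X i \<in> ball 0 \<delta> - {0}" "X \<longlonglongrightarrow> (0::real)"
    have X0: "X i \<noteq> 0" "\<bar>X i\<bar> < \<delta>" for i using X by auto
    have eq: "(conv K f (x + t *\<^sub>R v) - conv K f x) / t = (\<integral>z. ((K (z - x - t *\<^sub>R v) - K (z - x)) / t) * f z \<partial>lborel)" if "t \<noteq> 0" for t
    proof -
      have "conv K f (x + t *\<^sub>R v) - conv K f x = (\<integral>z. K (z - x - t *\<^sub>R v) * f z - K (z - x) * f z \<partial>lborel)"
        unfolding conv_def using conv_integrable[OF f, of "x + t *\<^sub>R v"] conv_integrable[OF f, of x]
        by (subst Bochner_Integration.integral_diff) (auto simp: algebra_simps)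
      also have "\<dots> = (\<integral>z. t * (((K (z - x - t *\<^sub>R v) - K (z - x)) / t) * f z) \<partial>lborel)"
        using that by (intro Bochner_Integration.integral_cong) (auto simp: field_simps)
      finally show ?thesis using that by simp
    qed
    have "(\<lambda>i. \<integral>z. ((K (z - x - X i *\<^sub>R v) - K (z - x)) / X i) * f z \<partial>lborel) \<longlonglongrightarrow> (\<integral>z. - K' (z - x) * f z \<partial>lborel)"
    proof (rule integral_dominated_convergence[where w="\<lambda>z. C * \<bar>indicator (ball 0 (norm x + 1 + r)) z * f z\<bar>"])
      show "AE z in lborel. (\<lambda>i. ((K (z - x - X i *\<^sub>R v) - K (z - x)) / X i) * f z) \<longlonglongrightarrow> - K' (z - x) * f z"
      proof (intro AE_I2 tendsto_intros)
        fix y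
        have "((\<lambda>t. (K (y - x + t *\<^sub>R v) - K (y - x)) / t) \<longlongrightarrow> K' (y - x)) (at 0)"
          using d[of "y - x"] by (simp add: has_field_derivative_iff)
        moreover have "filterlim (\<lambda>i. - X i) (at 0) sequentially"
          using tendsto_minus[OF X(2)] X0 by (auto simp: filterlim_at)
        ultimately have "(\<lambda>i. (K (y - x + (- X i) *\<^sub>R v) - K (y - x)) / (- X i)) \<longlonglongrightarrow> K' (y - x)"
          by (rule filterlim_compose)
        from tendsto_minus[OF this]
        show "(\<lambda>i. (K (y - x - X i *\<^sub>R v) - K (y - x)) / X i) \<longlonglongrightarrow> - K' (y - x)" by simp
      qed
      show "integrable lborel (\<lambda>z. C * \<bar>indicator (ball 0 (norm x + 1 + r)) z * f z\<bar>)"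
        by (intro integrable_mult_right integrable_abs locintD f)
      show "AE z in lborel. norm (((K (z - x - X i *\<^sub>R v) - K (z - x)) / X i) * f z) \<le> C * \<bar>indicator (ball 0 (norm x + 1 + r)) z * f z\<bar>" for i
      proof (rule AE_I2)
        fix y
        have "norm (X i *\<^sub>R v) \<le> 1" using \<delta>v X0 by blast
        then have *: "y \<in> ball 0 (norm x + 1 + r) \<or> (norm (y - x - X i *\<^sub>R v) \<ge> r \<and> norm (y - x) \<ge> r)"
          using norm_triangle_ineq[of "y - x - X i *\<^sub>R v" "X i *\<^sub>R v + x"] norm_triangle_ineq[of "X i *\<^sub>R v" x]
             norm_triangle_ineq[of "y - x" "x"]
          by auto
        have "\<bar>K (y - x - X i *\<^sub>R v) - K (y - x)\<bar> \<le> C * \<bar>X i\<bar>" using lip[of "y - x" "- X i"] by simp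
        then have "\<bar>(K (y - x - X i *\<^sub>R v) - K (y - x)) / X i\<bar> \<le> C" using X0[of i] by (simp add: field_simps)
        then show "norm (((K (y - x - X i *\<^sub>R v) - K (y - x)) / X i) * f y) \<le> C * \<bar>indicator (ball 0 (norm x + 1 + r)) y * f y\<bar>"
          using * z C(1) by (auto simp: abs_mult indicator_def simp del: abs_divide times_divide_eq_left intro!: mult_right_mono)
      qed
    qed simp_all
    then show "((\<lambda>t. (conv K f (x + t *\<^sub>R v) - conv K f x) / t) \<circ> X) \<longlonglongrightarrow> - conv K' f x"
      using eq X0 by (simp add: comp_def conv_def)
  qed
  then show ?thesis
    using \<delta> by (simp add: has_field_derivative_iff at_within_open[OF _ open_ball])
qed

end

declare kernel_meas[measurable del]

section \<open>A twice continuously differentiable mollifier\<close>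

lemma max_0_power2_deriv:
  "((\<lambda>t::real. (max 0 t)\<^sup>2) has_real_derivative 2 * max 0 t) (at t)"
proof -
  consider "t > 0" | "t < 0" | "t = 0" by linarith
  then show ?thesis
  proof cases
    case 1
    have "((\<lambda>t::real. t\<^sup>2) has_real_derivative 2 * max 0 t) (at t)"
      using 1 by (auto intro!: derivative_eq_intros)
    then show ?thesis
      by (rule has_field_derivative_transform_within_open[OF _ open_greaterThan]) (use 1 in auto)
  next
    case 2
    have "((\<lambda>t::real. 0) has_real_derivative 2 * max 0 t) (at t)"
      using 2 by (auto intro!: derivative_eq_intros)
    then show ?thesis
      by (rule has_field_derivative_transform_within_open[OF _ open_lessThan]) (use 2 in auto)
  next
    case 3
    have "((\<lambda>h::real. (max 0 h)\<^sup>2 / h) \<longlongrightarrow> 0) (at 0)"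
    proof (rule Lim_null_comparison)
      show "eventually (\<lambda>h::real. norm ((max 0 h)\<^sup>2 / h) \<le> \<bar>h\<bar>) (at 0)"
        by (intro always_eventually allI) (auto simp: max_def power2_eq_square)
      show "((\<lambda>h::real. \<bar>h\<bar>) \<longlongrightarrow> 0) (at 0)" by (intro tendsto_rabs_zero) simp
    qed
    then show ?thesis using 3 by (simp add: has_field_derivative_iff)
  qed
qed

lemma max_0_power3_deriv:
  "((\<lambda>t::real. (max 0 t) ^ 3) has_real_derivative 3 * (max 0 t)\<^sup>2) (at t)"
proof -
  have "((\<lambda>t::real. t * (max 0 t)\<^sup>2) has_real_derivative 3 * (max 0 t)\<^sup>2) (at t)"
    by (rule derivative_eq_intros max_0_power2_deriv refl)+ (auto simp: max_def power2_eq_square)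
  moreover have "(\<lambda>t::real. t * (max 0 t)\<^sup>2) = (\<lambda>t. (max 0 t) ^ 3)"
    by (auto simp: max_def power2_eq_square power3_eq_cube)
  ultimately show ?thesis by simp
qed

text \<open>\<open>kerg \<eta> v\<close> and \<open>kerh \<eta> v w\<close> are the first and second directional derivatives of \<open>ker \<eta>\<close>; the
  third power makes \<open>ker \<eta>\<close> twice continuously differentiable.\<close>

definition bump :: "real \<Rightarrow> 'a::euclidean_space \<Rightarrow> real" where
  "bump \<eta> z = (max 0 (\<eta>\<^sup>2 - z \<bullet> z)) ^ 3"

definition ker :: "real \<Rightarrow> 'a::euclidean_space \<Rightarrow> real" where
  "ker \<eta> z = bump \<eta> z / (\<integral>y. bump \<eta> y \<partial>(lborel :: 'a measure))"

definition kerg :: "real \<Rightarrow> 'a::euclidean_space \<Rightarrow> 'a \<Rightarrow> real" where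
  "kerg \<eta> v z = - 6 * (max 0 (\<eta>\<^sup>2 - z \<bullet> z))\<^sup>2 * (z \<bullet> v) / (\<integral>y. bump \<eta> y \<partial>(lborel :: 'a measure))"

definition kerh :: "real \<Rightarrow> 'a::euclidean_space \<Rightarrow> 'a \<Rightarrow> 'a \<Rightarrow> real" where
  "kerh \<eta> v w z = (24 * max 0 (\<eta>\<^sup>2 - z \<bullet> z) * (z \<bullet> v) * (z \<bullet> w) - 6 * (max 0 (\<eta>\<^sup>2 - z \<bullet> z))\<^sup>2 * (v \<bullet> w))
     / (\<integral>y. bump \<eta> y \<partial>(lborel :: 'a measure))"

text \<open>Symmetry of second derivatives, made explicit on the kernel; it passes to mollified maps
  and there supplies the hypothesis \<open>sym\<close> of the integral identities for
  determinants.\<close>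

lemma kerh_sym: "kerh \<eta> v w z = kerh \<eta> w v z"
  by (simp add: kerh_def inner_commute)

lemma max_0_norm: "\<eta> > 0 \<Longrightarrow> norm z \<ge> \<eta> \<Longrightarrow> max 0 (\<eta>\<^sup>2 - z \<bullet> z) = 0"
  by (simp add: max_def dot_square_norm power_mono)

lemma ker_supp:
  assumes "\<eta> > 0" "norm z \<ge> \<eta>"
  shows "bump \<eta> z = 0" "ker \<eta> z = 0" "kerg \<eta> v z = 0" "kerh \<eta> v w z = 0"
  using max_0_norm[OF assms] by (simp_all add: ker_def bump_def kerg_def kerh_def)

lemma ker_cont:
  "continuous_on UNIV (bump \<eta>)" "continuous_on UNIV (ker \<eta>)" "continuous_on UNIV (kerg \<eta> v)" "continuous_on UNIV (kerh \<eta> v w)"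
  unfolding ker_def bump_def kerg_def kerh_def divide_inverse by (intro continuous_intros; simp)+

lemma bump_arg_deriv:
  fixes z v :: "'a::euclidean_space"
  shows "((\<lambda>t. \<eta>\<^sup>2 - (z + t *\<^sub>R v) \<bullet> (z + t *\<^sub>R v)) has_real_derivative - 2 * (z \<bullet> v)) (at 0)"
proof -
  have "(\<lambda>t. \<eta>\<^sup>2 - (z + t *\<^sub>R v) \<bullet> (z + t *\<^sub>R v)) = (\<lambda>t. \<eta>\<^sup>2 - z \<bullet> z - t * (2 * (z \<bullet> v)) - t\<^sup>2 * (v \<bullet> v))"
    by (auto simp: inner_add_left inner_add_right algebra_simps power2_eq_square inner_commute)
  then show ?thesis by (auto intro!: derivative_eq_intros)
qed

lemma ker_deriv: 
  fixes z v :: "'a::euclidean_space"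
  shows "((\<lambda>t. ker \<eta> (z + t *\<^sub>R v)) has_real_derivative kerg \<eta> v z) (at 0)"
proof -
  have "((\<lambda>t. max 0 (\<eta>\<^sup>2 - (z + t *\<^sub>R v) \<bullet> (z + t *\<^sub>R v)) ^ 3) has_real_derivative
       (- 2 * (z \<bullet> v)) * (3 * (max 0 (\<eta>\<^sup>2 - (z + 0 *\<^sub>R v) \<bullet> (z + 0 *\<^sub>R v)))\<^sup>2)) (at 0)"
    using DERIV_chain'[OF bump_arg_deriv max_0_power3_deriv, of \<eta> z v] by (simp only: mult.commute)
  from DERIV_cdivide[OF this, of "\<integral>y. bump \<eta> y \<partial>(lborel :: 'a measure)"]
  show ?thesis by (simp add: ker_def bump_def kerg_def algebra_simps)
qed

lemma kerg_deriv: 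
  fixes z v :: "'a::euclidean_space"
  shows "((\<lambda>t. kerg \<eta> v (z + t *\<^sub>R w)) has_real_derivative kerh \<eta> v w z) (at 0)"
proof -
  have 1: "((\<lambda>t. (max 0 (\<eta>\<^sup>2 - (z + t *\<^sub>R w) \<bullet> (z + t *\<^sub>R w)))\<^sup>2) has_real_derivative
       (- 2 * (z \<bullet> w)) * (2 * (max 0 (\<eta>\<^sup>2 - (z + 0 *\<^sub>R w) \<bullet> (z + 0 *\<^sub>R w))))) (at 0)"
    using DERIV_chain'[OF bump_arg_deriv max_0_power2_deriv, of \<eta> z w] by (simp only: mult.commute)
  have 2: "((\<lambda>t. (z + t *\<^sub>R w) \<bullet> v) has_real_derivative (w \<bullet> v)) (at 0)"
    by (auto simp: inner_add_left intro!: derivative_eq_intros)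
  have "((\<lambda>t. (max 0 (\<eta>\<^sup>2 - (z + t *\<^sub>R w) \<bullet> (z + t *\<^sub>R w)))\<^sup>2 * ((z + t *\<^sub>R w) \<bullet> v)) has_real_derivative
      (- 4 * (z \<bullet> w)) * max 0 (\<eta>\<^sup>2 - z \<bullet> z) * (z \<bullet> v) + (max 0 (\<eta>\<^sup>2 - z \<bullet> z))\<^sup>2 * (w \<bullet> v)) (at 0)"
    using DERIV_mult[OF 1 2] by (simp add: algebra_simps)
  from DERIV_cdivide[OF DERIV_cmult[OF this, of "-6"], of "\<integral>y. bump \<eta> y \<partial>(lborel :: 'a measure)"]
  show ?thesis by (simp add: kerg_def kerh_def algebra_simps inner_commute)
qed

text \<open>A nonnegative function of integral zero vanishes almost everywhere, but
  \<open>bump \<eta>\<close> is positive on a ball, which has positive volume. This legitimises the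
  division in \<open>ker\<close>.\<close>

lemma bump_integral_pos:
  assumes "\<eta> > 0"
  shows "(\<integral>y. bump \<eta> y \<partial>(lborel :: 'a::euclidean_space measure)) > 0"
proof -
  have int: "integrable lborel (bump \<eta> :: 'a \<Rightarrow> real)"
    by (rule integrable_continuous_bounded_support(2)[OF ker_cont(1), of \<eta>]) (rule ker_supp[OF assms])
  have nn: "bump \<eta> y \<ge> 0" for y :: 'a by (simp add: bump_def)
  have pos: "bump \<eta> y > 0" if "y \<in> ball 0 \<eta>" for y :: 'a
    using that assms by (simp add: bump_def dot_square_norm power_strict_mono)
  have "(\<integral>y. bump \<eta> y \<partial>(lborel :: 'a measure)) \<noteq> 0"
  proof
    assume "(\<integral>y. bump \<eta> y \<partial>(lborel :: 'a measure)) = 0"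
    then have "AE y in (lborel :: 'a measure). bump \<eta> y = 0"
      using integral_nonneg_eq_0_iff_AE[OF int] nn by simp
    then have "AE y in (lborel :: 'a measure). y \<notin> ball 0 \<eta>"
      by eventually_elim (use pos in force)
    then have "emeasure lborel (ball (0::'a) \<eta>) = 0"
      by (subst (asm) AE_iff_measurable[of "ball (0::'a) \<eta>"]) (auto simp: set_eq_iff)
    then show False using content_ball_pos[OF assms, of "0::'a"] by (simp add: measure_def)
  qed
  moreover have "(\<integral>y. bump \<eta> y \<partial>(lborel :: 'a measure)) \<ge> 0" using nn by simp
  ultimately show ?thesis by simp
qed

lemma ker_nonneg: "\<eta> > 0 \<Longrightarrow> ker \<eta> z \<ge> 0"
  using bump_integral_pos[of \<eta>, where 'a='a] by (simp add: ker_def bump_def)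

lemma ker_integral:
  assumes "\<eta> > 0"
  shows "integrable lborel (ker \<eta> :: 'a::euclidean_space \<Rightarrow> real)" "(\<integral>y. ker \<eta> y \<partial>(lborel :: 'a measure)) = 1"
    "(\<integral>\<^sup>+y. ker \<eta> y \<partial>(lborel :: 'a measure)) = 1"
proof -
  show i: "integrable lborel (ker \<eta> :: 'a::euclidean_space \<Rightarrow> real)"
    by (rule integrable_continuous_bounded_support(2)[OF ker_cont(2), of \<eta>]) (rule ker_supp[OF assms])
  show e: "(\<integral>y. ker \<eta> y \<partial>(lborel :: 'a measure)) = 1"
    using bump_integral_pos[OF assms, where 'a='a] by (simp add: ker_def[abs_def])
  show "(\<integral>\<^sup>+y. ker \<eta> y \<partial>(lborel :: 'a measure)) = 1"
    using nn_integral_eq_integral[OF i] e by (simp add: ker_nonneg[OF assms])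
qed

lemma ker_meas[measurable]: "ker \<eta> \<in> borel_measurable borel"
  by (rule borel_measurable_continuous_onI[OF ker_cont(2)])

text \<open>Read as a probability density, the kernel makes mollification an expectation, to which
  Jensen's inequality applies.\<close>

lemma kernel_prob_space:
  assumes "\<eta> > 0"
  shows "prob_space (density lborel (\<lambda>y. ennreal (ker \<eta> (y :: 'a::euclidean_space))))"
  by (rule prob_spaceI) (simp add: emeasure_density ker_integral(3)[OF assms])

lemma conv_ker_shift:
  assumes "\<eta> > 0" "locint f"
  shows "conv (ker \<eta>) f x = (\<integral>y. ker \<eta> y * f (x + y) \<partial>lborel)"
    "integrable lborel (\<lambda>y. ker \<eta> y * f (x + y))"
  by (rule conv_shift[OF ker_cont(2) _ assms(2), where r=\<eta>]; simp add: ker_supp(2)[OF assms(1)])+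

lemma conv_ker_continuous:
  assumes "\<eta> > 0" "locint f"
  shows "continuous_on UNIV (conv (ker \<eta>) f)"
  by (rule conv_continuous[OF ker_cont(2) _ assms(2), where r=\<eta>]) (simp add: ker_supp(2)[OF assms(1)])

text \<open>Jensen's inequality for the convex function \<open>\<bar>t\<bar> ^ m\<close>. Powers of
  mollified derivatives are thereby dominated by mollified powers, which converge in local mean;
  this is the source of the majorants for determinants of mollified maps.\<close>

lemma conv_ker_power:
  assumes \<eta>: "\<eta> > 0" and f: "locint f" and fm: "locint (\<lambda>x. \<bar>f x\<bar> ^ m)" and m: "m \<ge> 1"
  shows "\<bar>conv (ker \<eta>) f x\<bar> ^ m \<le> conv (ker \<eta>) (\<lambda>x. \<bar>f x\<bar> ^ m) x"
proof -
  note [measurable] = locint_measurable[OF f] locint_measurable[OF fm]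
  note cs = conv_ker_shift[OF \<eta>]
  interpret Q: prob_space "density lborel (\<lambda>y. ennreal (ker \<eta> (y :: 'a::euclidean_space)))"
    by (rule kernel_prob_space[OF \<eta>])
  have dens: "integrable (density lborel (\<lambda>y. ennreal (ker \<eta> y))) h \<longleftrightarrow> integrable lborel (\<lambda>y. ker \<eta> y * h y)"
    if "h \<in> borel_measurable borel" for h :: "'a \<Rightarrow> real"
    using that by (subst integrable_density) (auto simp: ker_nonneg[OF \<eta>])
  have densi: "(\<integral>y. h y \<partial>(density lborel (\<lambda>y. ennreal (ker \<eta> y)))) = (\<integral>y. ker \<eta> y * h y \<partial>lborel)"
    if "h \<in> borel_measurable borel" for h :: "'a \<Rightarrow> real"
    using that by (subst integral_density) (auto simp: ker_nonneg[OF \<eta>])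
  have cvx: "convex_on UNIV (\<lambda>t::real. \<bar>t\<bar> ^ m)"
  proof -
    have 1: "convex_on {0..} (\<lambda>t::real. t ^ m)"
    proof (rule f''_ge0_imp_convex[where f' = "\<lambda>t. real m * t ^ (m - 1)" and f'' = "\<lambda>t. real m * (real (m - 1) * t ^ (m - 1 - 1))"])
    qed (auto intro!: derivative_eq_intros)
    show ?thesis
    proof (rule convex_onI)
      fix t x y :: real assume t: "0 < t" "t < 1"
      have "\<bar>(1 - t) *\<^sub>R x + t *\<^sub>R y\<bar> \<le> (1 - t) * \<bar>x\<bar> + t * \<bar>y\<bar>"
        using t by (auto simp: abs_mult intro!: order_trans[OF abs_triangle_ineq])
      then have "\<bar>(1 - t) *\<^sub>R x + t *\<^sub>R y\<bar> ^ m \<le> ((1 - t) * \<bar>x\<bar> + t * \<bar>y\<bar>) ^ m"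
        by (intro power_mono) auto
      also have "\<dots> \<le> (1 - t) * \<bar>x\<bar> ^ m + t * \<bar>y\<bar> ^ m"
        using convex_onD[OF 1, of t "\<bar>x\<bar>" "\<bar>y\<bar>"] t by simp
      finally show "\<bar>(1 - t) *\<^sub>R x + t *\<^sub>R y\<bar> ^ m \<le> (1 - t) * \<bar>x\<bar> ^ m + t * \<bar>y\<bar> ^ m" .
    qed simp
  qed
  have "\<bar>\<integral>y. f (x + y) \<partial>(density lborel (\<lambda>y. ennreal (ker \<eta> y)))\<bar> ^ m
      \<le> (\<integral>y. \<bar>f (x + y)\<bar> ^ m \<partial>(density lborel (\<lambda>y. ennreal (ker \<eta> y))))"
    using cs(2)[OF f] cs(2)[OF fm] by (intro Q.jensens_inequality[where I=UNIV] cvx) (auto simp: dens)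
  then show ?thesis by (simp add: densi cs(1)[OF f] cs(1)[OF fm])
qed

section \<open>Convergence of mollifications in local mean\<close>

lemma ennreal_tendsto_0I:
  fixes f :: "'a \<Rightarrow> ennreal"
  assumes "\<And>e::real. e > 0 \<Longrightarrow> eventually (\<lambda>n. f n \<le> ennreal e) F"
  shows "(f \<longlongrightarrow> 0) F"
proof (rule order_tendstoI)
  fix a :: ennreal assume "0 < a"
  then obtain b where b: "0 < b" "b < a" using dense by blast
  then have "b < \<infinity>" using less_trans[of b a] top.not_eq_extremum by (cases "a = \<infinity>") auto
  then obtain e where e: "b = ennreal e" "e > 0" using b(1) by (cases b) auto
  from assms[OF e(2)] show "eventually (\<lambda>n. f n < a) F"
    by eventually_elim (use b e in auto)
qed auto

text \<open>Three errors of size \<open>e / 3\<close>: \<open>f\<close> is close in mean to a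
  bounded continuous \<open>g\<close> on the ball of radius \<open>R + 1\<close>; mollifying the
  difference \<open>d\<close> does not increase its mean, the enlarged radius absorbing shifts by at
  most \<open>\<eta> n \<le> 1\<close>; and \<open>g\<close> is uniformly continuous on the larger
  ball, so its mollification is uniformly close to it.\<close>

lemma conv_ker_tendsto_L1:
  fixes f :: "'a::euclidean_space \<Rightarrow> real"
  assumes f: "locint f" and \<eta>: "\<And>n. 0 < \<eta> n" "\<And>n. \<eta> n \<le> 1" "\<eta> \<longlonglongrightarrow> 0"
  shows "(\<lambda>n. \<integral>\<^sup>+x. indicator (ball 0 R) x * ennreal \<bar>conv (ker (\<eta> n)) f x - f x\<bar> \<partial>lborel) \<longlonglongrightarrow> 0"
proof (rule ennreal_tendsto_0I)
  fix e :: real assume e: "e > 0"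
  note [measurable] = locint_measurable[OF f]
  have cs: "conv (ker (\<eta> n)) h x = (\<integral>y. ker (\<eta> n) y * h (x + y) \<partial>lborel)"
    "integrable lborel (\<lambda>y. ker (\<eta> n) y * h (x + y))" if "locint h" for n h and x :: 'a
    using conv_ker_shift[OF \<eta>(1) that] by auto
  have cm[measurable]: "conv (ker (\<eta> n)) h \<in> borel_measurable borel" if "locint h" for h :: "'a \<Rightarrow> real" and n
    using borel_measurable_continuous_onI[OF conv_ker_continuous[OF \<eta>(1) that]] by simp
  define \<nu> where "\<nu> = density lborel (\<lambda>x. indicator (ball (0::'a) (R+1)) x)"
  have fin: "finite_measure \<nu>"
    by (rule finite_measureI) (use emeasure_lborel_ball_finite[of "0::'a" "R+1"] in \<open>auto simp: \<nu>_def emeasure_density\<close>)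
  have sets\<nu>: "sets \<nu> = sets borel" by (simp add: \<nu>_def)
  have "integrable \<nu> f"
    unfolding \<nu>_def by (subst integrable_density[where g="indicator (ball 0 (R+1))", simplified ennreal_indicator]) (auto intro: locintD[OF f])
  from L1_approx_continuous[OF fin sets\<nu> this, of "e/3"] e
  obtain g where g: "continuous_on UNIV g" "bounded (range g)" "(\<integral>x. \<bar>f x - g x\<bar> \<partial>\<nu>) < e/3" by auto
  have gm[measurable]: "g \<in> borel_measurable borel" using borel_measurable_continuous_onI[OF g(1)] by simp
  obtain B where B: "\<And>x. \<bar>g x\<bar> \<le> B" using g(2) by (auto simp: bounded_iff)
  have gl: "locint g"
    unfolding locint_def
  proof (intro conjI allI gm)
    fix R show "integrable lborel (\<lambda>x. indicator (ball 0 R) x * g x)"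
    proof (rule Bochner_Integration.integrable_bound)
      show "integrable lborel (\<lambda>x::'a. B * indicator (ball 0 R) x)"
        by (intro integrable_mult_right integrable_real_indicator) (auto intro!: emeasure_lborel_ball_finite simp: emeasure_lborel_ball_finite[simplified])
      show "AE x in lborel. norm (indicator (ball 0 R) x * g x) \<le> norm (B * indicator (ball 0 R) x)"
        by (intro AE_I2) (use B abs_ge_self[of B] in \<open>auto simp: indicator_def intro: order_trans[OF B]\<close>)
    qed simp
  qed
  define d where "d x = f x - g x" for x
  have dm[measurable]: "d \<in> borel_measurable borel" unfolding d_def by measurable
  have dl: "locint d"
    unfolding d_def locint_def right_diff_distrib
    by (auto intro!: Bochner_Integration.integrable_diff locintD f gl)
  have dint: "(\<integral>\<^sup>+x. indicator (ball 0 (R+1)) x * ennreal \<bar>d x\<bar> \<partial>lborel) \<le> ennreal (e/3)"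
  proof -
    have "integrable \<nu> (\<lambda>x. \<bar>d x\<bar>)"
      unfolding \<nu>_def using integrable_abs[OF locintD[OF dl, of "R+1"]]
      by (subst integrable_density[where g="indicator (ball 0 (R+1))", simplified ennreal_indicator]) (auto simp: abs_mult)
    then have "(\<integral>\<^sup>+x. ennreal \<bar>d x\<bar> \<partial>\<nu>) = ennreal (\<integral>x. \<bar>d x\<bar> \<partial>\<nu>)"
      by (rule nn_integral_eq_integral) simp
    also have "\<dots> \<le> ennreal (e/3)" using g(3) by (intro ennreal_leI) (simp add: d_def)
    finally show ?thesis unfolding \<nu>_def by (subst (asm) nn_integral_density) auto
  qed
  have conv_d: "(\<integral>\<^sup>+x. indicator (ball 0 R) x * ennreal \<bar>conv (ker (\<eta> n)) d x\<bar> \<partial>lborel) \<le> ennreal (e/3)" for n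
  proof -
    have "(\<integral>\<^sup>+x. indicator (ball 0 R) x * ennreal \<bar>conv (ker (\<eta> n)) d x\<bar> \<partial>lborel)
        \<le> (\<integral>\<^sup>+x. indicator (ball 0 R) x * (\<integral>\<^sup>+y. ennreal (ker (\<eta> n) y) * ennreal \<bar>d (x + y)\<bar> \<partial>lborel) \<partial>lborel)"
    proof (intro nn_integral_mono mult_left_mono)
      fix x :: 'a
      have "ennreal \<bar>conv (ker (\<eta> n)) d x\<bar> \<le> (\<integral>\<^sup>+y. norm (ker (\<eta> n) y * d (x + y)) \<partial>lborel)"
        unfolding cs(1)[OF dl] using integral_norm_bound_ennreal[OF cs(2)[OF dl]] by simp
      also have "\<dots> = (\<integral>\<^sup>+y. ennreal (ker (\<eta> n) y) * ennreal \<bar>d (x + y)\<bar> \<partial>lborel)"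
        by (intro nn_integral_cong) (simp add: abs_mult ennreal_mult ker_nonneg[OF \<eta>(1)])
      finally show "ennreal \<bar>conv (ker (\<eta> n)) d x\<bar> \<le> (\<integral>\<^sup>+y. ennreal (ker (\<eta> n) y) * ennreal \<bar>d (x + y)\<bar> \<partial>lborel)" .
    qed simp
    also have "\<dots> = (\<integral>\<^sup>+x. \<integral>\<^sup>+y. indicator (ball 0 R) x * (ennreal (ker (\<eta> n) y) * ennreal \<bar>d (x + y)\<bar>) \<partial>lborel \<partial>lborel)"
      by (intro nn_integral_cong nn_integral_cmult[symmetric]) simp
    also have "\<dots> = (\<integral>\<^sup>+y. \<integral>\<^sup>+x. indicator (ball 0 R) x * (ennreal (ker (\<eta> n) y) * ennreal \<bar>d (x + y)\<bar>) \<partial>lborel \<partial>lborel)"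
      by (rule lborel_pair.Fubini') simp
    also have "\<dots> \<le> (\<integral>\<^sup>+y. ennreal (ker (\<eta> n) y) * ennreal (e/3) \<partial>(lborel :: 'a measure))"
    proof (intro nn_integral_mono)
      fix y :: 'a
      show "(\<integral>\<^sup>+x. indicator (ball 0 R) x * (ennreal (ker (\<eta> n) y) * ennreal \<bar>d (x + y)\<bar>) \<partial>lborel) \<le> ennreal (ker (\<eta> n) y) * ennreal (e/3)"
      proof (cases "norm y \<ge> \<eta> n")
        case True
        then show ?thesis by (simp add: ker_supp(2)[OF \<eta>(1)])
      next
        case False
        then have y: "norm y < 1" using \<eta>(2)[of n] by simp
        have "(\<integral>\<^sup>+x. indicator (ball 0 R) x * (ennreal (ker (\<eta> n) y) * ennreal \<bar>d (x + y)\<bar>) \<partial>lborel)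
           = ennreal (ker (\<eta> n) y) * (\<integral>\<^sup>+x. indicator (ball 0 R) x * ennreal \<bar>d (x + y)\<bar> \<partial>lborel)"
          by (subst nn_integral_cmult[symmetric]) (auto simp: mult_ac)
        also have "(\<integral>\<^sup>+x. indicator (ball 0 R) x * ennreal \<bar>d (x + y)\<bar> \<partial>lborel) \<le>
            (\<integral>\<^sup>+x. indicator (ball 0 (R+1)) (y + x) * ennreal \<bar>d (y + x)\<bar> \<partial>lborel)"
        proof (intro nn_integral_mono)
          fix x :: 'a
          have "norm (y + x) < R + 1" if "norm x < R" using norm_triangle_ineq[of y x] y that by simp
          then show "indicator (ball 0 R) x * ennreal \<bar>d (x + y)\<bar> \<le> indicator (ball 0 (R+1)) (y + x) * ennreal \<bar>d (y + x)\<bar>"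
            by (auto simp: indicator_def add.commute)
        qed
        also have "\<dots> = (\<integral>\<^sup>+x. indicator (ball 0 (R+1)) x * ennreal \<bar>d x\<bar> \<partial>lborel)"
          by (rule lborel_nn_integral_translation[of "\<lambda>x. indicator (ball 0 (R+1)) x * ennreal \<bar>d x\<bar>"]) simp
        also note dint
        finally show ?thesis by (simp add: mult_left_mono)
      qed
    qed
    also have "(\<integral>\<^sup>+y. ennreal (ker (\<eta> n) y) * ennreal (e/3) \<partial>(lborel :: 'a measure)) = ennreal (e/3)"
      by (subst nn_integral_multc) (auto simp: ker_integral(3)[OF \<eta>(1)])
    finally show ?thesis .
  qed
  define V where "V = measure lborel (ball (0::'a) R)"
  \<comment> \<open>A uniform error \<open>\<delta>\<close> over a ball of volume \<open>V\<close>
    integrates to at most \<open>e / 3\<close>; the \<open>+ 1\<close> covers the case of zero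
    volume.\<close>
  define \<delta> where "\<delta> = e / (3 * (V + 1))"
  have V: "V \<ge> 0" by (simp add: V_def)
  have \<delta>: "\<delta> > 0" using e V by (simp add: \<delta>_def add_nonneg_pos)
  have "uniformly_continuous_on (cball 0 (R+1)) g"
    by (intro compact_uniformly_continuous continuous_on_subset[OF g(1)]) auto
  then obtain \<rho> where \<rho>: "\<rho> > 0" "\<And>x x'. x \<in> cball 0 (R+1) \<Longrightarrow> x' \<in> cball 0 (R+1) \<Longrightarrow> dist x' x < \<rho> \<Longrightarrow> dist (g x') (g x) < \<delta>"
    using \<delta> unfolding uniformly_continuous_on_def by metis
  have "eventually (\<lambda>n. \<eta> n < \<rho>) sequentially" using \<eta>(3) \<rho>(1) by (rule order_tendstoD)
  then show "eventually (\<lambda>n. (\<integral>\<^sup>+x. indicator (ball 0 R) x * ennreal \<bar>conv (ker (\<eta> n)) f x - f x\<bar> \<partial>lborel) \<le> ennreal e) sequentially"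
  proof eventually_elim
    case (elim n)
    have cg: "\<bar>conv (ker (\<eta> n)) g x - g x\<bar> \<le> \<delta>" if x: "x \<in> ball 0 R" for x
    proof -
      note i = cs(2)[OF gl, of n x]
      have i': "integrable lborel (\<lambda>y::'a. ker (\<eta> n) y * g x)"
        using ker_integral(1)[OF \<eta>(1)[of n]] by (rule integrable_mult_left)
      have "conv (ker (\<eta> n)) g x - g x = (\<integral>y. ker (\<eta> n) y * g (x + y) \<partial>lborel) - (\<integral>y. ker (\<eta> n) y * g x \<partial>(lborel :: 'a measure))"
        by (simp add: cs(1)[OF gl] ker_integral(2)[OF \<eta>(1)])
      also have "\<dots> = (\<integral>y. ker (\<eta> n) y * (g (x + y) - g x) \<partial>lborel)"
        using i i' by (simp add: Bochner_Integration.integral_diff right_diff_distrib)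
      finally have *: "\<bar>conv (ker (\<eta> n)) g x - g x\<bar> = \<bar>\<integral>y. ker (\<eta> n) y * (g (x + y) - g x) \<partial>lborel\<bar>" by simp
      note *
      also have "\<bar>\<integral>y. ker (\<eta> n) y * (g (x + y) - g x) \<partial>lborel\<bar> \<le> (\<integral>y. ker (\<eta> n) y * \<delta> \<partial>(lborel :: 'a measure))"
      proof (rule order_trans[OF integral_abs_bound], rule integral_mono)
        show "integrable lborel (\<lambda>y. \<bar>ker (\<eta> n) y * (g (x + y) - g x)\<bar>)"
          using i i' by (auto simp: right_diff_distrib intro!: integrable_abs)
        show "integrable lborel (\<lambda>y. ker (\<eta> n) y * \<delta>)"
          using ker_integral(1)[OF \<eta>(1)[of n]] by (rule integrable_mult_left)
        fix y :: 'a
        show "\<bar>ker (\<eta> n) y * (g (x + y) - g x)\<bar> \<le> ker (\<eta> n) y * \<delta>"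
        proof (cases "norm y \<ge> \<eta> n")
          case True then show ?thesis by (simp add: ker_supp(2)[OF \<eta>(1)])
        next
          case False
          then have "dist (g (x + y)) (g x) < \<delta>"
            using elim x \<eta>(2)[of n] norm_triangle_ineq[of x y] norm_triangle_ineq4[of "- x" y] by (intro \<rho>(2)) (auto simp: dist_norm)
          then show ?thesis by (auto simp: abs_mult dist_norm ker_nonneg[OF \<eta>(1)] intro!: mult_left_mono)
        qed
      qed
      also have "\<dots> = \<delta>" using ker_integral(2)[OF \<eta>(1)[of n], where 'a='a] by simp
      finally show ?thesis .
    qed
    have "(\<integral>\<^sup>+x. indicator (ball 0 R) x * ennreal \<bar>conv (ker (\<eta> n)) f x - f x\<bar> \<partial>lborel)
      \<le> (\<integral>\<^sup>+x. indicator (ball 0 R) x * ennreal \<bar>conv (ker (\<eta> n)) d x\<bar> + indicator (ball 0 R) x * ennreal \<delta>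
             + indicator (ball 0 (R+1)) x * ennreal \<bar>d x\<bar> \<partial>lborel)"
    proof (intro nn_integral_mono)
      fix x :: 'a
      show "indicator (ball 0 R) x * ennreal \<bar>conv (ker (\<eta> n)) f x - f x\<bar> \<le> indicator (ball 0 R) x * ennreal \<bar>conv (ker (\<eta> n)) d x\<bar> + indicator (ball 0 R) x * ennreal \<delta>
             + indicator (ball 0 (R+1)) x * ennreal \<bar>d x\<bar>"
      proof (cases "x \<in> ball 0 R")
        case True
        have "conv (ker (\<eta> n)) d x = conv (ker (\<eta> n)) f x - conv (ker (\<eta> n)) g x"
          unfolding cs(1)[OF dl] cs(1)[OF f] cs(1)[OF gl] using cs(2)[OF f, of n x] cs(2)[OF gl, of n x]
          by (simp add: d_def right_diff_distrib)
        then have "\<bar>conv (ker (\<eta> n)) f x - f x\<bar> \<le> \<bar>conv (ker (\<eta> n)) d x\<bar> + \<delta> + \<bar>d x\<bar>"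
          using cg[OF True] by (simp add: d_def)
        then have "ennreal \<bar>conv (ker (\<eta> n)) f x - f x\<bar> \<le> ennreal (\<bar>conv (ker (\<eta> n)) d x\<bar> + \<delta> + \<bar>d x\<bar>)"
          by (rule ennreal_leI)
        then show ?thesis using True \<delta> by (simp add: ennreal_plus)
      qed auto
    qed
    also have "\<dots> = (\<integral>\<^sup>+x. indicator (ball 0 R) x * ennreal \<bar>conv (ker (\<eta> n)) d x\<bar> \<partial>lborel) 
        + (\<integral>\<^sup>+x. ennreal \<delta> * indicator (ball (0::'a) R) x \<partial>lborel) + (\<integral>\<^sup>+x. indicator (ball 0 (R+1)) x * ennreal \<bar>d x\<bar> \<partial>lborel)"
      using cm[OF dl, measurable] by (simp add: nn_integral_add mult.commute)
    also have "(\<integral>\<^sup>+x. ennreal \<delta> * indicator (ball (0::'a) R) x \<partial>lborel) \<le> ennreal (e/3)"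
    proof -
      have "(\<integral>\<^sup>+x. ennreal \<delta> * indicator (ball (0::'a) R) x \<partial>lborel) = ennreal \<delta> * ennreal V"
        using emeasure_lborel_ball_finite[of "0::'a" R]
        by (subst nn_integral_cmult_indicator) (auto simp: V_def emeasure_eq_ennreal_measure)
      also have "\<dots> = ennreal (\<delta> * V)" using \<delta> V by (simp add: ennreal_mult)
      also have "\<delta> * V \<le> e/3" using e V by (simp add: \<delta>_def field_simps add_nonneg_pos)
      finally show ?thesis by (simp add: ennreal_leI)
    qed
    also note conv_d[of n]
    also note dint
    finally have "(\<integral>\<^sup>+x. indicator (ball 0 R) x * ennreal \<bar>conv (ker (\<eta> n)) f x - f x\<bar> \<partial>lborel) \<le> ennreal (e/3) + ennreal (e/3) + ennreal (e/3)"
      by (simp add: add_mono add_left_mono add_right_mono)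
    also have "\<dots> = ennreal e" using e by (simp flip: ennreal_plus)
    finally show ?case .
  qed
qed

text \<open>Convolution of \<open>u\<close> with the constant \<open>1\<close> is constant, equal to
  the integral of \<open>u\<close>; its derivative is minus the integral of \<open>u'\<close>. This
  is the integration by parts used below, obtained without iterated integrals along lines.\<close>

lemma integral_line_derivative_zero:
  fixes u u' :: "'a::euclidean_space \<Rightarrow> real"
  assumes c: "continuous_on UNIV u" "continuous_on UNIV u'"
    and z: "\<And>z. norm z \<ge> r \<Longrightarrow> u z = 0" "\<And>z. norm z \<ge> r \<Longrightarrow> u' z = 0"
    and d: "\<And>z. ((\<lambda>t. u (z + t *\<^sub>R v)) has_real_derivative u' z) (at 0)"
  shows "(\<integral>x. u' x \<partial>lborel) = 0"
proof -
  have l: "locint (\<lambda>x::'a. 1)"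
    by (auto simp: locint_def intro!: integrable_real_indicator emeasure_lborel_ball_finite[simplified])
  have m: "u \<in> borel_measurable borel" using borel_measurable_continuous_onI[OF c(1)] .
  have eq: "conv u (\<lambda>_. 1) x = (\<integral>x. u x \<partial>lborel)" for x
    using lborel_integral_translation[OF m, of "- x"] by (simp add: conv_def)
  have "((\<lambda>t. conv u (\<lambda>_. 1) (0 + t *\<^sub>R v)) has_real_derivative - conv u' (\<lambda>_. 1) 0) (at 0)"
    by (rule conv_deriv[OF c(1) z(1) l c(2) z(2) d])
  then have "((\<lambda>t::real. (\<integral>x. u x \<partial>lborel)) has_real_derivative - (\<integral>x. u' x \<partial>lborel)) (at 0)"
    unfolding eq by (simp add: conv_def)
  from DERIV_unique[OF this DERIV_const] show ?thesis by simp
qed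

section \<open>Sobolev maps and the area identity\<close>

text \<open>Each second-derivative term appears twice, with opposite signs, by \<open>sym\<close> and antisymmetry of
  the determinant.\<close>

lemma null_lagrangian:
  fixes u :: "real^'m \<Rightarrow> real" and ug :: "'m \<Rightarrow> real^'m \<Rightarrow> real"
    and d :: "'m \<Rightarrow> 'm \<Rightarrow> real^'m \<Rightarrow> real" and dd :: "'m \<Rightarrow> 'm \<Rightarrow> 'm \<Rightarrow> real^'m \<Rightarrow> real"
  assumes c: "continuous_on UNIV u" "\<And>i. continuous_on UNIV (ug i)" "\<And>i j. continuous_on UNIV (d i j)"
      "\<And>l i j. continuous_on UNIV (dd l i j)"
    and z: "\<And>z. norm z \<ge> r \<Longrightarrow> u z = 0" "\<And>i z. norm z \<ge> r \<Longrightarrow> ug i z = 0"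
    and du: "\<And>i x. ((\<lambda>t. u (x + t *\<^sub>R axis i 1)) has_real_derivative ug i x) (at 0)"
    and ddd: "\<And>l i j x. ((\<lambda>t. d i j (x + t *\<^sub>R axis l 1)) has_real_derivative dd l i j x) (at 0)"
    and sym: "\<And>l i j x. dd l i j x = dd i l j x"
  shows "(\<integral>x. det ((\<chi> j. if j = k then (\<chi> i. ug i x) else (\<chi> i. d i j x)) :: real^'m^'m) \<partial>lborel) = 0"
proof -
  let ?P = "{p. p permutes (UNIV :: 'm set)}"
  \<comment> \<open>\<open>a p\<close> is the Leibniz term of the permutation \<open>p\<close>. When
    the derivative in direction \<open>p k\<close> is moved off \<open>u\<close> by parts, it falls
    in turn on the factor of each other row \<open>j\<close>, which produces
    \<open>t p j\<close>.\<close>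
  define a where "a p x = ug (p k) x * (\<Prod>j\<in>UNIV - {k}. d (p j) j x)" for p x
  define t where "t p j x = u x * (dd (p k) (p j) j x * (\<Prod>l\<in>UNIV - {k} - {j}. d (p l) l x))" for p j x
  have int: "integrable lborel (a p)" "integrable lborel (t p j)" for p j
    unfolding a_def t_def
    by (rule integrable_continuous_bounded_support(2)[where r=r]; (intro continuous_intros c)?; simp add: z)+
  have det: "det ((\<chi> j. if j = k then (\<chi> i. ug i x) else (\<chi> i. d i j x)) :: real^'m^'m) = (\<Sum>p\<in>?P. of_int (sign p) * a p x)" for x
    unfolding det_def a_def
  proof (intro sum.cong refl arg_cong2[where f="(*)"])
    fix p assume "p \<in> ?P"
    have "(\<Prod>i\<in>UNIV. (\<chi> j. if j = k then \<chi> i. ug i x else (\<chi> i. d i j x)) $ i $ p i) =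
        (\<chi> j. if j = k then \<chi> i. ug i x else (\<chi> i. d i j x)) $ k $ p k * (\<Prod>i\<in>UNIV - {k}. (\<chi> j. if j = k then \<chi> i. ug i x else (\<chi> i. d i j x)) $ i $ p i)"
      by (rule prod.remove) auto
    also have "\<dots> = ug (p k) x * (\<Prod>j\<in>UNIV - {k}. d (p j) j x)"
      by (intro arg_cong2[where f="(*)"] prod.cong) auto
    finally show "(\<Prod>i\<in>UNIV. (\<chi> j. if j = k then \<chi> i. ug i x else (\<chi> i. d i j x)) $ i $ p i) = ug (p k) x * (\<Prod>j\<in>UNIV - {k}. d (p j) j x)" .
  qed
  have ibp: "(\<integral>x. a p x \<partial>lborel) = - (\<Sum>j\<in>UNIV - {k}. \<integral>x. t p j x \<partial>lborel)" for p
  proof -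
    have "(\<integral>x. a p x + (\<Sum>j\<in>UNIV - {k}. t p j x) \<partial>lborel) = 0"
    proof (rule integral_line_derivative_zero[where r=r and v="axis (p k) 1" and u="\<lambda>x. u x * (\<Prod>j\<in>UNIV - {k}. d (p j) j x)"])
      fix x
      have "((\<lambda>t. \<Prod>j\<in>UNIV - {k}. d (p j) j (x + t *\<^sub>R axis (p k) 1)) has_real_derivative
         (\<Sum>j\<in>UNIV - {k}. dd (p k) (p j) j x * (\<Prod>l\<in>UNIV - {k} - {j}. d (p l) l (x + 0 *\<^sub>R axis (p k) 1)))) (at 0)"
        by (rule has_field_derivative_prod) (rule ddd)
      from DERIV_mult[OF du this]
      show "((\<lambda>t. u (x + t *\<^sub>R axis (p k) 1) * (\<Prod>j\<in>UNIV - {k}. d (p j) j (x + t *\<^sub>R axis (p k) 1))) has_real_derivative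
         a p x + (\<Sum>j\<in>UNIV - {k}. t p j x)) (at 0)"
        by (simp add: a_def t_def sum_distrib_left mult_ac)
    qed (unfold a_def t_def, (intro continuous_intros c), (intro continuous_intros c), simp_all add: z)
    then show ?thesis using int by (simp add: Bochner_Integration.integral_add Bochner_Integration.integral_sum)
  qed
  have swap: "(\<Sum>p\<in>?P. of_int (sign p) * (\<integral>x. t p j x \<partial>lborel)) = 0" if j: "j \<noteq> k" for j
  proof -
    let ?\<tau> = "Transposition.transpose k j"
    have "(\<Sum>p\<in>?P. of_int (sign p) * (\<integral>x. t p j x \<partial>lborel)) = (\<Sum>p\<in>?P. of_int (sign (p \<circ> ?\<tau>)) * (\<integral>x. t (p \<circ> ?\<tau>) j x \<partial>lborel))"
      by (rule sum_permutations_compose_right) (rule permutes_swap_id; simp)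
    also have "\<dots> = (\<Sum>p\<in>?P. - (of_int (sign p) * (\<integral>x. t p j x \<partial>lborel)))"
    proof (intro sum.cong refl)
      fix p assume "p \<in> ?P"
      then have "permutation p" using permutation_permutes finite by blast
      then have s: "sign (p \<circ> ?\<tau>) = - sign p" using j by (simp add: sign_compose permutation_swap_id sign_swap_id)
      have "t (p \<circ> ?\<tau>) j x = t p j x" for x
      proof -
        have "(\<Prod>l\<in>UNIV - {k} - {j}. d ((p \<circ> ?\<tau>) l) l x) = (\<Prod>l\<in>UNIV - {k} - {j}. d (p l) l x)"
          by (intro prod.cong) (auto simp: Transposition.transpose_def)
        then show ?thesis unfolding t_def using sym[of "p j" "p k" j x] by simp
      qed
      then show "of_int (sign (p \<circ> ?\<tau>)) * (\<integral>x. t (p \<circ> ?\<tau>) j x \<partial>lborel) = - (of_int (sign p) * (\<integral>x. t p j x \<partial>lborel))"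
        using s by simp
    qed
    finally show ?thesis by (simp add: sum_negf)
  qed
  have "(\<integral>x. det ((\<chi> j. if j = k then (\<chi> i. ug i x) else (\<chi> i. d i j x)) :: real^'m^'m) \<partial>lborel)
     = (\<Sum>p\<in>?P. of_int (sign p) * (\<integral>x. a p x \<partial>lborel))"
    unfolding det using int by (simp add: Bochner_Integration.integral_sum)
  also have "\<dots> = - (\<Sum>p\<in>?P. \<Sum>j\<in>UNIV - {k}. of_int (sign p) * (\<integral>x. t p j x \<partial>lborel))"
    by (simp add: ibp sum_distrib_left sum_negf)
  also have "\<dots> = - (\<Sum>j\<in>UNIV - {k}. \<Sum>p\<in>?P. of_int (sign p) * (\<integral>x. t p j x \<partial>lborel))"
    by (subst sum.swap) simp
  also have "\<dots> = 0" using swap by simp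
  finally show ?thesis .
qed

section \<open>Continuously differentiable functions and the smooth area identity\<close>

definition C1 :: "('a::euclidean_space \<Rightarrow> real) \<Rightarrow> ('a \<Rightarrow> 'a) \<Rightarrow> bool" where
  "C1 f g \<longleftrightarrow> continuous_on UNIV g \<and> (\<forall>x. (f has_derivative (\<lambda>v. g x \<bullet> v)) (at x))"

lemma C1_continuous: "C1 f g \<Longrightarrow> continuous_on UNIV f"
  unfolding C1_def by (meson continuous_at_imp_continuous_on has_derivative_continuous)

lemma C1_measurable: "C1 f g \<Longrightarrow> f \<in> borel_measurable borel" "C1 f g \<Longrightarrow> g \<in> borel_measurable borel"
  using borel_measurable_continuous_onI[OF C1_continuous] borel_measurable_continuous_onI by (auto simp: C1_def)

lemma C1_line:
  assumes "C1 f g"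
  shows "((\<lambda>t. f (x + t *\<^sub>R v)) has_real_derivative g (x + t *\<^sub>R v) \<bullet> v) (at t)"
proof -
  have "((\<lambda>t. x + t *\<^sub>R v) has_derivative (\<lambda>s. s *\<^sub>R v)) (at t)"
    by (auto intro!: derivative_eq_intros)
  moreover have "(f has_derivative (\<lambda>w. g (x + t *\<^sub>R v) \<bullet> w)) (at (x + t *\<^sub>R v))" using assms by (simp add: C1_def)
  ultimately have "((\<lambda>t. f (x + t *\<^sub>R v)) has_derivative (\<lambda>s. g (x + t *\<^sub>R v) \<bullet> (s *\<^sub>R v))) (at t)"
    by (rule has_derivative_compose)
  then show ?thesis by (simp add: has_field_derivative_def mult_commute_abs)
qed

lemma C1_curve:
  assumes "C1 f g" "(c has_vector_derivative c') (at t)"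
  shows "((\<lambda>t. f (c t)) has_real_derivative g (c t) \<bullet> c') (at t)"
proof -
  have "(f has_derivative (\<lambda>w. g (c t) \<bullet> w)) (at (c t))" using assms by (simp add: C1_def)
  from has_derivative_compose[OF assms(2)[unfolded has_vector_derivative_def] this]
  show ?thesis by (simp add: has_field_derivative_def mult_commute_abs)
qed

text \<open>The mean value theorem on the segment from \<open>x\<close> to \<open>y\<close>, with
  continuity of the candidate gradient at \<open>x\<close>, controls the remainder. Convolutions
  come with directional derivatives only; this upgrades them.\<close>

lemma C1I_line:
  fixes f :: "'a::euclidean_space \<Rightarrow> real"
  assumes c: "continuous_on UNIV g" and d: "\<And>x v. ((\<lambda>t. f (x + t *\<^sub>R v)) has_real_derivative g x \<bullet> v) (at 0)"
  shows "C1 f g"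
  unfolding C1_def
proof (intro conjI allI c)
  fix x
  have d': "((\<lambda>t. f (x + t *\<^sub>R v)) has_real_derivative g (x + t *\<^sub>R v) \<bullet> v) (at t)" for v t
  proof -
    have "((\<lambda>s. f ((x + t *\<^sub>R v) + s *\<^sub>R v)) has_real_derivative g (x + t *\<^sub>R v) \<bullet> v) (at 0)" by (rule d)
    then show ?thesis
      using DERIV_shift[of "\<lambda>s. f (x + s *\<^sub>R v)" "g (x + t *\<^sub>R v) \<bullet> v" 0 t]
      by (simp add: algebra_simps)
  qed
  show "(f has_derivative (\<lambda>v. g x \<bullet> v)) (at x)"
    unfolding has_derivative_at_alt
  proof (intro conjI allI impI)
    show "bounded_linear ((\<bullet>) (g x))" by (rule bounded_linear_inner_right)
    fix e :: real assume e: "e > 0"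
    have "isCont g x" using c by (simp add: continuous_on_eq_continuous_at)
    then obtain \<delta> where \<delta>: "\<delta> > 0" "\<And>y. dist y x < \<delta> \<Longrightarrow> dist (g y) (g x) < e"
      using e unfolding continuous_at_eps_delta dist_norm by blast
    show "\<exists>\<delta>>0. \<forall>y. norm (y - x) < \<delta> \<longrightarrow> norm (f y - f x - g x \<bullet> (y - x)) \<le> e * norm (y - x)"
    proof (intro exI conjI allI impI)
      fix y assume y: "norm (y - x) < \<delta>"
      let ?v = "y - x"
      obtain \<theta> where \<theta>: "0 < \<theta>" "\<theta> < 1" "f (x + 1 *\<^sub>R ?v) - f (x + 0 *\<^sub>R ?v) = (1 - 0) * (g (x + \<theta> *\<^sub>R ?v) \<bullet> ?v)"
        using MVT2[of 0 1 "\<lambda>t. f (x + t *\<^sub>R ?v)" "\<lambda>t. g (x + t *\<^sub>R ?v) \<bullet> ?v"] d' by auto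
      then have "f y - f x - g x \<bullet> ?v = (g (x + \<theta> *\<^sub>R ?v) - g x) \<bullet> ?v" by (simp add: inner_diff_left)
      also have "norm \<dots> \<le> norm (g (x + \<theta> *\<^sub>R ?v) - g x) * norm ?v" by (simp add: Cauchy_Schwarz_ineq2)
      also have "\<dots> \<le> e * norm ?v"
      proof (rule mult_right_mono)
        have "dist (x + \<theta> *\<^sub>R ?v) x < \<delta>" using y \<theta> mult_left_le_one_le[of "norm ?v" \<theta>] by (simp add: dist_norm)
        from \<delta>(2)[OF this] show "norm (g (x + \<theta> *\<^sub>R ?v) - g x) \<le> e" by (simp add: dist_norm)
      qed simp
      finally show "norm (f y - f x - g x \<bullet> (y - x)) \<le> e * norm (y - x)" .
    qed (rule \<delta>)
  qed
qed

text \<open>The null Lagrangian identity is applied to \<open>u = \<xi> * \<phi>(F)\<close>. The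
  gradient of \<open>u\<close> is \<open>\<phi>(F) * \<xi>'\<close> plus \<open>\<xi>\<close> times
  a linear combination of the rows of the Jacobian matrix. Expanding the determinant in row
  \<open>k\<close>, the first part gives the error term, and of the combination only the multiple of
  row \<open>k\<close> itself survives.\<close>

lemma area_identity_smooth:
  fixes F :: "'m \<Rightarrow> real^'m \<Rightarrow> real" and d :: "'m \<Rightarrow> 'm \<Rightarrow> real^'m \<Rightarrow> real" and \<chi>' :: "real^'m \<Rightarrow> real^'m"
  assumes F: "\<And>j. continuous_on UNIV (F j)" "\<And>i j. continuous_on UNIV (d i j)"
      "\<And>l i j. continuous_on UNIV (dd l i j)"
    and dF: "\<And>i j x. ((\<lambda>t. F j (x + t *\<^sub>R axis i 1)) has_real_derivative d i j x) (at 0)"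
    and ddF: "\<And>l i j x. ((\<lambda>t. d i j (x + t *\<^sub>R axis l 1)) has_real_derivative dd l i j x) (at 0)"
    and sym: "\<And>l i j x. dd l i j x = dd i l j x"
    and \<phi>: "C1 \<phi> g" and \<xi>: "C1 \<xi> \<xi>'"
    and z: "\<And>z. norm z \<ge> r \<Longrightarrow> \<xi> z = 0" "\<And>z. norm z \<ge> r \<Longrightarrow> \<xi>' z = 0"
  shows "(\<integral>x. \<xi> x * g (\<chi> j. F j x) $ k * det ((\<chi> j. (\<chi> i. d i j x)) :: real^'m^'m) \<partial>lborel) =
    - (\<integral>x. \<phi> (\<chi> j. F j x) * det ((\<chi> j. if j = k then \<xi>' x else (\<chi> i. d i j x)) :: real^'m^'m) \<partial>lborel)"
proof -
  let ?F = "\<lambda>x. (\<chi> j. F j x) :: real^'m"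
  have Fc: "continuous_on UNIV ?F" by (intro continuous_intros F)
  have gc: "continuous_on UNIV (\<lambda>x. g (?F x))"
    using \<phi> by (intro continuous_on_compose2[OF _ Fc, of UNIV g]) (auto simp: C1_def)
  have \<phi>c: "continuous_on UNIV (\<lambda>x. \<phi> (?F x))"
    by (intro continuous_on_compose2[OF C1_continuous[OF \<phi>] Fc]) auto
  have \<xi>'c: "continuous_on UNIV \<xi>'" using \<xi> by (simp add: C1_def)
  note \<xi>c = C1_continuous[OF \<xi>]
  define u where "u x = \<xi> x * \<phi> (?F x)" for x
  define ug where "ug i x = \<xi>' x $ i * \<phi> (?F x) + \<xi> x * (\<Sum>l\<in>UNIV. g (?F x) $ l * d i l x)" for i x
  have dFv: "((\<lambda>t. ?F (x + t *\<^sub>R axis i 1)) has_vector_derivative (\<chi> j. d i j x)) (at 0)" for x i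
    unfolding has_vector_derivative_def
    by (subst has_derivative_componentwise_within)
       (use dF in \<open>auto simp: Basis_vec_def inner_axis has_field_derivative_def mult_commute_abs mult.commute\<close>)
  have *: "(\<integral>x. det ((\<chi> j. if j = k then (\<chi> i. ug i x) else (\<chi> i. d i j x)) :: real^'m^'m) \<partial>lborel) = 0"
  proof (rule null_lagrangian[where r=r and u=u and dd=dd])
    show "continuous_on UNIV u" unfolding u_def by (intro continuous_intros \<phi>c \<xi>c)
    show "continuous_on UNIV (ug i)" for i unfolding ug_def by (intro continuous_intros \<phi>c \<xi>c \<xi>'c gc F)
    show "u y = 0" if "norm y \<ge> r" for y using z that by (simp add: u_def)
    show "ug i y = 0" if "norm y \<ge> r" for i y using z that by (simp add: ug_def)
    fix i x
    have e1: "\<xi>' x \<bullet> axis i 1 = \<xi>' x $ i" by (simp add: inner_axis)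
    have e2: "g (?F x) \<bullet> (\<chi> j. d i j x) = (\<Sum>l\<in>UNIV. g (?F x) $ l * d i l x)" by (simp add: inner_vec_def)
    have "((\<lambda>t. \<phi> (?F (x + t *\<^sub>R axis i 1))) has_real_derivative g (?F x) \<bullet> (\<chi> j. d i j x)) (at 0)"
      using C1_curve[OF \<phi> dFv] by simp
    from DERIV_mult[OF C1_line[OF \<xi>, of x "axis i 1" 0] this]
    show "((\<lambda>t. u (x + t *\<^sub>R axis i 1)) has_real_derivative ug i x) (at 0)"
      by (simp add: u_def ug_def e1 e2 mult.commute)
  qed (rule F ddF sym)+
  let ?D = "\<lambda>x. det ((\<chi> j. (\<chi> i. d i j x)) :: real^'m^'m)"
  let ?E = "\<lambda>x. det ((\<chi> j. if j = k then \<xi>' x else (\<chi> i. d i j x)) :: real^'m^'m)"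
  have det: "det ((\<chi> j. if j = k then (\<chi> i. ug i x) else (\<chi> i. d i j x)) :: real^'m^'m) = \<phi> (?F x) * ?E x + \<xi> x * g (?F x) $ k * ?D x" for x
  proof -
    let ?A = "(\<chi> j. (\<chi> i. d i j x)) :: real^'m^'m"
    let ?s = "sum (\<lambda>i. g (?F x) $ i *s row i ?A) (UNIV::'m set)"
    have row: "row j ?A = (\<chi> i. d i j x)" for j by (simp add: row_def vec_eq_iff)
    have "(\<chi> i. ug i x) = \<phi> (?F x) *s \<xi>' x + \<xi> x *s ?s"
      by (simp add: vec_eq_iff ug_def row mult.commute)
    then have "det ((\<chi> j. if j = k then (\<chi> i. ug i x) else (\<chi> i. d i j x)) :: real^'m^'m) =
      det ((\<chi> j. if j = k then \<phi> (?F x) *s \<xi>' x + \<xi> x *s ?s else (\<chi> i. d i j x)) :: real^'m^'m)" by (simp only:)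
    also have "\<dots> = \<phi> (?F x) * ?E x + \<xi> x * det ((\<chi> j. if j = k then ?s else (\<chi> i. d i j x)) :: real^'m^'m)"
      by (simp only: det_row_add[of k "\<lambda>_. \<phi> (?F x) *s \<xi>' x" "\<lambda>_. \<xi> x *s ?s"] det_row_mul[of k _ "\<lambda>_. \<xi>' x"] det_row_mul[of k _ "\<lambda>_. ?s"])
    also have "det ((\<chi> j. if j = k then ?s else (\<chi> i. d i j x)) :: real^'m^'m) = g (?F x) $ k * ?D x"
      using cramer_lemma_transpose[of k "g (?F x)" ?A] unfolding row .
    finally show ?thesis by simp
  qed
  have "continuous_on UNIV (\<lambda>x. (if i = k then \<xi>' x else (\<chi> i'. d i' i x)))" for i
    by (cases "i = k") (auto intro!: continuous_intros F \<xi>'c)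
  then have Dc: "continuous_on UNIV ?D" "continuous_on UNIV ?E"
    unfolding det_def by (auto intro!: continuous_intros F)
  have i1: "integrable lborel (\<lambda>x. \<phi> (?F x) * ?E x)"
  proof (rule integrable_continuous_bounded_support(2)[where r=r])
    fix y :: "real^'m" assume y: "r \<le> norm y"
    have "?E y = det ((\<chi> j. if j = k then 0 *s \<xi>' y else (\<chi> i. d i j y)) :: real^'m^'m)"
      using z(2)[OF y] by (simp cong: if_cong)
    also have "\<dots> = 0" by (subst det_row_mul) simp
    finally show "\<phi> (?F y) * ?E y = 0" by simp
  qed (intro continuous_intros Dc \<phi>c)
  have i2: "integrable lborel (\<lambda>x. \<xi> x * g (?F x) $ k * ?D x)"
    by (rule integrable_continuous_bounded_support(2)[where r=r]) (intro continuous_intros Dc \<xi>c gc, simp add: z)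
  show ?thesis using * unfolding det using i1 i2 by simp
qed

text \<open>A strong derivative in local mean along one sequence of step lengths. One sequence is
  enough to identify the derivative of every mollification, and on an orbit convergence is obtained
  only along a subsequence of the steps used on the probability space.\<close>

definition wderiv :: "'m \<Rightarrow> (real^'m \<Rightarrow> real) \<Rightarrow> (real^'m \<Rightarrow> real) \<Rightarrow> bool" where
  "wderiv i f g \<longleftrightarrow> (\<exists>\<epsilon>::nat \<Rightarrow> real. (\<forall>n. \<epsilon> n \<noteq> 0) \<and> \<epsilon> \<longlonglongrightarrow> 0 \<and>
     (\<forall>R. (\<lambda>n. \<integral>\<^sup>+x. indicator (ball 0 R) x * ennreal \<bar>(f (x + \<epsilon> n *\<^sub>R axis i 1) - f x) / \<epsilon> n - g x\<bar> \<partial>lborel) \<longlonglongrightarrow> 0))"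

lemma locint_translation:
  assumes f: "locint f" shows "locint (\<lambda>x. f (x + v))"
  unfolding locint_iff_nn
proof (intro conjI allI)
  note [measurable] = locint_measurable[OF f]
  show "(\<lambda>x. f (x + v)) \<in> borel_measurable borel" by measurable
  fix R
  have "(\<integral>\<^sup>+x. indicator (ball 0 R) x * ennreal \<bar>f (x + v)\<bar> \<partial>lborel) \<le> (\<integral>\<^sup>+x. indicator (ball 0 (R + norm v)) (v + x) * ennreal \<bar>f (v + x)\<bar> \<partial>lborel)"
  proof (intro nn_integral_mono)
    fix x :: 'a
    show "indicator (ball 0 R) x * ennreal \<bar>f (x + v)\<bar> \<le> indicator (ball 0 (R + norm v)) (v + x) * ennreal \<bar>f (v + x)\<bar>"
      using norm_triangle_ineq[of v x] by (auto simp: indicator_def add.commute)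
  qed
  also have "\<dots> = (\<integral>\<^sup>+x. indicator (ball 0 (R + norm v)) x * ennreal \<bar>f x\<bar> \<partial>lborel)"
    by (rule lborel_nn_integral_translation[of "\<lambda>x. indicator (ball 0 (R + norm v)) x * ennreal \<bar>f x\<bar>"]) simp
  also have "\<dots> < \<infinity>" using f by (simp add: locint_iff_nn)
  finally show "(\<integral>\<^sup>+x. indicator (ball 0 R) x * ennreal \<bar>f (x + v)\<bar> \<partial>lborel) < \<infinity>" .
qed

text \<open>Both sides are the limit of the difference quotients \<open>q n\<close> of the mollified
  function. On one hand the kernel can be differentiated; on the other, \<open>q n\<close> is the
  mollified difference quotient of \<open>f\<close>, and mollification turns local mean convergence
  into pointwise convergence, since the kernel is bounded with bounded support.\<close>

lemma conv_ker_wderiv: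
  fixes f g :: "real^'m \<Rightarrow> real"
  assumes \<eta>: "\<eta> > 0" and f: "locint f" and g: "locint g" and w: "wderiv i f g"
  shows "conv (ker \<eta>) g x = - conv (kerg \<eta> (axis i 1)) f x"
proof -
  note [measurable] = locint_measurable[OF f] locint_measurable[OF g]
  let ?e = "axis i 1 :: real^'m"
  have ci: "integrable lborel (\<lambda>z. ker \<eta> (z - x) * h z)" if "locint h" for h and x :: "real^'m"
    by (rule conv_integrable[OF ker_cont(2) _ that, where r=\<eta>]) (simp add: ker_supp(2)[OF \<eta>])
  obtain \<epsilon> where \<epsilon>: "\<And>n::nat. \<epsilon> n \<noteq> (0::real)" "\<epsilon> \<longlonglongrightarrow> 0"
    "\<And>R. (\<lambda>n. \<integral>\<^sup>+x. indicator (ball 0 R) x * ennreal \<bar>(f (x + \<epsilon> n *\<^sub>R ?e) - f x) / \<epsilon> n - g x\<bar> \<partial>lborel) \<longlonglongrightarrow> 0"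
    using w unfolding wderiv_def by blast
  define q where "q n = (conv (ker \<eta>) f (x + \<epsilon> n *\<^sub>R ?e) - conv (ker \<eta>) f x) / \<epsilon> n" for n
  have "((\<lambda>t. conv (ker \<eta>) f (x + t *\<^sub>R ?e)) has_real_derivative - conv (kerg \<eta> ?e) f x) (at 0)"
    by (rule conv_deriv[OF ker_cont(2) _ f ker_cont(3) _ ker_deriv, where r=\<eta>]) (auto simp: ker_supp[OF \<eta>])
  then have "((\<lambda>t. (conv (ker \<eta>) f (x + t *\<^sub>R ?e) - conv (ker \<eta>) f x) / t) \<longlongrightarrow> - conv (kerg \<eta> ?e) f x) (at 0)"
    by (simp add: has_field_derivative_iff)
  moreover have "filterlim \<epsilon> (at 0) sequentially" using \<epsilon> by (auto simp: filterlim_at)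
  ultimately have lim1: "q \<longlonglongrightarrow> - conv (kerg \<eta> ?e) f x"
    unfolding q_def by (rule filterlim_compose)
  define dq where "dq n z = (f (z + \<epsilon> n *\<^sub>R ?e) - f z) / \<epsilon> n" for n z
  have [measurable]: "dq n \<in> borel_measurable borel" for n unfolding dq_def by measurable
  have fs: "locint (\<lambda>z. f (z + \<epsilon> n *\<^sub>R ?e))" for n by (rule locint_translation[OF f])
  have dql: "locint (dq n)" for n
    using locintD[OF fs] locintD[OF f] unfolding locint_def dq_def diff_divide_distrib right_diff_distrib
    by (auto simp flip: times_divide_eq_right intro!: Bochner_Integration.integrable_diff) 
      (auto intro!: integrable_divide_zero)
  have q: "q n = conv (ker \<eta>) (dq n) x" for n
  proof -
    have "conv (ker \<eta>) f (x + \<epsilon> n *\<^sub>R ?e) = conv (ker \<eta>) (\<lambda>z. f (z + \<epsilon> n *\<^sub>R ?e)) x"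
      using conv_ker_shift(1)[OF \<eta> f, of "x + \<epsilon> n *\<^sub>R ?e"] conv_ker_shift(1)[OF \<eta> fs, of n x] by (simp add: algebra_simps)
    moreover have "conv (ker \<eta>) (dq n) x = (conv (ker \<eta>) (\<lambda>z. f (z + \<epsilon> n *\<^sub>R ?e)) x - conv (ker \<eta>) f x) / \<epsilon> n"
    proof -
      have "conv (ker \<eta>) (dq n) x = (\<integral>z. (ker \<eta> (z - x) * f (z + \<epsilon> n *\<^sub>R ?e) - ker \<eta> (z - x) * f z) / \<epsilon> n \<partial>lborel)"
        unfolding conv_def by (intro Bochner_Integration.integral_cong) (auto simp: dq_def right_diff_distrib)
      then show ?thesis using ci[OF f] ci[OF fs] by (simp add: conv_def)
    qed
    ultimately show ?thesis by (simp add: q_def)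
  qed
  obtain C where C: "C \<ge> 0" "\<And>z::real^'m. \<bar>ker \<eta> z\<bar> \<le> C"
    using integrable_continuous_bounded_support(1)[OF ker_cont(2), of \<eta> \<eta>] ker_supp(2)[OF \<eta>] by blast
  define R where "R = norm x + \<eta>"
  have bnd: "ennreal \<bar>q n - conv (ker \<eta>) g x\<bar> \<le> ennreal C * (\<integral>\<^sup>+z. indicator (ball 0 R) z * ennreal \<bar>dq n z - g z\<bar> \<partial>lborel)" for n
  proof -
    have qe: "q n - conv (ker \<eta>) g x = (\<integral>z. ker \<eta> (z - x) * (dq n z - g z) \<partial>lborel)"
      unfolding q conv_def using ci[OF dql] ci[OF g] by (simp add: right_diff_distrib)
    have "integrable lborel (\<lambda>z. ker \<eta> (z - x) * (dq n z - g z))"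
      using ci[OF dql] ci[OF g] by (simp add: right_diff_distrib)
    from integral_norm_bound_ennreal[OF this] qe have "ennreal \<bar>q n - conv (ker \<eta>) g x\<bar> \<le> (\<integral>\<^sup>+z. norm (ker \<eta> (z - x) * (dq n z - g z)) \<partial>lborel)"
      by simp
    also have "\<dots> \<le> (\<integral>\<^sup>+z. ennreal C * (indicator (ball 0 R) z * ennreal \<bar>dq n z - g z\<bar>) \<partial>lborel)"
    proof (intro nn_integral_mono)
      fix z
      show "ennreal (norm (ker \<eta> (z - x) * (dq n z - g z))) \<le> ennreal C * (indicator (ball 0 R) z * ennreal \<bar>dq n z - g z\<bar>)"
      proof (cases "z \<in> ball 0 R")
        case True
        then show ?thesis using C by (auto simp: abs_mult simp flip: ennreal_mult' intro!: ennreal_leI mult_right_mono)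
      next
        case False
        then have "norm (z - x) \<ge> \<eta>" using norm_triangle_ineq[of "z - x" x] by (simp add: R_def)
        then show ?thesis by (simp add: ker_supp(2)[OF \<eta>])
      qed
    qed
    also have "\<dots> = ennreal C * (\<integral>\<^sup>+z. indicator (ball 0 R) z * ennreal \<bar>dq n z - g z\<bar> \<partial>lborel)"
      by (rule nn_integral_cmult) simp
    finally show ?thesis .
  qed
  have "(\<lambda>n. ennreal C * (\<integral>\<^sup>+z. indicator (ball 0 R) z * ennreal \<bar>dq n z - g z\<bar> \<partial>lborel)) \<longlonglongrightarrow> ennreal C * 0"
    unfolding dq_def by (intro ennreal_tendsto_cmult \<epsilon>(3)) simp
  then have L: "(\<lambda>n. ennreal C * (\<integral>\<^sup>+z. indicator (ball 0 R) z * ennreal \<bar>dq n z - g z\<bar> \<partial>lborel)) \<longlonglongrightarrow> 0"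
    by (simp only: mult_zero_right)
  have "(\<lambda>n. ennreal \<bar>q n - conv (ker \<eta>) g x\<bar>) \<longlonglongrightarrow> 0"
    by (rule tendsto_sandwich[OF _ _ tendsto_const L]; intro always_eventually allI bnd zero_le)
  then have "(\<lambda>n. ennreal \<bar>q n - conv (ker \<eta>) g x\<bar>) \<longlonglongrightarrow> ennreal 0" by (simp only: ennreal_0)
  then have "(\<lambda>n. \<bar>q n - conv (ker \<eta>) g x\<bar>) \<longlonglongrightarrow> 0"
    by (rule iffD1[OF tendsto_ennreal_iff, rotated 2]) auto
  then have "q \<longlonglongrightarrow> conv (ker \<eta>) g x" by (rule LIM_zero_cancel[OF tendsto_rabs_zero_cancel])
  from LIMSEQ_unique[OF this lim1] show ?thesis .
qed

section \<open>Determinants of matrices with entries integrable to the power of the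
  dimension\<close>

lemma prod_le_sum_power:
  fixes b :: "'m::finite \<Rightarrow> real"
  shows "\<bar>\<Prod>j\<in>UNIV. b j\<bar> \<le> (\<Sum>j\<in>UNIV. \<bar>b j\<bar> ^ CARD('m))"
proof -
  have "Max (range (\<lambda>j. \<bar>b j\<bar>)) \<in> range (\<lambda>j. \<bar>b j\<bar>)" by (rule Max_in) auto
  then obtain j0 where "Max (range (\<lambda>j. \<bar>b j\<bar>)) = \<bar>b j0\<bar>" by (rule rangeE)
  then have j0: "\<bar>b j0\<bar> = Max (range (\<lambda>j. \<bar>b j\<bar>))" ..
  have "\<bar>\<Prod>j\<in>UNIV. b j\<bar> = (\<Prod>j\<in>UNIV. \<bar>b j\<bar>)" by (rule abs_prod)
  also have "\<dots> \<le> (\<Prod>j\<in>(UNIV::'m set). \<bar>b j0\<bar>)"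
    by (rule prod_mono) (auto simp: j0)
  also have "\<dots> = \<bar>b j0\<bar> ^ CARD('m)" by simp
  also have "\<dots> \<le> (\<Sum>j\<in>UNIV. \<bar>b j\<bar> ^ CARD('m))" by (rule member_le_sum) auto
  finally show ?thesis .
qed

text \<open>Leibniz expansion, where each of the \<open>m!\<close> products of \<open>m\<close>
  entries is bounded by the sum of the \<open>m\<close>-th powers of its factors. The determinant is
  homogeneous of degree \<open>m\<close>, so \<open>m\<close>-th power integrability of the entries
  is the natural scale for its integrability.\<close>

lemma det_bound:
  fixes A :: "real^'m^'m"
  shows "\<bar>det A\<bar> \<le> fact CARD('m) * (\<Sum>j\<in>UNIV. \<Sum>i\<in>UNIV. \<bar>A $ j $ i\<bar> ^ CARD('m))"
proof -
  let ?P = "{p. p permutes (UNIV :: 'm set)}"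
  have "\<bar>det A\<bar> \<le> (\<Sum>p\<in>?P. \<bar>of_int (sign p) * (\<Prod>i\<in>UNIV. A $ i $ p i)\<bar>)"
    unfolding det_def by (rule sum_abs)
  also have "\<dots> \<le> (\<Sum>p\<in>?P. \<Sum>j\<in>UNIV. \<Sum>i\<in>UNIV. \<bar>A $ j $ i\<bar> ^ CARD('m))"
  proof (rule sum_mono)
    fix p
    have "\<bar>of_int (sign p) * (\<Prod>i\<in>UNIV. A $ i $ p i)\<bar> = \<bar>\<Prod>i\<in>UNIV. A $ i $ p i\<bar>"
      by (simp add: abs_mult sign_def)
    also have "\<dots> \<le> (\<Sum>j\<in>UNIV. \<bar>A $ j $ p j\<bar> ^ CARD('m))" by (rule prod_le_sum_power)
    also have "\<dots> \<le> (\<Sum>j\<in>UNIV. \<Sum>i\<in>UNIV. \<bar>A $ j $ i\<bar> ^ CARD('m))"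
      by (intro sum_mono member_le_sum) auto
    finally show "\<bar>of_int (sign p) * (\<Prod>i\<in>UNIV. A $ i $ p i)\<bar> \<le> (\<Sum>j\<in>UNIV. \<Sum>i\<in>UNIV. \<bar>A $ j $ i\<bar> ^ CARD('m))" .
  qed
  also have "\<dots> = fact CARD('m) * (\<Sum>j\<in>UNIV. \<Sum>i\<in>UNIV. \<bar>A $ j $ i\<bar> ^ CARD('m))"
    by (simp add: card_permutations[OF refl])
  finally show ?thesis .
qed

lemma det_measurable:
  fixes A :: "'a \<Rightarrow> real^'m^'m"
  assumes "\<And>j i. (\<lambda>x. A x $ j $ i) \<in> borel_measurable M"
  shows "(\<lambda>x. det (A x)) \<in> borel_measurable M"
  unfolding det_def by (intro borel_measurable_sum borel_measurable_times borel_measurable_const borel_measurable_prod assms)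

text \<open>Dominated convergence, formulated with bounded scalar factors supported in the ball.
  This covers both sides of the area identity: factors built from the cut-off function, and
  indicators of the ball when a row has been replaced by the gradient of the cut-off.\<close>

lemma det_L1_tendsto:
  fixes A :: "nat \<Rightarrow> 'a::euclidean_space \<Rightarrow> real^'m^'m" and B :: "'a \<Rightarrow> real^'m^'m"
  assumes [measurable]: "\<And>n j i. (\<lambda>x. A n x $ j $ i) \<in> borel_measurable borel" "\<And>j i. (\<lambda>x. B x $ j $ i) \<in> borel_measurable borel"
      "\<And>n. s n \<in> borel_measurable borel" "so \<in> borel_measurable borel"
    and lim: "AE x in lborel. x \<in> ball 0 R \<longrightarrow> (\<forall>j i. (\<lambda>n. A n x $ j $ i) \<longlonglongrightarrow> B x $ j $ i)"
    and dom: "AE x in lborel. x \<in> ball 0 R \<longrightarrow> (\<forall>n j i. \<bar>A n x $ j $ i\<bar> ^ CARD('m) \<le> H x)"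
    and H: "integrable lborel (\<lambda>x. indicator (ball 0 R) x * H x)"
    and s: "AE x in lborel. (\<lambda>n. s n x) \<longlonglongrightarrow> so x" "\<And>n x. \<bar>s n x\<bar> \<le> c * indicator (ball 0 R) x"
  shows "(\<lambda>n. \<integral>x. \<bar>s n x * det (A n x) - so x * det (B x)\<bar> \<partial>lborel) \<longlonglongrightarrow> 0"
    "integrable lborel (\<lambda>x. s n x * det (A n x))" "integrable lborel (\<lambda>x. so x * det (B x))"
proof -
  have [measurable]: "(\<lambda>x. det (A n x)) \<in> borel_measurable borel" "(\<lambda>x. det (B x)) \<in> borel_measurable borel" for n
    by (intro det_measurable; simp)+
  \<comment> \<open>\<open>fact CARD('m)\<close> counts the permutations in \<open>det_bound\<close>
    and the remaining factor the entries of the matrix, each bounded by the common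
    \<open>h\<close>.\<close>
  define K where "K = fact CARD('m) * (real CARD('m) * real CARD('m))"
  have K: "K \<ge> 0" by (simp add: K_def)
  have c: "c * indicator (ball 0 R) x \<ge> 0" for x :: 'a using s(2)[of 0 x] by linarith
  have bd: "\<bar>det X\<bar> \<le> K * h" if "\<And>j i. \<bar>X $ j $ i\<bar> ^ CARD('m) \<le> h" for X :: "real^'m^'m" and h
  proof -
    have "(\<Sum>j\<in>UNIV. \<Sum>i\<in>UNIV. \<bar>X $ j $ i\<bar> ^ CARD('m)) \<le> (\<Sum>j\<in>(UNIV::'m set). \<Sum>i\<in>(UNIV::'m set). h)"
      by (intro sum_mono that)
    then have "fact CARD('m) * (\<Sum>j\<in>UNIV. \<Sum>i\<in>UNIV. \<bar>X $ j $ i\<bar> ^ CARD('m)) \<le> fact CARD('m) * (\<Sum>j\<in>(UNIV::'m set). \<Sum>i\<in>(UNIV::'m set). h)"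
      by (intro mult_left_mono) auto
    also have "fact CARD('m) * (\<Sum>j\<in>(UNIV::'m set). \<Sum>i\<in>(UNIV::'m set). h) = K * h" by (simp add: K_def)
    finally show ?thesis using det_bound[of X] by linarith
  qed
  define w where "w x = (c * indicator (ball 0 R) x) * (K * (indicator (ball 0 R) x * H x))" for x
  have wi: "integrable lborel w"
  proof -
    have "w = (\<lambda>x. (c * K) * (indicator (ball 0 R) x * H x))" by (auto simp: w_def indicator_def)
    then show ?thesis using H by simp
  qed
  have b1: "AE x in lborel. \<forall>n. \<bar>s n x * det (A n x)\<bar> \<le> w x"
    using dom
  proof eventually_elim
    case (elim x)
    show ?case
    proof
      fix n
      show "\<bar>s n x * det (A n x)\<bar> \<le> w x"
      proof (cases "x \<in> ball 0 R")
        case True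
        then have "\<bar>det (A n x)\<bar> \<le> K * H x" using elim by (intro bd) auto
        then show ?thesis using s(2)[of n x] True c[of x] by (auto simp: w_def abs_mult intro!: mult_mono)
      next
        case False then show ?thesis using s(2)[of n x] by (simp add: w_def)
      qed
    qed
  qed
  have l: "AE x in lborel. (\<lambda>n. s n x * det (A n x)) \<longlonglongrightarrow> so x * det (B x)"
    using lim s(1)
  proof eventually_elim
    case (elim x)
    show ?case
    proof (cases "x \<in> ball 0 R")
      case True
      with elim show ?thesis unfolding det_def
        by (intro tendsto_mult tendsto_sum tendsto_prod tendsto_const) auto
    next
      case False
      then have "s n x = 0" for n using s(2)[of n x] by simp
      moreover from this elim have "so x = 0" by (simp add: LIMSEQ_const_iff)
      ultimately show ?thesis by simp
    qed
  qed
  have b2: "AE x in lborel. \<bar>so x * det (B x)\<bar> \<le> w x"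
    using b1 l
  proof eventually_elim
    case (elim x)
    show ?case by (rule LIMSEQ_le_const2[OF tendsto_rabs[OF elim(2)]]) (use elim in auto)
  qed
  show i1: "integrable lborel (\<lambda>x. s n x * det (A n x))" for n
  proof (rule Bochner_Integration.integrable_bound[OF wi])
    show "AE x in lborel. norm (s n x * det (A n x)) \<le> norm (w x)"
      using b1 
    proof eventually_elim
      case (elim x)
      then have "\<bar>s n x * det (A n x)\<bar> \<le> w x" by blast
      then show ?case by simp
    qed
  qed simp
  show i2: "integrable lborel (\<lambda>x. so x * det (B x))"
  proof (rule Bochner_Integration.integrable_bound[OF wi])
    show "AE x in lborel. norm (so x * det (B x)) \<le> norm (w x)"
      using b2 by eventually_elim simp
  qed simp
  have "(\<lambda>n. \<integral>x. \<bar>s n x * det (A n x) - so x * det (B x)\<bar> \<partial>lborel) \<longlonglongrightarrow> (\<integral>x. 0 \<partial>(lborel :: 'a measure))"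
  proof (rule integral_dominated_convergence[where w="\<lambda>x. 2 * w x"])
    show "AE x in lborel. (\<lambda>n. \<bar>s n x * det (A n x) - so x * det (B x)\<bar>) \<longlonglongrightarrow> 0"
      using l by eventually_elim (intro tendsto_rabs_zero LIM_zero)
    show "AE x in lborel. norm \<bar>s n x * det (A n x) - so x * det (B x)\<bar> \<le> 2 * w x" for n
      using b1 b2
    proof eventually_elim
      case (elim x)
      then have "\<bar>s n x * det (A n x)\<bar> \<le> w x" by blast
      then show ?case using elim(2) abs_triangle_ineq4[of "s n x * det (A n x)" "so x * det (B x)"] by simp
    qed
  qed (use wi in auto)
  then show "(\<lambda>n. \<integral>x. \<bar>s n x * det (A n x) - so x * det (B x)\<bar> \<partial>lborel) \<longlonglongrightarrow> 0" by simp
qed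

lemma L1_tendsto_integral:
  fixes f :: "nat \<Rightarrow> 'a \<Rightarrow> real"
  assumes "\<And>n. integrable M (f n)" "integrable M g" "(\<lambda>n. \<integral>x. \<bar>f n x - g x\<bar> \<partial>M) \<longlonglongrightarrow> 0"
  shows "(\<lambda>n. \<integral>x. f n x \<partial>M) \<longlonglongrightarrow> (\<integral>x. g x \<partial>M)"
proof (rule LIM_zero_cancel, rule tendsto_rabs_zero_cancel, rule tendsto_sandwich[OF _ _ tendsto_const assms(3)])
  show "eventually (\<lambda>n. \<bar>(\<integral>x. f n x \<partial>M) - (\<integral>x. g x \<partial>M)\<bar> \<le> (\<integral>x. \<bar>f n x - g x\<bar> \<partial>M)) sequentially"
  proof (intro always_eventually allI)
    fix n
    have "(\<integral>x. f n x \<partial>M) - (\<integral>x. g x \<partial>M) = (\<integral>x. f n x - g x \<partial>M)" using assms by simp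
    then show "\<bar>(\<integral>x. f n x \<partial>M) - (\<integral>x. g x \<partial>M)\<bar> \<le> (\<integral>x. \<bar>f n x - g x\<bar> \<partial>M)" by simp
  qed
qed simp

text \<open>The summable subsequence is chosen for the sum over the finite index type, so that one
  subsequence and one majorant \<open>Y\<close> serve all members of the family. \<open>Y\<close> is
  the sum of the series, which is finite almost everywhere.\<close>

lemma subseq_family:
  fixes X :: "'k::finite \<Rightarrow> nat \<Rightarrow> 'a \<Rightarrow> real"
  assumes [measurable]: "\<And>k n. X k n \<in> borel_measurable M" "S \<in> sets M"
    and lim: "\<And>k. (\<lambda>n. \<integral>\<^sup>+x. indicator S x * ennreal \<bar>X k n x\<bar> \<partial>M) \<longlonglongrightarrow> 0"
  shows "\<exists>r Y. strict_mono r \<and> integrable M Y \<and> (AE x in M. x \<in> S \<longrightarrow> (\<forall>k. (\<lambda>n. X k (r n) x) \<longlonglongrightarrow> 0 \<and> (\<forall>n. \<bar>X k (r n) x\<bar> \<le> Y x)))"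
proof -
  define Z where "Z n x = (\<Sum>k\<in>UNIV. indicator S x * ennreal \<bar>X k n x\<bar>)" for n x
  have [measurable]: "Z n \<in> borel_measurable M" for n unfolding Z_def by measurable
  have "(\<integral>\<^sup>+x. Z n x \<partial>M) = (\<Sum>k\<in>UNIV. \<integral>\<^sup>+x. indicator S x * ennreal \<bar>X k n x\<bar> \<partial>M)" for n
    unfolding Z_def by (rule nn_integral_sum) simp
  moreover have "(\<lambda>n. \<Sum>k\<in>UNIV. \<integral>\<^sup>+x. indicator S x * ennreal \<bar>X k n x\<bar> \<partial>M) \<longlonglongrightarrow> (\<Sum>k\<in>(UNIV::'k set). 0)"
    by (intro tendsto_sum lim)
  ultimately have "(\<lambda>n. \<integral>\<^sup>+x. Z n x \<partial>M) \<longlonglongrightarrow> 0" by simp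
  from nn_integral_subseq_summable[OF _ this] obtain r where r: "strict_mono r" "(\<integral>\<^sup>+x. (\<Sum>n. Z (r n) x) \<partial>M) < \<infinity>" by auto
  define Y where "Y x = enn2real (\<Sum>n. Z (r n) x)" for x
  have fin: "AE x in M. (\<Sum>n. Z (r n) x) < \<infinity>"
    using nn_integral_PInf_AE[of "\<lambda>x. \<Sum>n. Z (r n) x" M] r(2) by (auto simp: less_top[symmetric])
  have "(\<integral>\<^sup>+x. ennreal (Y x) \<partial>M) \<le> (\<integral>\<^sup>+x. (\<Sum>n. Z (r n) x) \<partial>M)"
    by (intro nn_integral_mono) (auto simp: Y_def intro: ennreal_enn2real_if[THEN eq_refl, THEN order_trans])
  moreover have "Y \<in> borel_measurable M" unfolding Y_def by measurable
  ultimately have "integrable M Y"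
    by (intro integrableI_nonneg) (use r(2) in \<open>auto simp: Y_def\<close>)
  moreover have "AE x in M. x \<in> S \<longrightarrow> (\<forall>k. (\<lambda>n. X k (r n) x) \<longlonglongrightarrow> 0 \<and> (\<forall>n. \<bar>X k (r n) x\<bar> \<le> Y x))"
    using fin
  proof eventually_elim
    case (elim x)
    show ?case
    proof (intro impI allI)
      fix k assume "x \<in> S"
      then have le: "ennreal \<bar>X k n x\<bar> \<le> Z n x" for n
        unfolding Z_def using member_le_sum[of k UNIV "\<lambda>k. ennreal \<bar>X k n x\<bar>"] by simp
      note t = ennreal_suminf_finite_tendsto_0[OF elim]
      have "(\<lambda>n. ennreal \<bar>X k (r n) x\<bar>) \<longlonglongrightarrow> 0"
        by (rule tendsto_sandwich[OF _ _ tendsto_const t(1)]; intro always_eventually allI le zero_le)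
      then have "(\<lambda>n. ennreal \<bar>X k (r n) x\<bar>) \<longlonglongrightarrow> ennreal 0" by (simp only: ennreal_0)
      then have "(\<lambda>n. \<bar>X k (r n) x\<bar>) \<longlonglongrightarrow> 0"
        by (rule iffD1[OF tendsto_ennreal_iff, rotated 2]) auto
      then have 1: "(\<lambda>n. X k (r n) x) \<longlonglongrightarrow> 0" by (rule tendsto_rabs_zero_cancel)
      have "\<bar>X k (r n) x\<bar> \<le> Y x" for n
      proof -
        have "ennreal \<bar>X k (r n) x\<bar> \<le> (\<Sum>n. Z (r n) x)" using le[of "r n"] t(2)[of n] by (rule order_trans)
        also have "\<dots> = ennreal (Y x)" using elim by (simp add: Y_def)
        finally show ?thesis by (simp add: Y_def)
      qed
      with 1 show "(\<lambda>n. X k (r n) x) \<longlonglongrightarrow> 0 \<and> (\<forall>n. \<bar>X k (r n) x\<bar> \<le> Y x)" by blast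
    qed
  qed
  ultimately show ?thesis using r(1) by blast
qed

section \<open>The area identity for Sobolev maps\<close>

lemma kerg_sum:
  fixes v z :: "real^'m"
  shows "kerg \<eta> v z = (\<Sum>i\<in>UNIV. v $ i * kerg \<eta> (axis i 1) z)"
proof -
  have "z \<bullet> v = (\<Sum>i\<in>UNIV. v $ i * (z \<bullet> axis i 1))" by (simp add: inner_axis) (simp add: inner_vec_def mult.commute)
  moreover have "kerg \<eta> w z = (- 6 * (max 0 (\<eta>\<^sup>2 - z \<bullet> z))\<^sup>2 / (\<integral>y. bump \<eta> y \<partial>(lborel :: (real^'m) measure))) * (z \<bullet> w)" for w
    by (simp add: kerg_def)
  ultimately show ?thesis by (simp only: sum_distrib_left mult.left_commute)
qed

lemma kerg_conv_integrable:
  assumes "\<eta> > 0" "locint f"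
  shows "integrable lborel (\<lambda>z. kerg \<eta> v (z - x) * f z)"
  by (rule conv_integrable[OF ker_cont(3) _ assms(2), where r=\<eta>]) (simp add: ker_supp(3)[OF assms(1)])

lemma conv_kerg_continuous:
  assumes "\<eta> > 0" "locint f"
  shows "continuous_on UNIV (conv (kerg \<eta> v) f)"
  by (rule conv_continuous[OF ker_cont(3) _ assms(2), where r=\<eta>]) (simp add: ker_supp(3)[OF assms(1)])

lemma conv_ker_deriv:
  assumes "\<eta> > 0" "locint f"
  shows "((\<lambda>t. conv (ker \<eta>) f (x + t *\<^sub>R v)) has_real_derivative - conv (kerg \<eta> v) f x) (at 0)"
  by (rule conv_deriv[OF ker_cont(2) _ assms(2) ker_cont(3) _ ker_deriv, where r=\<eta>]) (auto simp: ker_supp[OF assms(1)])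

lemma conv_kerg_deriv:
  assumes "\<eta> > 0" "locint f"
  shows "((\<lambda>t. conv (kerg \<eta> v) f (x + t *\<^sub>R w)) has_real_derivative - conv (kerh \<eta> v w) f x) (at 0)"
  by (rule conv_deriv[OF ker_cont(3) _ assms(2) ker_cont(4) _ kerg_deriv, where r=\<eta>]) (auto simp: ker_supp[OF assms(1)])

lemma conv_kerh_continuous:
  assumes "\<eta> > 0" "locint f"
  shows "continuous_on UNIV (conv (kerh \<eta> v w) f)"
  by (rule conv_continuous[OF ker_cont(4) _ assms(2), where r=\<eta>]) (simp add: ker_supp(4)[OF assms(1)])

lemma conv_ker_C1:
  fixes f :: "real^'m \<Rightarrow> real"
  assumes \<eta>: "\<eta> > 0" and f: "locint f"
  shows "C1 (conv (ker \<eta>) f) (\<lambda>x. \<chi> i. - conv (kerg \<eta> (axis i 1)) f x)"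
proof (rule C1I_line)
  show "continuous_on UNIV (\<lambda>x. \<chi> i. - conv (kerg \<eta> (axis i 1)) f x)"
    by (intro continuous_intros conv_kerg_continuous \<eta> f)
  fix x v :: "real^'m"
  have "conv (kerg \<eta> v) f x = (\<integral>z. (\<Sum>i\<in>UNIV. v $ i * (kerg \<eta> (axis i 1) (z - x) * f z)) \<partial>lborel)"
    unfolding conv_def by (subst kerg_sum) (simp add: sum_distrib_right mult.assoc)
  also have "\<dots> = (\<Sum>i\<in>UNIV. v $ i * conv (kerg \<eta> (axis i 1)) f x)"
    unfolding conv_def using kerg_conv_integrable[OF \<eta> f] by (subst Bochner_Integration.integral_sum) auto
  finally have "- conv (kerg \<eta> v) f x = (\<chi> i. - conv (kerg \<eta> (axis i 1)) f x) \<bullet> v"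
    by (simp add: inner_vec_def sum_negf mult.commute)
  then show "((\<lambda>t. conv (ker \<eta>) f (x + t *\<^sub>R v)) has_real_derivative (\<chi> i. - conv (kerg \<eta> (axis i 1)) f x) \<bullet> v) (at 0)"
    using conv_ker_deriv[OF \<eta> f, of x v] by simp
qed

text \<open>Row \<open>j\<close> of \<open>G x\<close> is the gradient of the component
  \<open>j\<close> of \<open>F\<close>. The clause on \<open>CARD('m)\<close>-th powers is the
  Sobolev exponent equal to the dimension, at which determinants of Jacobian matrices are just
  locally integrable.\<close>

definition sobolev_map :: "(real^'m \<Rightarrow> real^'m) \<Rightarrow> (real^'m \<Rightarrow> real^'m^'m) \<Rightarrow> bool" where
  "sobolev_map F G \<longleftrightarrow> (\<forall>j. locint (\<lambda>x. F x $ j)) \<and>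
     (\<forall>j i. locint (\<lambda>x. G x $ j $ i) \<and> locint (\<lambda>x. \<bar>G x $ j $ i\<bar> ^ CARD('m)) \<and>
            wderiv i (\<lambda>x. F x $ j) (\<lambda>x. G x $ j $ i))"

lemma sobolev_mapD:
  fixes F :: "real^'m \<Rightarrow> real^'m"
  assumes "sobolev_map F G"
  shows "locint (\<lambda>x. F x $ j)" "locint (\<lambda>x. G x $ j $ i)" "locint (\<lambda>x. \<bar>G x $ j $ i\<bar> ^ CARD('m))"
    "wderiv i (\<lambda>x. F x $ j) (\<lambda>x. G x $ j $ i)"
  using assms by (auto simp: sobolev_map_def)

text \<open>The smooth identity is applied to mollifications of \<open>F\<close>, whose Jacobian
  matrix is the mollified \<open>G\<close> by \<open>conv_ker_wderiv\<close>. As the scale tends to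
  \<open>0\<close>, convergence holds almost everywhere along a subsequence. Domination comes from
  \<open>conv_ker_power\<close>: the powers of the mollified entries lie below the mollified powers,
  and these differ from the powers themselves by at most an integrable \<open>Y\<close>.\<close>

lemma area_identity:
  fixes F :: "real^'m \<Rightarrow> real^'m" and G :: "real^'m \<Rightarrow> real^'m^'m"
  assumes S: "sobolev_map F G"
    and \<phi>: "C1 \<phi> g" "\<And>x. \<bar>\<phi> x\<bar> \<le> B" "\<And>x. norm (g x) \<le> B"
    and \<xi>: "C1 \<xi> \<xi>'" "\<And>z. norm z \<ge> r \<Longrightarrow> \<xi> z = 0" "\<And>z. norm z \<ge> r \<Longrightarrow> \<xi>' z = 0"
  shows "(\<integral>x. \<xi> x * g (F x) $ k * det (G x) \<partial>lborel) =
    - (\<integral>x. \<phi> (F x) * det ((\<chi> j. if j = k then \<xi>' x else G x $ j) :: real^'m^'m) \<partial>lborel)" (is "?L = - ?R")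
    and "integrable lborel (\<lambda>x. \<phi> (F x) * det ((\<chi> j. if j = k then \<xi>' x else G x $ j) :: real^'m^'m))"
proof -
  note SD = sobolev_mapD[OF S]
  note [measurable] = SD(1,2,3)[THEN locint_measurable]
  note [measurable] = C1_measurable[OF \<phi>(1)] C1_measurable[OF \<xi>(1)]
  define m where "m = CARD('m)"
  have m: "m \<ge> 1" by (simp add: m_def Suc_leI)
  note SD3 = SD(3)[folded m_def]
  define \<eta> where "\<eta> n = 1 / (real n + 1)" for n :: nat
  have \<eta>: "0 < \<eta> n" "\<eta> n \<le> 1" for n by (auto simp: \<eta>_def)
  have \<eta>0: "\<eta> \<longlonglongrightarrow> 0" unfolding \<eta>_def using LIMSEQ_inverse_real_of_nat by (simp add: inverse_eq_divide add.commute)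
  \<comment> \<open>Components, matrix entries and powers of matrix entries are put into one finite
    family, so that a single subsequence handles all three kinds of mollification error.\<close>
  define X :: "'m + ('m \<times> 'm) + ('m \<times> 'm) \<Rightarrow> nat \<Rightarrow> real^'m \<Rightarrow> real" where
    "X k n x = (case k of Inl j \<Rightarrow> conv (ker (\<eta> n)) (\<lambda>x. F x $ j) x - F x $ j
       | Inr (Inl (j, i)) \<Rightarrow> conv (ker (\<eta> n)) (\<lambda>x. G x $ j $ i) x - G x $ j $ i
       | Inr (Inr (j, i)) \<Rightarrow> conv (ker (\<eta> n)) (\<lambda>x. \<bar>G x $ j $ i\<bar> ^ m) x - \<bar>G x $ j $ i\<bar> ^ m)" for k n x
  have cm: "conv (ker (\<eta> n)) h \<in> borel_measurable borel" if "locint h" for h :: "real^'m \<Rightarrow> real" and n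
    using borel_measurable_continuous_onI[OF conv_ker_continuous[OF \<eta>(1) that]] by simp
  note [measurable] = SD(1,2)[THEN cm] SD3[THEN cm]
  have k3: thesis if "\<And>j. k = Inl j \<Longrightarrow> thesis" "\<And>j i. k = Inr (Inl (j, i)) \<Longrightarrow> thesis" "\<And>j i. k = Inr (Inr (j, i)) \<Longrightarrow> thesis"
    for k :: "'m + ('m \<times> 'm) + ('m \<times> 'm)" and thesis
    using that by (metis obj_sumE surj_pair)
  have Xm: "X k n \<in> borel_measurable lborel" for k n
    by (rule k3[of k]) (simp_all add: X_def[abs_def])
  have Xl: "(\<lambda>n. \<integral>\<^sup>+x. indicator (ball 0 r) x * ennreal \<bar>X k n x\<bar> \<partial>lborel) \<longlonglongrightarrow> 0" for k
    by (rule k3[of k]) (simp_all add: X_def conv_ker_tendsto_L1[OF SD(1) \<eta> \<eta>0] conv_ker_tendsto_L1[OF SD(2) \<eta> \<eta>0] conv_ker_tendsto_L1[OF SD3 \<eta> \<eta>0])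
  obtain q Y where q: "strict_mono q" and Y: "integrable lborel Y" and
    AEX: "AE x in lborel. x \<in> ball 0 r \<longrightarrow> (\<forall>k. (\<lambda>n. X k (q n) x) \<longlonglongrightarrow> 0 \<and> (\<forall>n. \<bar>X k (q n) x\<bar> \<le> Y x))"
    using subseq_family[of X lborel "ball 0 r", OF Xm _ Xl] by auto
  define Fh where "Fh n x = (\<chi> j. conv (ker (\<eta> (q n))) (\<lambda>x. F x $ j) x)" for n x
  define Gh where "Gh n x = ((\<chi> j i. conv (ker (\<eta> (q n))) (\<lambda>x. G x $ j $ i) x) :: real^'m^'m)" for n x
  have smooth: "(\<integral>x. \<xi> x * g (Fh n x) $ k * det (Gh n x) \<partial>lborel) =
    - (\<integral>x. \<phi> (Fh n x) * det ((\<chi> j. if j = k then \<xi>' x else Gh n x $ j) :: real^'m^'m) \<partial>lborel)" for n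
  proof -
    have eq: "conv (ker (\<eta> (q n))) (\<lambda>x. G x $ j $ i) = (\<lambda>x. - conv (kerg (\<eta> (q n)) (axis i 1)) (\<lambda>x. F x $ j) x)" for i j
      by (rule ext, rule conv_ker_wderiv[OF \<eta>(1) SD(1,2,4)])
    have row: "Gh n x $ j = (\<chi> i. conv (ker (\<eta> (q n))) (\<lambda>x. G x $ j $ i) x)" for x j by (simp add: Gh_def)
    show ?thesis
      unfolding row unfolding Fh_def Gh_def
    proof (rule area_identity_smooth[where dd="\<lambda>l i j. conv (kerh (\<eta> (q n)) (axis i 1) (axis l 1)) (\<lambda>x. F x $ j)", OF _ _ _ _ _ _ \<phi>(1) \<xi>])
      show "continuous_on UNIV (conv (ker (\<eta> (q n))) (\<lambda>x. F x $ j))" for j by (rule conv_ker_continuous[OF \<eta>(1) SD(1)])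
      show "continuous_on UNIV (conv (ker (\<eta> (q n))) (\<lambda>x. G x $ j $ i))" for i j by (rule conv_ker_continuous[OF \<eta>(1) SD(2)])
      show "continuous_on UNIV (conv (kerh (\<eta> (q n)) (axis i 1) (axis l 1)) (\<lambda>x. F x $ j))" for l i j
        by (rule conv_kerh_continuous[OF \<eta>(1) SD(1)])
      show "((\<lambda>t. conv (ker (\<eta> (q n))) (\<lambda>x. F x $ j) (x + t *\<^sub>R axis i 1)) has_real_derivative conv (ker (\<eta> (q n))) (\<lambda>x. G x $ j $ i) x) (at 0)" for i j x
        unfolding eq by (rule conv_ker_deriv[OF \<eta>(1) SD(1)])
      show "((\<lambda>t. conv (ker (\<eta> (q n))) (\<lambda>x. G x $ j $ i) (x + t *\<^sub>R axis l 1)) has_real_derivative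
          conv (kerh (\<eta> (q n)) (axis i 1) (axis l 1)) (\<lambda>x. F x $ j) x) (at 0)" for l i j x
        unfolding eq using DERIV_minus[OF conv_kerg_deriv[OF \<eta>(1) SD(1)]] by simp
      show "conv (kerh (\<eta> (q n)) (axis i 1) (axis l 1)) (\<lambda>x. F x $ j) x = conv (kerh (\<eta> (q n)) (axis l 1) (axis i 1)) (\<lambda>x. F x $ j) x" for l i j x
        by (simp add: conv_def kerh_sym[of _ "axis i 1"])
    qed
  qed
  have \<xi>'c: "continuous_on UNIV (\<lambda>x. norm (\<xi>' x))" using \<xi>(1) by (auto simp: C1_def intro!: continuous_intros)
  obtain C where C: "C \<ge> 0" "\<And>x. norm (\<xi>' x) \<le> C"
    using integrable_continuous_bounded_support(1)[OF \<xi>'c, of r] \<xi>(3) by auto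
  obtain C0 where C0: "C0 \<ge> 0" "\<And>x. \<bar>\<xi> x\<bar> \<le> C0"
    using integrable_continuous_bounded_support(1)[OF C1_continuous[OF \<xi>(1)], of r] \<xi>(2) by auto
  have Bp: "B \<ge> 0" using \<phi>(2)[of 0] by simp
  \<comment> \<open>The summands bound the error of the mollified powers, the powers themselves, and
    the entries of the row \<open>\<xi>'\<close>; thus \<open>H\<close> serves for the full Jacobian
    matrix and for the matrix with row \<open>k\<close> replaced.\<close>
  define H where "H x = Y x + (\<Sum>j\<in>UNIV. \<Sum>i\<in>UNIV. \<bar>G x $ j $ i\<bar> ^ m) + C ^ m" for x
  have H: "integrable lborel (\<lambda>x. indicator (ball 0 r) x * H x)"
  proof -
    have eq: "(\<lambda>x. indicator (ball 0 r) x * H x) = (\<lambda>x. indicator (ball 0 r) x * Y x + (\<Sum>j\<in>UNIV. \<Sum>i\<in>UNIV. indicator (ball 0 r) x * \<bar>G x $ j $ i\<bar> ^ m) + C ^ m * indicator (ball 0 r) x)"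
      by (simp add: H_def fun_eq_iff algebra_simps sum_distrib_left)
    have "integrable lborel (\<lambda>x. indicator (ball 0 r) x * Y x)"
      using integrable_mult_indicator[OF _ Y, of "ball 0 r"] by simp
    moreover have "integrable lborel (\<lambda>x. indicator (ball 0 r) x * \<bar>G x $ j $ i\<bar> ^ m)" for j i by (rule locintD[OF SD3])
    moreover have "integrable lborel (\<lambda>x::real^'m. C ^ m * indicator (ball 0 r) x)"
      by (intro integrable_mult_right integrable_real_indicator) (auto simp: emeasure_lborel_ball_finite[simplified])
    ultimately show ?thesis unfolding eq by (intro Bochner_Integration.integrable_add Bochner_Integration.integrable_sum)
  qed
  have limF: "AE x in lborel. x \<in> ball 0 r \<longrightarrow> (\<lambda>n. Fh n x) \<longlonglongrightarrow> F x"
    using AEX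
  proof eventually_elim
    case (elim x)
    show ?case
    proof
      assume "x \<in> ball 0 r"
      then have "(\<lambda>n. X (Inl j) (q n) x) \<longlonglongrightarrow> 0" for j using elim by blast
      then have "(\<lambda>n. conv (ker (\<eta> (q n))) (\<lambda>x. F x $ j) x) \<longlonglongrightarrow> F x $ j" for j by (simp add: X_def LIM_zero_iff)
      then show "(\<lambda>n. Fh n x) \<longlonglongrightarrow> F x" unfolding Fh_def by (intro vec_tendstoI) simp
    qed
  qed
  have limG: "AE x in lborel. x \<in> ball 0 r \<longrightarrow> (\<forall>j i. (\<lambda>n. Gh n x $ j $ i) \<longlonglongrightarrow> G x $ j $ i)"
    using AEX
  proof eventually_elim
    case (elim x)
    show ?case
    proof (intro impI allI)
      fix j i assume "x \<in> ball 0 r"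
      then have "(\<lambda>n. X (Inr (Inl (j, i))) (q n) x) \<longlonglongrightarrow> 0" using elim by blast
      then show "(\<lambda>n. Gh n x $ j $ i) \<longlonglongrightarrow> G x $ j $ i" by (simp add: X_def Gh_def LIM_zero_iff)
    qed
  qed
  have domG: "AE x in lborel. x \<in> ball 0 r \<longrightarrow> (\<forall>n j i. \<bar>Gh n x $ j $ i\<bar> ^ m \<le> H x) \<and> C ^ m \<le> H x"
    using AEX
  proof eventually_elim
    case (elim x)
    show ?case
    proof (intro impI)
      assume x: "x \<in> ball 0 r"
      have Y0: "0 \<le> Y x" using elim x abs_ge_zero order_trans by blast
      have "\<bar>Gh n x $ j $ i\<bar> ^ m \<le> H x" for n j i
      proof -
        have "\<bar>Gh n x $ j $ i\<bar> ^ m \<le> conv (ker (\<eta> (q n))) (\<lambda>x. \<bar>G x $ j $ i\<bar> ^ m) x"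
          unfolding Gh_def using conv_ker_power[OF \<eta>(1) SD(2) SD3 m] by simp
        also have "\<dots> \<le> \<bar>G x $ j $ i\<bar> ^ m + Y x"
        proof -
          have "\<bar>X (Inr (Inr (j, i))) (q n) x\<bar> \<le> Y x" using elim x by blast
          then show ?thesis by (simp add: X_def)
        qed
        also have "\<bar>G x $ j $ i\<bar> ^ m \<le> (\<Sum>j\<in>UNIV. \<Sum>i\<in>UNIV. \<bar>G x $ j $ i\<bar> ^ m)"
        proof -
          have "\<bar>G x $ j $ i\<bar> ^ m \<le> (\<Sum>i\<in>UNIV. \<bar>G x $ j $ i\<bar> ^ m)" by (rule member_le_sum) auto
          also have "\<dots> \<le> (\<Sum>j\<in>UNIV. \<Sum>i\<in>UNIV. \<bar>G x $ j $ i\<bar> ^ m)"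
            by (rule member_le_sum[where f="\<lambda>j. \<Sum>i\<in>UNIV. \<bar>G x $ j $ i\<bar> ^ m"]) (auto intro: sum_nonneg)
          finally show ?thesis .
        qed
        finally show ?thesis using zero_le_power[OF C(1), of m] by (simp add: H_def)
      qed
      moreover have "C ^ m \<le> H x" using Y0 by (simp add: H_def sum_nonneg)
      ultimately show "(\<forall>n j i. \<bar>Gh n x $ j $ i\<bar> ^ m \<le> H x) \<and> C ^ m \<le> H x" by blast
    qed
  qed
  have gk: "\<bar>g y $ k\<bar> \<le> B" for y using component_le_norm_cart[of "g y" k] \<phi>(3)[of y] by linarith
  have gcont: "isCont g y" "isCont \<phi> y" for y
    using \<phi>(1) C1_continuous[OF \<phi>(1)] by (auto simp: C1_def continuous_on_eq_continuous_at)
  have Ghm[measurable]: "(\<lambda>x. Gh n x $ j $ i) \<in> borel_measurable borel" for n j i unfolding Gh_def by simp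
  have Fhm[measurable]: "Fh n \<in> borel_measurable borel" for n 
    unfolding Fh_def by (intro borel_measurable_continuous_onI continuous_intros conv_ker_continuous \<eta> SD)
  have [measurable]: "F \<in> borel_measurable borel"
    by (subst borel_measurable_euclidean_space) (auto simp: Basis_vec_def inner_axis)
  have gkm[measurable]: "(\<lambda>y. g y $ k) \<in> borel_measurable borel"
    using \<phi>(1) by (intro borel_measurable_continuous_onI continuous_intros) (simp add: C1_def)
  have \<xi>'m[measurable]: "(\<lambda>y. \<xi>' y $ i) \<in> borel_measurable borel" for i
    using \<xi>(1) by (intro borel_measurable_continuous_onI continuous_intros) (simp add: C1_def)
  have Fm: "(\<lambda>x. F x $ j) \<in> borel_measurable borel" for j by measurable
  have limg: "AE x in lborel. (\<lambda>n. \<xi> x * g (Fh n x) $ k) \<longlonglongrightarrow> \<xi> x * g (F x) $ k"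
    using limF
  proof eventually_elim
    case (elim x)
    show ?case
    proof (cases "x \<in> ball 0 r")
      case True
      then have "(\<lambda>n. g (Fh n x)) \<longlonglongrightarrow> g (F x)" using elim isCont_tendsto_compose[OF gcont(1)] by blast
      then show ?thesis by (intro tendsto_intros)
    qed (simp add: \<xi>(2))
  qed
  have sb: "\<bar>\<xi> x * g y $ k\<bar> \<le> (C0 * B) * indicator (ball 0 r) x" for x y
    using C0 gk[of y] \<xi>(2)[of x] by (cases "x \<in> ball 0 r") (auto simp: abs_mult intro!: mult_mono)
  have domG': "AE x in lborel. x \<in> ball 0 r \<longrightarrow> (\<forall>n j i. \<bar>Gh n x $ j $ i\<bar> ^ CARD('m) \<le> H x)"
    using domG by eventually_elim (auto simp: m_def)
  note dL = det_L1_tendsto[where A=Gh and B=G and s="\<lambda>n x. \<xi> x * g (Fh n x) $ k" and so="\<lambda>x. \<xi> x * g (F x) $ k" and R=r and H=H and c="C0 * B",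
        OF Ghm locint_measurable[OF SD(2)] _ _ limG _ H limg sb]
  have L: "(\<lambda>n. \<integral>x. \<xi> x * g (Fh n x) $ k * det (Gh n x) \<partial>lborel) \<longlonglongrightarrow> ?L"
    by (rule L1_tendsto_integral; rule dL; (rule domG')?; simp)
  define A where "A n x = ((\<chi> j. if j = k then \<xi>' x else Gh n x $ j) :: real^'m^'m)" for n x
  define A0 where "A0 x = ((\<chi> j. if j = k then \<xi>' x else G x $ j) :: real^'m^'m)" for x
  have Am: "(\<lambda>x. A n x $ j $ i) \<in> borel_measurable borel" "(\<lambda>x. A0 x $ j $ i) \<in> borel_measurable borel" for n j i
    by (cases "j = k"; simp add: A_def A0_def)+
  have limA: "AE x in lborel. x \<in> ball 0 r \<longrightarrow> (\<forall>j i. (\<lambda>n. A n x $ j $ i) \<longlonglongrightarrow> A0 x $ j $ i)"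
    using limG by eventually_elim (auto simp: A_def A0_def)
  have domA: "AE x in lborel. x \<in> ball 0 r \<longrightarrow> (\<forall>n j i. \<bar>A n x $ j $ i\<bar> ^ CARD('m) \<le> H x)"
    using domG
  proof eventually_elim
    case (elim x)
    have "\<bar>\<xi>' x $ i\<bar> ^ m \<le> C ^ m" for i
      using component_le_norm_cart[of "\<xi>' x" i] C(2)[of x] by (intro power_mono) auto
    with elim show ?case by (auto simp: A_def m_def intro: order_trans)
  qed
  have lim\<phi>: "AE x in lborel. (\<lambda>n. indicator (ball 0 r) x * \<phi> (Fh n x)) \<longlonglongrightarrow> indicator (ball 0 r) x * \<phi> (F x)"
    using limF
  proof eventually_elim
    case (elim x)
    show ?case
    proof (cases "x \<in> ball 0 r")
      case True
      then have "(\<lambda>n. \<phi> (Fh n x)) \<longlonglongrightarrow> \<phi> (F x)" using elim isCont_tendsto_compose[OF gcont(2)] by blast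
      then show ?thesis by (intro tendsto_intros)
    qed simp
  qed
  have sb\<phi>: "\<bar>indicator (ball 0 r) x * \<phi> y\<bar> \<le> B * indicator (ball 0 r) x" for x :: "real^'m" and y
    using \<phi>(2)[of y] by (auto simp: indicator_def)
  have out: "indicator (ball 0 r) x * \<phi> y * det (A n x) = \<phi> y * det (A n x)" "indicator (ball 0 r) x * \<phi> y * det (A0 x) = \<phi> y * det (A0 x)" for x y n
  proof -
    have "det (A n x) = 0 \<and> det (A0 x) = 0" if "x \<notin> ball 0 r"
    proof -
      have "\<xi>' x = 0" using that \<xi>(3)[of x] by simp
      then have "row k (A n x) = 0" "row k (A0 x) = 0" by (simp_all add: A_def A0_def row_def vec_eq_iff)
      then show ?thesis using det_zero_row by blast
    qed
    then show "indicator (ball 0 r) x * \<phi> y * det (A n x) = \<phi> y * det (A n x)" "indicator (ball 0 r) x * \<phi> y * det (A0 x) = \<phi> y * det (A0 x)"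
      by (auto simp: indicator_def)
  qed
  note dR = det_L1_tendsto[where A=A and B=A0 and s="\<lambda>n x. indicator (ball 0 r) x * \<phi> (Fh n x)" and so="\<lambda>x. indicator (ball 0 r) x * \<phi> (F x)" and R=r and H=H and c="B",
        OF Am _ _ limA domA H lim\<phi> sb\<phi>, unfolded out]
  have R: "(\<lambda>n. \<integral>x. \<phi> (Fh n x) * det (A n x) \<partial>lborel) \<longlonglongrightarrow> ?R"
    unfolding A0_def[symmetric] by (rule L1_tendsto_integral; rule dR; simp)
  have "(\<lambda>n. \<integral>x. \<xi> x * g (Fh n x) $ k * det (Gh n x) \<partial>lborel) \<longlonglongrightarrow> - ?R"
    unfolding smooth A_def[symmetric] by (intro tendsto_minus R)
  from LIMSEQ_unique[OF L this] show "?L = - ?R" .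
  show "integrable lborel (\<lambda>x. \<phi> (F x) * det ((\<chi> j. if j = k then \<xi>' x else G x $ j) :: real^'m^'m))"
    unfolding A0_def[symmetric] by (rule dR(3); simp)
qed

section \<open>Translation and smoothing of weighted images\<close>

lemma C1_translation: "C1 \<phi> g \<Longrightarrow> C1 (\<lambda>z. \<phi> (z + w)) (\<lambda>z. g (z + w))"
  unfolding C1_def
proof (elim conjE, intro conjI allI)
  assume c: "continuous_on UNIV g" and d: "\<forall>x. (\<phi> has_derivative (\<bullet>) (g x)) (at x)"
  show "continuous_on UNIV (\<lambda>z. g (z + w))" by (intro continuous_on_compose2[OF c] continuous_intros) auto
  fix x
  have "((\<lambda>z. z + w) has_derivative (\<lambda>v. v)) (at x)" by (auto intro!: derivative_eq_intros)
  from has_derivative_compose[OF this, of \<phi> "(\<bullet>) (g (x + w))"] d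
  show "((\<lambda>z. \<phi> (z + w)) has_derivative (\<bullet>) (g (x + w))) (at x)" by blast
qed

lemma has_real_derivative_integral:
  fixes D :: "'a \<Rightarrow> real" and \<psi> \<psi>' :: "real \<Rightarrow> 'a \<Rightarrow> real"
  assumes D: "integrable M D" and m[measurable]: "\<And>t. \<psi> t \<in> borel_measurable M" "\<psi>' t0 \<in> borel_measurable M"
    and b: "\<And>t x. \<bar>\<psi> t x\<bar> \<le> B"
    and d: "\<And>t x. ((\<lambda>t. \<psi> t x) has_real_derivative \<psi>' t x) (at t)" and K: "\<And>t x. \<bar>\<psi>' t x\<bar> \<le> K"
  shows "((\<lambda>t. \<integral>x. D x * \<psi> t x \<partial>M) has_real_derivative (\<integral>x. D x * \<psi>' t0 x \<partial>M)) (at t0)"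
proof -
  note [measurable] = borel_measurable_integrable[OF D]
  have i: "integrable M (\<lambda>x. D x * \<psi> t x)" for t
  proof (rule Bochner_Integration.integrable_bound)
    show "integrable M (\<lambda>x. B * D x)" using D by simp
    show "AE x in M. norm (D x * \<psi> t x) \<le> norm (B * D x)"
    proof (intro AE_I2)
      fix x
      have "\<bar>D x\<bar> * \<bar>\<psi> t x\<bar> \<le> \<bar>D x\<bar> * \<bar>B\<bar>" by (intro mult_left_mono order_trans[OF b abs_ge_self]) auto
      then show "norm (D x * \<psi> t x) \<le> norm (B * D x)" by (simp add: abs_mult mult.commute)
    qed
  qed simp
  have "((\<lambda>h. ((\<integral>x. D x * \<psi> (t0 + h) x \<partial>M) - (\<integral>x. D x * \<psi> t0 x \<partial>M)) / h) \<longlongrightarrow> (\<integral>x. D x * \<psi>' t0 x \<partial>M)) (at 0)"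
    unfolding tendsto_at_iff_sequentially
  proof (intro allI impI)
    fix X :: "nat \<Rightarrow> real" assume X: "\<forall>i. X i \<in> UNIV - {0}" "X \<longlonglongrightarrow> 0"
    then have X0: "X i \<noteq> 0" for i by auto
    have eq: "((\<integral>x. D x * \<psi> (t0 + X i) x \<partial>M) - (\<integral>x. D x * \<psi> t0 x \<partial>M)) / X i = (\<integral>x. D x * ((\<psi> (t0 + X i) x - \<psi> t0 x) / X i) \<partial>M)" for i
    proof -
      have "(\<integral>x. D x * \<psi> (t0 + X i) x \<partial>M) - (\<integral>x. D x * \<psi> t0 x \<partial>M) = (\<integral>x. D x * \<psi> (t0 + X i) x - D x * \<psi> t0 x \<partial>M)"
        using i by simp
      also have "\<dots> = (\<integral>x. X i * (D x * ((\<psi> (t0 + X i) x - \<psi> t0 x) / X i)) \<partial>M)"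
        using X0 by (intro Bochner_Integration.integral_cong) (auto simp: field_simps)
      finally show ?thesis using X0 by simp
    qed
    have "(\<lambda>i. \<integral>x. D x * ((\<psi> (t0 + X i) x - \<psi> t0 x) / X i) \<partial>M) \<longlonglongrightarrow> (\<integral>x. D x * \<psi>' t0 x \<partial>M)"
    proof (rule integral_dominated_convergence[where w="\<lambda>x. \<bar>D x\<bar> * K"])
      show "AE x in M. (\<lambda>i. D x * ((\<psi> (t0 + X i) x - \<psi> t0 x) / X i)) \<longlonglongrightarrow> D x * \<psi>' t0 x"
      proof (intro AE_I2 tendsto_intros)
        fix x
        have "((\<lambda>h. (\<psi> (t0 + h) x - \<psi> t0 x) / h) \<longlongrightarrow> \<psi>' t0 x) (at 0)" using d[of x t0] by (simp add: DERIV_def)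
        moreover have "filterlim X (at 0) sequentially" using X X0 by (auto simp: filterlim_at)
        ultimately show "(\<lambda>i. (\<psi> (t0 + X i) x - \<psi> t0 x) / X i) \<longlonglongrightarrow> \<psi>' t0 x" by (rule filterlim_compose)
      qed
      show "AE x in M. norm (D x * ((\<psi> (t0 + X i) x - \<psi> t0 x) / X i)) \<le> \<bar>D x\<bar> * K" for i
      proof (intro AE_I2)
        fix x
        have "\<bar>\<psi> (t0 + X i) x - \<psi> t0 x\<bar> \<le> K * \<bar>X i\<bar>"
          using field_differentiable_bound[of UNIV "\<lambda>t. \<psi> t x" "\<lambda>t. \<psi>' t x" K "t0 + X i" t0] d K by simp
        then have "\<bar>(\<psi> (t0 + X i) x - \<psi> t0 x) / X i\<bar> \<le> K" using X0[of i] by (simp add: field_simps)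
        then show "norm (D x * ((\<psi> (t0 + X i) x - \<psi> t0 x) / X i)) \<le> \<bar>D x\<bar> * K"
          by (simp add: abs_mult mult_left_mono del: abs_divide times_divide_eq_right)
      qed
    qed (use D in auto)
    then show "((\<lambda>h. ((\<integral>x. D x * \<psi> (t0 + h) x \<partial>M) - (\<integral>x. D x * \<psi> t0 x \<partial>M)) / h) \<circ> X) \<longlonglongrightarrow> (\<integral>x. D x * \<psi>' t0 x \<partial>M)"
      by (simp add: comp_def eq)
  qed
  then show ?thesis by (simp add: DERIV_def)
qed

lemma locint_bounded:
  fixes f :: "'a::euclidean_space \<Rightarrow> real"
  assumes [measurable]: "f \<in> borel_measurable borel" and b: "\<And>x. \<bar>f x\<bar> \<le> B"
  shows "locint f"
  unfolding locint_def
proof (intro conjI allI assms)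
  fix R show "integrable lborel (\<lambda>x. indicator (ball 0 R) x * f x)"
  proof (rule Bochner_Integration.integrable_bound)
    show "integrable lborel (\<lambda>x::'a. B * indicator (ball 0 R) x)"
      by (intro integrable_mult_right integrable_real_indicator) (auto simp: emeasure_lborel_ball_finite[simplified])
    show "AE x in lborel. norm (indicator (ball 0 R) x * f x) \<le> norm (B * indicator (ball 0 R) x)"
      by (intro AE_I2) (use order_trans[OF b abs_ge_self] in \<open>auto simp: indicator_def\<close>)
  qed simp
qed

lemma locint_det:
  fixes G :: "real^'m \<Rightarrow> real^'m^'m"
  assumes m: "\<And>j i. (\<lambda>x. G x $ j $ i) \<in> borel_measurable borel" and l: "\<And>j i. locint (\<lambda>x. \<bar>G x $ j $ i\<bar> ^ CARD('m))"
  shows "locint (\<lambda>x. det (G x))"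
  unfolding locint_def
proof (intro conjI allI)
  note [measurable] = det_measurable[OF m]
  show "(\<lambda>x. det (G x)) \<in> borel_measurable borel" by measurable
  fix R
  show "integrable lborel (\<lambda>x. indicator (ball 0 R) x * det (G x))"
  proof (rule Bochner_Integration.integrable_bound)
    show "integrable lborel (\<lambda>x. fact CARD('m) * (\<Sum>j\<in>UNIV. \<Sum>i\<in>UNIV. indicator (ball 0 R) x * \<bar>G x $ j $ i\<bar> ^ CARD('m)))"
      by (intro integrable_mult_right Bochner_Integration.integrable_sum locintD l)
    show "AE x in lborel. norm (indicator (ball 0 R) x * det (G x)) \<le>
      norm (fact CARD('m) * (\<Sum>j\<in>UNIV. \<Sum>i\<in>UNIV. indicator (ball 0 R) x * \<bar>G x $ j $ i\<bar> ^ CARD('m)))"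
    proof (intro AE_I2)
      fix x
      have "\<bar>det (G x)\<bar> \<le> \<bar>fact CARD('m) * (\<Sum>j\<in>UNIV. \<Sum>i\<in>UNIV. \<bar>G x $ j $ i\<bar> ^ CARD('m))\<bar>"
        using det_bound[of "G x"] by (rule order_trans[OF _ abs_ge_self])
      then show "norm (indicator (ball 0 R) x * det (G x)) \<le>
        norm (fact CARD('m) * (\<Sum>j\<in>UNIV. \<Sum>i\<in>UNIV. indicator (ball 0 R) x * \<bar>G x $ j $ i\<bar> ^ CARD('m)))"
        by (cases "x \<in> ball 0 R") simp_all
    qed
  qed measurable
qed

lemma locint_mult_bounded_support:
  fixes \<xi> :: "'a::euclidean_space \<Rightarrow> real"
  assumes "continuous_on UNIV \<xi>" "\<And>z. norm z \<ge> r \<Longrightarrow> \<xi> z = 0" "locint f"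
  shows "integrable lborel (\<lambda>z. \<xi> z * f z)"
  using conv_integrable[OF assms(1) _ assms(3), where r=r and x=0] assms(2) by simp

lemma sobolev_map_measurable:
  fixes F :: "real^'m \<Rightarrow> real^'m"
  assumes "sobolev_map F G" shows "F \<in> borel_measurable borel"
proof -
  note [measurable] = sobolev_mapD(1)[OF assms, THEN locint_measurable]
  show ?thesis by (subst borel_measurable_euclidean_space) (auto simp: Basis_vec_def inner_axis)
qed

text \<open>The total mass of the error terms \<open>E\<^sub>k\<close> of the integration by parts; it bounds the Lipschitz constant of
  translation in variation.\<close>

definition cof_mass :: "(real^'m \<Rightarrow> real^'m) \<Rightarrow> (real^'m \<Rightarrow> real^'m^'m) \<Rightarrow> real" where
  "cof_mass \<xi>' G = (\<Sum>k\<in>UNIV. \<integral>x. \<bar>det ((\<chi> j. if j = k then \<xi>' x else G x $ j) :: real^'m^'m)\<bar> \<partial>lborel)"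

text \<open>Differentiating along the translation by \<open>t *\<^sub>R v\<close> brings the
  gradient of \<open>\<phi>\<close> under the integral, and \<open>area_identity\<close> trades it
  for \<open>\<phi>\<close> itself against the error terms. The bound \<open>B\<close> on the
  gradient justifies these operations but leaves no trace in the constant, so the estimate is
  uniform over arbitrarily steep test functions.\<close>

lemma translation_bound:
  fixes F :: "real^'m \<Rightarrow> real^'m" and G :: "real^'m \<Rightarrow> real^'m^'m"
  assumes S: "sobolev_map F G"
    and \<phi>: "C1 \<phi> g" "\<And>x. \<bar>\<phi> x\<bar> \<le> 1" "\<And>x. norm (g x) \<le> B"
    and \<xi>: "C1 \<xi> \<xi>'" "\<And>z. norm z \<ge> r \<Longrightarrow> \<xi> z = 0" "\<And>z. norm z \<ge> r \<Longrightarrow> \<xi>' z = 0"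
  shows "\<bar>(\<integral>x. \<xi> x * det (G x) * \<phi> (F x + v) \<partial>lborel) - (\<integral>x. \<xi> x * det (G x) * \<phi> (F x) \<partial>lborel)\<bar> \<le> norm v * cof_mass \<xi>' G"
proof -
  note SD = sobolev_mapD[OF S]
  note Gm = SD(2)[THEN locint_measurable]
  note [measurable] = Gm det_measurable[OF Gm] sobolev_map_measurable[OF S] C1_measurable[OF \<phi>(1)] C1_measurable[OF \<xi>(1)]
  define E where "E k x = det ((\<chi> j. if j = k then \<xi>' x else G x $ j) :: real^'m^'m)" for k x
  define B' where "B' = max 1 B"
  have C1v: "C1 (\<lambda>z. \<phi> (z + w)) (\<lambda>z. g (z + w))" for w by (rule C1_translation[OF \<phi>(1)])
  have bv: "\<bar>\<phi> (z + w)\<bar> \<le> B'" "norm (g (z + w)) \<le> B'" for z w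
    using \<phi>(2)[of "z + w"] \<phi>(3)[of "z + w"] by (auto simp: B'_def)
  \<comment> \<open>For the constant test function \<open>1\<close> the integrability part of
    \<open>area_identity\<close> is that of the error term \<open>E k\<close> alone.\<close>
  have C1c: "C1 (\<lambda>z::real^'m. 1) (\<lambda>z. 0)" by (auto simp: C1_def)
  have Ei: "integrable lborel (E k)" for k
    using area_identity(2)[OF S C1c _ _ \<xi>, where B=1 and k=k] by (simp add: E_def[abs_def])
  have D: "integrable lborel (\<lambda>x. \<xi> x * det (G x))"
    by (rule locint_mult_bounded_support[OF C1_continuous[OF \<xi>(1)] \<xi>(2) locint_det[OF Gm SD(3)]])
  define T where "T t = (\<integral>x. (\<xi> x * det (G x)) * \<phi> (F x + t *\<^sub>R v) \<partial>lborel)" for t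
  define T' where "T' t = (\<integral>x. (\<xi> x * det (G x)) * (g (F x + t *\<^sub>R v) \<bullet> v) \<partial>lborel)" for t
  have gm: "(\<lambda>x. g (F x + w)) \<in> borel_measurable borel" for w by measurable
  have dT: "(T has_real_derivative T' t) (at t)" for t
    unfolding T_def[abs_def] T'_def
  proof (rule has_real_derivative_integral[OF D, where B=1 and K="B' * norm v"])
    show "((\<lambda>t. \<phi> (F x + t *\<^sub>R v)) has_real_derivative g (F x + t *\<^sub>R v) \<bullet> v) (at t)" for t x
      by (rule C1_line[OF \<phi>(1)])
    show "\<bar>g (F x + t *\<^sub>R v) \<bullet> v\<bar> \<le> B' * norm v" for t x
      by (rule order_trans[OF Cauchy_Schwarz_ineq2]) (intro mult_right_mono bv; simp)
  qed (use \<phi>(2) in auto)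
  have T': "\<bar>T' t\<bar> \<le> norm v * cof_mass \<xi>' G" for t
  proof -
    have int: "integrable lborel (\<lambda>x. v $ k * (\<xi> x * g (F x + t *\<^sub>R v) $ k * det (G x)))" for k
    proof (rule integrable_mult_right, rule Bochner_Integration.integrable_bound)
      show "integrable lborel (\<lambda>x. B' * (\<xi> x * det (G x)))" using D by simp
      show "AE x in lborel. norm (\<xi> x * g (F x + t *\<^sub>R v) $ k * det (G x)) \<le> norm (B' * (\<xi> x * det (G x)))"
      proof (intro AE_I2)
        fix x
        have "\<bar>g (F x + t *\<^sub>R v) $ k\<bar> \<le> \<bar>B'\<bar>" using component_le_norm_cart[of "g (F x + t *\<^sub>R v)" k] bv(2)[of "F x" "t *\<^sub>R v"] by linarith
        then have "\<bar>g (F x + t *\<^sub>R v) $ k\<bar> * (\<bar>\<xi> x\<bar> * \<bar>det (G x)\<bar>) \<le> \<bar>B'\<bar> * (\<bar>\<xi> x\<bar> * \<bar>det (G x)\<bar>)" by (rule mult_right_mono) simp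
        then show "norm (\<xi> x * g (F x + t *\<^sub>R v) $ k * det (G x)) \<le> norm (B' * (\<xi> x * det (G x)))" by (simp add: abs_mult mult_ac)
      qed
      have [measurable]: "(\<lambda>y. g y $ k) \<in> borel_measurable borel"
        using \<phi>(1) by (intro borel_measurable_continuous_onI continuous_intros) (simp add: C1_def)
      have "(\<lambda>x. g (F x + t *\<^sub>R v) $ k) \<in> borel_measurable borel" by measurable
      then show "(\<lambda>x. \<xi> x * g (F x + t *\<^sub>R v) $ k * det (G x)) \<in> borel_measurable lborel" by measurable
    qed
    have "T' t = (\<integral>x. (\<Sum>k\<in>UNIV. v $ k * (\<xi> x * g (F x + t *\<^sub>R v) $ k * det (G x))) \<partial>lborel)"
      unfolding T'_def by (simp add: inner_vec_def sum_distrib_left mult_ac)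
    also have "\<dots> = (\<Sum>k\<in>UNIV. v $ k * (\<integral>x. \<xi> x * g (F x + t *\<^sub>R v) $ k * det (G x) \<partial>lborel))"
      using int by (subst Bochner_Integration.integral_sum) auto
    also have "\<dots> = (\<Sum>k\<in>UNIV. v $ k * - (\<integral>x. \<phi> (F x + t *\<^sub>R v) * E k x \<partial>lborel))"
      unfolding E_def using area_identity(1)[OF S C1v bv \<xi>] by simp
    finally have "\<bar>T' t\<bar> \<le> (\<Sum>k\<in>UNIV. \<bar>v $ k * - (\<integral>x. \<phi> (F x + t *\<^sub>R v) * E k x \<partial>lborel)\<bar>)"
      by (simp only: sum_abs)
    also have "\<dots> \<le> (\<Sum>k\<in>UNIV. norm v * (\<integral>x. \<bar>E k x\<bar> \<partial>lborel))"
    proof (rule sum_mono)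
      fix k
      have "\<bar>\<integral>x. \<phi> (F x + t *\<^sub>R v) * E k x \<partial>lborel\<bar> \<le> (\<integral>x. \<bar>E k x\<bar> \<partial>lborel)"
      proof (rule order_trans[OF integral_abs_bound], rule integral_mono_AE')
        show "integrable lborel (\<lambda>x. \<bar>E k x\<bar>)" using Ei by simp
        show "AE x in lborel. \<bar>\<phi> (F x + t *\<^sub>R v) * E k x\<bar> \<le> \<bar>E k x\<bar>"
          using \<phi>(2) by (intro AE_I2) (auto simp: abs_mult intro: mult_left_le_one_le)
      qed auto
      then show "\<bar>v $ k * - (\<integral>x. \<phi> (F x + t *\<^sub>R v) * E k x \<partial>lborel)\<bar> \<le> norm v * (\<integral>x. \<bar>E k x\<bar> \<partial>lborel)"
        unfolding abs_mult abs_minus by (intro mult_mono component_le_norm_cart) auto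
    qed
    also have "\<dots> = norm v * cof_mass \<xi>' G" by (simp add: cof_mass_def E_def sum_distrib_left)
    finally show ?thesis .
  qed
  have "norm (T 1 - T 0) \<le> norm v * cof_mass \<xi>' G * norm (1 - 0 :: real)"
    by (rule field_differentiable_bound[of UNIV T T']) (use dT T' in auto)
  then show ?thesis by (simp add: T_def)
qed

text \<open>The mollified test function is an average of translates by vectors shorter than
  \<open>\<delta>\<close>. By Fubini the difference of the integrals is the same average of the
  differences controlled by \<open>translation_bound\<close>.\<close>

lemma smoothing_bound:
  fixes F :: "real^'m \<Rightarrow> real^'m" and G :: "real^'m \<Rightarrow> real^'m^'m"
  assumes S: "sobolev_map F G"
    and \<phi>: "C1 \<phi> g" "\<And>x. \<bar>\<phi> x\<bar> \<le> 1" "\<And>x. norm (g x) \<le> B"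
    and \<xi>: "C1 \<xi> \<xi>'" "\<And>z. norm z \<ge> r \<Longrightarrow> \<xi> z = 0" "\<And>z. norm z \<ge> r \<Longrightarrow> \<xi>' z = 0"
    and \<delta>: "\<delta> > 0"
  shows "\<bar>(\<integral>x. \<xi> x * det (G x) * conv (ker \<delta>) \<phi> (F x) \<partial>lborel) - (\<integral>x. \<xi> x * det (G x) * \<phi> (F x) \<partial>lborel)\<bar> \<le> \<delta> * cof_mass \<xi>' G"
proof -
  note SD = sobolev_mapD[OF S]
  note Gm = SD(2)[THEN locint_measurable]
  note [measurable] = Gm det_measurable[OF Gm] sobolev_map_measurable[OF S] C1_measurable[OF \<phi>(1)] C1_measurable[OF \<xi>(1)]
  define D where "D x = \<xi> x * det (G x)" for x
  have [measurable]: "D \<in> borel_measurable borel" unfolding D_def by measurable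
  have D: "integrable lborel D"
    unfolding D_def[abs_def] by (rule locint_mult_bounded_support[OF C1_continuous[OF \<xi>(1)] \<xi>(2) locint_det[OF Gm SD(3)]])
  have \<phi>l: "locint \<phi>" by (rule locint_bounded[OF _ \<phi>(2)]) measurable
  have nn: "cof_mass \<xi>' G \<ge> 0" by (auto simp: cof_mass_def intro!: sum_nonneg)
  have fub: "integrable (lborel \<Otimes>\<^sub>M lborel) (\<lambda>(x, y). D x * (ker \<delta> y * \<phi> (F x + y)))"
  proof (rule integrableI_bounded)
    have "(\<integral>\<^sup>+p. ennreal (norm (case p of (x, y) \<Rightarrow> D x * (ker \<delta> y * \<phi> (F x + y)))) \<partial>(lborel \<Otimes>\<^sub>M lborel))
      \<le> (\<integral>\<^sup>+p. (case p of (x, y) \<Rightarrow> ennreal \<bar>D x\<bar> * ennreal (ker \<delta> y)) \<partial>(lborel \<Otimes>\<^sub>M (lborel :: (real^'m) measure)))"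
    proof (intro nn_integral_mono, clarify)
      fix x y
      have "\<bar>D x\<bar> * (\<bar>ker \<delta> y\<bar> * \<bar>\<phi> (F x + y)\<bar>) \<le> \<bar>D x\<bar> * (ker \<delta> y * 1)"
        using \<phi>(2) ker_nonneg[OF \<delta>, of y] by (intro mult_left_mono mult_mono) auto
      then show "ennreal (norm (D x * (ker \<delta> y * \<phi> (F x + y)))) \<le> ennreal \<bar>D x\<bar> * ennreal (ker \<delta> y)"
        using ker_nonneg[OF \<delta>, of y] by (simp add: abs_mult flip: ennreal_mult)
    qed
    also have "\<dots> = (\<integral>\<^sup>+x. \<integral>\<^sup>+y. ennreal \<bar>D x\<bar> * ennreal (ker \<delta> y) \<partial>(lborel :: (real^'m) measure) \<partial>lborel)"
      by (subst lborel.nn_integral_fst[of "\<lambda>(x, y). ennreal \<bar>D x\<bar> * ennreal (ker \<delta> y)", symmetric]) auto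
    also have "(\<integral>\<^sup>+x. \<integral>\<^sup>+y. ennreal \<bar>D x\<bar> * ennreal (ker \<delta> y) \<partial>(lborel :: (real^'m) measure) \<partial>lborel) = (\<integral>\<^sup>+x. ennreal \<bar>D x\<bar> \<partial>lborel)"
      by (subst nn_integral_cmult) (auto simp: ker_integral(3)[OF \<delta>])
    also have "\<dots> < \<infinity>" using D by (simp add: integrable_iff_bounded)
    finally show "(\<integral>\<^sup>+p. ennreal (norm (case p of (x, y) \<Rightarrow> D x * (ker \<delta> y * \<phi> (F x + y)))) \<partial>(lborel \<Otimes>\<^sub>M lborel)) < \<infinity>" .
  qed measurable
  define T where "T y = (\<integral>x. D x * \<phi> (F x + y) \<partial>lborel)" for y
  have pull: "(\<integral>x. D x * (ker \<delta> y * \<phi> (F x + y)) \<partial>lborel) = ker \<delta> y * (\<integral>x. D x * \<phi> (F x + y) \<partial>lborel)" for y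
    by (simp only: mult.left_commute[of "D _"] integral_mult_right_zero)
  have TB: "\<bar>T y - T 0\<bar> \<le> norm y * cof_mass \<xi>' G" for y
    unfolding T_def D_def using translation_bound[OF S \<phi> \<xi>, where v=y] by simp
  have "(\<integral>x. D x * conv (ker \<delta>) \<phi> (F x) \<partial>lborel) = (\<integral>x. \<integral>y. D x * (ker \<delta> y * \<phi> (F x + y)) \<partial>lborel \<partial>lborel)"
    by (simp add: conv_ker_shift(1)[OF \<delta> \<phi>l])
  also have "\<dots> = (\<integral>y. \<integral>x. D x * (ker \<delta> y * \<phi> (F x + y)) \<partial>lborel \<partial>lborel)"
    by (rule lborel_pair.Fubini_integral[symmetric]) (rule fub)
  also have "\<dots> = (\<integral>y. ker \<delta> y * T y \<partial>lborel)"
    unfolding T_def by (subst pull) (rule refl)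
  finally have e1: "(\<integral>x. D x * conv (ker \<delta>) \<phi> (F x) \<partial>lborel) = (\<integral>y. ker \<delta> y * T y \<partial>lborel)" .
  have i1: "integrable lborel (\<lambda>y. ker \<delta> y * T y)"
    using lborel_pair.integrable_snd[OF fub] unfolding T_def pull by simp
  have i2: "integrable lborel (\<lambda>y::real^'m. ker \<delta> y * T 0)"
    using ker_integral(1)[OF \<delta>] by (rule integrable_mult_left)
  have "(\<integral>y. ker \<delta> y * T y \<partial>lborel) - T 0 = (\<integral>y. ker \<delta> y * T y \<partial>lborel) - (\<integral>y. ker \<delta> y * T 0 \<partial>(lborel :: (real^'m) measure))"
    by (simp add: ker_integral(2)[OF \<delta>])
  also have "\<dots> = (\<integral>y. ker \<delta> y * (T y - T 0) \<partial>lborel)"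
    using i1 i2 by (simp add: right_diff_distrib)
  finally have e2: "(\<integral>y. ker \<delta> y * T y \<partial>lborel) - T 0 = (\<integral>y. ker \<delta> y * (T y - T 0) \<partial>lborel)" .
  have "\<bar>\<integral>y. ker \<delta> y * (T y - T 0) \<partial>lborel\<bar> \<le> (\<integral>y. ker \<delta> y * (\<delta> * cof_mass \<xi>' G) \<partial>(lborel :: (real^'m) measure))"
  proof (rule order_trans[OF integral_abs_bound], rule integral_mono)
    show "integrable lborel (\<lambda>y. \<bar>ker \<delta> y * (T y - T 0)\<bar>)" using i1 i2 by (auto simp: right_diff_distrib intro!: integrable_abs)
    show "integrable lborel (\<lambda>y::real^'m. ker \<delta> y * (\<delta> * cof_mass \<xi>' G))"
      using ker_integral(1)[OF \<delta>] by (rule integrable_mult_left)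
    fix y :: "real^'m"
    show "\<bar>ker \<delta> y * (T y - T 0)\<bar> \<le> ker \<delta> y * (\<delta> * cof_mass \<xi>' G)"
    proof (cases "norm y \<ge> \<delta>")
      case True then show ?thesis by (simp add: ker_supp(2)[OF \<delta>])
    next
      case False
      then have "\<bar>T y - T 0\<bar> \<le> \<delta> * cof_mass \<xi>' G" using TB[of y] nn mult_right_mono[of "norm y" \<delta> "cof_mass \<xi>' G"] by linarith
      then show ?thesis using ker_nonneg[OF \<delta>, of y] by (simp add: abs_mult mult_left_mono)
    qed
  qed
  also have "\<dots> = \<delta> * cof_mass \<xi>' G" by (simp add: ker_integral(2)[OF \<delta>])
  finally show ?thesis using e1 e2 by (simp add: T_def D_def)
qed

lemma conv_ker_bounded:
  fixes \<phi> :: "'a::euclidean_space \<Rightarrow> real"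
  assumes \<delta>: "\<delta> > 0" and [measurable]: "\<phi> \<in> borel_measurable borel" and b: "\<And>x. \<bar>\<phi> x\<bar> \<le> B"
  shows "\<bar>conv (ker \<delta>) \<phi> z\<bar> \<le> B"
proof -
  have l: "locint \<phi>" by (rule locint_bounded[OF _ b]) measurable
  have "\<bar>\<integral>y. ker \<delta> y * \<phi> (z + y) \<partial>lborel\<bar> \<le> (\<integral>y. ker \<delta> y * B \<partial>(lborel :: 'a measure))"
  proof (rule order_trans[OF integral_abs_bound], rule integral_mono)
    show "integrable lborel (\<lambda>y. \<bar>ker \<delta> y * \<phi> (z + y)\<bar>)" using conv_ker_shift(2)[OF \<delta> l] by (rule integrable_abs)
    show "integrable lborel (\<lambda>y::'a. ker \<delta> y * B)" using ker_integral(1)[OF \<delta>] by (rule integrable_mult_left)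
    show "\<bar>ker \<delta> y * \<phi> (z + y)\<bar> \<le> ker \<delta> y * B" for y
      using b[of "z + y"] ker_nonneg[OF \<delta>, of y] by (simp add: abs_mult mult_left_mono)
  qed
  then show ?thesis by (simp add: conv_ker_shift(1)[OF \<delta> l] ker_integral(2)[OF \<delta>])
qed

text \<open>The difference is at most the mean distance of two shifted kernels, an expression from
  which \<open>\<phi> n\<close> has disappeared. This is what allows the test function to change
  with \<open>n\<close>.\<close>

lemma conv_ker_equicontinuous:
  fixes \<phi> :: "nat \<Rightarrow> 'a::euclidean_space \<Rightarrow> real"
  assumes \<delta>: "\<delta> > 0" and [measurable]: "\<And>n. \<phi> n \<in> borel_measurable borel" and b: "\<And>n x. \<bar>\<phi> n x\<bar> \<le> 1"
    and z: "zn \<longlonglongrightarrow> z"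
  shows "(\<lambda>n. conv (ker \<delta>) (\<phi> n) (zn n) - conv (ker \<delta>) (\<phi> n) z) \<longlonglongrightarrow> 0"
proof -
  have l: "locint (\<phi> n)" for n by (rule locint_bounded[OF _ b]) measurable
  have ci: "integrable lborel (\<lambda>w. ker \<delta> (w - x) * \<phi> n w)" for n x
    by (rule conv_integrable[OF ker_cont(2) _ l, where r=\<delta>]) (simp add: ker_supp(2)[OF \<delta>])
  have l1: "locint (\<lambda>_::'a. 1)" by (rule locint_bounded[of _ 1]) auto
  have ki: "integrable lborel (\<lambda>w::'a. ker \<delta> (w - x))" for x
    using conv_integrable[OF ker_cont(2) _ l1, where r=\<delta>, of \<delta> x] by (simp add: ker_supp(2)[OF \<delta>])
  obtain C where C: "C \<ge> 0" "\<And>z::'a. \<bar>ker \<delta> z\<bar> \<le> C"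
    using integrable_continuous_bounded_support(1)[OF ker_cont(2), of \<delta> \<delta>] ker_supp(2)[OF \<delta>] by blast
  obtain R where R: "\<And>n. norm (zn n) \<le> R" using convergent_imp_bounded[OF z] by (auto simp: bounded_iff)
  have Rz: "norm z \<le> R" by (rule LIMSEQ_le_const2[OF tendsto_norm[OF z]]) (use R in auto)
  have "(\<lambda>n. \<integral>w. \<bar>ker \<delta> (w - zn n) - ker \<delta> (w - z)\<bar> \<partial>lborel) \<longlonglongrightarrow> (\<integral>w. 0 \<partial>(lborel :: 'a measure))"
  proof (rule integral_dominated_convergence[where w="\<lambda>w. 2 * C * indicator (ball 0 (R + \<delta>)) w"])
    show "AE w in lborel. (\<lambda>n. \<bar>ker \<delta> (w - zn n) - ker \<delta> (w - z)\<bar>) \<longlonglongrightarrow> 0"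
    proof (intro AE_I2 tendsto_rabs_zero LIM_zero)
      fix w show "(\<lambda>n. ker \<delta> (w - zn n)) \<longlonglongrightarrow> ker \<delta> (w - z)"
        by (rule continuous_on_tendsto_compose[OF ker_cont(2)]) (auto intro!: tendsto_intros z)
    qed
    show "integrable lborel (\<lambda>w::'a. 2 * C * indicator (ball 0 (R + \<delta>)) w)"
      by (intro integrable_mult_right integrable_real_indicator) (auto simp: emeasure_lborel_ball_finite[simplified])
    show "AE w in lborel. norm \<bar>ker \<delta> (w - zn n) - ker \<delta> (w - z)\<bar> \<le> 2 * C * indicator (ball 0 (R + \<delta>)) w" for n
    proof (intro AE_I2)
      fix w
      show "norm \<bar>ker \<delta> (w - zn n) - ker \<delta> (w - z)\<bar> \<le> 2 * C * indicator (ball 0 (R + \<delta>)) w"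
      proof (cases "w \<in> ball 0 (R + \<delta>)")
        case True
        then show ?thesis using C(2)[of "w - zn n"] C(2)[of "w - z"] abs_triangle_ineq4[of "ker \<delta> (w - zn n)" "ker \<delta> (w - z)"] by simp
      next
        case False
        then have "norm (w - zn n) \<ge> \<delta>" "norm (w - z) \<ge> \<delta>" 
          using R[of n] Rz norm_triangle_ineq[of "w - zn n" "zn n"] norm_triangle_ineq[of "w - z" "z"] by auto
        then show ?thesis using False by (simp add: ker_supp(2)[OF \<delta>])
      qed
    qed
  qed simp_all
  then have lim: "(\<lambda>n. \<integral>w. \<bar>ker \<delta> (w - zn n) - ker \<delta> (w - z)\<bar> \<partial>lborel) \<longlonglongrightarrow> 0" by simp
  have "\<bar>conv (ker \<delta>) (\<phi> n) (zn n) - conv (ker \<delta>) (\<phi> n) z\<bar> \<le> (\<integral>w. \<bar>ker \<delta> (w - zn n) - ker \<delta> (w - z)\<bar> \<partial>lborel)" for n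
  proof -
    have "conv (ker \<delta>) (\<phi> n) (zn n) - conv (ker \<delta>) (\<phi> n) z = (\<integral>w. (ker \<delta> (w - zn n) - ker \<delta> (w - z)) * \<phi> n w \<partial>lborel)"
      unfolding conv_def using ci by (simp add: left_diff_distrib)
    also have "\<bar>\<integral>w. (ker \<delta> (w - zn n) - ker \<delta> (w - z)) * \<phi> n w \<partial>lborel\<bar> \<le> (\<integral>w. \<bar>ker \<delta> (w - zn n) - ker \<delta> (w - z)\<bar> \<partial>lborel)"
    proof (rule order_trans[OF integral_abs_bound], rule integral_mono_AE')
      show "integrable lborel (\<lambda>w. \<bar>ker \<delta> (w - zn n) - ker \<delta> (w - z)\<bar>)" using ki by auto
      show "AE w in lborel. \<bar>(ker \<delta> (w - zn n) - ker \<delta> (w - z)) * \<phi> n w\<bar> \<le> \<bar>ker \<delta> (w - zn n) - ker \<delta> (w - z)\<bar>"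
        using b by (intro AE_I2) (auto simp: abs_mult intro: mult_left_le)
    qed auto
    finally show ?thesis .
  qed
  then show ?thesis
    by (intro tendsto_rabs_zero_cancel[OF tendsto_sandwich[OF _ _ tendsto_const lim]] always_eventually allI) auto
qed

section \<open>Approximation of test functions and densities by smooth functions\<close>

lemma conv_ker_tendsto:
  fixes \<psi> :: "'a::euclidean_space \<Rightarrow> real"
  assumes c: "continuous_on UNIV \<psi>" and b: "\<And>x. \<bar>\<psi> x\<bar> \<le> B"
    and \<eta>: "\<And>n. \<eta> n > 0" "\<eta> \<longlonglongrightarrow> 0"
  shows "(\<lambda>n. conv (ker (\<eta> n)) \<psi> x) \<longlonglongrightarrow> \<psi> x"
proof (rule LIMSEQ_I)
  have m: "\<psi> \<in> borel_measurable borel" by (rule borel_measurable_continuous_onI[OF c])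
  have l: "locint \<psi>" by (rule locint_bounded[OF m b])
  fix e :: real assume e: "e > 0"
  have "isCont \<psi> x" using c by (simp add: continuous_on_eq_continuous_at)
  then obtain d where d: "d > 0" "\<And>y. dist y x < d \<Longrightarrow> dist (\<psi> y) (\<psi> x) < e/2"
    using e unfolding continuous_at_eps_delta dist_norm by (metis half_gt_zero)
  have "eventually (\<lambda>n. \<eta> n < d) sequentially" using \<eta>(2) d(1) by (rule order_tendstoD)
  then obtain N where N: "\<And>n. n \<ge> N \<Longrightarrow> \<eta> n < d" by (auto simp: eventually_sequentially)
  have "norm (conv (ker (\<eta> n)) \<psi> x - \<psi> x) < e" if "n \<ge> N" for n
  proof -
    note i = conv_ker_shift(2)[OF \<eta>(1)[of n] l, of x]
    have i': "integrable lborel (\<lambda>y::'a. ker (\<eta> n) y * \<psi> x)" using ker_integral(1)[OF \<eta>(1)[of n]] by (rule integrable_mult_left)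
    have "conv (ker (\<eta> n)) \<psi> x - \<psi> x = (\<integral>y. ker (\<eta> n) y * \<psi> (x + y) \<partial>lborel) - (\<integral>y. ker (\<eta> n) y * \<psi> x \<partial>(lborel :: 'a measure))"
      by (simp add: conv_ker_shift(1)[OF \<eta>(1) l] ker_integral(2)[OF \<eta>(1)])
    also have "\<dots> = (\<integral>y. ker (\<eta> n) y * (\<psi> (x + y) - \<psi> x) \<partial>lborel)" using i i' by (simp add: right_diff_distrib)
    finally have e1: "conv (ker (\<eta> n)) \<psi> x - \<psi> x = (\<integral>y. ker (\<eta> n) y * (\<psi> (x + y) - \<psi> x) \<partial>lborel)" .
    have "\<bar>\<integral>y. ker (\<eta> n) y * (\<psi> (x + y) - \<psi> x) \<partial>lborel\<bar> \<le> (\<integral>y. ker (\<eta> n) y * (e/2) \<partial>(lborel :: 'a measure))"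
    proof (rule order_trans[OF integral_abs_bound], rule integral_mono)
      show "integrable lborel (\<lambda>y. \<bar>ker (\<eta> n) y * (\<psi> (x + y) - \<psi> x)\<bar>)" using i i' by (auto simp: right_diff_distrib intro!: integrable_abs)
      show "integrable lborel (\<lambda>y::'a. ker (\<eta> n) y * (e/2))" using ker_integral(1)[OF \<eta>(1)[of n]] by (rule integrable_mult_left)
      fix y :: 'a
      show "\<bar>ker (\<eta> n) y * (\<psi> (x + y) - \<psi> x)\<bar> \<le> ker (\<eta> n) y * (e/2)"
      proof (cases "norm y \<ge> \<eta> n")
        case True then show ?thesis by (simp add: ker_supp(2)[OF \<eta>(1)])
      next
        case False
        then have "dist (\<psi> (x + y)) (\<psi> x) < e/2" using N[OF that] by (intro d(2)) (simp add: dist_norm)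
        then have "ker (\<eta> n) y * \<bar>\<psi> (x + y) - \<psi> x\<bar> \<le> ker (\<eta> n) y * (e/2)"
          by (intro mult_left_mono ker_nonneg[OF \<eta>(1)]) (simp add: dist_norm)
        then show ?thesis by (simp add: abs_mult ker_nonneg[OF \<eta>(1)])
      qed
    qed
    also have "\<dots> = e/2" by (simp add: ker_integral(2)[OF \<eta>(1)])
    finally show ?thesis using e1 e by simp
  qed
  then show "\<exists>no. \<forall>n\<ge>no. norm (conv (ker (\<eta> n)) \<psi> x - \<psi> x) < e" by blast
qed

lemma conv_kerg_bounded:
  fixes \<psi> :: "real^'m \<Rightarrow> real"
  assumes \<eta>: "\<eta> > 0" and m: "\<psi> \<in> borel_measurable borel" and b: "\<And>x. \<bar>\<psi> x\<bar> \<le> B"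
  shows "\<exists>B'. \<forall>x. norm ((\<chi> i. - conv (kerg \<eta> (axis i 1)) \<psi> x) :: real^'m) \<le> B'"
proof -
  have l: "locint \<psi>" by (rule locint_bounded[OF m b])
  have cs: "conv (kerg \<eta> v) \<psi> x = (\<integral>y. kerg \<eta> v y * \<psi> (x + y) \<partial>lborel)" "integrable lborel (\<lambda>y. kerg \<eta> v y * \<psi> (x + y))" for x v
    using conv_shift[OF ker_cont(3) _ l, where r=\<eta>, of \<eta> v x] by (auto simp: ker_supp(3)[OF \<eta>])
  have ki: "integrable lborel (\<lambda>y. \<bar>kerg \<eta> v y\<bar>)" for v :: "real^'m"
    using integrable_continuous_bounded_support(2)[OF ker_cont(3), of \<eta> \<eta> v] by (auto simp: ker_supp(3)[OF \<eta>])
  have "\<bar>conv (kerg \<eta> v) \<psi> x\<bar> \<le> (\<integral>y. \<bar>kerg \<eta> v y\<bar> * B \<partial>lborel)" for v x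
    unfolding cs(1)
  proof (rule order_trans[OF integral_abs_bound], rule integral_mono)
    show "integrable lborel (\<lambda>y. \<bar>kerg \<eta> v y * \<psi> (x + y)\<bar>)" using cs(2) by (rule integrable_abs)
    show "integrable lborel (\<lambda>y. \<bar>kerg \<eta> v y\<bar> * B)" using ki by (rule integrable_mult_left)
    show "\<bar>kerg \<eta> v y * \<psi> (x + y)\<bar> \<le> \<bar>kerg \<eta> v y\<bar> * B" for y
      using b[of "x + y"] by (simp add: abs_mult mult_left_mono)
  qed
  then have "norm ((\<chi> i. - conv (kerg \<eta> (axis i 1)) \<psi> x) :: real^'m) \<le> (\<Sum>i\<in>UNIV. \<integral>y. \<bar>kerg \<eta> (axis i 1 :: real^'m) y\<bar> * B \<partial>lborel)" for x
    by (intro order_trans[OF norm_le_l1_cart] sum_mono) simp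
  then show ?thesis by blast
qed

text \<open>A continuous approximation is clipped to values between \<open>-1\<close> and
  \<open>1\<close>, which can only bring it closer to \<open>\<phi>\<close>, and then mollified,
  which preserves the bound and produces a bounded gradient.\<close>

lemma L1_approx_C1:
  fixes M :: "(real^'m) measure"
  assumes fin: "finite_measure M" and sets: "sets M = sets borel"
    and m: "\<phi> \<in> borel_measurable borel" and b: "\<And>x. \<bar>\<phi> x\<bar> \<le> 1" and e: "e > 0"
  shows "\<exists>\<psi> g B. C1 \<psi> g \<and> (\<forall>x. \<bar>\<psi> x\<bar> \<le> 1) \<and> (\<forall>x. norm (g x) \<le> B) \<and> (\<integral>x. \<bar>\<phi> x - \<psi> x\<bar> \<partial>M) < e"
proof -
  interpret finite_measure M by (rule fin)
  have mM: "f \<in> borel_measurable M" if "f \<in> borel_measurable borel" for f :: "real^'m \<Rightarrow> real"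
    using that measurable_cong_sets[OF sets refl] by blast
  have ib: "integrable M f" if "f \<in> borel_measurable borel" "\<And>x. \<bar>f x\<bar> \<le> B" for f :: "real^'m \<Rightarrow> real" and B
  proof (rule integrable_const_bound[where B=B])
    show "AE x in M. norm (f x) \<le> B" using that(2) by (intro AE_I2) simp
    show "f \<in> borel_measurable M" by (rule mM[OF that(1)])
  qed
  have "integrable M \<phi>" by (rule ib[OF m b])
  from L1_approx_continuous[OF fin sets this, of "e/2"] e
  obtain \<psi>0 where \<psi>0: "continuous_on UNIV \<psi>0" "bounded (range \<psi>0)" "(\<integral>x. \<bar>\<phi> x - \<psi>0 x\<bar> \<partial>M) < e/2" by auto
  obtain B0 where B0: "\<And>x. \<bar>\<psi>0 x\<bar> \<le> B0" using \<psi>0(2) by (auto simp: bounded_iff)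
  define \<psi> where "\<psi> x = max (-1) (min 1 (\<psi>0 x))" for x
  have c: "continuous_on UNIV \<psi>" unfolding \<psi>_def by (intro continuous_intros \<psi>0)
  have b1: "\<bar>\<psi> x\<bar> \<le> 1" for x by (auto simp: \<psi>_def)
  have m1: "\<psi> \<in> borel_measurable borel" "\<psi>0 \<in> borel_measurable borel" 
    using borel_measurable_continuous_onI[OF c] borel_measurable_continuous_onI[OF \<psi>0(1)] by simp_all
  have le: "(\<integral>x. \<bar>\<phi> x - \<psi> x\<bar> \<partial>M) < e/2"
  proof (rule le_less_trans[OF integral_mono \<psi>0(3)])
    show "integrable M (\<lambda>x. \<bar>\<phi> x - \<psi> x\<bar>)" "integrable M (\<lambda>x. \<bar>\<phi> x - \<psi>0 x\<bar>)"
      using ib[OF m b] ib[OF m1(1) b1] ib[OF m1(2) B0] by auto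
    show "\<bar>\<phi> x - \<psi> x\<bar> \<le> \<bar>\<phi> x - \<psi>0 x\<bar>" for x using b[of x] by (auto simp: \<psi>_def)
  qed
  define \<eta> where "\<eta> n = 1 / (real n + 1)" for n :: nat
  have \<eta>: "0 < \<eta> n" for n by (auto simp: \<eta>_def)
  have \<eta>0: "\<eta> \<longlonglongrightarrow> 0" unfolding \<eta>_def using LIMSEQ_inverse_real_of_nat by (simp add: inverse_eq_divide add.commute)
  have l: "locint \<psi>" by (rule locint_bounded[OF m1(1) b1])
  have cm: "conv (ker (\<eta> n)) \<psi> \<in> borel_measurable borel" for n
    by (rule borel_measurable_continuous_onI[OF conv_ker_continuous[OF \<eta> l]])
  note cb = conv_ker_bounded[OF \<eta> m1(1) b1]
  have "(\<lambda>n. \<integral>x. \<bar>\<psi> x - conv (ker (\<eta> n)) \<psi> x\<bar> \<partial>M) \<longlonglongrightarrow> (\<integral>x. 0 \<partial>M)"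
  proof (rule integral_dominated_convergence[where w="\<lambda>_. 2"])
    show "AE x in M. (\<lambda>n. \<bar>\<psi> x - conv (ker (\<eta> n)) \<psi> x\<bar>) \<longlonglongrightarrow> 0"
    proof (intro AE_I2)
      fix x
      have "(\<lambda>n. \<psi> x - conv (ker (\<eta> n)) \<psi> x) \<longlonglongrightarrow> \<psi> x - \<psi> x"
        by (intro tendsto_intros conv_ker_tendsto[OF c b1 \<eta> \<eta>0])
      then show "(\<lambda>n. \<bar>\<psi> x - conv (ker (\<eta> n)) \<psi> x\<bar>) \<longlonglongrightarrow> 0" by (intro tendsto_rabs_zero) simp
    qed
    show "AE x in M. norm \<bar>\<psi> x - conv (ker (\<eta> n)) \<psi> x\<bar> \<le> 2" for n
    proof (intro AE_I2)
      fix x show "norm \<bar>\<psi> x - conv (ker (\<eta> n)) \<psi> x\<bar> \<le> 2"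
        using b1[of x] cb[of n x] abs_triangle_ineq4[of "\<psi> x" "conv (ker (\<eta> n)) \<psi> x"] by simp
    qed
    show "(\<lambda>x. \<bar>\<psi> x - conv (ker (\<eta> n)) \<psi> x\<bar>) \<in> borel_measurable M" for n
      by (intro borel_measurable_abs borel_measurable_diff mM m1 cm)
  qed simp_all
  then have "eventually (\<lambda>n. (\<integral>x. \<bar>\<psi> x - conv (ker (\<eta> n)) \<psi> x\<bar> \<partial>M) < e/2) sequentially"
    using e by (intro order_tendstoD) auto
  then obtain n where n: "(\<integral>x. \<bar>\<psi> x - conv (ker (\<eta> n)) \<psi> x\<bar> \<partial>M) < e/2" by (auto simp: eventually_sequentially)
  note ints = ib[OF m b] ib[OF m1(1) b1] ib[OF cm cb]
  have "(\<integral>x. \<bar>\<phi> x - conv (ker (\<eta> n)) \<psi> x\<bar> \<partial>M) \<le> (\<integral>x. \<bar>\<phi> x - \<psi> x\<bar> + \<bar>\<psi> x - conv (ker (\<eta> n)) \<psi> x\<bar> \<partial>M)"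
    using ints by (intro integral_mono) auto
  also have "\<dots> = (\<integral>x. \<bar>\<phi> x - \<psi> x\<bar> \<partial>M) + (\<integral>x. \<bar>\<psi> x - conv (ker (\<eta> n)) \<psi> x\<bar> \<partial>M)"
    using ints by (intro Bochner_Integration.integral_add) auto
  also have "\<dots> < e" using le n by simp
  finally have f: "(\<integral>x. \<bar>\<phi> x - conv (ker (\<eta> n)) \<psi> x\<bar> \<partial>M) < e" .
  obtain B' where "\<forall>x. norm ((\<chi> i. - conv (kerg (\<eta> n) (axis i 1)) \<psi> x) :: real^'m) \<le> B'"
    using conv_kerg_bounded[OF \<eta> m1(1) b1] by blast
  with f cb conv_ker_C1[OF \<eta> l] show ?thesis by blast
qed

text \<open>The continuous approximation is cut off between the radii \<open>R\<close> and
  \<open>R + 1\<close>, where \<open>g\<close> vanishes, so the error does not grow. Mollification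
  at scale at most \<open>1\<close> widens the support once more; hence
  \<open>R + 2\<close>.\<close>

lemma L1_approx_C1_support:
  fixes M :: "(real^'m) measure"
  assumes fin: "finite_measure M" and sets: "sets M = sets borel"
    and g: "integrable M g" and z: "\<And>x. norm x \<ge> R \<Longrightarrow> g x = 0" and e: "e > 0"
  shows "\<exists>\<xi> \<xi>'. C1 \<xi> \<xi>' \<and> (\<forall>x. norm x \<ge> R + 2 \<longrightarrow> \<xi> x = 0 \<and> \<xi>' x = 0) \<and> (\<integral>x. \<bar>g x - \<xi> x\<bar> \<partial>M) < e"
proof -
  interpret finite_measure M by (rule fin)
  have mM: "f \<in> borel_measurable M" if "f \<in> borel_measurable borel" for f :: "real^'m \<Rightarrow> real"
    using that measurable_cong_sets[OF sets refl] by blast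
  have ib: "integrable M f" if "f \<in> borel_measurable borel" "\<And>x. \<bar>f x\<bar> \<le> B" for f :: "real^'m \<Rightarrow> real" and B
  proof (rule integrable_const_bound[where B=B])
    show "AE x in M. norm (f x) \<le> B" using that(2) by (intro AE_I2) simp
    show "f \<in> borel_measurable M" by (rule mM[OF that(1)])
  qed
  from L1_approx_continuous[OF fin sets g, of "e/2"] e
  obtain \<psi>0 where \<psi>0: "continuous_on UNIV \<psi>0" "bounded (range \<psi>0)" "(\<integral>x. \<bar>g x - \<psi>0 x\<bar> \<partial>M) < e/2" by auto
  obtain B0 where B0: "\<And>x. \<bar>\<psi>0 x\<bar> \<le> B0" using \<psi>0(2) by (auto simp: bounded_iff)
  define \<zeta> where "\<zeta> x = max 0 (min 1 (R + 1 - norm x))" for x :: "real^'m"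
  have \<zeta>: "0 \<le> \<zeta> x" "\<zeta> x \<le> 1" "norm x \<le> R \<Longrightarrow> \<zeta> x = 1" "norm x \<ge> R + 1 \<Longrightarrow> \<zeta> x = 0" for x
    by (auto simp: \<zeta>_def)
  define \<psi> where "\<psi> x = \<psi>0 x * \<zeta> x" for x
  have c: "continuous_on UNIV \<psi>" unfolding \<psi>_def \<zeta>_def by (intro continuous_intros \<psi>0)
  have b1: "\<bar>\<psi> x\<bar> \<le> B0" for x 
    using B0[of x] \<zeta>(1,2)[of x] by (auto simp: \<psi>_def abs_mult intro: order_trans[OF mult_left_le])
  have m1: "\<psi> \<in> borel_measurable borel" "\<psi>0 \<in> borel_measurable borel" 
    using borel_measurable_continuous_onI[OF c] borel_measurable_continuous_onI[OF \<psi>0(1)] by simp_all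
  have le: "(\<integral>x. \<bar>g x - \<psi> x\<bar> \<partial>M) < e/2"
  proof (rule le_less_trans[OF integral_mono \<psi>0(3)])
    show "integrable M (\<lambda>x. \<bar>g x - \<psi> x\<bar>)" "integrable M (\<lambda>x. \<bar>g x - \<psi>0 x\<bar>)"
      using g ib[OF m1(1) b1] ib[OF m1(2) B0] by auto
    show "\<bar>g x - \<psi> x\<bar> \<le> \<bar>g x - \<psi>0 x\<bar>" for x
    proof (cases "norm x \<ge> R")
      case True
      then show ?thesis using z[OF True] \<zeta>(1,2)[of x] by (auto simp: \<psi>_def abs_mult intro: mult_left_le)
    next
      case False then show ?thesis using \<zeta>(3)[of x] by (simp add: \<psi>_def)
    qed
  qed
  define \<eta> where "\<eta> n = 1 / (real n + 1)" for n :: nat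
  have \<eta>: "0 < \<eta> n" "\<eta> n \<le> 1" for n by (auto simp: \<eta>_def)
  have \<eta>0: "\<eta> \<longlonglongrightarrow> 0" unfolding \<eta>_def using LIMSEQ_inverse_real_of_nat by (simp add: inverse_eq_divide add.commute)
  have l: "locint \<psi>" by (rule locint_bounded[OF m1(1) b1])
  have cm: "conv (ker (\<eta> n)) \<psi> \<in> borel_measurable borel" for n
    by (rule borel_measurable_continuous_onI[OF conv_ker_continuous[OF \<eta>(1) l]])
  note cb = conv_ker_bounded[OF \<eta>(1) m1(1) b1]
  have "(\<lambda>n. \<integral>x. \<bar>\<psi> x - conv (ker (\<eta> n)) \<psi> x\<bar> \<partial>M) \<longlonglongrightarrow> (\<integral>x. 0 \<partial>M)"
  proof (rule integral_dominated_convergence[where w="\<lambda>_. 2 * B0"])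
    show "AE x in M. (\<lambda>n. \<bar>\<psi> x - conv (ker (\<eta> n)) \<psi> x\<bar>) \<longlonglongrightarrow> 0"
    proof (intro AE_I2)
      fix x
      have "(\<lambda>n. \<psi> x - conv (ker (\<eta> n)) \<psi> x) \<longlonglongrightarrow> \<psi> x - \<psi> x"
        by (intro tendsto_intros conv_ker_tendsto[OF c b1 \<eta>(1) \<eta>0])
      then show "(\<lambda>n. \<bar>\<psi> x - conv (ker (\<eta> n)) \<psi> x\<bar>) \<longlonglongrightarrow> 0" by (intro tendsto_rabs_zero) simp
    qed
    show "AE x in M. norm \<bar>\<psi> x - conv (ker (\<eta> n)) \<psi> x\<bar> \<le> 2 * B0" for n
    proof (intro AE_I2)
      fix x show "norm \<bar>\<psi> x - conv (ker (\<eta> n)) \<psi> x\<bar> \<le> 2 * B0"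
        using b1[of x] cb[of n x] abs_triangle_ineq4[of "\<psi> x" "conv (ker (\<eta> n)) \<psi> x"] by simp
    qed
    show "(\<lambda>x. \<bar>\<psi> x - conv (ker (\<eta> n)) \<psi> x\<bar>) \<in> borel_measurable M" for n
      by (intro borel_measurable_abs borel_measurable_diff mM m1 cm)
  qed simp_all
  then have "eventually (\<lambda>n. (\<integral>x. \<bar>\<psi> x - conv (ker (\<eta> n)) \<psi> x\<bar> \<partial>M) < e/2) sequentially"
    using e by (intro order_tendstoD) auto
  then obtain n where n: "(\<integral>x. \<bar>\<psi> x - conv (ker (\<eta> n)) \<psi> x\<bar> \<partial>M) < e/2" by (auto simp: eventually_sequentially)
  note ints = g ib[OF m1(1) b1] ib[OF cm cb]
  have "(\<integral>x. \<bar>g x - conv (ker (\<eta> n)) \<psi> x\<bar> \<partial>M) \<le> (\<integral>x. \<bar>g x - \<psi> x\<bar> + \<bar>\<psi> x - conv (ker (\<eta> n)) \<psi> x\<bar> \<partial>M)"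
    using ints by (intro integral_mono) auto
  also have "\<dots> = (\<integral>x. \<bar>g x - \<psi> x\<bar> \<partial>M) + (\<integral>x. \<bar>\<psi> x - conv (ker (\<eta> n)) \<psi> x\<bar> \<partial>M)"
    using ints by (intro Bochner_Integration.integral_add) auto
  also have "\<dots> < e" using le n by simp
  finally have f: "(\<integral>x. \<bar>g x - conv (ker (\<eta> n)) \<psi> x\<bar> \<partial>M) < e" .
  have supp: "conv (ker (\<eta> n)) \<psi> x = 0 \<and> (\<chi> i. - conv (kerg (\<eta> n) (axis i 1)) \<psi> x) = (0 :: real^'m)" if x: "norm x \<ge> R + 2" for x
  proof -
    have *: "ker (\<eta> n) (w - x) * \<psi> w = 0 \<and> kerg (\<eta> n) v (w - x) * \<psi> w = 0" for w v
    proof (cases "norm (w - x) \<ge> \<eta> n")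
      case True then show ?thesis by (simp add: ker_supp[OF \<eta>(1)])
    next
      case False
      then have "norm w \<ge> R + 1" using x \<eta>(2)[of n] norm_triangle_ineq2[of x w] by (simp add: norm_minus_commute)
      then show ?thesis using \<zeta>(4) by (simp add: \<psi>_def)
    qed
    have "conv (ker (\<eta> n)) \<psi> x = 0" "conv (kerg (\<eta> n) v) \<psi> x = 0" for v
      unfolding conv_def by (simp_all only: * Bochner_Integration.integral_zero)
    then show ?thesis by (simp add: vec_eq_iff)
  qed
  show ?thesis
    using conv_ker_C1[OF \<eta>(1) l, of n] supp f by (intro exI[of _ "conv (ker (\<eta> n)) \<psi>"]) auto
qed

text \<open>Since \<open>w\<close> vanishes where the determinant does, \<open>w\<close> is a
  density with respect to \<open>\<bar>det (G x)\<bar> dx\<close>, which is finite on balls.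
  Approximating that density by a smooth \<open>\<xi>\<close> of bounded support reduces the claim
  to weights \<open>\<xi> * det (G x)\<close>, for which smoothing the test function is harmless by
  \<open>smoothing_bound\<close>.\<close>

theorem sobolev_variation_convergence:
  fixes Fn :: "nat \<Rightarrow> real^'m \<Rightarrow> real^'m" and Gn :: "nat \<Rightarrow> real^'m \<Rightarrow> real^'m^'m"
  assumes Sn: "\<And>n. sobolev_map (Fn n) (Gn n)" and S: "sobolev_map F G"
    and limF: "AE x in lborel. (\<lambda>n. Fn n x) \<longlonglongrightarrow> F x"
    and limG: "AE x in lborel. \<forall>j i. (\<lambda>n. Gn n x $ j $ i) \<longlonglongrightarrow> G x $ j $ i"
    and H: "locint H" and dom: "AE x in lborel. \<forall>n j i. \<bar>Gn n x $ j $ i\<bar> ^ CARD('m) \<le> H x"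
    and \<phi>: "\<And>n. C1 (\<phi> n) (g n)" "\<And>n x. \<bar>\<phi> n x\<bar> \<le> 1" "\<And>n x. norm (g n x) \<le> B n"
    and w: "integrable lborel w" "\<And>x. norm x \<ge> R \<Longrightarrow> w x = 0" "\<And>x. det (G x) = 0 \<Longrightarrow> w x = 0"
  shows "(\<lambda>n. \<integral>x. w x * (\<phi> n (Fn n x) - \<phi> n (F x)) \<partial>lborel) \<longlonglongrightarrow> 0"
proof (rule LIMSEQ_I)
  fix e :: real assume e: "e > 0"
  note SD = sobolev_mapD[OF S]
  note Gm = SD(2)[THEN locint_measurable]
  note Gnm = sobolev_mapD(2)[OF Sn, THEN locint_measurable]
  note [measurable] = Gm det_measurable[OF Gm] sobolev_map_measurable[OF S]
    Gnm det_measurable[OF Gnm] sobolev_map_measurable[OF Sn] C1_measurable(1)[OF \<phi>(1)] borel_measurable_integrable[OF w(1)]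
  note detl = locint_det[OF Gm SD(3)]
  define \<nu> where "\<nu> = density lborel (\<lambda>x. ennreal (indicator (ball 0 (R + 2)) x * \<bar>det (G x)\<bar>))"
  have \<nu>_int: "integrable \<nu> f \<longleftrightarrow> integrable lborel (\<lambda>x. indicator (ball 0 (R + 2)) x * \<bar>det (G x)\<bar> * f x)"
    if "f \<in> borel_measurable borel" for f :: "real^'m \<Rightarrow> real"
    unfolding \<nu>_def by (subst integrable_density) (use that in auto)
  have \<nu>_integral: "(\<integral>x. f x \<partial>\<nu>) = (\<integral>x. indicator (ball 0 (R + 2)) x * \<bar>det (G x)\<bar> * f x \<partial>lborel)"
    if "f \<in> borel_measurable borel" for f :: "real^'m \<Rightarrow> real"
    unfolding \<nu>_def by (subst integral_density) (use that in auto)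
  have sets\<nu>: "sets \<nu> = sets borel" by (simp add: \<nu>_def)
  have fin: "finite_measure \<nu>"
  proof (rule finite_measureI)
    have "integrable lborel (\<lambda>x. indicator (ball 0 (R + 2)) x * \<bar>det (G x)\<bar>)"
      using integrable_abs[OF locintD[OF detl, of "R + 2"]] by (simp add: abs_mult)
    then have "(\<integral>\<^sup>+x. ennreal (indicator (ball 0 (R + 2)) x * \<bar>det (G x)\<bar>) \<partial>lborel) < \<infinity>"
      by (subst nn_integral_eq_integral) auto
    then show "emeasure \<nu> (space \<nu>) \<noteq> \<infinity>" by (simp add: \<nu>_def emeasure_density)
  qed
  \<comment> \<open>Division by zero yields \<open>0\<close> exactly where \<open>w\<close> vanishes
    as well, so \<open>det (G x) * g0 x = w x\<close> holds everywhere.\<close>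
  define g0 where "g0 x = w x / det (G x)" for x
  have g0m: "g0 \<in> borel_measurable borel" unfolding g0_def by measurable
  have wR: "w x = 0" if "x \<notin> ball 0 (R + 2)" for x using w(2)[of x] that by simp
  have "integrable \<nu> g0"
  proof (subst \<nu>_int[OF g0m], rule Bochner_Integration.integrable_bound[OF w(1)])
    show "AE x in lborel. norm (indicator (ball 0 (R + 2)) x * \<bar>det (G x)\<bar> * g0 x) \<le> norm (w x)"
      by (intro AE_I2) (auto simp: g0_def indicator_def abs_mult)
  qed (use g0m in measurable)
  from L1_approx_C1_support[OF fin sets\<nu> this, of R "e/8"] w(2) e
  obtain \<xi> \<xi>' where \<xi>: "C1 \<xi> \<xi>'" "\<And>x. norm x \<ge> R + 2 \<Longrightarrow> \<xi> x = 0" "\<And>x. norm x \<ge> R + 2 \<Longrightarrow> \<xi>' x = 0" 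
    and approx: "(\<integral>x. \<bar>g0 x - \<xi> x\<bar> \<partial>\<nu>) < e/8" by (auto simp: g0_def)
  note [measurable] = C1_measurable[OF \<xi>(1)]
  define D where "D x = \<xi> x * det (G x)" for x
  define Dn where "Dn n x = \<xi> x * det (Gn n x)" for n x
  have [measurable]: "D \<in> borel_measurable borel" "Dn n \<in> borel_measurable borel" for n unfolding D_def Dn_def by measurable
  have Di: "integrable lborel D" unfolding D_def[abs_def]
    by (rule locint_mult_bounded_support[OF C1_continuous[OF \<xi>(1)] \<xi>(2) detl])
  have Dni: "integrable lborel (Dn n)" for n unfolding Dn_def[abs_def]
    by (rule locint_mult_bounded_support[OF C1_continuous[OF \<xi>(1)] \<xi>(2) locint_det[OF Gnm sobolev_mapD(3)[OF Sn]]])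
  have wD: "(\<integral>x. \<bar>w x - D x\<bar> \<partial>lborel) < e/8"
  proof -
    have "(\<integral>x. \<bar>g0 x - \<xi> x\<bar> \<partial>\<nu>) = (\<integral>x. indicator (ball 0 (R + 2)) x * \<bar>det (G x)\<bar> * \<bar>g0 x - \<xi> x\<bar> \<partial>lborel)"
      by (rule \<nu>_integral) (use g0m in measurable)
    also have "\<dots> = (\<integral>x. \<bar>w x - D x\<bar> \<partial>lborel)"
    proof (rule Bochner_Integration.integral_cong[OF refl])
      fix x
      show "indicator (ball 0 (R + 2)) x * \<bar>det (G x)\<bar> * \<bar>g0 x - \<xi> x\<bar> = \<bar>w x - D x\<bar>"
      proof (cases "x \<in> ball 0 (R + 2)")
        case True
        then have "indicator (ball 0 (R + 2)) x * \<bar>det (G x)\<bar> * \<bar>g0 x - \<xi> x\<bar> = \<bar>det (G x) * (g0 x - \<xi> x)\<bar>" by (simp add: abs_mult)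
        also have "det (G x) * (g0 x - \<xi> x) = w x - D x" using w(3)[of x] by (cases "det (G x) = 0") (auto simp: g0_def D_def field_simps)
        finally show ?thesis .
      next
        case False then show ?thesis using wR[of x] \<xi>(2)[of x] by (simp add: D_def)
      qed
    qed
    finally show ?thesis using approx by simp
  qed
  obtain C0 where C0: "C0 \<ge> 0" "\<And>x. \<bar>\<xi> x\<bar> \<le> C0"
    using integrable_continuous_bounded_support(1)[OF C1_continuous[OF \<xi>(1)] \<xi>(2)] by auto
  have \<xi>'c: "continuous_on UNIV (\<lambda>x. norm (\<xi>' x))" using \<xi>(1) by (auto simp: C1_def intro!: continuous_intros)
  obtain C where C: "C \<ge> 0" "\<And>x. norm (\<xi>' x) \<le> C"
    using integrable_continuous_bounded_support(1)[OF \<xi>'c, of "R + 2"] \<xi>(3) by auto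
  have lim1: "(\<lambda>n. \<integral>x. \<bar>Dn n x - D x\<bar> \<partial>lborel) \<longlonglongrightarrow> 0"
    unfolding Dn_def D_def
  proof (rule det_L1_tendsto(1)[where R="R+2" and H=H and c=C0])
    show "AE x in lborel. x \<in> ball 0 (R + 2) \<longrightarrow> (\<forall>j i. (\<lambda>n. Gn n x $ j $ i) \<longlonglongrightarrow> G x $ j $ i)" using limG by auto
    show "AE x in lborel. x \<in> ball 0 (R + 2) \<longrightarrow> (\<forall>n j i. \<bar>Gn n x $ j $ i\<bar> ^ CARD('m) \<le> H x)" using dom by eventually_elim auto
    show "\<bar>\<xi> x\<bar> \<le> C0 * indicator (ball 0 (R + 2)) x" for x using C0 \<xi>(2)[of x] by (auto simp: indicator_def)
  qed (use locintD[OF H] in auto)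
  have [measurable]: "(\<lambda>y. \<xi>' y $ i) \<in> borel_measurable borel" for i
    using \<xi>(1) by (intro borel_measurable_continuous_onI continuous_intros) (simp add: C1_def)
  \<comment> \<open>The smoothing error must be uniform in \<open>n\<close>. The replaced row is
    common to all \<open>n\<close> and the other rows converge with domination, so the masses
    converge and are eventually below \<open>Cm\<close>.\<close>
  have cof_lim: "(\<lambda>n. cof_mass \<xi>' (Gn n)) \<longlonglongrightarrow> cof_mass \<xi>' G"
    unfolding cof_mass_def
  proof (intro tendsto_sum)
    fix k
    define A where "A n x = ((\<chi> j. if j = k then \<xi>' x else Gn n x $ j) :: real^'m^'m)" for n x
    define A0 where "A0 x = ((\<chi> j. if j = k then \<xi>' x else G x $ j) :: real^'m^'m)" for x
    have Am: "(\<lambda>x. A n x $ j $ i) \<in> borel_measurable borel" "(\<lambda>x. A0 x $ j $ i) \<in> borel_measurable borel" for n j i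
      by (cases "j = k"; simp add: A_def A0_def)+
    have limA: "AE x in lborel. x \<in> ball 0 (R+2) \<longrightarrow> (\<forall>j i. (\<lambda>n. A n x $ j $ i) \<longlonglongrightarrow> A0 x $ j $ i)"
      using limG by eventually_elim (auto simp: A_def A0_def)
    have domA: "AE x in lborel. x \<in> ball 0 (R+2) \<longrightarrow> (\<forall>n j i. \<bar>A n x $ j $ i\<bar> ^ CARD('m) \<le> \<bar>H x\<bar> + C ^ CARD('m))"
      using dom
    proof eventually_elim
      case (elim x)
      have 1: "\<bar>\<xi>' x $ i\<bar> ^ CARD('m) \<le> C ^ CARD('m)" for i
        using component_le_norm_cart[of "\<xi>' x" i] C(2)[of x] by (intro power_mono) auto
      have 2: "\<bar>Gn n x $ j $ i\<bar> ^ CARD('m) \<le> \<bar>H x\<bar>" for n j i using elim abs_ge_self[of "H x"] order_trans by blast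
      have 3: "0 \<le> C ^ CARD('m)" using C(1) by simp
      have "\<bar>A n x $ j $ i\<bar> ^ CARD('m) \<le> \<bar>H x\<bar> + C ^ CARD('m)" for n j i
        using 1[of i] 2[of n j i] 3 abs_ge_zero[of "H x"] by (cases "j = k") (simp_all add: A_def)
      then show ?case by blast
    qed
    have H2: "integrable lborel (\<lambda>x. indicator (ball 0 (R+2)) x * (\<bar>H x\<bar> + C ^ CARD('m)))"
    proof -
      have "integrable lborel (\<lambda>x. \<bar>indicator (ball 0 (R+2)) x * H x\<bar> + C ^ CARD('m) * indicator (ball (0::real^'m) (R+2)) x)"
        by (intro Bochner_Integration.integrable_add integrable_abs locintD H integrable_mult_right integrable_real_indicator)
           (auto simp: emeasure_lborel_ball_finite[simplified])
      then show ?thesis by (simp add: abs_mult algebra_simps)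
    qed
    note dR = det_L1_tendsto[where A=A and B=A0 and s="\<lambda>n x. indicator (ball 0 (R+2)) x" and so="\<lambda>x. indicator (ball 0 (R+2)) x" and R="R+2" and c=1,
        OF Am _ _ limA domA H2]
    have out: "indicator (ball 0 (R+2)) x * det (A n x) = det (A n x)" "indicator (ball 0 (R+2)) x * det (A0 x) = det (A0 x)" for x n
    proof -
      have "det (A n x) = 0 \<and> det (A0 x) = 0" if "x \<notin> ball 0 (R+2)"
      proof -
        have "\<xi>' x = 0" using that \<xi>(3)[of x] by simp
        then have "row k (A n x) = 0" "row k (A0 x) = 0" by (simp_all add: A_def A0_def row_def vec_eq_iff)
        then show ?thesis using det_zero_row by blast
      qed
      then show "indicator (ball 0 (R+2)) x * det (A n x) = det (A n x)" "indicator (ball 0 (R+2)) x * det (A0 x) = det (A0 x)"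
        by (auto simp: indicator_def)
    qed
    have i: "(\<lambda>n. \<integral>x. \<bar>det (A n x) - det (A0 x)\<bar> \<partial>lborel) \<longlonglongrightarrow> 0" "integrable lborel (\<lambda>x. det (A n x))" "integrable lborel (\<lambda>x. det (A0 x))" for n
      using dR unfolding out by auto
    have "(\<lambda>n. \<integral>x. \<bar>\<bar>det (A n x)\<bar> - \<bar>det (A0 x)\<bar>\<bar> \<partial>lborel) \<longlonglongrightarrow> 0"
    proof (rule tendsto_sandwich[OF _ _ tendsto_const i(1)]; intro always_eventually allI)
      fix n
      show "(\<integral>x. \<bar>\<bar>det (A n x)\<bar> - \<bar>det (A0 x)\<bar>\<bar> \<partial>lborel) \<le> (\<integral>x. \<bar>det (A n x) - det (A0 x)\<bar> \<partial>lborel)"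
        using i by (intro integral_mono) auto
    qed simp
    then show "(\<lambda>n. \<integral>x. \<bar>det ((\<chi> j. if j = k then \<xi>' x else Gn n x $ j) :: real^'m^'m)\<bar> \<partial>lborel) \<longlonglongrightarrow> (\<integral>x. \<bar>det ((\<chi> j. if j = k then \<xi>' x else G x $ j) :: real^'m^'m)\<bar> \<partial>lborel)"
      unfolding A_def[symmetric] A0_def[symmetric] using i by (intro L1_tendsto_integral) auto
  qed
  define Cm where "Cm = cof_mass \<xi>' G + 1"
  have Cm: "Cm > 0" by (auto simp: Cm_def cof_mass_def intro!: add_nonneg_pos sum_nonneg)
  \<comment> \<open>With this scale the smoothing error is at most \<open>e / 8\<close>, both for
    \<open>G\<close> and, once the masses are below \<open>Cm\<close>, for \<open>Gn n\<close>. The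
    scale is fixed before \<open>n\<close> tends to infinity.\<close>
  define \<delta> where "\<delta> = e / (8 * Cm)"
  have \<delta>: "\<delta> > 0" using e Cm by (simp add: \<delta>_def)
  have \<delta>Cm: "\<delta> * Cm = e/8" using Cm by (simp add: \<delta>_def)
  have evC: "eventually (\<lambda>n. cof_mass \<xi>' (Gn n) < Cm) sequentially"
    using cof_lim by (rule order_tendstoD) (simp add: Cm_def)
  define \<Phi> where "\<Phi> n = conv (ker \<delta>) (\<phi> n)" for n
  have \<phi>m: "\<phi> n \<in> borel_measurable borel" for n by measurable
  have \<phi>l: "locint (\<phi> n)" for n by (rule locint_bounded[OF \<phi>m \<phi>(2)])
  have [measurable]: "\<Phi> n \<in> borel_measurable borel" for n unfolding \<Phi>_def
    by (rule borel_measurable_continuous_onI[OF conv_ker_continuous[OF \<delta> \<phi>l]])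
  have \<Phi>b: "\<bar>\<Phi> n z\<bar> \<le> 1" for n z unfolding \<Phi>_def by (rule conv_ker_bounded[OF \<delta> \<phi>m \<phi>(2)])
  have lim2: "(\<lambda>n. \<integral>x. D x * (\<Phi> n (Fn n x) - \<Phi> n (F x)) \<partial>lborel) \<longlonglongrightarrow> 0"
  proof -
    have "(\<lambda>n. \<integral>x. D x * (\<Phi> n (Fn n x) - \<Phi> n (F x)) \<partial>lborel) \<longlonglongrightarrow> (\<integral>x. D x * 0 \<partial>(lborel :: (real^'m) measure))"
    proof (rule integral_dominated_convergence[where w="\<lambda>x. \<bar>D x\<bar> * 2"])
      show "AE x in lborel. (\<lambda>n. D x * (\<Phi> n (Fn n x) - \<Phi> n (F x))) \<longlonglongrightarrow> D x * 0"
        using limF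
      proof eventually_elim
        case (elim x)
        show ?case unfolding \<Phi>_def by (intro tendsto_intros conv_ker_equicontinuous[OF \<delta> \<phi>m \<phi>(2) elim])
      qed
      show "AE x in lborel. norm (D x * (\<Phi> n (Fn n x) - \<Phi> n (F x))) \<le> \<bar>D x\<bar> * 2" for n
      proof (intro AE_I2)
        fix x
        have "\<bar>\<Phi> n (Fn n x) - \<Phi> n (F x)\<bar> \<le> 2" using \<Phi>b[of n "Fn n x"] \<Phi>b[of n "F x"] by linarith
        then show "norm (D x * (\<Phi> n (Fn n x) - \<Phi> n (F x))) \<le> \<bar>D x\<bar> * 2" by (simp add: abs_mult mult_left_mono)
      qed
    qed (use Di in auto)
    then show ?thesis by simp
  qed
  have ev1: "eventually (\<lambda>n. (\<integral>x. \<bar>Dn n x - D x\<bar> \<partial>lborel) < e/8) sequentially" using lim1 e by (intro order_tendstoD) auto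
  have ev2: "eventually (\<lambda>n. \<bar>\<integral>x. D x * (\<Phi> n (Fn n x) - \<Phi> n (F x)) \<partial>lborel\<bar> < e/8) sequentially"
    using tendsto_rabs_zero[OF lim2] e by (intro order_tendstoD) auto
  have int: "integrable lborel (\<lambda>x. d x * h x)" if d: "integrable lborel d" and [measurable]: "h \<in> borel_measurable borel" and b: "\<And>x. \<bar>h x\<bar> \<le> 1" for d h :: "real^'m \<Rightarrow> real"
  proof (rule Bochner_Integration.integrable_bound[OF d])
    show "AE x in lborel. norm (d x * h x) \<le> norm (d x)" using b by (intro AE_I2) (auto simp: abs_mult intro: mult_left_le)
  qed (use borel_measurable_integrable[OF d] in auto)
  have diff: "\<bar>(\<integral>x. d x * h x \<partial>lborel) - (\<integral>x. d' x * h x \<partial>lborel)\<bar> \<le> (\<integral>x. \<bar>d x - d' x\<bar> \<partial>lborel)"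
    if d: "integrable lborel d" "integrable lborel d'" and h: "h \<in> borel_measurable borel" and b: "\<And>x. \<bar>h x\<bar> \<le> 1" for d d' h :: "real^'m \<Rightarrow> real"
  proof -
    have "(\<integral>x. d x * h x \<partial>lborel) - (\<integral>x. d' x * h x \<partial>lborel) = (\<integral>x. (d x - d' x) * h x \<partial>lborel)"
      using int[OF d(1) h b] int[OF d(2) h b] by (simp add: left_diff_distrib)
    also have "\<bar>\<dots>\<bar> \<le> (\<integral>x. \<bar>d x - d' x\<bar> \<partial>lborel)"
    proof (rule order_trans[OF integral_abs_bound], rule integral_mono_AE')
      show "AE x in lborel. \<bar>(d x - d' x) * h x\<bar> \<le> \<bar>d x - d' x\<bar>"
        using b by (intro AE_I2) (auto simp: abs_mult intro: mult_left_le)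
    qed (use d in auto)
    finally show ?thesis .
  qed
  \<comment> \<open>Seven comparisons, each within \<open>e / 8\<close>, lead from \<open>w\<close>
    and \<open>\<phi> n (Fn n x)\<close> to \<open>w\<close> and \<open>\<phi> n (F x)\<close>: the
    weight passes to \<open>D\<close>, then to \<open>Dn n\<close>, the test function is smoothed,
    the weight returns to \<open>D\<close>, \<open>Fn n\<close> is replaced by \<open>F\<close>, and
    then smoothing and weight are undone.\<close>
  have "eventually (\<lambda>n. \<bar>\<integral>x. w x * (\<phi> n (Fn n x) - \<phi> n (F x)) \<partial>lborel\<bar> < e) sequentially"
    using evC ev1 ev2
  proof eventually_elim
    case (elim n)
    let ?I = "\<lambda>d h. \<integral>x. d x * h x \<partial>(lborel :: (real^'m) measure)"
    have m1: "(\<lambda>x. \<phi> n (Fn n x)) \<in> borel_measurable borel" "(\<lambda>x. \<phi> n (F x)) \<in> borel_measurable borel"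
      "(\<lambda>x. \<Phi> n (Fn n x)) \<in> borel_measurable borel" "(\<lambda>x. \<Phi> n (F x)) \<in> borel_measurable borel" by measurable
    have "(\<integral>x. w x * (\<phi> n (Fn n x) - \<phi> n (F x)) \<partial>lborel) = ?I w (\<lambda>x. \<phi> n (Fn n x)) - ?I w (\<lambda>x. \<phi> n (F x))"
      using int[OF w(1) m1(1) \<phi>(2)] int[OF w(1) m1(2) \<phi>(2)] by (simp add: right_diff_distrib)
    moreover have "\<bar>?I w (\<lambda>x. \<phi> n (Fn n x)) - ?I D (\<lambda>x. \<phi> n (Fn n x))\<bar> < e/8"
      using diff[OF w(1) Di m1(1) \<phi>(2)] wD by linarith
    moreover have "\<bar>?I w (\<lambda>x. \<phi> n (F x)) - ?I D (\<lambda>x. \<phi> n (F x))\<bar> < e/8"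
      using diff[OF w(1) Di m1(2) \<phi>(2)] wD by linarith
    moreover have "\<bar>?I (Dn n) (\<lambda>x. \<phi> n (Fn n x)) - ?I D (\<lambda>x. \<phi> n (Fn n x))\<bar> < e/8"
      using diff[OF Dni Di m1(1) \<phi>(2), of n] elim by linarith
    moreover have "\<bar>?I (Dn n) (\<lambda>x. \<Phi> n (Fn n x)) - ?I D (\<lambda>x. \<Phi> n (Fn n x))\<bar> < e/8"
      using diff[OF Dni Di m1(3) \<Phi>b, of n] elim by linarith
    moreover have "\<bar>?I (Dn n) (\<lambda>x. \<Phi> n (Fn n x)) - ?I (Dn n) (\<lambda>x. \<phi> n (Fn n x))\<bar> \<le> e/8"
    proof -
      have "\<bar>?I (Dn n) (\<lambda>x. \<Phi> n (Fn n x)) - ?I (Dn n) (\<lambda>x. \<phi> n (Fn n x))\<bar> \<le> \<delta> * cof_mass \<xi>' (Gn n)"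
        unfolding Dn_def \<Phi>_def by (rule smoothing_bound[OF Sn \<phi> \<xi> \<delta>])
      also have "\<dots> \<le> \<delta> * Cm" using elim \<delta> by (intro mult_left_mono) auto
      finally show ?thesis by (simp only: \<delta>Cm)
    qed
    moreover have "\<bar>?I D (\<lambda>x. \<Phi> n (F x)) - ?I D (\<lambda>x. \<phi> n (F x))\<bar> \<le> e/8"
    proof -
      have "\<bar>?I D (\<lambda>x. \<Phi> n (F x)) - ?I D (\<lambda>x. \<phi> n (F x))\<bar> \<le> \<delta> * cof_mass \<xi>' G"
        unfolding D_def \<Phi>_def by (rule smoothing_bound[OF S \<phi> \<xi> \<delta>])
      also have "\<dots> \<le> \<delta> * Cm" using \<delta> by (intro mult_left_mono) (auto simp: Cm_def)
      finally show ?thesis by (simp only: \<delta>Cm)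
    qed
    moreover have "\<bar>?I D (\<lambda>x. \<Phi> n (Fn n x)) - ?I D (\<lambda>x. \<Phi> n (F x))\<bar> < e/8"
    proof -
      have "(\<integral>x. D x * (\<Phi> n (Fn n x) - \<Phi> n (F x)) \<partial>lborel) = ?I D (\<lambda>x. \<Phi> n (Fn n x)) - ?I D (\<lambda>x. \<Phi> n (F x))"
        unfolding right_diff_distrib by (rule Bochner_Integration.integral_diff[OF int[OF Di m1(3) \<Phi>b] int[OF Di m1(4) \<Phi>b]])
      with elim(3) show ?thesis by simp
    qed
    ultimately show ?case by (simp only: abs_less_iff abs_le_iff, elim conjE, intro conjI; linarith)
  qed
  then show "\<exists>no. \<forall>n\<ge>no. norm ((\<integral>x. w x * (\<phi> n (Fn n x) - \<phi> n (F x)) \<partial>lborel) - 0) < e"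
    by (simp add: eventually_sequentially)
qed

text \<open>On a set of finite measure the elementary bound
  \<open>\<bar>t\<bar> \<le> \<delta> + c * \<bar>t\<bar> ^ m\<close> with
  \<open>c = 1 / \<delta> ^ (m - 1)\<close>, checked separately below and above the threshold
  \<open>\<delta>\<close>, replaces Hoelder's inequality.\<close>

lemma power_tendsto_L1:
  fixes d :: "nat \<Rightarrow> 'a \<Rightarrow> real"
  assumes [measurable]: "\<And>k. d k \<in> borel_measurable M" "S \<in> sets M" and fin: "emeasure M S < \<infinity>" and m: "m \<ge> 1"
    and lim: "(\<lambda>k. \<integral>\<^sup>+x. indicator S x * ennreal (\<bar>d k x\<bar> ^ m) \<partial>M) \<longlonglongrightarrow> 0"
  shows "(\<lambda>k. \<integral>\<^sup>+x. indicator S x * ennreal \<bar>d k x\<bar> \<partial>M) \<longlonglongrightarrow> 0"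
proof (rule ennreal_tendsto_0I)
  fix e :: real assume e: "e > 0"
  define V where "V = measure M S"
  have V: "V \<ge> 0" "emeasure M S = ennreal V" using fin by (auto simp: V_def emeasure_eq_ennreal_measure)
  define \<delta> where "\<delta> = e / (2 * (V + 1))"
  have \<delta>: "\<delta> > 0" using e V by (simp add: \<delta>_def add_nonneg_pos)
  have \<delta>V: "\<delta> * V \<le> e / 2" using e V by (simp add: \<delta>_def field_simps add_nonneg_pos)
  define c where "c = 1 / \<delta> ^ (m - 1)"
  have c: "c > 0" using \<delta> by (simp add: c_def)
  have le: "\<bar>t\<bar> \<le> \<delta> + c * \<bar>t\<bar> ^ m" for t :: real
  proof (cases "\<bar>t\<bar> \<le> \<delta>")
    case True then show ?thesis using c by (simp add: add_increasing2)
  next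
    case False
    then have "\<delta> ^ (m - 1) \<le> \<bar>t\<bar> ^ (m - 1)" using \<delta> by (intro power_mono) auto
    then have "\<bar>t\<bar> * \<delta> ^ (m - 1) \<le> \<bar>t\<bar> * \<bar>t\<bar> ^ (m - 1)" by (intro mult_left_mono) auto
    also have "\<bar>t\<bar> * \<bar>t\<bar> ^ (m - 1) = \<bar>t\<bar> ^ m" using m by (cases m) auto
    finally have "\<bar>t\<bar> \<le> c * \<bar>t\<bar> ^ m" using \<delta> by (simp add: c_def field_simps)
    then show ?thesis using \<delta> by simp
  qed
  have "eventually (\<lambda>k. (\<integral>\<^sup>+x. indicator S x * ennreal (\<bar>d k x\<bar> ^ m) \<partial>M) < ennreal (e / (2 * c))) sequentially"
    using lim by (rule order_tendstoD) (use e c in simp)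
  then show "eventually (\<lambda>k. (\<integral>\<^sup>+x. indicator S x * ennreal \<bar>d k x\<bar> \<partial>M) \<le> ennreal e) sequentially"
  proof eventually_elim
    case (elim k)
    have "(\<integral>\<^sup>+x. indicator S x * ennreal \<bar>d k x\<bar> \<partial>M) \<le> (\<integral>\<^sup>+x. ennreal \<delta> * indicator S x + ennreal c * (indicator S x * ennreal (\<bar>d k x\<bar> ^ m)) \<partial>M)"
    proof (rule nn_integral_mono)
      fix x
      have "ennreal \<bar>d k x\<bar> \<le> ennreal (\<delta> + c * \<bar>d k x\<bar> ^ m)" by (rule ennreal_leI[OF le])
      also have "\<dots> = ennreal \<delta> + ennreal c * ennreal (\<bar>d k x\<bar> ^ m)" using \<delta> c by (simp add: ennreal_plus ennreal_mult)
      finally show "indicator S x * ennreal \<bar>d k x\<bar> \<le> ennreal \<delta> * indicator S x + ennreal c * (indicator S x * ennreal (\<bar>d k x\<bar> ^ m))"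
        by (cases "x \<in> S") auto
    qed
    also have "\<dots> = ennreal \<delta> * ennreal V + ennreal c * (\<integral>\<^sup>+x. indicator S x * ennreal (\<bar>d k x\<bar> ^ m) \<partial>M)"
      by (simp add: nn_integral_add nn_integral_cmult V(2))
    also have "\<dots> \<le> ennreal (e / 2) + ennreal c * ennreal (e / (2 * c))"
      using elim \<delta>V \<delta> V by (intro add_mono mult_left_mono) (auto simp flip: ennreal_mult intro!: ennreal_leI)
    also have "\<dots> = ennreal e" using c e by (simp flip: ennreal_mult ennreal_plus)
    finally show ?case .
  qed
qed

section \<open>Quasi-invariant actions\<close>

text \<open>What the analysis needs from the grid: \<open>qi\<close> says that
  \<open>\<theta> s\<close> carries the measure with density \<open>\<rho> s\<close> to
  \<open>P\<close>. The positive lower bound in \<open>\<rho>_lower\<close>, for fixed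
  \<open>\<omega>\<close> and bounded \<open>s\<close>, lets orbit integrals weighted by
  \<open>\<rho>\<close> control unweighted ones.\<close>

locale qi_flow = prob_space P for P :: "'w measure" +
  fixes \<theta> :: "real^'m \<Rightarrow> 'w \<Rightarrow> 'w" and \<rho> :: "real^'m \<Rightarrow> 'w \<Rightarrow> real"
  assumes \<theta>_meas: "(\<lambda>(s, \<omega>). \<theta> s \<omega>) \<in> borel \<Otimes>\<^sub>M P \<rightarrow>\<^sub>M P"
    and \<theta>_add: "\<omega> \<in> space P \<Longrightarrow> \<theta> (s + t) \<omega> = \<theta> s (\<theta> t \<omega>)"
    and \<rho>_meas: "(\<lambda>(s, \<omega>). \<rho> s \<omega>) \<in> borel_measurable (borel \<Otimes>\<^sub>M P)"
    and \<rho>_lower: "\<omega> \<in> space P \<Longrightarrow> \<exists>c>0. \<forall>s. norm s \<le> R \<longrightarrow> c \<le> \<rho> s \<omega>"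
    and qi: "Z \<in> borel_measurable P \<Longrightarrow> (\<integral>\<^sup>+\<omega>. Z (\<theta> s \<omega>) * ennreal (\<rho> s \<omega>) \<partial>P) = (\<integral>\<^sup>+\<omega>. Z \<omega> \<partial>P)"
begin

sublocale L: pair_sigma_finite "lborel :: (real^'m) measure" P ..

lemma sets_lP: "sets (lborel \<Otimes>\<^sub>M P) = sets (borel \<Otimes>\<^sub>M P)"
  by (rule sets_pair_measure_cong) auto

lemma \<theta>_meas'[measurable]: "(\<lambda>(s, \<omega>). \<theta> s \<omega>) \<in> lborel \<Otimes>\<^sub>M P \<rightarrow>\<^sub>M P"
  using \<theta>_meas measurable_cong_sets[OF sets_lP refl] by blast

lemma \<rho>_meas'[measurable]: "(\<lambda>(s, \<omega>). \<rho> s \<omega>) \<in> borel_measurable (lborel \<Otimes>\<^sub>M P)"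
  using \<rho>_meas measurable_cong_sets[OF sets_lP refl] by blast

lemma \<theta>_meas1[measurable]: "\<theta> s \<in> P \<rightarrow>\<^sub>M P"
  using measurable_compose[OF measurable_Pair1' \<theta>_meas', of s] by simp

lemma \<rho>_meas1[measurable]: "\<rho> s \<in> borel_measurable P"
  using measurable_compose[OF measurable_Pair1' \<rho>_meas', of s] by simp

lemma \<theta>_meas2: "\<omega> \<in> space P \<Longrightarrow> (\<lambda>s. \<theta> s \<omega>) \<in> borel \<rightarrow>\<^sub>M P"
  using measurable_compose[OF measurable_Pair2' \<theta>_meas, of \<omega>] by simp

lemma \<rho>_meas2: "\<omega> \<in> space P \<Longrightarrow> (\<lambda>s. \<rho> s \<omega>) \<in> borel_measurable borel"
  using measurable_compose[OF measurable_Pair2' \<rho>_meas, of \<omega>] by simp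

text \<open>Fubini, then \<open>qi\<close> at each fixed \<open>s\<close>: the inner expectation
  does not depend on \<open>s\<close>, so the volume of the ball factors out. Finiteness almost
  everywhere follows, and dividing by the lower bound of \<open>\<rho>\<close> removes the
  weight.\<close>

lemma fiber_finite_R:
  fixes Z :: "'w \<Rightarrow> ennreal"
  assumes [measurable]: "Z \<in> borel_measurable P" and fin: "(\<integral>\<^sup>+\<omega>. Z \<omega> \<partial>P) < \<infinity>"
  shows "(\<integral>\<^sup>+\<omega>. \<integral>\<^sup>+s. indicator (ball 0 R) s * (Z (\<theta> s \<omega>) * ennreal (\<rho> s \<omega>)) \<partial>lborel \<partial>P) = emeasure lborel (ball (0::real^'m) R) * (\<integral>\<^sup>+\<omega>. Z \<omega> \<partial>P)"
    "AE \<omega> in P. (\<integral>\<^sup>+s. indicator (ball 0 R) s * Z (\<theta> s \<omega>) \<partial>lborel) < \<infinity>"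
proof -
  have [measurable]: "(\<lambda>(s, \<omega>). Z (\<theta> s \<omega>)) \<in> borel_measurable (lborel \<Otimes>\<^sub>M P)"
    using measurable_compose[OF \<theta>_meas' assms(1)] by (simp add: split_beta')
  have "(\<integral>\<^sup>+\<omega>. \<integral>\<^sup>+s. indicator (ball 0 R) s * (Z (\<theta> s \<omega>) * ennreal (\<rho> s \<omega>)) \<partial>lborel \<partial>P) =
      (\<integral>\<^sup>+s. \<integral>\<^sup>+\<omega>. indicator (ball 0 R) s * (Z (\<theta> s \<omega>) * ennreal (\<rho> s \<omega>)) \<partial>P \<partial>lborel)"
    by (rule L.Fubini') measurable
  also have "\<dots> = (\<integral>\<^sup>+s. indicator (ball 0 R) s * (\<integral>\<^sup>+\<omega>. Z \<omega> \<partial>P) \<partial>(lborel :: (real^'m) measure))"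
    by (intro nn_integral_cong) (simp add: nn_integral_cmult qi)
  also have "\<dots> = emeasure lborel (ball (0::real^'m) R) * (\<integral>\<^sup>+\<omega>. Z \<omega> \<partial>P)"
    by (subst nn_integral_multc) auto
  finally show eq: "(\<integral>\<^sup>+\<omega>. \<integral>\<^sup>+s. indicator (ball 0 R) s * (Z (\<theta> s \<omega>) * ennreal (\<rho> s \<omega>)) \<partial>lborel \<partial>P) = emeasure lborel (ball (0::real^'m) R) * (\<integral>\<^sup>+\<omega>. Z \<omega> \<partial>P)" .
  have "\<dots> < \<infinity>" using fin emeasure_lborel_ball_finite[of "0::real^'m" R] by (simp add: ennreal_mult_less_top)
  then have "AE \<omega> in P. (\<integral>\<^sup>+s. indicator (ball 0 R) s * (Z (\<theta> s \<omega>) * ennreal (\<rho> s \<omega>)) \<partial>lborel) \<noteq> \<infinity>"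
    unfolding eq[symmetric] by (intro nn_integral_PInf_AE) (auto simp: less_top[symmetric])
  then show "AE \<omega> in P. (\<integral>\<^sup>+s. indicator (ball 0 R) s * Z (\<theta> s \<omega>) \<partial>lborel) < \<infinity>"
    using AE_space
  proof eventually_elim
    case (elim \<omega>)
    obtain c where c: "c > 0" "\<And>s. norm s \<le> R \<Longrightarrow> c \<le> \<rho> s \<omega>" using \<rho>_lower[OF elim(2), of R] by blast
    note [measurable] = \<theta>_meas2[OF elim(2)] \<rho>_meas2[OF elim(2)]
    have "ennreal c * (\<integral>\<^sup>+s. indicator (ball 0 R) s * Z (\<theta> s \<omega>) \<partial>lborel) = (\<integral>\<^sup>+s. ennreal c * (indicator (ball 0 R) s * Z (\<theta> s \<omega>)) \<partial>lborel)"
      by (rule nn_integral_cmult[symmetric]) measurable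
    also have "\<dots> \<le> (\<integral>\<^sup>+s. indicator (ball 0 R) s * (Z (\<theta> s \<omega>) * ennreal (\<rho> s \<omega>)) \<partial>lborel)"
    proof (rule nn_integral_mono)
      fix s :: "real^'m"
      show "ennreal c * (indicator (ball 0 R) s * Z (\<theta> s \<omega>)) \<le> indicator (ball 0 R) s * (Z (\<theta> s \<omega>) * ennreal (\<rho> s \<omega>))"
        using c(2)[of s] by (cases "s \<in> ball 0 R") (auto simp: mult.commute[of "Z _"] intro!: mult_right_mono ennreal_leI)
    qed
    also have "\<dots> < \<infinity>" using elim(1) by (simp add: less_top)
    finally show ?case using c(1) by (auto simp: ennreal_mult_less_top)
  qed
qed

lemma fiber_finite:
  fixes Z :: "'w \<Rightarrow> ennreal"
  assumes "Z \<in> borel_measurable P" "(\<integral>\<^sup>+\<omega>. Z \<omega> \<partial>P) < \<infinity>"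
  shows "AE \<omega> in P. \<forall>R. (\<integral>\<^sup>+s. indicator (ball 0 R) s * Z (\<theta> s \<omega>) \<partial>lborel) < \<infinity>"
proof -
  have "AE \<omega> in P. \<forall>n::nat. (\<integral>\<^sup>+s. indicator (ball 0 (real n)) s * Z (\<theta> s \<omega>) \<partial>lborel) < \<infinity>"
    unfolding AE_all_countable using fiber_finite_R(2)[OF assms] by blast
  then show ?thesis
  proof eventually_elim
    case (elim \<omega>)
    show ?case
    proof
      fix R :: real
      obtain n :: nat where n: "R \<le> real n" using real_arch_simple by blast
      have "(\<integral>\<^sup>+s. indicator (ball 0 R) s * Z (\<theta> s \<omega>) \<partial>lborel) \<le> (\<integral>\<^sup>+s. indicator (ball 0 (real n)) s * Z (\<theta> s \<omega>) \<partial>lborel)"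
        using n by (intro nn_integral_mono mult_right_mono) (auto simp: indicator_def)
      also have "\<dots> < \<infinity>" using elim by blast
      finally show "(\<integral>\<^sup>+s. indicator (ball 0 R) s * Z (\<theta> s \<omega>) \<partial>lborel) < \<infinity>" .
    qed
  qed
qed

text \<open>The \<open>L\<^sub>p\<close> derivative with \<open>p\<close> the dimension, written
  through integrals of powers in \<open>ennreal\<close> so that Fubini applies directly, and along
  one sequence of steps as in \<open>wderiv\<close>.\<close>

definition flow_deriv :: "'m \<Rightarrow> ('w \<Rightarrow> real) \<Rightarrow> ('w \<Rightarrow> real) \<Rightarrow> bool" where
  "flow_deriv i f g \<longleftrightarrow> f \<in> borel_measurable P \<and> g \<in> borel_measurable P \<and>
     (\<integral>\<^sup>+\<omega>. ennreal (\<bar>f \<omega>\<bar> ^ CARD('m)) \<partial>P) < \<infinity> \<and> (\<integral>\<^sup>+\<omega>. ennreal (\<bar>g \<omega>\<bar> ^ CARD('m)) \<partial>P) < \<infinity> \<and>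
     (\<exists>\<epsilon>::nat \<Rightarrow> real. (\<forall>k. \<epsilon> k \<noteq> 0) \<and> \<epsilon> \<longlonglongrightarrow> 0 \<and>
        (\<lambda>k. \<integral>\<^sup>+\<omega>. ennreal (\<bar>(f (\<theta> (\<epsilon> k *\<^sub>R axis i 1) \<omega>) - f \<omega>) / \<epsilon> k - g \<omega>\<bar> ^ CARD('m)) \<partial>P) \<longlonglongrightarrow> 0)"

lemma flow_derivD:
  assumes "flow_deriv i f g"
  shows "f \<in> borel_measurable P" "g \<in> borel_measurable P"
    "(\<integral>\<^sup>+\<omega>. ennreal (\<bar>f \<omega>\<bar> ^ CARD('m)) \<partial>P) < \<infinity>" "(\<integral>\<^sup>+\<omega>. ennreal (\<bar>g \<omega>\<bar> ^ CARD('m)) \<partial>P) < \<infinity>"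
  using assms by (auto simp: flow_deriv_def)

lemma locint_fiber_power:
  assumes "\<omega> \<in> space P" "f \<in> borel_measurable P" "\<forall>R. (\<integral>\<^sup>+s. indicator (ball 0 R) s * ennreal (\<bar>f (\<theta> s \<omega>)\<bar> ^ m) \<partial>lborel) < \<infinity>" "m \<ge> 1"
  shows "locint (\<lambda>s. \<bar>f (\<theta> s \<omega>)\<bar> ^ m)" "locint (\<lambda>s. f (\<theta> s \<omega>))"
proof -
  note [measurable] = \<theta>_meas2[OF assms(1)] assms(2)
  show "locint (\<lambda>s. \<bar>f (\<theta> s \<omega>)\<bar> ^ m)"
    unfolding locint_iff_nn using assms(3) by simp
  show "locint (\<lambda>s. f (\<theta> s \<omega>))"
    unfolding locint_iff_nn
  proof (intro conjI allI)
    fix R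
    have "(\<integral>\<^sup>+s. indicator (ball 0 R) s * ennreal \<bar>f (\<theta> s \<omega>)\<bar> \<partial>lborel) \<le> (\<integral>\<^sup>+s. indicator (ball 0 R) s + indicator (ball 0 R) s * ennreal (\<bar>f (\<theta> s \<omega>)\<bar> ^ m) \<partial>lborel)"
    proof (rule nn_integral_mono)
      fix s
      have "\<bar>t\<bar> \<le> 1 + \<bar>t\<bar> ^ m" for t :: real
      proof (cases "\<bar>t\<bar> \<ge> 1")
        case True then show ?thesis using self_le_power[of "\<bar>t\<bar>" m] assms(4) by simp
      next
        case False then show ?thesis using zero_le_power[of "\<bar>t\<bar>" m] by linarith
      qed
      then have "ennreal \<bar>f (\<theta> s \<omega>)\<bar> \<le> ennreal (1 + \<bar>f (\<theta> s \<omega>)\<bar> ^ m)" by (intro ennreal_leI)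
      also have "\<dots> = 1 + ennreal (\<bar>f (\<theta> s \<omega>)\<bar> ^ m)" by (simp add: ennreal_plus)
      finally show "indicator (ball 0 R) s * ennreal \<bar>f (\<theta> s \<omega>)\<bar> \<le> indicator (ball 0 R) s + indicator (ball 0 R) s * ennreal (\<bar>f (\<theta> s \<omega>)\<bar> ^ m)"
        by (cases "s \<in> ball 0 R") auto
    qed
    also have "\<dots> = emeasure lborel (ball (0::real^'m) R) + (\<integral>\<^sup>+s. indicator (ball 0 R) s * ennreal (\<bar>f (\<theta> s \<omega>)\<bar> ^ m) \<partial>lborel)"
      by (subst nn_integral_add) auto
    also have "\<dots> < \<infinity>" using assms(3) emeasure_lborel_ball_finite[of "0::real^'m" R] by simp
    finally show "(\<integral>\<^sup>+s. indicator (ball 0 R) s * ennreal \<bar>f (\<theta> s \<omega>)\<bar> \<partial>lborel) < \<infinity>" .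
  qed measurable
qed

text \<open>Along a subsequence the sum of the error powers has finite expectation, hence is locally
  integrable on almost every orbit, where its terms then tend to \<open>0\<close> in local mean.
  Additivity of the action identifies the error at the point \<open>\<theta> s \<omega>\<close> with
  the difference quotient of the orbit function at \<open>s\<close>.\<close>

lemma fiber_wderiv:
  assumes D: "flow_deriv i f g"
  shows "AE \<omega> in P. wderiv i (\<lambda>s. f (\<theta> s \<omega>)) (\<lambda>s. g (\<theta> s \<omega>))"
proof -
  note [measurable] = flow_derivD(1,2)[OF D]
  obtain \<epsilon> :: "nat \<Rightarrow> real" where \<epsilon>: "\<And>k. \<epsilon> k \<noteq> 0" "\<epsilon> \<longlonglongrightarrow> 0"
    "(\<lambda>k. \<integral>\<^sup>+\<omega>. ennreal (\<bar>(f (\<theta> (\<epsilon> k *\<^sub>R axis i 1) \<omega>) - f \<omega>) / \<epsilon> k - g \<omega>\<bar> ^ CARD('m)) \<partial>P) \<longlonglongrightarrow> 0"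
    using D unfolding flow_deriv_def by blast
  define Z where "Z k \<omega> = ennreal (\<bar>(f (\<theta> (\<epsilon> k *\<^sub>R axis i 1) \<omega>) - f \<omega>) / \<epsilon> k - g \<omega>\<bar> ^ CARD('m))" for k \<omega>
  have Zm[measurable]: "Z k \<in> borel_measurable P" for k unfolding Z_def by measurable
  obtain r where r: "strict_mono r" "(\<integral>\<^sup>+\<omega>. (\<Sum>k. Z (r k) \<omega>) \<partial>P) < \<infinity>"
    using nn_integral_subseq_summable[OF Zm \<epsilon>(3)[folded Z_def]] by blast
  have "AE \<omega> in P. \<forall>R. (\<integral>\<^sup>+s. indicator (ball 0 R) s * (\<Sum>k. Z (r k) (\<theta> s \<omega>)) \<partial>lborel) < \<infinity>"
    by (rule fiber_finite[OF _ r(2)]) measurable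
  then show ?thesis
    using AE_space
  proof eventually_elim
    case (elim \<omega>)
    note [measurable] = \<theta>_meas2[OF elim(2)]
    have \<theta>e: "\<theta> t (\<theta> s \<omega>) = \<theta> (s + t) \<omega>" for s t using \<theta>_add[OF elim(2), of t s] by (simp add: add.commute)
    show ?case
      unfolding wderiv_def
    proof (intro exI[of _ "\<epsilon> \<circ> r"] conjI allI)
      show "(\<epsilon> \<circ> r) \<longlonglongrightarrow> 0" by (rule LIMSEQ_subseq_LIMSEQ[OF \<epsilon>(2) r(1)])
      show "(\<epsilon> \<circ> r) n \<noteq> 0" for n using \<epsilon> by simp
      fix R
      define d where "d k s = (f (\<theta> (s + \<epsilon> (r k) *\<^sub>R axis i 1) \<omega>) - f (\<theta> s \<omega>)) / \<epsilon> (r k) - g (\<theta> s \<omega>)" for k s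
      have [measurable]: "d k \<in> borel_measurable lborel" for k unfolding d_def by measurable
      have Zd: "Z (r k) (\<theta> s \<omega>) = ennreal (\<bar>d k s\<bar> ^ CARD('m))" for k s
        unfolding Z_def d_def \<theta>e ..
      have "(\<Sum>k. \<integral>\<^sup>+s. indicator (ball 0 R) s * Z (r k) (\<theta> s \<omega>) \<partial>lborel) = (\<integral>\<^sup>+s. (\<Sum>k. indicator (ball 0 R) s * Z (r k) (\<theta> s \<omega>)) \<partial>lborel)"
        by (rule nn_integral_suminf[symmetric]) measurable
      also have "\<dots> = (\<integral>\<^sup>+s. indicator (ball 0 R) s * (\<Sum>k. Z (r k) (\<theta> s \<omega>)) \<partial>lborel)"
        by (simp add: ennreal_suminf_cmult)
      also have "\<dots> < \<infinity>" using elim(1) by blast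
      finally have "(\<lambda>k. \<integral>\<^sup>+s. indicator (ball 0 R) s * Z (r k) (\<theta> s \<omega>) \<partial>lborel) \<longlonglongrightarrow> 0"
        by (rule ennreal_suminf_finite_tendsto_0(1))
      then have "(\<lambda>k. \<integral>\<^sup>+s. indicator (ball 0 R) s * ennreal \<bar>d k s\<bar> \<partial>lborel) \<longlonglongrightarrow> 0"
        unfolding Zd by (rule power_tendsto_L1[rotated -1]) (auto simp: emeasure_lborel_ball_finite[simplified] Suc_leI)
      then show "(\<lambda>n. \<integral>\<^sup>+x. indicator (ball 0 R) x * ennreal \<bar>(f (\<theta> (x + (\<epsilon> \<circ> r) n *\<^sub>R axis i 1) \<omega>) - f (\<theta> x \<omega>)) / (\<epsilon> \<circ> r) n - g (\<theta> x \<omega>)\<bar> \<partial>lborel) \<longlonglongrightarrow> 0"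
        by (simp add: d_def)
    qed
  qed
qed

definition flow_sobolev :: "('w \<Rightarrow> real^'m) \<Rightarrow> ('w \<Rightarrow> real^'m^'m) \<Rightarrow> bool" where
  "flow_sobolev f G \<longleftrightarrow> (\<forall>i j. flow_deriv i (\<lambda>\<omega>. f \<omega> $ j) (\<lambda>\<omega>. G \<omega> $ j $ i))"

lemma fiber_sobolev:
  assumes "flow_sobolev f G"
  shows "AE \<omega> in P. sobolev_map (\<lambda>s. f (\<theta> s \<omega>)) (\<lambda>s. G (\<theta> s \<omega>))"
proof -
  have D: "flow_deriv i (\<lambda>\<omega>. f \<omega> $ j) (\<lambda>\<omega>. G \<omega> $ j $ i)" for i j using assms by (auto simp: flow_sobolev_def)
  have c: "CARD('m) \<ge> 1" by (simp add: Suc_leI)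
  have m1: "(\<lambda>\<omega>. ennreal (\<bar>f \<omega> $ j\<bar> ^ CARD('m))) \<in> borel_measurable P" "(\<lambda>\<omega>. ennreal (\<bar>G \<omega> $ j $ i\<bar> ^ CARD('m))) \<in> borel_measurable P" for j i
    using flow_derivD(1,2)[OF D] by measurable
  have "AE \<omega> in P. \<forall>j i. wderiv i (\<lambda>s. f (\<theta> s \<omega>) $ j) (\<lambda>s. G (\<theta> s \<omega>) $ j $ i)"
    using fiber_wderiv[OF D] by (intro eventually_all_finite)
  moreover have "AE \<omega> in P. \<forall>j R. (\<integral>\<^sup>+s. indicator (ball 0 R) s * ennreal (\<bar>f (\<theta> s \<omega>) $ j\<bar> ^ CARD('m)) \<partial>lborel) < \<infinity>"
    by (intro eventually_all_finite fiber_finite m1 flow_derivD(3)[OF D])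
  moreover have "AE \<omega> in P. \<forall>j i R. (\<integral>\<^sup>+s. indicator (ball 0 R) s * ennreal (\<bar>G (\<theta> s \<omega>) $ j $ i\<bar> ^ CARD('m)) \<partial>lborel) < \<infinity>"
    by (intro eventually_all_finite fiber_finite m1 flow_derivD(4)[OF D])
  ultimately show ?thesis
    using AE_space
  proof eventually_elim
    case (elim \<omega>)
    show ?case unfolding sobolev_map_def
    proof (intro conjI allI)
      show "locint (\<lambda>s. f (\<theta> s \<omega>) $ j)" for j
        by (rule locint_fiber_power(2)[OF elim(4) flow_derivD(1)[OF D] _ c]) (use elim in blast)
      show "locint (\<lambda>s. G (\<theta> s \<omega>) $ j $ i)" for j i
        by (rule locint_fiber_power(2)[OF elim(4) flow_derivD(2)[OF D] _ c]) (use elim in blast)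
      show "locint (\<lambda>s. \<bar>G (\<theta> s \<omega>) $ j $ i\<bar> ^ CARD('m))" for j i
        by (rule locint_fiber_power(1)[OF elim(4) flow_derivD(2)[OF D] _ c]) (use elim in blast)
    qed (use elim in blast)
  qed
qed

text \<open>The signed counterpart of \<open>qi\<close>, obtained by identifying \<open>P\<close>
  itself as an image of a measure with density; no integrability of \<open>X\<close> has to be
  discussed.\<close>

lemma qi_integral:
  fixes X :: "'w \<Rightarrow> real"
  assumes [measurable]: "X \<in> borel_measurable P"
  shows "(\<integral>\<omega>. \<rho> s \<omega> * X (\<theta> s \<omega>) \<partial>P) = (\<integral>\<omega>. X \<omega> \<partial>P)"
proof -
  have \<rho>0: "\<omega> \<in> space P \<Longrightarrow> \<rho> s \<omega> > 0" for \<omega> using \<rho>_lower[of \<omega> "norm s"] by force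
  have "distr (density P (\<lambda>\<omega>. ennreal (\<rho> s \<omega>))) P (\<theta> s) = P"
  proof (rule measure_eqI)
    fix A assume "A \<in> sets (distr (density P (\<lambda>\<omega>. ennreal (\<rho> s \<omega>))) P (\<theta> s))"
    then have A[measurable]: "A \<in> sets P" by simp
    have "emeasure (distr (density P (\<lambda>\<omega>. ennreal (\<rho> s \<omega>))) P (\<theta> s)) A = (\<integral>\<^sup>+\<omega>. indicator A \<omega> \<partial>distr (density P (\<lambda>\<omega>. ennreal (\<rho> s \<omega>))) P (\<theta> s))"
      by simp
    also have "\<dots> = (\<integral>\<^sup>+\<omega>. indicator A (\<theta> s \<omega>) * ennreal (\<rho> s \<omega>) \<partial>P)"
      by (subst nn_integral_distr) (auto simp: nn_integral_density mult.commute)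
    also have "\<dots> = (\<integral>\<^sup>+\<omega>. indicator A \<omega> \<partial>P)" by (rule qi) simp
    finally show "emeasure (distr (density P (\<lambda>\<omega>. ennreal (\<rho> s \<omega>))) P (\<theta> s)) A = emeasure P A" by simp
  qed simp
  then have "(\<integral>\<omega>. X \<omega> \<partial>P) = (\<integral>\<omega>. X \<omega> \<partial>distr (density P (\<lambda>\<omega>. ennreal (\<rho> s \<omega>))) P (\<theta> s))" by simp
  also have "\<dots> = (\<integral>\<omega>. X (\<theta> s \<omega>) \<partial>density P (\<lambda>\<omega>. ennreal (\<rho> s \<omega>)))"
    by (rule integral_distr) auto
  also have "\<dots> = (\<integral>\<omega>. \<rho> s \<omega> * X (\<theta> s \<omega>) \<partial>P)"
    using \<rho>0 by (subst integral_density) (auto intro!: less_imp_le)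
  finally show ?thesis ..
qed

text \<open>For almost every \<open>\<omega>\<close> the orbit integral \<open>q n \<omega>\<close>
  tends to \<open>0\<close> by the theorem on Sobolev maps, and its expectation is the volume of the
  unit ball times the integral in question. The subsequence makes the errors summable, which gives
  convergence and a majorant on almost every orbit at once.\<close>

lemma variation_subseq:
  fixes fn :: "nat \<Rightarrow> 'w \<Rightarrow> real^'m" and Gn :: "nat \<Rightarrow> 'w \<Rightarrow> real^'m^'m"
  assumes Sn: "\<And>n. flow_sobolev (fn n) (Gn n)" and S: "flow_sobolev f G"
    and limf: "\<And>j. (\<lambda>n. \<integral>\<^sup>+\<omega>. ennreal (\<bar>fn n \<omega> $ j - f \<omega> $ j\<bar> ^ CARD('m)) \<partial>P) \<longlonglongrightarrow> 0"
    and limG: "\<And>j i. (\<lambda>n. \<integral>\<^sup>+\<omega>. ennreal (\<bar>Gn n \<omega> $ j $ i - G \<omega> $ j $ i\<bar> ^ CARD('m)) \<partial>P) \<longlonglongrightarrow> 0"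
    and \<phi>: "\<And>n. C1 (\<phi> n) (g n)" "\<And>n x. \<bar>\<phi> n x\<bar> \<le> 1" "\<And>n x. norm (g n x) \<le> B n"
    and A: "A \<in> sets P" "\<And>\<omega>. \<omega> \<in> A \<Longrightarrow> det (G \<omega>) \<noteq> 0"
  shows "\<exists>r. strict_mono r \<and> (\<lambda>n. \<integral>\<omega>. indicator A \<omega> * (\<phi> (r n) (fn (r n) \<omega>) - \<phi> (r n) (f \<omega>)) \<partial>P) \<longlonglongrightarrow> 0"
proof -
  define m where "m = CARD('m)"
  have m: "m \<ge> 1" by (simp add: m_def Suc_leI)
  have Dn: "flow_deriv i (\<lambda>\<omega>. fn n \<omega> $ j) (\<lambda>\<omega>. Gn n \<omega> $ j $ i)" for n i j using Sn by (auto simp: flow_sobolev_def)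
  have D: "flow_deriv i (\<lambda>\<omega>. f \<omega> $ j) (\<lambda>\<omega>. G \<omega> $ j $ i)" for i j using S by (auto simp: flow_sobolev_def)
  note [measurable] = flow_derivD(1,2)[OF D] flow_derivD(1,2)[OF Dn]
  have fm: "f \<in> borel_measurable P" "fn n \<in> borel_measurable P" for n
    by (subst borel_measurable_euclidean_space; auto simp: Basis_vec_def inner_axis)+
  note [measurable] = fm C1_measurable(1)[OF \<phi>(1)] A(1)
  define Z where "Z n \<omega> = (\<Sum>j\<in>UNIV. ennreal (\<bar>fn n \<omega> $ j - f \<omega> $ j\<bar> ^ m)) + (\<Sum>j\<in>UNIV. \<Sum>i\<in>UNIV. ennreal (\<bar>Gn n \<omega> $ j $ i - G \<omega> $ j $ i\<bar> ^ m))" for n \<omega>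
  have Zm[measurable]: "Z n \<in> borel_measurable P" for n unfolding Z_def by measurable
  have "(\<integral>\<^sup>+\<omega>. Z n \<omega> \<partial>P) = (\<Sum>j\<in>UNIV. \<integral>\<^sup>+\<omega>. ennreal (\<bar>fn n \<omega> $ j - f \<omega> $ j\<bar> ^ m) \<partial>P) + (\<Sum>j\<in>UNIV. \<Sum>i\<in>UNIV. \<integral>\<^sup>+\<omega>. ennreal (\<bar>Gn n \<omega> $ j $ i - G \<omega> $ j $ i\<bar> ^ m) \<partial>P)" for n
    unfolding Z_def by (simp add: nn_integral_add nn_integral_sum del: sum_ennreal)
  moreover have "(\<lambda>n. (\<Sum>j\<in>UNIV. \<integral>\<^sup>+\<omega>. ennreal (\<bar>fn n \<omega> $ j - f \<omega> $ j\<bar> ^ m) \<partial>P) + (\<Sum>j\<in>UNIV. \<Sum>i\<in>UNIV. \<integral>\<^sup>+\<omega>. ennreal (\<bar>Gn n \<omega> $ j $ i - G \<omega> $ j $ i\<bar> ^ m) \<partial>P))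
      \<longlonglongrightarrow> (\<Sum>j\<in>(UNIV::'m set). 0) + (\<Sum>j\<in>(UNIV::'m set). \<Sum>i\<in>(UNIV::'m set). 0)"
    unfolding m_def by (intro tendsto_add tendsto_sum limf limG)
  ultimately have "(\<lambda>n. \<integral>\<^sup>+\<omega>. Z n \<omega> \<partial>P) \<longlonglongrightarrow> 0" by simp
  from nn_integral_subseq_summable[OF Zm this] obtain r where r: "strict_mono r" "(\<integral>\<^sup>+\<omega>. (\<Sum>n. Z (r n) \<omega>) \<partial>P) < \<infinity>" by blast
  define Y where "Y \<omega> = (\<Sum>n. Z (r n) \<omega>)" for \<omega>
  have Ym[measurable]: "Y \<in> borel_measurable P" unfolding Y_def by measurable
  have Yfin: "AE \<omega> in P. \<forall>R. (\<integral>\<^sup>+s. indicator (ball 0 R) s * Y (\<theta> s \<omega>) \<partial>lborel) < \<infinity>"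
    by (rule fiber_finite[OF Ym]) (use r(2) in \<open>simp add: Y_def\<close>)
  define b where "b = ball (0::real^'m) 1"
  define X where "X n \<omega> = indicator A \<omega> * (\<phi> (r n) (fn (r n) \<omega>) - \<phi> (r n) (f \<omega>))" for n \<omega>
  have Xm[measurable]: "X n \<in> borel_measurable P" for n unfolding X_def by measurable
  have Xb: "\<bar>X n \<omega>\<bar> \<le> 2 * indicator A \<omega>" for n \<omega>
    using \<phi>(2)[of "r n" "fn (r n) \<omega>"] \<phi>(2)[of "r n" "f \<omega>"] by (auto simp: X_def indicator_def)
  have \<rho>0: "\<omega> \<in> space P \<Longrightarrow> \<rho> s \<omega> > 0" for s \<omega> using \<rho>_lower[of \<omega> "norm s"] by force
  \<comment> \<open>As a function of \<open>s\<close> this weight is supported in the unit ball and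
    vanishes where the Jacobian determinant of the orbit map does, as the theorem on Sobolev maps
    demands. The factor \<open>\<rho>\<close> makes the expectation independent of \<open>s\<close>
    in the unit ball.\<close>
  define w where "w \<omega> s = indicator b s * (\<rho> s \<omega> * indicator A (\<theta> s \<omega>))" for \<omega> s
  have bm[measurable]: "b \<in> sets borel" by (simp add: b_def)
  have [measurable]: "(\<lambda>(s, \<omega>). X n (\<theta> s \<omega>)) \<in> borel_measurable (lborel \<Otimes>\<^sub>M P)" for n
    using measurable_compose[OF \<theta>_meas' Xm] by (simp add: split_beta')
  have iAm: "(indicator A :: 'w \<Rightarrow> real) \<in> borel_measurable P" by measurable
  have [measurable]: "(\<lambda>(s, \<omega>). indicat_real A (\<theta> s \<omega>)) \<in> borel_measurable (lborel \<Otimes>\<^sub>M P)"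
    using measurable_compose[OF \<theta>_meas' iAm] by (simp add: split_beta')
  have "(\<integral>\<^sup>+\<omega>. indicator A \<omega> \<partial>P) < \<infinity>" by (simp add: less_top[symmetric])
  from fiber_finite_R(1)[OF _ this, of 1]
  have wE: "(\<integral>\<^sup>+\<omega>. \<integral>\<^sup>+s. ennreal (w \<omega> s) \<partial>lborel \<partial>P) = emeasure lborel b * emeasure P A"
  proof -
    have "(\<integral>\<^sup>+\<omega>. \<integral>\<^sup>+s. ennreal (w \<omega> s) \<partial>lborel \<partial>P) = (\<integral>\<^sup>+\<omega>. \<integral>\<^sup>+s. indicator (ball 0 1) s * (indicator A (\<theta> s \<omega>) * ennreal (\<rho> s \<omega>)) \<partial>lborel \<partial>P)"
      by (intro nn_integral_cong) (auto simp: w_def b_def indicator_def)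
    also have "\<dots> = emeasure lborel (ball (0::real^'m) 1) * (\<integral>\<^sup>+\<omega>. indicator A \<omega> \<partial>P)"
      by (rule fiber_finite_R(1)) (auto simp: less_top[symmetric])
    finally show ?thesis by (simp add: b_def)
  qed
  have wfin: "(\<integral>\<^sup>+\<omega>. \<integral>\<^sup>+s. ennreal (w \<omega> s) \<partial>lborel \<partial>P) < \<infinity>"
  proof -
    have "emeasure lborel b < top" "emeasure P A < top"
      using emeasure_lborel_ball_finite[of "0::real^'m" 1] emeasure_finite[of A] by (simp_all only: b_def infinity_ennreal_def less_top[symmetric] not_False_eq_True simp_thms)
    then show ?thesis unfolding wE by (simp add: ennreal_mult_less_top)
  qed
  have w0: "\<omega> \<in> space P \<Longrightarrow> w \<omega> s \<ge> 0" for \<omega> s using less_imp_le[OF \<rho>0] by (auto simp: w_def)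
  have wm: "(\<lambda>(s, \<omega>). w \<omega> s) \<in> borel_measurable (lborel \<Otimes>\<^sub>M P)" unfolding w_def by measurable
  have wint: "integrable (lborel \<Otimes>\<^sub>M P) (\<lambda>(s, \<omega>). w \<omega> s)"
  proof (rule integrableI_bounded[OF wm])
    have "(\<integral>\<^sup>+p. ennreal (norm (case p of (s, \<omega>) \<Rightarrow> w \<omega> s)) \<partial>(lborel \<Otimes>\<^sub>M P)) = (\<integral>\<^sup>+p. (case p of (s, \<omega>) \<Rightarrow> ennreal (w \<omega> s)) \<partial>(lborel \<Otimes>\<^sub>M P))"
      by (rule nn_integral_cong) (use w0 in \<open>auto simp: space_pair_measure\<close>)
    also have "\<dots> = (\<integral>\<^sup>+\<omega>. \<integral>\<^sup>+s. ennreal (w \<omega> s) \<partial>lborel \<partial>P)"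
      using wm by (subst L.nn_integral_snd[symmetric]) (auto simp: split_beta')
    finally show "(\<integral>\<^sup>+p. ennreal (norm (case p of (s, \<omega>) \<Rightarrow> w \<omega> s)) \<partial>(lborel \<Otimes>\<^sub>M P)) < \<infinity>" using wfin by simp
  qed
  have wAE: "AE \<omega> in P. integrable lborel (w \<omega>)" using L.AE_integrable_snd[OF wint] .
  have Wint: "integrable P (\<lambda>\<omega>. \<integral>s. w \<omega> s \<partial>lborel)" using L.integrable_snd[OF wint] .
  define q where "q n \<omega> = (\<integral>s. w \<omega> s * (\<phi> (r n) (fn (r n) (\<theta> s \<omega>)) - \<phi> (r n) (f (\<theta> s \<omega>))) \<partial>lborel)" for n \<omega>
  have wX: "w \<omega> s * (\<phi> (r n) (fn (r n) (\<theta> s \<omega>)) - \<phi> (r n) (f (\<theta> s \<omega>))) = indicator b s * (\<rho> s \<omega> * X n (\<theta> s \<omega>))" for n \<omega> s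
    by (simp add: w_def X_def)
  have wXb: "\<bar>indicator b s * (\<rho> s \<omega> * X n (\<theta> s \<omega>))\<bar> \<le> 2 * w \<omega> s" if "\<omega> \<in> space P" for n \<omega> s
  proof -
    have "\<bar>indicator b s * (\<rho> s \<omega> * X n (\<theta> s \<omega>))\<bar> = indicator b s * (\<rho> s \<omega> * \<bar>X n (\<theta> s \<omega>)\<bar>)" using \<rho>0[OF that, of s] by (simp add: abs_mult)
    also have "\<dots> \<le> indicator b s * (\<rho> s \<omega> * (2 * indicator A (\<theta> s \<omega>)))"
      using \<rho>0[OF that, of s] by (intro mult_left_mono Xb) auto
    finally show ?thesis by (simp add: w_def)
  qed
  have Xint: "integrable (lborel \<Otimes>\<^sub>M P) (\<lambda>(s, \<omega>). indicator b s * (\<rho> s \<omega> * X n (\<theta> s \<omega>)))" for n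
  proof (rule Bochner_Integration.integrable_bound)
    show "integrable (lborel \<Otimes>\<^sub>M P) (\<lambda>p. 2 * (case p of (s, \<omega>) \<Rightarrow> w \<omega> s))" using wint by (rule integrable_mult_right)
    show "AE p in lborel \<Otimes>\<^sub>M P. norm (case p of (s, \<omega>) \<Rightarrow> indicator b s * (\<rho> s \<omega> * X n (\<theta> s \<omega>))) \<le> norm (2 * (case p of (s, \<omega>) \<Rightarrow> w \<omega> s))"
      using wXb by (intro AE_I2) (auto simp: space_pair_measure intro: order_trans[OF _ abs_ge_self])
  qed measurable
  have qE: "(\<integral>\<omega>. q n \<omega> \<partial>P) = measure lborel b * (\<integral>\<omega>. X n \<omega> \<partial>P)" for n
  proof -
    have "(\<integral>\<omega>. q n \<omega> \<partial>P) = (\<integral>\<omega>. \<integral>s. indicator b s * (\<rho> s \<omega> * X n (\<theta> s \<omega>)) \<partial>lborel \<partial>P)" unfolding q_def wX ..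
    also have "\<dots> = (\<integral>s. \<integral>\<omega>. indicator b s * (\<rho> s \<omega> * X n (\<theta> s \<omega>)) \<partial>P \<partial>lborel)"
      by (rule L.Fubini_integral[OF Xint])
    also have "\<dots> = (\<integral>s. indicator b s * (\<integral>\<omega>. X n \<omega> \<partial>P) \<partial>lborel)" by (simp add: qi_integral)
    also have "\<dots> = measure lborel b * (\<integral>\<omega>. X n \<omega> \<partial>P)" by simp
    finally show ?thesis .
  qed
  have detm: "AE \<omega> in P. \<forall>n. sobolev_map (\<lambda>s. fn (r n) (\<theta> s \<omega>)) (\<lambda>s. Gn (r n) (\<theta> s \<omega>))"
    unfolding AE_all_countable using fiber_sobolev[OF Sn] by blast
  have lim: "AE \<omega> in P. (\<lambda>n. q n \<omega>) \<longlonglongrightarrow> 0"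
    using Yfin wAE detm fiber_sobolev[OF S] AE_space
  proof eventually_elim
    case (elim \<omega>)
    note \<omega> = elim(5)
    note [measurable] = \<theta>_meas2[OF \<omega>] \<rho>_meas2[OF \<omega>]
    have "AE s in lborel. \<forall>k::nat. indicator (ball 0 (real k)) s * Y (\<theta> s \<omega>) \<noteq> \<infinity>"
      unfolding AE_all_countable using elim(1) by (intro allI nn_integral_PInf_AE) (auto simp: less_top)
    then have AEY: "AE s in lborel. Y (\<theta> s \<omega>) < \<infinity>"
    proof eventually_elim
      case (elim s)
      obtain k :: nat where "norm s < real k" using reals_Archimedean2 by blast
      then show ?case using elim[rule_format, of k] by (simp add: less_top)
    qed
    \<comment> \<open>The factor \<open>2 ^ m\<close> stems from
      \<open>\<bar>x\<bar> \<le> 2 * max \<bar>y\<bar> \<bar>x - y\<bar>\<close>, with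
      \<open>y\<close> an entry of the limit matrix and the power of \<open>x - y\<close> bounded by
      the sum \<open>Y\<close> of all errors.\<close>
    define H where "H s = 2 ^ m * ((\<Sum>j\<in>UNIV. \<Sum>i\<in>UNIV. \<bar>G (\<theta> s \<omega>) $ j $ i\<bar> ^ m) + enn2real (Y (\<theta> s \<omega>)))" for s
    have conv0: "(\<lambda>n. x n) \<longlonglongrightarrow> x0" if le: "\<And>n. ennreal (\<bar>x n - x0\<bar> ^ m) \<le> Z (r n) \<omega>'" and Y: "Y \<omega>' < \<infinity>" for x :: "nat \<Rightarrow> real" and x0 \<omega>'
    proof -
      have "(\<lambda>n. Z (r n) \<omega>') \<longlonglongrightarrow> 0" using ennreal_suminf_finite_tendsto_0(1)[of "\<lambda>n. Z (r n) \<omega>'"] Y by (simp add: Y_def)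
      then have "(\<lambda>n. ennreal (\<bar>x n - x0\<bar> ^ m)) \<longlonglongrightarrow> 0"
        by (rule tendsto_sandwich[OF _ _ tendsto_const, rotated 2]; intro always_eventually allI le zero_le)
      then have "(\<lambda>n. ennreal (\<bar>x n - x0\<bar> ^ m)) \<longlonglongrightarrow> ennreal 0" by (simp only: ennreal_0)
      then have "(\<lambda>n. \<bar>x n - x0\<bar> ^ m) \<longlonglongrightarrow> 0" by (rule iffD1[OF tendsto_ennreal_iff, rotated 2]) auto
      then have "(\<lambda>n. root m (\<bar>x n - x0\<bar> ^ m)) \<longlonglongrightarrow> root m 0" by (intro tendsto_real_root)
      then have "(\<lambda>n. \<bar>x n - x0\<bar>) \<longlonglongrightarrow> 0" using m by (simp add: real_root_power_cancel)
      then show ?thesis by (rule LIM_zero_cancel[OF tendsto_rabs_zero_cancel])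
    qed
    have lef: "ennreal (\<bar>fn n \<omega>' $ j - f \<omega>' $ j\<bar> ^ m) \<le> Z n \<omega>'" for n \<omega>' j
      unfolding Z_def by (intro add_increasing2 member_le_sum[where f="\<lambda>j. ennreal (\<bar>fn n \<omega>' $ j - f \<omega>' $ j\<bar> ^ m)"]) auto
    have leG: "ennreal (\<bar>Gn n \<omega>' $ j $ i - G \<omega>' $ j $ i\<bar> ^ m) \<le> Z n \<omega>'" for n \<omega>' j i
    proof -
      have "ennreal (\<bar>Gn n \<omega>' $ j $ i - G \<omega>' $ j $ i\<bar> ^ m) \<le> (\<Sum>i\<in>UNIV. ennreal (\<bar>Gn n \<omega>' $ j $ i - G \<omega>' $ j $ i\<bar> ^ m))"
        by (rule member_le_sum) auto
      also have "\<dots> \<le> (\<Sum>j\<in>UNIV. \<Sum>i\<in>UNIV. ennreal (\<bar>Gn n \<omega>' $ j $ i - G \<omega>' $ j $ i\<bar> ^ m))"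
        by (rule member_le_sum[where f="\<lambda>j. \<Sum>i\<in>UNIV. ennreal (\<bar>Gn n \<omega>' $ j $ i - G \<omega>' $ j $ i\<bar> ^ m)"]) auto
      also have "\<dots> \<le> Z n \<omega>'" unfolding Z_def by (rule add_increasing) auto
      finally show ?thesis .
    qed
    note SM = sobolev_mapD[OF elim(4), folded m_def]
    show ?case
      unfolding q_def
    proof (rule sobolev_variation_convergence[where Gn="\<lambda>n s. Gn (r n) (\<theta> s \<omega>)" and G="\<lambda>s. G (\<theta> s \<omega>)" and H=H and R=1 and g="\<lambda>n. g (r n)" and B="\<lambda>n. B (r n)"])
      show "AE s in lborel. (\<lambda>n. fn (r n) (\<theta> s \<omega>)) \<longlonglongrightarrow> f (\<theta> s \<omega>)"
        using AEY by eventually_elim (intro vec_tendstoI conv0[OF lef])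
      show "AE s in lborel. \<forall>j i. (\<lambda>n. Gn (r n) (\<theta> s \<omega>) $ j $ i) \<longlonglongrightarrow> G (\<theta> s \<omega>) $ j $ i"
        using AEY by eventually_elim (intro allI conv0[OF leG])
      show "locint H"
      proof -
        have Yl: "locint (\<lambda>s. enn2real (Y (\<theta> s \<omega>)))"
          unfolding locint_iff_nn
        proof (intro conjI allI)
          fix R
          have "(\<integral>\<^sup>+s. indicator (ball 0 R) s * ennreal \<bar>enn2real (Y (\<theta> s \<omega>))\<bar> \<partial>lborel) \<le> (\<integral>\<^sup>+s. indicator (ball 0 R) s * Y (\<theta> s \<omega>) \<partial>lborel)"
            by (intro nn_integral_mono mult_left_mono) (auto simp: ennreal_enn2real_if)
          also have "\<dots> < \<infinity>" using elim(1) by blast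
          finally show "(\<integral>\<^sup>+s. indicator (ball 0 R) s * ennreal \<bar>enn2real (Y (\<theta> s \<omega>))\<bar> \<partial>lborel) < \<infinity>" .
        qed measurable
        have eq: "(\<lambda>s. indicator (ball 0 R) s * H s) = (\<lambda>s. 2 ^ m * ((\<Sum>j\<in>UNIV. \<Sum>i\<in>UNIV. indicator (ball 0 R) s * \<bar>G (\<theta> s \<omega>) $ j $ i\<bar> ^ m) + indicator (ball 0 R) s * enn2real (Y (\<theta> s \<omega>))))" for R
          by (simp add: H_def fun_eq_iff algebra_simps sum_distrib_left)
        show ?thesis unfolding locint_def
        proof (intro conjI allI)
          show "H \<in> borel_measurable borel" unfolding H_def by measurable
          show "integrable lborel (\<lambda>x. indicator (ball 0 R) x * H x)" for R
            unfolding eq by (intro integrable_mult_right Bochner_Integration.integrable_add Bochner_Integration.integrable_sum locintD Yl SM)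
        qed
      qed
      show "AE s in lborel. \<forall>n j i. \<bar>Gn (r n) (\<theta> s \<omega>) $ j $ i\<bar> ^ CARD('m) \<le> H s"
        using AEY
      proof eventually_elim
        case (elim s)
        show ?case
        proof (intro allI)
          fix n j i
          define x where "x = Gn (r n) (\<theta> s \<omega>) $ j $ i"
          define y where "y = G (\<theta> s \<omega>) $ j $ i"
          have "ennreal (\<bar>x - y\<bar> ^ m) \<le> Y (\<theta> s \<omega>)"
            unfolding x_def y_def using leG[of "r n" "\<theta> s \<omega>" j i] ennreal_suminf_finite_tendsto_0(2)[of "\<lambda>n. Z (r n) (\<theta> s \<omega>)" n] elim
            by (auto simp: Y_def intro: order_trans)
          also have "\<dots> = ennreal (enn2real (Y (\<theta> s \<omega>)))" using elim by simp
          finally have 1: "\<bar>x - y\<bar> ^ m \<le> enn2real (Y (\<theta> s \<omega>))" by simp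
          have "\<bar>y\<bar> ^ m \<le> (\<Sum>i\<in>UNIV. \<bar>G (\<theta> s \<omega>) $ j $ i\<bar> ^ m)" unfolding y_def by (rule member_le_sum) auto
          also have "\<dots> \<le> (\<Sum>j\<in>UNIV. \<Sum>i\<in>UNIV. \<bar>G (\<theta> s \<omega>) $ j $ i\<bar> ^ m)"
            by (rule member_le_sum[where f="\<lambda>j. \<Sum>i\<in>UNIV. \<bar>G (\<theta> s \<omega>) $ j $ i\<bar> ^ m"]) (auto intro: sum_nonneg)
          finally have 2: "\<bar>y\<bar> ^ m \<le> (\<Sum>j\<in>UNIV. \<Sum>i\<in>UNIV. \<bar>G (\<theta> s \<omega>) $ j $ i\<bar> ^ m)" .
          have "\<bar>x\<bar> \<le> 2 * max \<bar>y\<bar> \<bar>x - y\<bar>" using abs_triangle_ineq[of y "x - y"] by (auto simp: max_def)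
          then have "\<bar>x\<bar> ^ m \<le> (2 * max \<bar>y\<bar> \<bar>x - y\<bar>) ^ m" by (rule power_mono) simp
          also have "\<dots> = 2 ^ m * max \<bar>y\<bar> \<bar>x - y\<bar> ^ m" by (rule power_mult_distrib)
          also have "max \<bar>y\<bar> \<bar>x - y\<bar> ^ m \<le> \<bar>y\<bar> ^ m + \<bar>x - y\<bar> ^ m" by (simp add: max_def)
          finally have "\<bar>x\<bar> ^ m \<le> 2 ^ m * (\<bar>y\<bar> ^ m + \<bar>x - y\<bar> ^ m)" by simp
          also have "\<dots> \<le> H s" unfolding H_def using 1 2 by (intro mult_left_mono add_mono) auto
          finally show "\<bar>Gn (r n) (\<theta> s \<omega>) $ j $ i\<bar> ^ CARD('m) \<le> H s" by (simp add: x_def m_def)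
        qed
      qed
      show "w \<omega> s = 0" if "norm s \<ge> 1" for s using that by (simp add: w_def b_def)
      show "w \<omega> s = 0" if "det (G (\<theta> s \<omega>)) = 0" for s using A(2)[of "\<theta> s \<omega>"] that by (auto simp: w_def indicator_def)
    qed (use elim \<phi> in auto)
  qed
  have "(\<lambda>n. \<integral>\<omega>. q n \<omega> \<partial>P) \<longlonglongrightarrow> (\<integral>\<omega>. 0 \<partial>P)"
  proof (rule integral_dominated_convergence[where w="\<lambda>\<omega>. 2 * (\<integral>s. w \<omega> s \<partial>lborel)"])
    show "AE \<omega> in P. norm (q n \<omega>) \<le> 2 * (\<integral>s. w \<omega> s \<partial>lborel)" for n
      using wAE AE_space
    proof eventually_elim
      case (elim \<omega>)
      have "\<bar>\<integral>s. indicator b s * (\<rho> s \<omega> * X n (\<theta> s \<omega>)) \<partial>lborel\<bar> \<le> (\<integral>s. 2 * w \<omega> s \<partial>lborel)"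
        by (rule order_trans[OF integral_abs_bound], rule integral_mono_AE')
           (use elim wXb w0 in auto)
      then show ?case unfolding q_def wX by simp
    qed
    show "q n \<in> borel_measurable P" for n
      unfolding q_def wX using L.integrable_snd[OF Xint] by (rule borel_measurable_integrable)
  qed (use lim Wint in auto)
  then have "(\<lambda>n. measure lborel b * (\<integral>\<omega>. X n \<omega> \<partial>P)) \<longlonglongrightarrow> 0" by (simp add: qE)
  moreover have "measure lborel b > 0" unfolding b_def using content_ball_pos[of 1 "0::real^'m"] by (simp add: measure_def)
  ultimately have "(\<lambda>n. \<integral>\<omega>. X n \<omega> \<partial>P) \<longlonglongrightarrow> 0"
    using tendsto_mult_left_iff[of "measure lborel b" "\<lambda>n. \<integral>\<omega>. X n \<omega> \<partial>P" 0 sequentially] by simp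
  then show ?thesis using r(1) by (auto simp: X_def)
qed

text \<open>Subsequence principle: if convergence failed, the integrals would stay at least
  \<open>e\<close> away from \<open>0\<close> along some subsequence, but
  \<open>variation_subseq\<close> applied to that subsequence extracts a further one tending to
  \<open>0\<close>.\<close>

theorem flow_variation:
  fixes fn :: "nat \<Rightarrow> 'w \<Rightarrow> real^'m" and Gn :: "nat \<Rightarrow> 'w \<Rightarrow> real^'m^'m"
  assumes Sn: "\<And>n. flow_sobolev (fn n) (Gn n)" and S: "flow_sobolev f G"
    and limf: "\<And>j. (\<lambda>n. \<integral>\<^sup>+\<omega>. ennreal (\<bar>fn n \<omega> $ j - f \<omega> $ j\<bar> ^ CARD('m)) \<partial>P) \<longlonglongrightarrow> 0"
    and limG: "\<And>j i. (\<lambda>n. \<integral>\<^sup>+\<omega>. ennreal (\<bar>Gn n \<omega> $ j $ i - G \<omega> $ j $ i\<bar> ^ CARD('m)) \<partial>P) \<longlonglongrightarrow> 0"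
    and \<phi>: "\<And>n. C1 (\<phi> n) (g n)" "\<And>n x. \<bar>\<phi> n x\<bar> \<le> 1" "\<And>n x. norm (g n x) \<le> B n"
    and A: "A \<in> sets P" "\<And>\<omega>. \<omega> \<in> A \<Longrightarrow> det (G \<omega>) \<noteq> 0"
  shows "(\<lambda>n. \<integral>\<omega>. indicator A \<omega> * (\<phi> n (fn n \<omega>) - \<phi> n (f \<omega>)) \<partial>P) \<longlonglongrightarrow> 0"
proof (rule ccontr)
  define X where "X n = (\<integral>\<omega>. indicator A \<omega> * (\<phi> n (fn n \<omega>) - \<phi> n (f \<omega>)) \<partial>P)" for n
  assume "\<not> ?thesis"
  then have "\<not> (X \<longlonglongrightarrow> 0)" by (simp add: X_def[abs_def])
  then obtain e where e: "e > 0" "\<And>N. \<exists>n\<ge>N. \<bar>X n\<bar> \<ge> e" unfolding LIMSEQ_iff by (auto simp: not_less)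
  then have "infinite {n. \<bar>X n\<bar> \<ge> e}" unfolding infinite_nat_iff_unbounded_le by auto
  from infinite_enumerate[OF this] obtain k :: "nat \<Rightarrow> nat" where k: "strict_mono k" "\<And>n. \<bar>X (k n)\<bar> \<ge> e" by blast
  have "\<exists>r. strict_mono r \<and> (\<lambda>n. \<integral>\<omega>. indicator A \<omega> * (\<phi> (k (r n)) (fn (k (r n)) \<omega>) - \<phi> (k (r n)) (f \<omega>)) \<partial>P) \<longlonglongrightarrow> 0"
    by (rule variation_subseq[where fn="\<lambda>n. fn (k n)" and Gn="\<lambda>n. Gn (k n)" and \<phi>="\<lambda>n. \<phi> (k n)" and g="\<lambda>n. g (k n)" and B="\<lambda>n. B (k n)", OF Sn S])
       (use LIMSEQ_subseq_LIMSEQ[OF limf k(1)] LIMSEQ_subseq_LIMSEQ[OF limG k(1)] \<phi> A in \<open>auto simp: comp_def\<close>)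
  then obtain r where "(\<lambda>n. X (k (r n))) \<longlonglongrightarrow> 0" unfolding X_def by blast
  then have "eventually (\<lambda>n. \<bar>X (k (r n))\<bar> < e) sequentially"
    using e(1) by (intro order_tendstoD(2)[OF tendsto_rabs_zero])
  then show False using k(2) by (auto simp: eventually_sequentially not_less[symmetric])
qed

end

section \<open>The flow of a single stretching field\<close>

text \<open>The squared distance times \<open>exp (- 2 * K * s)\<close> is nonincreasing; squaring
  avoids differentiating an absolute value. The estimate yields both uniqueness in the definition of
  \<open>stretch\<close> and the Lipschitz bound of the flow.\<close>

lemma ode_gronwall:
  fixes v :: "real \<Rightarrow> real"
  assumes lip: "\<And>x y. 0 \<le> x \<Longrightarrow> 0 \<le> y \<Longrightarrow> \<bar>v x - v y\<bar> \<le> C * \<bar>x - y\<bar>"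
    and y: "\<And>s. s \<in> {0..1} \<Longrightarrow> y s \<ge> 0" "\<And>s. s \<in> {0..1} \<Longrightarrow> (y has_real_derivative t * v (y s)) (at s within {0..1})"
    and z: "\<And>s. s \<in> {0..1} \<Longrightarrow> z s \<ge> 0" "\<And>s. s \<in> {0..1} \<Longrightarrow> (z has_real_derivative t * v (z s)) (at s within {0..1})"
  shows "\<bar>y 1 - z 1\<bar> \<le> exp (C * \<bar>t\<bar>) * \<bar>y 0 - z 0\<bar>"
proof -
  define K where "K = C * \<bar>t\<bar>"
  define w where "w s = (y s - z s)\<^sup>2 * exp (- 2 * K * s)" for s
  have "w 1 \<le> w 0"
  proof (rule DERIV_nonpos_imp_decreasing_open[of 0 1 w])
    have "continuous_on {0..1} y" "continuous_on {0..1} z"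
      using y(2) z(2) by (meson DERIV_continuous_on)+
    then show "continuous_on {0..1} w" unfolding w_def by (intro continuous_intros)
    fix s :: real assume s: "0 < s" "s < 1"
    have at: "at s within {0..1} = at s" using s by (intro at_within_interior) simp
    have yd: "(y has_real_derivative t * v (y s)) (at s)" and zd: "(z has_real_derivative t * v (z s)) (at s)"
      using y(2)[of s] z(2)[of s] s by (simp_all add: at)
    define d where "d = y s - z s"
    have "(w has_real_derivative (2 * d * (t * v (y s) - t * v (z s)) * exp (- 2 * K * s) + d\<^sup>2 * (exp (- 2 * K * s) * (- 2 * K)))) (at s)"
      unfolding w_def d_def by (rule derivative_eq_intros yd zd refl | simp)+
    moreover have "2 * d * (t * v (y s) - t * v (z s)) * exp (- 2 * K * s) + d\<^sup>2 * (exp (- 2 * K * s) * (- 2 * K)) \<le> 0"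
    proof -
      have "d * (t * (v (y s) - v (z s))) \<le> \<bar>d\<bar> * (\<bar>t\<bar> * \<bar>v (y s) - v (z s)\<bar>)" by (metis abs_ge_self abs_mult)
      also have "\<dots> \<le> \<bar>d\<bar> * (\<bar>t\<bar> * (C * \<bar>d\<bar>))" using lip[of "y s" "z s"] y(1)[of s] z(1)[of s] s by (intro mult_left_mono) (auto simp: d_def)
      also have "\<dots> = K * d\<^sup>2" by (simp add: K_def power2_eq_square)
      finally have "(2 * (d * (t * (v (y s) - v (z s)))) - 2 * K * d\<^sup>2) * exp (- 2 * K * s) \<le> 0" by (intro mult_nonpos_nonneg) auto
      then show ?thesis by (simp add: algebra_simps)
    qed
    ultimately show "\<exists>y. (w has_real_derivative y) (at s) \<and> y \<le> 0" by blast
  qed simp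
  then have "(y 1 - z 1)\<^sup>2 * exp (- 2 * K) \<le> (y 0 - z 0)\<^sup>2" by (simp add: w_def)
  then have "(y 1 - z 1)\<^sup>2 * exp (- 2 * K) * exp (2 * K) \<le> (y 0 - z 0)\<^sup>2 * exp (2 * K)" by (intro mult_right_mono) auto
  then have "(y 1 - z 1)\<^sup>2 \<le> (y 0 - z 0)\<^sup>2 * exp (2 * K)" by (simp add: mult.assoc flip: exp_add)
  also have "\<dots> = (exp K * (y 0 - z 0))\<^sup>2" by (simp add: power_mult_distrib exp_double[of K] mult.commute[of _ "exp _"])
  finally have "\<bar>y 1 - z 1\<bar> \<le> \<bar>exp K * (y 0 - z 0)\<bar>" by (simp add: abs_le_square_iff)
  then show ?thesis by (simp add: abs_mult K_def)
qed

text \<open>The flow is \<open>x \<mapsto> G\<^sup>-\<^sup>1(G x + t)\<close> with \<open>G' = 1/v\<close>; the Lipschitz bound makes \<open>1/v\<close> non-integrable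
  at both ends, so \<open>G\<close> maps onto \<open>\<real>\<close>.\<close>

locale interval_flow =
  fixes v :: "real \<Rightarrow> real" and a b C :: real
  assumes ab: "a < b" and a0: "0 \<le> a"
    and lip: "\<And>x y. 0 \<le> x \<Longrightarrow> 0 \<le> y \<Longrightarrow> \<bar>v x - v y\<bar> \<le> C * \<bar>x - y\<bar>"
    and pos: "\<And>x. a < x \<Longrightarrow> x < b \<Longrightarrow> v x > 0"
    and zero: "\<And>x. 0 \<le> x \<Longrightarrow> x \<le> a \<or> b \<le> x \<Longrightarrow> v x = 0"
begin

text \<open>The field is zero at \<open>a\<close> and positive at the midpoint, which the Lipschitz
  bound excludes for a nonpositive constant.\<close>

lemma C_pos: "C > 0"
proof -
  have "\<bar>v ((a+b)/2) - v a\<bar> \<le> C * \<bar>(a+b)/2 - a\<bar>" using ab a0 by (intro lip) auto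
  moreover have "v ((a+b)/2) > 0" "v a = 0" using ab a0 by (auto intro!: pos zero)
  moreover have "(a+b)/2 - a > 0" using ab by simp
  ultimately show ?thesis by (smt (verit) mult_nonneg_nonneg zero_less_mult_iff mult_nonpos_nonneg)
qed

lemma v_cont: "continuous_on {0..} v"
  unfolding continuous_on_iff
proof (intro ballI allI impI)
  fix x e :: real assume x: "x \<in> {0..}" and e: "e > 0"
  show "\<exists>d>0. \<forall>x'\<in>{0..}. dist x' x < d \<longrightarrow> dist (v x') (v x) < e"
  proof (intro exI[of _ "e / C"] conjI ballI impI)
    show "e / C > 0" using e C_pos by simp
    fix y assume y: "y \<in> {0..}" "dist y x < e / C"
    have "\<bar>v y - v x\<bar> \<le> C * \<bar>y - x\<bar>" using x y by (intro lip) auto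
    also have "\<dots> < C * (e / C)" using y C_pos by (intro mult_strict_left_mono) (auto simp: dist_real_def)
    finally show "dist (v y) (v x) < e" using C_pos by (simp add: dist_real_def)
  qed
qed

lemma v_isCont: "a < x \<Longrightarrow> x < b \<Longrightarrow> isCont v x"
  using continuous_on_interior[OF v_cont, of x] a0 by simp

lemma antiderivative_ex: "\<exists>G. \<forall>x. a < x \<longrightarrow> x < b \<longrightarrow> (G has_real_derivative 1 / v x) (at x)"
proof -
  have "isCont (\<lambda>x. 1 / v x) x" if "a < x" "x < b" for x
    using v_isCont[OF that] pos[OF that] by (intro continuous_intros) auto
  then show ?thesis
    using einterval_antiderivative[of "ereal a" "ereal b" "\<lambda>x. 1 / v x"] ab
    by (simp add: has_real_derivative_iff_has_vector_derivative)
qed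

definition G :: "real \<Rightarrow> real" where
  "G = (SOME G. \<forall>x. a < x \<longrightarrow> x < b \<longrightarrow> (G has_real_derivative 1 / v x) (at x))"

lemma G_deriv: "a < x \<Longrightarrow> x < b \<Longrightarrow> (G has_real_derivative 1 / v x) (at x)"
  using someI_ex[OF antiderivative_ex] unfolding G_def by blast

lemma G_isCont: "a < x \<Longrightarrow> x < b \<Longrightarrow> isCont G x"
  using G_deriv DERIV_isCont by blast

lemma G_mono: "a < x \<Longrightarrow> x < y \<Longrightarrow> y < b \<Longrightarrow> G x < G y"
proof (rule DERIV_pos_imp_increasing[of x y G])
  fix u assume "a < x" "y < b" "x \<le> u" "u \<le> y"
  then show "\<exists>d. (G has_real_derivative d) (at u) \<and> 0 < d"
    using G_deriv[of u] pos[of u] by (intro exI[of _ "1 / v u"]) auto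
qed

lemma G_inj: "inj_on G {a<..<b}"
  by (rule linorder_inj_onI') (use G_mono in force)

text \<open>The Lipschitz bound at the zero \<open>a\<close> gives
  \<open>v u \<le> C * (u - a)\<close>, so \<open>G x - ln (x - a) / C\<close> is nondecreasing up
  to the midpoint. Hence \<open>G\<close> inherits the logarithmic divergence at
  \<open>a\<close>.\<close>

lemma G_low: "\<exists>x. a < x \<and> x < b \<and> G x \<le> y"
proof -
  define c where "c = (a + b) / 2"
  have c: "a < c" "c < b" using ab by (auto simp: c_def)
  have mono: "G x - ln (x - a) / C \<le> G c - ln (c - a) / C" if x: "a < x" "x \<le> c" for x
  proof (rule DERIV_nonneg_imp_nondecreasing[of x c "\<lambda>x. G x - ln (x - a) / C"])
    fix u assume u: "x \<le> u" "u \<le> c"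
    have "((\<lambda>x. G x - ln (x - a) / C) has_real_derivative 1 / v u - 1 / (u - a) / C) (at u)"
      using u x c C_pos by (auto intro!: derivative_eq_intros G_deriv)
    moreover have "1 / v u - 1 / (u - a) / C \<ge> 0"
    proof -
      have "\<bar>v u - v a\<bar> \<le> C * \<bar>u - a\<bar>" using u x a0 by (intro lip) auto
      then have "v u \<le> C * (u - a)" using zero[of a] a0 u x by simp
      moreover have "v u > 0" using u x c by (intro pos) auto
      ultimately show ?thesis using C_pos u x by (simp add: frac_le divide_simps mult.commute)
    qed
    ultimately show "\<exists>y. ((\<lambda>x. G x - ln (x - a) / C) has_real_derivative y) (at u) \<and> 0 \<le> y" by blast
  qed (use x in auto)
  \<comment> \<open>The exponential solves the inequality asked of \<open>ln (x - a)\<close>; the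
    minimum keeps \<open>x\<close> on the left of the midpoint, where the monotonicity was
    shown.\<close>
  define x where "x = a + min (c - a) (exp (C * (y - (G c - ln (c - a) / C))))"
  have x: "a < x" "x \<le> c" using c by (auto simp: x_def)
  have "G x \<le> G c - ln (c - a) / C + ln (x - a) / C" using mono[OF x] by simp
  also have "ln (x - a) \<le> C * (y - (G c - ln (c - a) / C))"
  proof -
    have "x - a \<le> exp (C * (y - (G c - ln (c - a) / C)))" by (simp add: x_def)
    then have "ln (x - a) \<le> ln (exp (C * (y - (G c - ln (c - a) / C))))" using x by (intro ln_mono) auto
    then show ?thesis by simp
  qed
  then have "ln (x - a) / C \<le> y - (G c - ln (c - a) / C)" by (simp only: pos_divide_le_eq[OF C_pos] mult.commute)
  finally have "G x \<le> y" by simp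
  then show ?thesis using x c by (intro exI[of _ x]) auto
qed

text \<open>The mirror image of \<open>G_low\<close>: near the zero \<open>b\<close> the bound
  \<open>v u \<le> C * (b - u)\<close> makes \<open>G x + ln (b - x) / C\<close>
  nondecreasing.\<close>

lemma G_high: "\<exists>x. a < x \<and> x < b \<and> y \<le> G x"
proof -
  define c where "c = (a + b) / 2"
  have c: "a < c" "c < b" using ab by (auto simp: c_def)
  have mono: "G c + ln (b - c) / C \<le> G x + ln (b - x) / C" if x: "c \<le> x" "x < b" for x
  proof (rule DERIV_nonneg_imp_nondecreasing[of c x "\<lambda>x. G x + ln (b - x) / C"])
    fix u assume u: "c \<le> u" "u \<le> x"
    have "((\<lambda>x. G x + ln (b - x) / C) has_real_derivative 1 / v u + - 1 / (b - u) / C) (at u)"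
      using u x c C_pos by (auto intro!: derivative_eq_intros G_deriv)
    moreover have "1 / v u + - 1 / (b - u) / C \<ge> 0"
    proof -
      have "\<bar>v u - v b\<bar> \<le> C * \<bar>u - b\<bar>" using u x c a0 by (intro lip) auto
      then have "v u \<le> C * (b - u)" using zero[of b] a0 ab u x by simp
      moreover have "v u > 0" using u x c by (intro pos) auto
      ultimately show ?thesis using C_pos u x by (simp add: frac_le divide_simps mult.commute)
    qed
    ultimately show "\<exists>y. ((\<lambda>x. G x + ln (b - x) / C) has_real_derivative y) (at u) \<and> 0 \<le> y" by blast
  qed (use x in auto)
  define x where "x = b - min (b - c) (exp (C * (G c + ln (b - c) / C - y)))"
  have x: "c \<le> x" "x < b" using c by (auto simp: x_def)
  have "ln (b - x) \<le> C * (G c + ln (b - c) / C - y)"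
  proof -
    have "b - x \<le> exp (C * (G c + ln (b - c) / C - y))" by (simp add: x_def)
    then have "ln (b - x) \<le> ln (exp (C * (G c + ln (b - c) / C - y)))" using x by (intro ln_mono) auto
    then show ?thesis by simp
  qed
  then have "ln (b - x) / C \<le> G c + ln (b - c) / C - y" by (simp only: pos_divide_le_eq[OF C_pos] mult.commute)
  then have "y \<le> G x" using mono[OF x] by simp
  then show ?thesis using x c by (intro exI[of _ x]) auto
qed

definition Gi :: "real \<Rightarrow> real" where "Gi y = (THE x. a < x \<and> x < b \<and> G x = y)"

lemma Gi: "a < Gi y" "Gi y < b" "G (Gi y) = y"
proof -
  obtain x1 x2 where x: "a < x1" "x1 < b" "G x1 \<le> y" "a < x2" "x2 < b" "y \<le> G x2"
    using G_low[of y] G_high[of y] by blast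
  have le: "x1 \<le> x2" using G_mono[of x2 x1] x by (cases "x2 < x1") auto
  have "\<exists>x\<ge>x1. x \<le> x2 \<and> G x = y"
    by (rule IVT) (use x le in \<open>auto intro!: G_isCont\<close>)
  then obtain x0 where "x1 \<le> x0" "x0 \<le> x2" "G x0 = y" by blast
  then have x0: "a < x0 \<and> x0 < b \<and> G x0 = y" using x by simp
  have "a < Gi y \<and> Gi y < b \<and> G (Gi y) = y"
    unfolding Gi_def by (rule theI[of _ x0]) (use x0 inj_onD[OF G_inj] in auto)
  then show "a < Gi y" "Gi y < b" "G (Gi y) = y" by auto
qed

lemma Gi_G: "a < x \<Longrightarrow> x < b \<Longrightarrow> Gi (G x) = x"
  using inj_onD[OF G_inj, of "Gi (G x)" x] Gi[of "G x"] by auto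

lemma Gi_isCont: "isCont Gi y"
proof -
  let ?x = "Gi y"
  have x: "a < ?x" "?x < b" using Gi by auto
  have "isCont Gi (G ?x)"
    by (rule isCont_inverse_function2[where a="(a + ?x) / 2" and b="(b + ?x) / 2"]) (use x in \<open>auto intro!: Gi_G G_isCont\<close>)
  then show ?thesis by (simp add: Gi)
qed

text \<open>Inverse function rule for \<open>G' = 1 / v\<close>: \<open>Gi\<close> is itself a
  trajectory of the field, and the other trajectories inside the interval are its time
  shifts.\<close>

lemma Gi_deriv: "(Gi has_real_derivative v (Gi y)) (at y)"
proof -
  have "(Gi has_real_derivative inverse (1 / v (Gi y))) (at y)"
  proof (rule DERIV_inverse_function[where f=G and a="y - 1" and b="y + 1"])
    show "(G has_real_derivative 1 / v (Gi y)) (at (Gi y))" by (rule G_deriv[OF Gi(1,2)])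
    show "1 / v (Gi y) \<noteq> 0" using pos[OF Gi(1,2), of y] by simp
  qed (use Gi Gi_isCont in auto)
  then show ?thesis by simp
qed

lemma Gi_mono: "x < y \<Longrightarrow> Gi x < Gi y"
  using G_mono[of "Gi y" "Gi x"] Gi[of x] Gi[of y] by (cases "Gi x" "Gi y" rule: linorder_cases) auto

section \<open>The flow map and its Jacobian\<close>

definition flow :: "real \<Rightarrow> real \<Rightarrow> real" where
  "flow t x = (if a < x \<and> x < b then Gi (G x + t) else x)"

definition jac :: "real \<Rightarrow> real \<Rightarrow> real" where
  "jac t x = (if a < x \<and> x < b then v (flow t x) / v x else 1)"

lemma flow_mem: "a < flow t x \<and> flow t x < b \<longleftrightarrow> a < x \<and> x < b"
  using Gi by (auto simp: flow_def)

lemma flow_0: "flow 0 x = x" by (simp add: flow_def Gi_G)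

lemma flow_add: "flow (s + t) x = flow s (flow t x)"
  using Gi by (auto simp: flow_def add_ac)

lemma flow_nonneg: "x \<ge> 0 \<Longrightarrow> flow t x \<ge> 0"
  using Gi(1)[of "G x + t"] a0 by (auto simp: flow_def)

text \<open>Time is rescaled so that the time \<open>t\<close> of the field \<open>v\<close> becomes
  the time \<open>1\<close> of the field \<open>t * v\<close>, the form in which
  \<open>stretch\<close> poses the equation.\<close>

lemma flow_ode: "x \<ge> 0 \<Longrightarrow> ((\<lambda>s. flow (s * t) x) has_real_derivative t * v (flow (s * t) x)) (at s)"
proof (cases "a < x \<and> x < b")
  case True
  have "((\<lambda>s. Gi (G x + s * t)) has_real_derivative v (Gi (G x + s * t)) * t) (at s)"
    by (rule DERIV_chain2[OF Gi_deriv]) (auto intro!: derivative_eq_intros)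
  with True show ?thesis by (simp add: flow_def[abs_def] mult.commute)
next
  case False
  assume "x \<ge> 0"
  then have "v x = 0" using False by (intro zero) auto
  with False show ?thesis by (auto simp: flow_def[abs_def])
qed

lemma flow_lip:
  assumes "x \<ge> 0" "y \<ge> 0"
  shows "\<bar>flow t x - flow t y\<bar> \<le> exp (C * \<bar>t\<bar>) * \<bar>x - y\<bar>"
  using ode_gronwall[of v C "\<lambda>s. flow (s * t) x" t "\<lambda>s. flow (s * t) y", OF lip] assms flow_nonneg has_field_derivative_at_within[OF flow_ode]
  by (simp add: flow_0)

lemma flow_deriv:
  assumes "a < x" "x < b"
  shows "(flow t has_real_derivative jac t x) (at x)"
proof -
  have "((\<lambda>x. Gi (G x + t)) has_real_derivative v (Gi (G x + t)) * (1 / v x + 0)) (at x)"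
    by (rule DERIV_chain2[OF Gi_deriv]) (intro derivative_intros G_deriv assms)
  then have "((\<lambda>x. Gi (G x + t)) has_real_derivative jac t x) (at x)" using assms by (simp add: jac_def flow_def)
  then show ?thesis
    by (rule has_field_derivative_transform_within_open[where S="{a<..<b}"]) (use assms in \<open>auto simp: flow_def\<close>)
qed

lemma jac_pos: "jac t x > 0"
  using pos[of x] pos[of "flow t x"] flow_mem[of t x] by (auto simp: jac_def)

text \<open>Inside the interval \<open>jac\<close> is the derivative of \<open>flow t\<close>, hence
  a limit of difference quotients, and these are bounded by the Lipschitz constant of
  \<open>flow_lip\<close>.\<close>

lemma jac_upper: "jac t x \<le> exp (C * \<bar>t\<bar>)"
proof (cases "a < x \<and> x < b")
  case True
  have "((\<lambda>h. (flow t (x + h) - flow t x) / h) \<longlongrightarrow> jac t x) (at 0)"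
    using flow_deriv[of x t] True by (simp add: DERIV_def)
  then show ?thesis
  proof (rule tendsto_upperbound)
    have "eventually (\<lambda>h. dist h 0 < x - a) (at 0)" using True by (intro eventually_at_topological[THEN iffD2] exI[of _ "ball 0 (x - a)"]) (auto simp: dist_commute)
    moreover have "eventually (\<lambda>h::real. h \<noteq> 0) (at 0)" by (simp add: eventually_at_filter)
    ultimately show "eventually (\<lambda>h. (flow t (x + h) - flow t x) / h \<le> exp (C * \<bar>t\<bar>)) (at 0)"
    proof eventually_elim
      case (elim h)
      have "\<bar>flow t (x + h) - flow t x\<bar> \<le> exp (C * \<bar>t\<bar>) * \<bar>(x + h) - x\<bar>" using True elim a0 by (intro flow_lip) (auto simp: dist_real_def)
      then have "\<bar>(flow t (x + h) - flow t x) / h\<bar> \<le> exp (C * \<bar>t\<bar>)" using elim by (simp add: field_simps)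
      then show ?case by linarith
    qed
  qed simp
qed (use C_pos in \<open>auto simp: jac_def\<close>)

text \<open>The Jacobians of \<open>flow t\<close> and of its inverse \<open>flow (- t)\<close> at
  the image point multiply to \<open>1\<close>, so the upper bound for the inverse is a lower bound
  here.\<close>

lemma jac_lower: "exp (- (C * \<bar>t\<bar>)) \<le> jac t x"
proof -
  have "jac t x * jac (- t) (flow t x) = 1"
  proof (cases "a < x \<and> x < b")
    case True
    then have "flow (- t) (flow t x) = x" by (simp add: flow_add[symmetric] flow_0)
    then show ?thesis using True flow_mem[of t x] pos[of x] pos[of "flow t x"] by (simp add: jac_def)
  next
    case False
    then have "flow t x = x" by (simp only: flow_def if_False)
    with False show ?thesis by (simp only: jac_def if_False mult_1)
  qed
  then have "jac t x = 1 / jac (- t) (flow t x)" using jac_pos[of "-t" "flow t x"] by (simp add: field_simps)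
  also have "\<dots> \<ge> 1 / exp (C * \<bar>- t\<bar>)" using jac_upper[of "-t" "flow t x"] jac_pos[of "-t" "flow t x"] by (intro divide_left_mono) auto
  finally show ?thesis by (simp add: exp_minus inverse_eq_divide)
qed

lemma flow_meas: "(\<lambda>(t, x). flow t x) \<in> borel_measurable (borel \<Otimes>\<^sub>M borel)"
proof -
  have "continuous_on {a<..<b} G" using G_isCont by (auto intro!: continuous_at_imp_continuous_on)
  then have [measurable]: "(\<lambda>x. if x \<in> {a<..<b} then G x else 0) \<in> borel_measurable borel"
    by (intro borel_measurable_continuous_on_if) auto
  have [measurable]: "Gi \<in> borel_measurable borel"
    using Gi_isCont by (intro borel_measurable_continuous_onI continuous_at_imp_continuous_on) auto
  have "(\<lambda>(t, x). if x \<in> {a<..<b} then Gi ((if x \<in> {a<..<b} then G x else 0) + t) else x) \<in> borel_measurable (borel \<Otimes>\<^sub>M borel)"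
    by measurable
  also have "(\<lambda>(t, x). if x \<in> {a<..<b} then Gi ((if x \<in> {a<..<b} then G x else 0) + t) else x) = (\<lambda>(t, x). flow t x)"
    by (auto simp: flow_def)
  finally show ?thesis .
qed

lemma jac_meas: "(\<lambda>(t, x). jac t x) \<in> borel_measurable (borel \<Otimes>\<^sub>M borel)"
proof -
  have "continuous_on {a<..<b} v" using a0 by (intro continuous_on_subset[OF v_cont]) auto
  then have [measurable]: "(\<lambda>x. if x \<in> {a<..<b} then v x else 0) \<in> borel_measurable borel"
    by (intro borel_measurable_continuous_on_if) auto
  note [measurable] = flow_meas
  let ?w = "\<lambda>x. if x \<in> {a<..<b} then v x else 0"
  have "(\<lambda>(t, x). if x \<in> {a<..<b} then ?w (flow t x) / ?w x else 1) \<in> borel_measurable (borel \<Otimes>\<^sub>M borel)"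
    by measurable
  also have "(\<lambda>(t, x). if x \<in> {a<..<b} then ?w (flow t x) / ?w x else 1) = (\<lambda>(t, x). jac t x)"
    using flow_mem by (auto simp: jac_def fun_eq_iff)
  finally show ?thesis .
qed

text \<open>In the coordinate \<open>G\<close> the flow is a shift by \<open>t\<close>, so it
  carries the compact interval from \<open>\<alpha> n\<close> to \<open>\<beta> n\<close> onto the
  one from \<open>\<alpha>' n\<close> to \<open>\<beta>' n\<close>. Substitution is performed on
  these, where \<open>jac t\<close> is continuous; both families exhaust the open interval, and
  monotone convergence concludes.\<close>

lemma nn_integral_flow:
  fixes f :: "real \<Rightarrow> ennreal"
  assumes [measurable]: "f \<in> borel_measurable borel"
  shows "(\<integral>\<^sup>+x. f (flow t x) * ennreal (jac t x) * indicator {a<..<b} x \<partial>lborel) = (\<integral>\<^sup>+x. f x * indicator {a<..<b} x \<partial>lborel)"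
proof -
  define \<alpha> where "\<alpha> n = Gi (- (real n + 1))" for n
  define \<beta> where "\<beta> n = Gi (real n + 1)" for n
  define \<alpha>' where "\<alpha>' n = Gi (- (real n + 1) + t)" for n
  define \<beta>' where "\<beta>' n = Gi (real n + 1 + t)" for n
  have [measurable]: "flow t \<in> borel_measurable borel" "jac t \<in> borel_measurable borel"
    using measurable_compose[OF measurable_Pair1' flow_meas, of t] measurable_compose[OF measurable_Pair1' jac_meas, of t] by simp_all
  have ab': "a < \<alpha> n" "\<alpha> n < \<beta> n" "\<beta> n < b" for n using Gi Gi_mono[of "- (real n + 1)" "real n + 1"] by (auto simp: \<alpha>_def \<beta>_def)
  have fl: "flow t (\<alpha> n) = \<alpha>' n" "flow t (\<beta> n) = \<beta>' n" for n
    using Gi by (auto simp: \<alpha>_def \<beta>_def \<alpha>'_def \<beta>'_def flow_def)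
  have step: "(\<integral>\<^sup>+x. f x * indicator {\<alpha>' n..\<beta>' n} x \<partial>lborel) = (\<integral>\<^sup>+x. f (flow t x) * ennreal (jac t x) * indicator {\<alpha> n..\<beta> n} x \<partial>lborel)" for n
    unfolding fl[symmetric]
  proof (rule nn_integral_substitution_aux)
    show "(flow t has_real_derivative jac t x) (at x)" if "x \<in> {\<alpha> n..\<beta> n}" for x
      using that ab'[of n] by (intro flow_deriv) auto
    show "continuous_on {\<alpha> n..\<beta> n} (jac t)"
    proof -
      have "continuous_on {\<alpha> n..\<beta> n} (\<lambda>x. v (flow t x) / v x)"
      proof (intro continuous_intros)
        have "continuous_on {\<alpha> n..\<beta> n} (flow t)"
          using ab'[of n] by (intro continuous_at_imp_continuous_on ballI DERIV_isCont[OF flow_deriv]) auto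
        then show "continuous_on {\<alpha> n..\<beta> n} (\<lambda>x. v (flow t x))"
          by (rule continuous_on_compose2[OF v_cont]) (use ab'[of n] a0 flow_nonneg in auto)
        show "continuous_on {\<alpha> n..\<beta> n} v" using ab'[of n] a0 by (intro continuous_on_subset[OF v_cont]) auto
        show "\<forall>x\<in>{\<alpha> n..\<beta> n}. v x \<noteq> 0"
        proof
          fix x assume "x \<in> {\<alpha> n..\<beta> n}"
          then show "v x \<noteq> 0" using pos[of x] ab'[of n] by auto
        qed
      qed
      then show ?thesis by (rule continuous_on_eq) (use ab'[of n] in \<open>auto simp: jac_def\<close>)
    qed
  qed (use ab' jac_pos in \<open>auto intro: less_imp_le\<close>)
  have sup1: "(\<integral>\<^sup>+x. f x * indicator {a<..<b} x \<partial>lborel) = (SUP n. \<integral>\<^sup>+x. f x * indicator {\<gamma> n..\<delta> n} x \<partial>lborel)"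
    if f: "f \<in> borel_measurable borel" and \<gamma>: "\<gamma> = (\<lambda>n. Gi (- (real n + 1) + s))" and \<delta>: "\<delta> = (\<lambda>n. Gi (real n + 1 + s))" for f :: "real \<Rightarrow> ennreal" and s \<gamma> \<delta>
  proof -
    have Gm: "x \<le> y \<Longrightarrow> Gi x \<le> Gi y" for x y using Gi_mono[of x y] by (cases "x = y") auto
    have inc: "incseq (\<lambda>n x. f x * indicator {\<gamma> n..\<delta> n} x)"
    proof (intro incseq_SucI le_funI mult_left_mono)
      fix n x
      have "\<gamma> (Suc n) \<le> \<gamma> n" "\<delta> n \<le> \<delta> (Suc n)" unfolding \<gamma> \<delta> by (auto intro!: Gm)
      then show "indicator {\<gamma> n..\<delta> n} x \<le> (indicator {\<gamma> (Suc n)..\<delta> (Suc n)} x :: ennreal)" by (auto simp: indicator_def)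
    qed simp
    have "f x * indicator {a<..<b} x = (SUP n. f x * indicator {\<gamma> n..\<delta> n} x)" for x
    proof (cases "a < x \<and> x < b")
      case True
      obtain N :: nat where N: "\<bar>G x\<bar> + \<bar>s\<bar> < real N" using reals_Archimedean2 by blast
      have "\<gamma> N \<le> Gi (G x)" "Gi (G x) \<le> \<delta> N" unfolding \<gamma> \<delta> using N by (auto intro!: Gm)
      then have xN: "x \<in> {\<gamma> N..\<delta> N}" using True by (simp add: Gi_G)
      show ?thesis
      proof (rule antisym)
        show "f x * indicator {a<..<b} x \<le> (SUP n. f x * indicator {\<gamma> n..\<delta> n} x)"
          using True xN by (intro SUP_upper2[of N]) auto
        show "(SUP n. f x * indicator {\<gamma> n..\<delta> n} x) \<le> f x * indicator {a<..<b} x"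
          using True by (intro SUP_least mult_left_mono) (auto simp: indicator_def)
      qed
    next
      case False
      then have "x \<notin> {\<gamma> n..\<delta> n}" for n unfolding \<gamma> \<delta> using Gi(1)[of "- (real n + 1) + s"] Gi(2)[of "real n + 1 + s"] by auto
      with False show ?thesis by simp
    qed
    then show ?thesis using f by (subst nn_integral_monotone_convergence_SUP[OF inc, symmetric]) (auto simp: image_comp)
  qed
  have "(\<integral>\<^sup>+x. f x * indicator {a<..<b} x \<partial>lborel) = (SUP n. \<integral>\<^sup>+x. f x * indicator {\<alpha>' n..\<beta>' n} x \<partial>lborel)"
    by (rule sup1[where s=t]) (auto simp: \<alpha>'_def \<beta>'_def)
  also have "\<dots> = (SUP n. \<integral>\<^sup>+x. f (flow t x) * ennreal (jac t x) * indicator {\<alpha> n..\<beta> n} x \<partial>lborel)" unfolding step ..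
  also have "\<dots> = (\<integral>\<^sup>+x. f (flow t x) * ennreal (jac t x) * indicator {a<..<b} x \<partial>lborel)"
    by (rule sup1[where s=0, symmetric]) (auto simp: \<alpha>_def \<beta>_def)
  finally show ?thesis ..
qed

end

section \<open>Poisson configurations\<close>

lemma finite_separated:
  fixes S :: "'a::metric_space set"
  assumes "finite S"
  shows "\<exists>d>0. \<forall>x\<in>S. \<forall>y\<in>S. x \<noteq> y \<longrightarrow> d \<le> dist x y"
proof -
  let ?A = "insert 1 ((\<lambda>(x, y). dist x y) ` {(x, y) \<in> S \<times> S. x \<noteq> y})"
  have f: "finite ?A" by (intro finite.insertI finite_imageI finite_subset[OF _ finite_cartesian_product[OF assms assms]]) auto
  have "Min ?A \<in> ?A" by (rule Min_in[OF f]) auto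
  then have "Min ?A > 0" by auto
  moreover have "Min ?A \<le> dist x y" if "x \<in> S" "y \<in> S" "x \<noteq> y" for x y
    by (rule Min_le[OF f]) (use that in force)
  ultimately show ?thesis by blast
qed

locale poisson_config =
  fixes \<mu> :: "'u::metric_space measure" and P :: "'u config measure" and C :: "'u set"
  assumes mark: "mark_measure \<mu>" and law: "poisson_law \<mu> P"
    and C: "countable C" and C_AE: "AE u in \<mu>. u \<in> closure C"
begin

abbreviation \<Lambda> :: "(real \<times> 'u) measure" where "\<Lambda> \<equiv> intensity \<mu>"

lemma sets_\<mu>: "sets \<mu> = sets borel" and space_\<mu>: "space \<mu> = UNIV"
  using mark sets_eq_imp_space_eq[of \<mu> borel] by (auto simp: mark_measure_def)

lemma \<mu>_bounded: "B \<in> sets borel \<Longrightarrow> bounded B \<Longrightarrow> emeasure \<mu> B < \<infinity>"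
  using mark by (auto simp: mark_measure_def)

sublocale \<mu>: sigma_finite_measure \<mu> using mark by (simp add: mark_measure_def)

sublocale T: sigma_finite_measure "restrict_space lborel {0::real..}"
  by (rule sigma_finite_measure_restrict_space) (auto intro: sigma_finite_lborel)

sublocale T\<mu>: pair_sigma_finite "restrict_space lborel {0::real..}" \<mu> ..

sublocale P: prob_space P using law by (simp add: poisson_law_def)

lemma space_P: "space P = configs" and sets_P: "sets P = vague_sets"
  using law by (auto simp: poisson_law_def)

lemma space_\<Lambda>: "space \<Lambda> = {0..} \<times> UNIV"
  by (simp add: intensity_def space_pair_measure space_restrict_space space_\<mu>)

lemma rect_in_\<Lambda>: "I \<in> sets borel \<Longrightarrow> I \<subseteq> {0..} \<Longrightarrow> B \<in> sets borel \<Longrightarrow> I \<times> B \<in> sets \<Lambda>"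
  unfolding intensity_def by (intro pair_measureI) (auto simp: sets_restrict_space sets_\<mu>)

lemma emeasure_rect: "I \<in> sets borel \<Longrightarrow> I \<subseteq> {0..} \<Longrightarrow> B \<in> sets borel \<Longrightarrow> emeasure \<Lambda> (I \<times> B) = emeasure lborel I * emeasure \<mu> B"
  unfolding intensity_def
  by (subst \<mu>.emeasure_pair_measure_Times) (auto simp: sets_restrict_space sets_\<mu> emeasure_restrict_space)

lemma bounded_subset_box:
  fixes B :: "(real \<times> 'u) set"
  assumes "bounded B" "B \<subseteq> {0..} \<times> UNIV"
  shows "\<exists>n::nat. B \<subseteq> {0..real n} \<times> ball u0 (real n)"
proof -
  obtain e where e: "\<And>x. x \<in> B \<Longrightarrow> dist (0, u0) x \<le> e" using assms(1) bounded_any_center[of B "(0, u0)"] by auto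
  obtain n :: nat where n: "e < real n" using reals_Archimedean2 by blast
  have "x \<in> {0..real n} \<times> ball u0 (real n)" if "x \<in> B" for x
  proof -
    have "dist 0 (fst x) \<le> e" "dist u0 (snd x) \<le> e"
      using e[OF that] dist_fst_le[of "(0, u0)" x] dist_snd_le[of "(0, u0)" x] by auto
    moreover have "fst x \<ge> 0" using that assms(2) by auto
    ultimately show ?thesis using n by (cases x) auto
  qed
  then show ?thesis by blast
qed

lemma bounded_box: "bounded ({0..r::real} \<times> ball u0 s)"
  using bounded_closed_interval[of "0::real" r] by (intro bounded_Times bounded_ball) simp

lemma emeasure_\<Lambda>_bounded:
  assumes "bounded B" "B \<in> sets \<Lambda>" shows "emeasure \<Lambda> B < \<infinity>"
proof -
  have "B \<subseteq> {0..} \<times> UNIV" using sets.sets_into_space[OF assms(2)] by (simp add: space_\<Lambda>)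
  \<comment> \<open>\<open>undefined\<close> serves as an arbitrary base point of the mark space,
    here and in the boxes below.\<close>
  then obtain n :: nat where n: "B \<subseteq> {0..real n} \<times> ball undefined (real n)" using bounded_subset_box[OF assms(1)] by blast
  have "emeasure \<Lambda> B \<le> emeasure \<Lambda> ({0..real n} \<times> ball undefined (real n))"
    by (intro emeasure_mono n rect_in_\<Lambda>) auto
  also have "\<dots> = ennreal (real n) * emeasure \<mu> (ball undefined (real n))"
    by (subst emeasure_rect) auto
  also have "\<dots> < \<infinity>" using \<mu>_bounded[of "ball undefined (real n)"] by (auto simp: ennreal_mult_less_top)
  finally show ?thesis .
qed

lemma config_finite: "\<omega> \<in> configs \<Longrightarrow> bounded B \<Longrightarrow> finite (\<omega> \<inter> B)"
  by (auto simp: configs_def)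

lemma card_measurable:
  assumes "B \<in> sets \<Lambda>" "bounded B"
  shows "(\<lambda>\<omega>. card (\<omega> \<inter> B)) \<in> P \<rightarrow>\<^sub>M count_space UNIV"
proof -
  have "finite {B} \<and> disjoint {B} \<and> (\<forall>B\<in>{B}. B \<in> sets \<Lambda> \<and> bounded B)" using assms by simp
  then have "P.indep_vars (\<lambda>_. count_space UNIV) (\<lambda>B \<omega>. card (\<omega> \<inter> B)) {B}"
    using law unfolding poisson_law_def by blast
  then show ?thesis by (simp add: P.indep_vars_def)
qed

section \<open>Void events and configurations with marks in a separable set\<close>

definition void :: "(real \<times> 'u) set \<Rightarrow> 'u config set" where
  "void B = {\<omega> \<in> configs. \<omega> \<inter> B = {}}"

definition void_gen :: "'u config set set" where
  "void_gen = {void B |B. B \<in> sets \<Lambda> \<and> bounded B}"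

lemma void_card: "bounded B \<Longrightarrow> void B = {\<omega> \<in> space P. card (\<omega> \<inter> B) = 0}"
proof (intro set_eqI)
  fix \<omega> assume B: "bounded B"
  show "\<omega> \<in> void B \<longleftrightarrow> \<omega> \<in> {\<omega> \<in> space P. card (\<omega> \<inter> B) = 0}"
    using config_finite[OF _ B, of \<omega>] by (auto simp: void_def space_P card_eq_0_iff)
qed

lemma void_sets: "B \<in> sets \<Lambda> \<Longrightarrow> bounded B \<Longrightarrow> void B \<in> sets P"
  using measurable_sets[OF card_measurable, of B "{0}"] by (simp add: void_card vimage_def Int_def conj_commute)

lemma void_prob: "B \<in> sets \<Lambda> \<Longrightarrow> bounded B \<Longrightarrow> measure P (void B) = exp (- measure \<Lambda> B)"
proof -
  assume B: "B \<in> sets \<Lambda>" "bounded B"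
  then have "measure P {\<omega> \<in> space P. card (\<omega> \<inter> B) = 0} = measure \<Lambda> B ^ 0 / fact 0 * exp (- measure \<Lambda> B)"
    using law unfolding poisson_law_def by blast
  then show ?thesis by (simp add: void_card[OF B(2)])
qed

text \<open>Avoiding two sets means avoiding their union. Intersection stability makes the class fit
  for uniqueness of measures.\<close>

lemma void_gen_Int_stable: "Int_stable void_gen"
proof (rule Int_stableI)
  fix a b assume "a \<in> void_gen" "b \<in> void_gen"
  then obtain A B where AB: "A \<in> sets \<Lambda>" "bounded A" "B \<in> sets \<Lambda>" "bounded B" "a = void A" "b = void B" by (auto simp: void_gen_def)
  then have "a \<inter> b = void (A \<union> B)" by (auto simp: void_def)
  then show "a \<inter> b \<in> void_gen" using AB by (auto simp: void_gen_def)
qed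

lemma void_gen_subset: "void_gen \<subseteq> Pow configs" by (auto simp: void_gen_def void_def)

lemma sigma_void_subset: "sigma_sets configs void_gen \<subseteq> sets P"
  unfolding space_P[symmetric] by (rule sets.sigma_sets_subset) (auto simp: void_gen_def void_sets)

text \<open>Almost every configuration has its marks in the separable set \<open>closure C\<close>; there the vague Borel
  sets are generated by the void events, which form an intersection-stable class.\<close>

definition conf0 :: "'u config set" where
  "conf0 = {\<omega> \<in> configs. \<omega> \<subseteq> {0..} \<times> closure C}"

lemma conf0_eq: "conf0 = (\<Inter>n::nat. void ({0..real n} \<times> (ball undefined (real n) - closure C)))"
proof (intro set_eqI iffI)
  fix \<omega> assume "\<omega> \<in> conf0" then show "\<omega> \<in> (\<Inter>n::nat. void ({0..real n} \<times> (ball undefined (real n) - closure C)))"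
    by (auto simp: conf0_def void_def)
next
  fix \<omega> assume w: "\<omega> \<in> (\<Inter>n::nat. void ({0..real n} \<times> (ball undefined (real n) - closure C)))"
  then have c: "\<omega> \<in> configs" by (auto simp: void_def)
  have "x \<in> {0..} \<times> closure C" if x: "x \<in> \<omega>" for x
  proof -
    have x0: "x \<in> {0..} \<times> UNIV" using c x by (auto simp: configs_def)
    obtain n :: nat where "{x} \<subseteq> {0..real n} \<times> ball undefined (real n)" using bounded_subset_box[of "{x}"] x0 by auto
    moreover have "x \<notin> {0..real n} \<times> (ball undefined (real n) - closure C)" using w x by (auto simp: void_def)
    ultimately show ?thesis using x0 by (cases x) auto
  qed
  then show "\<omega> \<in> conf0" using c by (auto simp: conf0_def)
qed

lemma conf0_box: "{0..real n} \<times> (ball undefined (real n) - closure C) \<in> sets \<Lambda>" "bounded ({0..real n} \<times> (ball undefined (real n) - closure C))"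
proof -
  show "{0..real n} \<times> (ball undefined (real n) - closure C) \<in> sets \<Lambda>" by (rule rect_in_\<Lambda>) auto
  show "bounded ({0..real n} \<times> (ball undefined (real n) - closure C))" by (rule bounded_subset[OF bounded_box[of "real n" undefined "real n"]]) auto
qed

lemma conf0_sigma: "conf0 \<in> sigma_sets configs void_gen"
proof -
  interpret s: sigma_algebra configs "sigma_sets configs void_gen" by (rule sigma_algebra_sigma_sets[OF void_gen_subset])
  show ?thesis unfolding conf0_eq
    by (intro s.countable_INT) (auto simp: void_gen_def intro!: sigma_sets.Basic conf0_box)
qed

lemma conf0_sets: "conf0 \<in> sets P" using conf0_sigma sigma_void_subset by blast

text \<open>The complement of \<open>closure C\<close> is a null set for \<open>\<mu>\<close>, so
  the part of each box over it has intensity zero and is avoided with probability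
  \<open>exp 0 = 1\<close>; countably many boxes suffice.\<close>

lemma AE_conf0: "AE \<omega> in P. \<omega> \<in> conf0"
proof -
  have "AE \<omega> in P. \<omega> \<in> void ({0..real n} \<times> (ball undefined (real n) - closure C))" for n :: nat
  proof (rule P.AE_prob_1)
    have "emeasure \<mu> (ball undefined (real n) - closure C) \<le> emeasure \<mu> (- closure C)"
      by (intro emeasure_mono) (auto simp: sets_\<mu>)
    also have "\<dots> = 0" using C_AE by (subst (asm) AE_iff_measurable[of "- closure C"]) (auto simp: sets_\<mu> space_\<mu>)
    finally have "emeasure \<Lambda> ({0..real n} \<times> (ball undefined (real n) - closure C)) = 0"
      by (subst emeasure_rect) auto
    then have "measure \<Lambda> ({0..real n} \<times> (ball undefined (real n) - closure C)) = 0" by (simp add: measure_def)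
    then show "measure P (void ({0..real n} \<times> (ball undefined (real n) - closure C))) = 1"
      by (simp add: void_prob[OF conf0_box])
  qed
  then have "AE \<omega> in P. \<forall>n::nat. \<omega> \<in> void ({0..real n} \<times> (ball undefined (real n) - closure C))" by (simp add: AE_all_countable)
  then show ?thesis by eventually_elim (auto simp: conf0_eq)
qed

section \<open>Vague Borel sets in terms of void events\<close>

definition base :: "(real \<times> 'u) set set" where
  "base = (\<lambda>(q1, q2, c, n). ({real_of_rat q1<..<real_of_rat q2} \<inter> {0..}) \<times> ball c (1 / real (Suc n))) ` (UNIV \<times> UNIV \<times> C \<times> UNIV)"

lemma countable_base: "countable base" unfolding base_def using C by (intro countable_image countable_SIGMA) auto

lemma base_sets: "D \<in> base \<Longrightarrow> D \<in> sets \<Lambda>" unfolding base_def by (auto intro!: rect_in_\<Lambda>)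

text \<open>Here separability enters: with centres in the countable set \<open>C\<close>, rational
  end points and radii \<open>1 / (n + 1)\<close>, the countable family \<open>base\<close> contains
  arbitrarily small neighbourhoods of every point with mark in \<open>closure C\<close>.\<close>

lemma base_nhd:
  assumes x: "x \<in> {0..} \<times> closure C" and d: "d > 0"
  shows "\<exists>D\<in>base. x \<in> D \<and> D \<subseteq> ball x d"
proof -
  obtain \<tau> u where xe: "x = (\<tau>, u)" "\<tau> \<ge> 0" "u \<in> closure C" using x by auto
  obtain n :: nat where n: "1 / real (Suc n) < d / 4" using nat_approx_posE[of "d/4"] d by auto
  obtain c where c: "c \<in> C" "dist c u < 1 / real (Suc n)"
    using xe(3) unfolding closure_approachable by (metis of_nat_0_less_iff zero_less_Suc zero_less_divide_1_iff)
  obtain q1 where q1: "\<tau> - d / 4 < real_of_rat q1" "real_of_rat q1 < \<tau>" using of_rat_dense[of "\<tau> - d/4" \<tau>] d by auto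
  obtain q2 where q2: "\<tau> < real_of_rat q2" "real_of_rat q2 < \<tau> + d / 4" using of_rat_dense[of \<tau> "\<tau> + d/4"] d by auto
  define D where "D = ({real_of_rat q1<..<real_of_rat q2} \<inter> {0..}) \<times> ball c (1 / real (Suc n))"
  have "D \<in> base" unfolding D_def base_def using c(1) by (auto intro!: image_eqI[of _ _ "(q1, q2, c, n)"])
  moreover have "x \<in> D" unfolding D_def xe using q1 q2 c xe by auto
  moreover have "D \<subseteq> ball x d"
  proof
    fix y assume "y \<in> D"
    then obtain \<tau>' u' where y: "y = (\<tau>', u')" "real_of_rat q1 < \<tau>'" "\<tau>' < real_of_rat q2" "dist c u' < 1 / real (Suc n)" by (auto simp: D_def)
    have "dist \<tau> \<tau>' < d / 4" using y(2,3) q1 q2 unfolding dist_real_def by linarith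
    moreover have "dist u u' < d / 2" using dist_triangle[of u u' c] y c n by (simp add: dist_commute)
    moreover have "dist x y \<le> dist \<tau> \<tau>' + dist u u'" unfolding xe y dist_Pair_Pair by (rule sqrt_sum_squares_le_sum) auto
    ultimately show "y \<in> ball x d" using d by simp
  qed
  ultimately show ?thesis by blast
qed

lemma base_separate:
  assumes S: "finite S" "S \<subseteq> {0..} \<times> closure C" and d: "d > 0"
  shows "\<exists>D. (\<forall>x\<in>S. D x \<in> base \<and> x \<in> D x \<and> D x \<subseteq> ball x d) \<and> (\<forall>x\<in>S. \<forall>y\<in>S. x \<noteq> y \<longrightarrow> D x \<inter> D y = {})"
proof -
  obtain e where e: "e > 0" "\<And>x y. x \<in> S \<Longrightarrow> y \<in> S \<Longrightarrow> x \<noteq> y \<Longrightarrow> e \<le> dist x y" using finite_separated[OF S(1)] by blast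
  \<comment> \<open>Two balls of radius at most half the minimal distance \<open>e\<close> of
    distinct points of \<open>S\<close> cannot meet.\<close>
  define r where "r = min d (e / 2)"
  have r: "r > 0" using d e by (simp add: r_def)
  have "\<forall>x\<in>S. \<exists>D\<in>base. x \<in> D \<and> D \<subseteq> ball x r" using base_nhd[OF _ r] S(2) by blast
  then obtain D where D: "\<And>x. x \<in> S \<Longrightarrow> D x \<in> base \<and> x \<in> D x \<and> D x \<subseteq> ball x r" by metis
  have "D x \<inter> D y = {}" if "x \<in> S" "y \<in> S" "x \<noteq> y" for x y
  proof (rule ccontr)
    assume "D x \<inter> D y \<noteq> {}"
    then obtain z where z: "z \<in> D x" "z \<in> D y" by blast
    then have "dist x z < r" "dist y z < r" using subsetD[of "D x" "ball x r" z] subsetD[of "D y" "ball y r" z] D[OF that(1)] D[OF that(2)] by simp_all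
    then have "dist x y < e" using dist_triangle2[of x y z] by (simp add: r_def)
    then show False using e(2)[OF that] by simp
  qed
  moreover have "D x \<subseteq> ball x d" if "x \<in> S" for x using D[OF that] by (auto simp: r_def)
  ultimately show ?thesis using D by blast
qed

text \<open>Membership in the sigma-algebra of the void events up to what happens off
  \<open>conf0\<close>. A configuration with marks outside \<open>closure C\<close> is not resolved
  by \<open>base\<close>, so equality can be expected of traces only.\<close>

definition trace0 :: "'u config set \<Rightarrow> bool" where
  "trace0 S \<longleftrightarrow> (\<exists>S'\<in>sigma_sets configs void_gen. S \<inter> conf0 = S' \<inter> conf0)"

lemma trace0_compl: "trace0 S \<Longrightarrow> trace0 (configs - S)"
proof -
  assume "trace0 S"
  then obtain S' where S': "S' \<in> sigma_sets configs void_gen" "S \<inter> conf0 = S' \<inter> conf0" by (auto simp: trace0_def)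
  have "(configs - S) \<inter> conf0 = (configs - S') \<inter> conf0" using S'(2) by blast
  then show ?thesis using sigma_sets.Compl[OF S'(1)] by (auto simp: trace0_def)
qed

lemma trace0_UN:
  assumes "countable I" "\<And>i. i \<in> I \<Longrightarrow> trace0 (S i)" shows "trace0 (\<Union>i\<in>I. S i)"
proof -
  interpret s: sigma_algebra configs "sigma_sets configs void_gen" by (rule sigma_algebra_sigma_sets[OF void_gen_subset])
  obtain S' where S': "\<And>i. i \<in> I \<Longrightarrow> S' i \<in> sigma_sets configs void_gen \<and> S i \<inter> conf0 = S' i \<inter> conf0"
    using assms(2) unfolding trace0_def by metis
  have "(\<Union>i\<in>I. S i) \<inter> conf0 = (\<Union>i\<in>I. S' i) \<inter> conf0" using S' by blast
  moreover have "(\<Union>i\<in>I. S' i) \<in> sigma_sets configs void_gen"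
    by (rule s.countable_UN'[OF assms(1)]) (use S' in auto)
  ultimately show ?thesis by (auto simp: trace0_def)
qed

lemma trace0_cong: "S \<inter> conf0 = T \<inter> conf0 \<Longrightarrow> trace0 S = trace0 T" by (simp add: trace0_def)

lemma conf0_configs: "conf0 \<subseteq> configs" by (auto simp: conf0_def)

lemma trace0_INT:
  assumes "countable I" "\<And>i. i \<in> I \<Longrightarrow> trace0 (S i)" shows "trace0 (configs \<inter> (\<Inter>i\<in>I. S i))"
proof -
  have "trace0 (configs - (\<Union>i\<in>I. configs - S i))"
    by (intro trace0_compl trace0_UN assms(1)) (use assms(2) in auto)
  moreover have "configs - (\<Union>i\<in>I. configs - S i) = configs \<inter> (\<Inter>i\<in>I. S i)" by blast
  ultimately show ?thesis by simp
qed

lemma trace0_void: "B \<in> sets \<Lambda> \<Longrightarrow> bounded B \<Longrightarrow> trace0 (void B)"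
  unfolding trace0_def by (rule bexI[of _ "void B"]) (auto simp: void_gen_def intro: sigma_sets.Basic)

lemma trace0_hit: "B \<in> sets \<Lambda> \<Longrightarrow> bounded B \<Longrightarrow> trace0 {\<omega> \<in> configs. \<omega> \<inter> B \<noteq> {}}"
proof -
  assume B: "B \<in> sets \<Lambda>" "bounded B"
  have "{\<omega> \<in> configs. \<omega> \<inter> B \<noteq> {}} = configs - void B" by (auto simp: void_def)
  then show ?thesis using trace0_compl[OF trace0_void[OF B]] by simp
qed

text \<open>On \<open>conf0\<close> at least \<open>k\<close> points lie in \<open>B\<close> exactly
  if \<open>k\<close> pairwise disjoint members of \<open>base\<close> each contain a point of the
  configuration in \<open>B\<close>: distinct points can be separated, and conversely disjoint sets
  pick out distinct points. There are countably many such choices.\<close>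

lemma trace0_card_ge:
  assumes B: "B \<in> sets \<Lambda>" "bounded B"
  shows "trace0 {\<omega> \<in> configs. card (\<omega> \<inter> B) \<ge> k}"
proof -
  define I where "I = {\<D>. \<D> \<subseteq> base \<and> finite \<D> \<and> disjoint \<D> \<and> card \<D> = k}"
  define H where "H \<D> = configs \<inter> (\<Inter>D\<in>\<D>. {\<omega> \<in> configs. \<omega> \<inter> (B \<inter> D) \<noteq> {}})" for \<D>
  have I: "countable I" unfolding I_def
    by (rule countable_subset[OF _ countable_Collect_finite_subset[OF countable_base]]) auto
  have "trace0 (\<Union>\<D>\<in>I. H \<D>)"
  proof (rule trace0_UN[OF I])
    fix \<D> assume D: "\<D> \<in> I"
    show "trace0 (H \<D>)" unfolding H_def
    proof (rule trace0_INT)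
      show "countable \<D>" using D by (auto simp: I_def intro: countable_finite)
      fix D assume "D \<in> \<D>"
      then have "D \<in> sets \<Lambda>" using D base_sets by (auto simp: I_def)
      then show "trace0 {\<omega> \<in> configs. \<omega> \<inter> (B \<inter> D) \<noteq> {}}" using B by (intro trace0_hit bounded_subset[OF B(2)]) auto
    qed
  qed
  moreover have "(\<Union>\<D>\<in>I. H \<D>) \<inter> conf0 = {\<omega> \<in> configs. card (\<omega> \<inter> B) \<ge> k} \<inter> conf0"
  proof (intro set_eqI iffI)
    fix \<omega> assume "\<omega> \<in> (\<Union>\<D>\<in>I. H \<D>) \<inter> conf0"
    then obtain \<D> where D: "\<D> \<in> I" "\<omega> \<in> H \<D>" "\<omega> \<in> conf0" by blast
    then have w: "\<omega> \<in> configs" using conf0_configs by blast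
    have "\<forall>D\<in>\<D>. \<exists>x. x \<in> \<omega> \<inter> (B \<inter> D)" using D(2) by (auto simp: H_def)
    then obtain p where p: "\<And>D. D \<in> \<D> \<Longrightarrow> p D \<in> \<omega> \<inter> (B \<inter> D)" by metis
    have "inj_on p \<D>"
    proof (rule inj_onI)
      fix D D' assume "D \<in> \<D>" "D' \<in> \<D>" "p D = p D'"
      then have "p D \<in> D \<inter> D'" using p[of D] p[of D'] by auto
      moreover have "disjoint \<D>" using D(1) by (simp add: I_def)
      ultimately show "D = D'" using \<open>D \<in> \<D>\<close> \<open>D' \<in> \<D>\<close> by (auto simp: disjoint_def)
    qed
    then have "k = card (p ` \<D>)" using D(1) by (simp add: card_image I_def)
    also have "\<dots> \<le> card (\<omega> \<inter> B)" using p config_finite[OF w B(2)] by (intro card_mono) auto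
    finally show "\<omega> \<in> {\<omega> \<in> configs. card (\<omega> \<inter> B) \<ge> k} \<inter> conf0" using w D by simp
  next
    fix \<omega> assume w: "\<omega> \<in> {\<omega> \<in> configs. card (\<omega> \<inter> B) \<ge> k} \<inter> conf0"
    then obtain S where S: "S \<subseteq> \<omega> \<inter> B" "card S = k" "finite S" by (auto elim: obtain_subset_with_card_n)
    have "S \<subseteq> {0..} \<times> closure C" using S w by (auto simp: conf0_def)
    from base_separate[OF S(3) this, of 1] obtain D where D: "\<And>x. x \<in> S \<Longrightarrow> D x \<in> base \<and> x \<in> D x"
      "\<And>x y. x \<in> S \<Longrightarrow> y \<in> S \<Longrightarrow> x \<noteq> y \<Longrightarrow> D x \<inter> D y = {}" by (metis zero_less_one)
    have "inj_on D S"
    proof (rule inj_onI)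
      fix x y assume "x \<in> S" "y \<in> S" "D x = D y"
      then show "x = y" using D(1)[of x] D(2)[of x y] by auto
    qed
    then have "card (D ` S) = k" using S by (simp add: card_image)
    moreover have "disjoint (D ` S)"
    proof (rule disjointI)
      fix a b assume "a \<in> D ` S" "b \<in> D ` S" "a \<noteq> b"
      then obtain x y where "x \<in> S" "y \<in> S" "a = D x" "b = D y" "x \<noteq> y" by blast
      then show "a \<inter> b = {}" using D(2) by simp
    qed
    ultimately have "D ` S \<in> I" using D(1) S by (auto simp: I_def)
    moreover have "\<omega> \<in> H (D ` S)" using w D(1) S(1) by (fastforce simp: H_def)
    ultimately show "\<omega> \<in> (\<Union>\<D>\<in>I. H \<D>) \<inter> conf0" using w by blast
  qed
  ultimately show ?thesis using trace0_cong by blast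
qed

lemma trace0_card_eq:
  assumes B: "B \<in> sets \<Lambda>" "bounded B"
  shows "trace0 {\<omega> \<in> configs. card (\<omega> \<inter> B) = k}"
proof -
  have "{\<omega> \<in> configs. card (\<omega> \<inter> B) = k} = configs \<inter> (\<Inter>b\<in>UNIV. (if b then {\<omega> \<in> configs. card (\<omega> \<inter> B) \<ge> k} else configs - {\<omega> \<in> configs. card (\<omega> \<inter> B) \<ge> Suc k}))"
    unfolding UNIV_bool by auto
  also have "trace0 \<dots>" by (rule trace0_INT) (auto intro!: trace0_compl trace0_card_ge[OF B])
  finally show ?thesis .
qed

definition box :: "nat \<Rightarrow> (real \<times> 'u) set" where "box n = {0..real n} \<times> ball undefined (real n)"

lemma box_sets: "box n \<in> sets \<Lambda>" "bounded (box n)"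
  unfolding box_def by (auto intro!: rect_in_\<Lambda> bounded_box)

text \<open>If the members of \<open>\<D>\<close> are disjoint, the count forces exactly one point
  of the configuration in each \<open>D \<inter> box n\<close> and no other point in the box. Sums
  of test functions supported in the box are then controlled by the oscillation on the sets
  \<open>D\<close>.\<close>

definition nbh :: "(real \<times> 'u) set set \<times> nat \<Rightarrow> 'u config set" where
  "nbh = (\<lambda>(\<D>, n). {\<omega> \<in> configs. card (\<omega> \<inter> box n) = card \<D> \<and> (\<forall>D\<in>\<D>. \<omega> \<inter> (D \<inter> box n) \<noteq> {})})"

definition nbhs :: "'u config set set" where
  "nbhs = (\<lambda>F. configs \<inter> (\<Inter>p\<in>F. nbh p)) ` {F. finite F \<and> F \<subseteq> {\<D>. finite \<D> \<and> \<D> \<subseteq> base} \<times> UNIV}"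

lemma countable_nbhs: "countable nbhs"
proof -
  have "countable {\<D>. finite \<D> \<and> \<D> \<subseteq> base}" by (rule countable_Collect_finite_subset[OF countable_base])
  then have "countable ({\<D>. finite \<D> \<and> \<D> \<subseteq> base} \<times> (UNIV :: nat set))" by (intro countable_SIGMA) auto
  then show ?thesis unfolding nbhs_def by (intro countable_image countable_Collect_finite_subset)
qed

lemma nbhs_Int: "E \<in> nbhs \<Longrightarrow> E' \<in> nbhs \<Longrightarrow> E \<inter> E' \<in> nbhs"
proof -
  assume "E \<in> nbhs" "E' \<in> nbhs"
  then obtain F F' where F: "finite F" "F \<subseteq> {\<D>. finite \<D> \<and> \<D> \<subseteq> base} \<times> UNIV" "E = configs \<inter> (\<Inter>p\<in>F. nbh p)"
    "finite F'" "F' \<subseteq> {\<D>. finite \<D> \<and> \<D> \<subseteq> base} \<times> UNIV" "E' = configs \<inter> (\<Inter>p\<in>F'. nbh p)" by (auto simp: nbhs_def)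
  then have "E \<inter> E' = configs \<inter> (\<Inter>p\<in>F \<union> F'. nbh p)" by auto
  moreover have "F \<union> F' \<in> {F. finite F \<and> F \<subseteq> {\<D>. finite \<D> \<and> \<D> \<subseteq> base} \<times> UNIV}" using F by blast
  ultimately show ?thesis unfolding nbhs_def by blast
qed

lemma trace0_nbhs: "E \<in> nbhs \<Longrightarrow> trace0 E"
proof -
  assume "E \<in> nbhs"
  then obtain F where F: "finite F" "F \<subseteq> {\<D>. finite \<D> \<and> \<D> \<subseteq> base} \<times> UNIV" "E = configs \<inter> (\<Inter>p\<in>F. nbh p)" by (auto simp: nbhs_def)
  show ?thesis unfolding F(3)
  proof (rule trace0_INT)
    show "countable F" using F(1) by (rule countable_finite)
    fix p assume "p \<in> F"
    then obtain \<D> n where p: "p = (\<D>, n)" "finite \<D>" "\<D> \<subseteq> base" using F(2) by (cases p) auto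
    have "nbh p = configs \<inter> (\<Inter>b\<in>insert None (Some ` \<D>). case b of None \<Rightarrow> {\<omega> \<in> configs. card (\<omega> \<inter> box n) = card \<D>} | Some D \<Rightarrow> {\<omega> \<in> configs. \<omega> \<inter> (D \<inter> box n) \<noteq> {}})"
      unfolding p(1) nbh_def by auto
    also have "trace0 \<dots>"
    proof (rule trace0_INT)
      show "countable (insert None (Some ` \<D>))" using p(2) by (auto intro: countable_finite)
      fix b assume "b \<in> insert None (Some ` \<D>)"
      then show "trace0 (case b of None \<Rightarrow> {\<omega> \<in> configs. card (\<omega> \<inter> box n) = card \<D>} | Some D \<Rightarrow> {\<omega> \<in> configs. \<omega> \<inter> (D \<inter> box n) \<noteq> {}})"
      proof (cases b)
        case None
        then show ?thesis using trace0_card_eq[OF box_sets] by simp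
      next
        case (Some D)
        then have "D \<in> base" using \<open>b \<in> _\<close> p(3) by auto
        then have "trace0 {\<omega> \<in> configs. \<omega> \<inter> (D \<inter> box n) \<noteq> {}}"
          by (intro trace0_hit sets.Int base_sets box_sets bounded_subset[OF box_sets(2)]) auto
        then show ?thesis using Some by simp
      qed
    qed
    finally show "trace0 (nbh p)" .
  qed
qed

text \<open>The points of \<open>\<omega>0\<close> in the box carrying the support get disjoint
  members of \<open>base\<close> on which \<open>\<phi>\<close> changes by less than
  \<open>e'\<close>. A configuration in the resulting neighbourhood matches these points one to one,
  so the two sums differ by less than \<open>e\<close>.\<close>

lemma nbhs_subbasic:
  assumes \<phi>: "test_fun \<phi>" and V: "open V" and w0: "\<omega>0 \<in> conf0" "config_sum \<phi> \<omega>0 \<in> V"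
  shows "\<exists>E\<in>nbhs. \<omega>0 \<in> E \<and> E \<subseteq> {\<omega> \<in> configs. config_sum \<phi> \<omega> \<in> V}"
proof -
  have w0c: "\<omega>0 \<in> configs" using w0 conf0_configs by blast
  obtain n where n: "{x \<in> {0..} \<times> UNIV. \<phi> x \<noteq> 0} \<subseteq> box n"
    using bounded_subset_box[of "{x \<in> {0..} \<times> UNIV. \<phi> x \<noteq> 0}"] \<phi> unfolding test_fun_def box_def by blast
  have sum: "config_sum \<phi> \<omega> = (\<Sum>x\<in>\<omega> \<inter> box n. \<phi> x)" if "\<omega> \<in> configs" for \<omega>
    unfolding config_sum_def
  proof (rule sum.mono_neutral_left)
    show "finite (\<omega> \<inter> box n)" using config_finite[OF that box_sets(2)] .
    show "{x \<in> \<omega>. \<phi> x \<noteq> 0} \<subseteq> \<omega> \<inter> box n" using n that by (auto simp: configs_def)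
  qed auto
  obtain e where e: "e > 0" "\<And>t. dist t (config_sum \<phi> \<omega>0) < e \<Longrightarrow> t \<in> V" using V w0(2) unfolding open_dist by blast
  define S where "S = \<omega>0 \<inter> box n"
  have S: "finite S" "S \<subseteq> {0..} \<times> closure C" using config_finite[OF w0c box_sets(2)] w0 by (auto simp: S_def conf0_def)
  \<comment> \<open>At most \<open>e'\<close> for each of the \<open>card S\<close> points adds up
    to strictly less than \<open>e\<close>, thanks to the \<open>+ 1\<close>, which also covers an
    empty \<open>S\<close>.\<close>
  define e' where "e' = e / (real (card S) + 1)"
  have e': "e' > 0" using e by (simp add: e'_def add_nonneg_pos)
  have "\<forall>x\<in>S. \<exists>d>0. \<forall>y\<in>{0..} \<times> UNIV. dist y x < d \<longrightarrow> dist (\<phi> y) (\<phi> x) < e'"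
  proof
    fix x assume "x \<in> S"
    then have "x \<in> {0..} \<times> UNIV" using S(2) by auto
    then show "\<exists>d>0. \<forall>y\<in>{0..} \<times> UNIV. dist y x < d \<longrightarrow> dist (\<phi> y) (\<phi> x) < e'"
      using \<phi> e' unfolding test_fun_def continuous_on_iff by blast
  qed
  then obtain \<delta> where \<delta>: "\<And>x. x \<in> S \<Longrightarrow> \<delta> x > 0" "\<And>x y. x \<in> S \<Longrightarrow> y \<in> {0..} \<times> UNIV \<Longrightarrow> dist y x < \<delta> x \<Longrightarrow> dist (\<phi> y) (\<phi> x) < e'" by metis
  define d where "d = Min (insert 1 (\<delta> ` S))"
  have d: "d > 0" "\<And>x. x \<in> S \<Longrightarrow> d \<le> \<delta> x" using S(1) \<delta>(1) by (auto simp: d_def)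
  obtain D where D: "\<And>x. x \<in> S \<Longrightarrow> D x \<in> base \<and> x \<in> D x \<and> D x \<subseteq> ball x d" "\<And>x y. x \<in> S \<Longrightarrow> y \<in> S \<Longrightarrow> x \<noteq> y \<Longrightarrow> D x \<inter> D y = {}"
    using base_separate[OF S d(1)] by metis
  have injD: "inj_on D S"
  proof (rule inj_onI)
    fix x y assume "x \<in> S" "y \<in> S" "D x = D y"
    then show "x = y" using D(1)[of x] D(2)[of x y] by auto
  qed
  then have cardD: "card (D ` S) = card S" by (rule card_image)
  let ?E = "configs \<inter> (\<Inter>p\<in>{(D ` S, n)}. nbh p)"
  have "?E \<in> nbhs" unfolding nbhs_def using D(1) S(1) by (intro imageI) auto
  moreover have "\<omega>0 \<in> ?E" using w0c D(1) cardD by (auto simp: nbh_def S_def)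
  moreover have "?E \<subseteq> {\<omega> \<in> configs. config_sum \<phi> \<omega> \<in> V}"
  proof
    fix \<omega> assume "\<omega> \<in> ?E"
    then have w: "\<omega> \<in> configs" "card (\<omega> \<inter> box n) = card S" "\<And>x. x \<in> S \<Longrightarrow> \<exists>y. y \<in> \<omega> \<inter> (D x \<inter> box n)"
      using cardD by (auto simp: nbh_def)
    then obtain y where y: "\<And>x. x \<in> S \<Longrightarrow> y x \<in> \<omega> \<inter> (D x \<inter> box n)" by metis
    have injy: "inj_on y S"
    proof (rule inj_onI)
      fix x x' assume "x \<in> S" "x' \<in> S" "y x = y x'"
      then show "x = x'" using y[of x] y[of x'] D(2)[of x x'] by auto
    qed
    have "y ` S = \<omega> \<inter> box n"
      by (rule card_subset_eq) (use config_finite[OF w(1) box_sets(2)] y w(2) card_image[OF injy] in auto)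
    then have "config_sum \<phi> \<omega> = (\<Sum>x\<in>S. \<phi> (y x))" using sum[OF w(1)] sum.reindex[OF injy, of \<phi>] by simp
    moreover have "config_sum \<phi> \<omega>0 = (\<Sum>x\<in>S. \<phi> x)" using sum[OF w0c] by (simp add: S_def)
    ultimately have "dist (config_sum \<phi> \<omega>) (config_sum \<phi> \<omega>0) = \<bar>\<Sum>x\<in>S. \<phi> (y x) - \<phi> x\<bar>" by (simp add: dist_real_def sum_subtractf)
    also have "\<dots> \<le> (\<Sum>x\<in>S. \<bar>\<phi> (y x) - \<phi> x\<bar>)" by (rule sum_abs)
    also have "\<dots> \<le> (\<Sum>x\<in>S. e')"
    proof (rule sum_mono)
      fix x assume x: "x \<in> S"
      have "y x \<in> {0..} \<times> UNIV" using y[OF x] w(1) by (auto simp: configs_def)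
      moreover have "dist (y x) x < \<delta> x"
      proof -
        have "y x \<in> ball x d" using y[OF x] D(1)[OF x] by blast
        then show ?thesis using d(2)[OF x] by (simp add: dist_commute)
      qed
      ultimately show "\<bar>\<phi> (y x) - \<phi> x\<bar> \<le> e'" using \<delta>(2)[OF x] by (fastforce simp: dist_real_def)
    qed
    also have "\<dots> < e" using e by (simp add: e'_def field_simps add_nonneg_pos)
    finally show "\<omega> \<in> {\<omega> \<in> configs. config_sum \<phi> \<omega> \<in> V}" using e(2) w(1) by blast
  qed
  ultimately show ?thesis by (intro bexI[of _ ?E] conjI)
qed

lemma nbhs_open:
  assumes "openin vague_topology W" and "\<omega>0 \<in> W \<inter> conf0"
  shows "\<exists>E\<in>nbhs. \<omega>0 \<in> E \<and> E \<subseteq> W"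
proof -
  have "generate_topology_on {{\<omega> \<in> configs. config_sum \<phi> \<omega> \<in> V} |\<phi> V. test_fun \<phi> \<and> open V} W"
    using assms(1) unfolding vague_topology_def openin_topology_generated_by_iff .
  then show ?thesis using assms(2)
  proof (induction arbitrary: \<omega>0)
    case (Int a b)
    from Int.prems have m: "\<omega>0 \<in> a \<inter> conf0" "\<omega>0 \<in> b \<inter> conf0" by auto
    obtain E where E: "E \<in> nbhs" "\<omega>0 \<in> E" "E \<subseteq> a" using Int.IH(1)[OF m(1)] by (elim bexE conjE)
    obtain E' where E': "E' \<in> nbhs" "\<omega>0 \<in> E'" "E' \<subseteq> b" using Int.IH(2)[OF m(2)] by (elim bexE conjE)
    show ?case using nbhs_Int[OF E(1) E'(1)] E E' by (intro bexI[of _ "E \<inter> E'"]) auto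
  next
    case (UN K)
    from UN.prems obtain k where k: "k \<in> K" "\<omega>0 \<in> k \<inter> conf0" by auto
    obtain E where "E \<in> nbhs" "\<omega>0 \<in> E" "E \<subseteq> k" using UN.IH[OF k] by (elim bexE conjE)
    then show ?case using k(1) by (intro bexI[of _ E]) auto
  next
    case (Basis s)
    then obtain \<phi> V where s: "s = {\<omega> \<in> configs. config_sum \<phi> \<omega> \<in> V}" "test_fun \<phi>" "open V" by auto
    then show ?case using nbhs_subbasic[OF s(2,3), of \<omega>0] Basis by simp
  qed simp
qed

text \<open>On \<open>conf0\<close> a vaguely open set is the union of the members of
  \<open>nbhs\<close> that it contains, and \<open>nbhs\<close> is countable. So open sets, and then
  all Borel sets, have traces generated by void events.\<close>

lemma trace0_sets: "S \<in> sets P \<Longrightarrow> trace0 S"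
  unfolding sets_P vague_sets_def
proof (induction rule: sigma_sets.induct)
  case (Basic W)
  then have W: "openin vague_topology W" by simp
  have "W \<inter> conf0 = (\<Union>E\<in>{E \<in> nbhs. E \<subseteq> W}. E) \<inter> conf0"
  proof (intro set_eqI iffI)
    fix \<omega> assume w: "\<omega> \<in> W \<inter> conf0"
    then obtain E where "E \<in> nbhs" "\<omega> \<in> E" "E \<subseteq> W" using nbhs_open[OF W w] by (elim bexE conjE)
    with w show "\<omega> \<in> (\<Union>E\<in>{E \<in> nbhs. E \<subseteq> W}. E) \<inter> conf0" by auto
  qed auto
  moreover have "trace0 (\<Union>E\<in>{E \<in> nbhs. E \<subseteq> W}. E)"
    by (rule trace0_UN) (auto intro: trace0_nbhs countable_subset[OF _ countable_nbhs])
  ultimately show ?case using trace0_cong by blast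
next
  case Empty
  show ?case by (auto simp: trace0_def intro: sigma_sets.Empty)
next
  case (Compl a) then show ?case by (intro trace0_compl)
next
  case (Union a) then show ?case by (intro trace0_UN) auto
qed

text \<open>A form of Renyi's theorem that void probabilities determine the law of a simple point
  process. Void events form an intersection-stable generator of the sigma-algebra in which, up to
  the complement of \<open>conf0\<close>, every measurable set has a representative.\<close>

lemma measure_eqI_void:
  assumes fin: "finite_measure Q" "finite_measure R" and sets: "sets Q = sets P" "sets R = sets P"
    and z: "AE \<omega> in Q. \<omega> \<in> conf0" "AE \<omega> in R. \<omega> \<in> conf0"
    and eq: "\<And>B. B \<in> sets \<Lambda> \<Longrightarrow> bounded B \<Longrightarrow> emeasure Q (void B) = emeasure R (void B)"
  shows "Q = R"
proof (rule measure_eqI)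
  show "sets Q = sets R" using sets by simp
  interpret Q: finite_measure Q by fact
  interpret R: finite_measure R by fact
  have spQ: "space Q = configs" "space R = configs" using sets sets_eq_imp_space_eq space_P by metis+
  have void0: "void {} = configs" by (auto simp: void_def)
  have "emeasure Q configs = emeasure R configs" using eq[of "{}"] by (simp add: void0)
  then have tot: "measure Q configs = measure R configs" by (simp add: measure_def)
  have G: "measure Q S = measure R S" if "S \<in> sigma_sets configs void_gen" for S
    using that
  proof (induction rule: sigma_sets_induct_disjoint[OF void_gen_Int_stable void_gen_subset, consumes 1, case_names basic empty compl union])
    case (basic A) then show ?case using eq by (auto simp: void_gen_def measure_def)
  next
    case empty show ?case by simp
  next
    case (compl A)
    then have "A \<in> sets P" using sigma_void_subset by blast
    then show ?case using compl Q.finite_measure_compl[of A] R.finite_measure_compl[of A] sets tot by (simp add: spQ)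
  next
    case (union A)
    then have "range A \<subseteq> sets P" using sigma_void_subset by blast
    then have "(\<lambda>i. measure Q (A i)) sums measure Q (\<Union>i. A i)" "(\<lambda>i. measure R (A i)) sums measure R (\<Union>i. A i)"
      using union(1) sets by (auto intro!: Q.finite_measure_UNION R.finite_measure_UNION)
    then show ?case using union(3) by (auto dest: sums_unique2)
  qed
  fix S assume "S \<in> sets Q"
  then have S: "S \<in> sets P" using sets by simp
  then obtain S' where S': "S' \<in> sigma_sets configs void_gen" "S \<inter> conf0 = S' \<inter> conf0" using trace0_sets by (auto simp: trace0_def)
  have S'P: "S' \<in> sets P" using S' sigma_void_subset by blast
  have "emeasure Q S = emeasure Q S'" by (rule emeasure_eq_AE) (use z(1) S'(2) S S'P sets in auto)
  also have "\<dots> = emeasure R S'" using G[OF S'(1)] by (simp add: Q.emeasure_eq_measure R.emeasure_eq_measure)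
  also have "\<dots> = emeasure R S" by (rule emeasure_eq_AE) (use z(2) S'(2) S S'P sets in auto)
  finally show "emeasure Q S = emeasure R S" .
qed

text \<open>Preimages of void events suffice, provided that the map is restricted to a set on which
  its values lie in \<open>conf0\<close>: there an arbitrary measurable set may be exchanged for a
  member of the generated sigma-algebra.\<close>

lemma preimage_measurable:
  assumes f: "\<And>x. x \<in> space N \<Longrightarrow> f x \<in> configs"
    and v: "\<And>B. B \<in> sets \<Lambda> \<Longrightarrow> bounded B \<Longrightarrow> {x \<in> space N. f x \<in> void B} \<in> sets N"
    and E: "E \<in> sets N" "\<And>x. x \<in> E \<Longrightarrow> f x \<in> conf0" and S: "S \<in> sets P"
  shows "{x \<in> E. f x \<in> S} \<in> sets N"
proof -
  obtain S' where S': "S' \<in> sigma_sets configs void_gen" "S \<inter> conf0 = S' \<inter> conf0" using trace0_sets[OF S] by (auto simp: trace0_def)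
  have "{x \<in> space N. f x \<in> S'} \<in> sets N"
    using S'(1)
  proof induction
    case (Basic a) then show ?case using v by (auto simp: void_gen_def)
  next
    case (Compl a)
    have "{x \<in> space N. f x \<in> configs - a} = space N - {x \<in> space N. f x \<in> a}" using f by auto
    then show ?case using Compl by auto
  next
    case (Union a)
    have "{x \<in> space N. f x \<in> \<Union> (range a)} = (\<Union>i. {x \<in> space N. f x \<in> a i})" by auto
    then show ?case using Union by auto
  qed auto
  moreover have "{x \<in> E. f x \<in> S} = E \<inter> {x \<in> space N. f x \<in> S'}"
    using E S'(2) sets.sets_into_space[OF E(1)] by blast
  ultimately show ?thesis using E(1) by auto
qed

section \<open>Sums and products over the points of a configuration\<close>

lemma config_in_space: "\<omega> \<in> configs \<Longrightarrow> x \<in> \<omega> \<Longrightarrow> x \<in> space \<Lambda>"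
  by (auto simp: configs_def space_\<Lambda>)

text \<open>For a measurable rectangle the sum is an indicator times a count, which is measurable by
  the Poisson law. The other sets follow by a Dynkin argument; boundedness of \<open>W\<close> keeps
  the counts finite, so that complements may be treated by subtraction.\<close>

lemma config_sum_indicator_measurable:
  assumes W: "W \<in> sets \<Lambda>" "bounded W" and A: "A \<in> sets (N \<Otimes>\<^sub>M \<Lambda>)"
  shows "(\<lambda>(s, \<omega>). \<Sum>x\<in>\<omega> \<inter> W. indicator A (s, x) :: ennreal) \<in> borel_measurable (N \<Otimes>\<^sub>M P)"
proof -
  let ?G = "{a \<times> b | a b. a \<in> sets N \<and> b \<in> sets \<Lambda>}"
  have card_m: "(\<lambda>(s, \<omega>). of_nat (card (\<omega> \<inter> B)) :: ennreal) \<in> borel_measurable (N \<Otimes>\<^sub>M P)" if "B \<in> sets \<Lambda>" "bounded B" for B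
    using measurable_compose[OF measurable_snd[of N P] measurable_compose[OF card_measurable[OF that], of "\<lambda>n. of_nat n :: ennreal" borel]]
    by (simp add: split_beta')
  have fin: "finite (\<omega> \<inter> W)" if "\<omega> \<in> space P" for \<omega> using config_finite[OF _ W(2)] that by (simp add: space_P)
  have sub: "?G \<subseteq> Pow (space N \<times> space \<Lambda>)"
    using sets.sets_into_space[of _ N] sets.sets_into_space[of _ \<Lambda>] by blast
  have "A \<in> sigma_sets (space N \<times> space \<Lambda>) ?G" using A by (simp add: sets_pair_measure)
  then show ?thesis
  proof (induction rule: sigma_sets_induct_disjoint[OF Int_stable_pair_measure_generator sub, consumes 1, case_names basic empty compl union])
    case (basic A)
    then obtain a b where ab: "A = a \<times> b" "a \<in> sets N" "b \<in> sets \<Lambda>" by auto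
    have "(\<lambda>(s, \<omega>). indicator a s * of_nat (card (\<omega> \<inter> (W \<inter> b))) :: ennreal) \<in> borel_measurable (N \<Otimes>\<^sub>M P)"
      using card_m[of "W \<inter> b"] ab W bounded_subset[OF W(2), of "W \<inter> b"] by (simp add: split_beta') measurable
    moreover have "(\<Sum>x\<in>\<omega> \<inter> W. indicator A (s, x) :: ennreal) = indicator a s * of_nat (card (\<omega> \<inter> (W \<inter> b)))" if "\<omega> \<in> space P" for s \<omega>
    proof -
      have "(\<Sum>x\<in>\<omega> \<inter> W. indicator A (s, x) :: ennreal) = (\<Sum>x\<in>\<omega> \<inter> W. indicator a s * indicator b x)"
        by (intro sum.cong) (auto simp: ab indicator_def)
      also have "\<dots> = indicator a s * (\<Sum>x\<in>\<omega> \<inter> W. indicator b x)" by (simp add: sum_distrib_left)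
      also have "(\<Sum>x\<in>\<omega> \<inter> W. indicator b x :: ennreal) = (\<Sum>x\<in>\<omega> \<inter> (W \<inter> b). 1)"
        using fin[OF that] by (intro sum.mono_neutral_cong_right) (auto simp: indicator_def)
      finally show ?thesis by simp
    qed
    ultimately show ?case by (subst measurable_cong[where g="\<lambda>(s, \<omega>). indicator a s * of_nat (card (\<omega> \<inter> (W \<inter> b)))"]) (auto simp: space_pair_measure)
  next
    case empty
    show ?case by simp
  next
    case (compl A)
    let ?f = "\<lambda>A s \<omega>. \<Sum>x\<in>\<omega> \<inter> W. indicator A (s, x) :: ennreal"
    have "?f (space N \<times> space \<Lambda> - A) s \<omega> = of_nat (card (\<omega> \<inter> W)) - ?f A s \<omega>" if "\<omega> \<in> space P" "s \<in> space N" for s \<omega>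
    proof -
      have "?f (space N \<times> space \<Lambda> - A) s \<omega> + ?f A s \<omega> = (\<Sum>x\<in>\<omega> \<inter> W. 1)"
        unfolding sum.distrib[symmetric] using that config_in_space by (intro sum.cong) (auto simp: indicator_def space_P)
      then have "of_nat (card (\<omega> \<inter> W)) = ?f (space N \<times> space \<Lambda> - A) s \<omega> + ?f A s \<omega>" by simp
      moreover have "?f A s \<omega> \<noteq> \<infinity>" using fin[OF that(1)] by (auto simp: indicator_def)
      ultimately show ?thesis by simp
    qed
    moreover have "(\<lambda>(s, \<omega>). of_nat (card (\<omega> \<inter> W)) - ?f A s \<omega>) \<in> borel_measurable (N \<Otimes>\<^sub>M P)"
      using compl card_m[OF W] by (simp add: split_beta')
    ultimately show ?case by (subst measurable_cong[where g="\<lambda>(s, \<omega>). of_nat (card (\<omega> \<inter> W)) - ?f A s \<omega>"]) (auto simp: space_pair_measure)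
  next
    case (union A)
    have "(\<Sum>x\<in>\<omega> \<inter> W. indicator (\<Union>i. A i) (s, x) :: ennreal) = (\<Sum>i. \<Sum>x\<in>\<omega> \<inter> W. indicator (A i) (s, x))" for s \<omega>
    proof -
      have "(\<Sum>x\<in>\<omega> \<inter> W. indicator (\<Union>i. A i) (s, x) :: ennreal) = (\<Sum>x\<in>\<omega> \<inter> W. \<Sum>i. indicator (A i) (s, x))"
        using union by (intro sum.cong refl suminf_indicator[symmetric])
      also have "\<dots> = (\<Sum>i. \<Sum>x\<in>\<omega> \<inter> W. indicator (A i) (s, x))" by (rule suminf_sum[symmetric]) simp
      finally show ?thesis .
    qed
    then show ?case using union by (simp add: split_beta')
  qed
qed

lemma config_sum_measurable:
  fixes g :: "'a \<times> (real \<times> 'u) \<Rightarrow> ennreal"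
  assumes W: "W \<in> sets \<Lambda>" "bounded W" and g: "g \<in> borel_measurable (N \<Otimes>\<^sub>M \<Lambda>)"
  shows "(\<lambda>(s, \<omega>). \<Sum>x\<in>\<omega> \<inter> W. g (s, x)) \<in> borel_measurable (N \<Otimes>\<^sub>M P)"
  using g
proof (induction rule: borel_measurable_induct)
  case (cong f g)
  have "(\<Sum>x\<in>\<omega> \<inter> W. f (s, x)) = (\<Sum>x\<in>\<omega> \<inter> W. g (s, x))" if "s \<in> space N" "\<omega> \<in> space P" for s \<omega>
    using that config_in_space cong by (intro sum.cong) (auto simp: space_P space_pair_measure)
  then show ?case using cong by (subst measurable_cong[where g="\<lambda>(s, \<omega>). \<Sum>x\<in>\<omega> \<inter> W. g (s, x)"]) (auto simp: space_pair_measure)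
next
  case (set A)
  then show ?case by (rule config_sum_indicator_measurable[OF W])
next
  case (mult u c)
  then show ?case by (simp add: sum_distrib_left[symmetric] split_beta')
next
  case (add u v)
  then show ?case by (simp add: sum.distrib split_beta')
next
  case (seq U)
  have "(\<Sum>x\<in>\<omega> \<inter> W. (SUP i. U i) (s, x)) = (SUP i. \<Sum>x\<in>\<omega> \<inter> W. U i (s, x))" for s \<omega>
  proof -
    have "incseq (\<lambda>i. U i p)" for p using incseqD[OF seq(3)] by (intro incseq_SucI) (auto intro: le_funD)
    then show ?thesis unfolding SUP_apply by (intro ennreal_SUP_sum[symmetric])
  qed
  then show ?case using seq by (simp add: split_beta')
qed

text \<open>The logarithm turns the product into a sum; positive and negative parts are summed
  separately because \<open>config_sum_measurable\<close> speaks of functions with values in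
  \<open>ennreal\<close>.\<close>

lemma config_prod_measurable:
  fixes k :: "'a \<times> (real \<times> 'u) \<Rightarrow> real"
  assumes W: "W \<in> sets \<Lambda>" "bounded W" and k[measurable]: "k \<in> borel_measurable (N \<Otimes>\<^sub>M \<Lambda>)" and pos: "\<And>p. k p > 0"
  shows "(\<lambda>(s, \<omega>). \<Prod>x\<in>\<omega> \<inter> W. k (s, x)) \<in> borel_measurable (N \<Otimes>\<^sub>M P)"
proof -
  define p where "p q = ennreal (max 0 (ln (k q)))" for q
  define n where "n q = ennreal (max 0 (- ln (k q)))" for q
  have pm: "p \<in> borel_measurable (N \<Otimes>\<^sub>M \<Lambda>)" "n \<in> borel_measurable (N \<Otimes>\<^sub>M \<Lambda>)" unfolding p_def n_def by measurable
  note [measurable] = config_sum_measurable[OF W pm(1)] config_sum_measurable[OF W pm(2)]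
  have "(\<Prod>x\<in>\<omega> \<inter> W. k (s, x)) = exp (enn2real (\<Sum>x\<in>\<omega> \<inter> W. p (s, x)) - enn2real (\<Sum>x\<in>\<omega> \<inter> W. n (s, x)))" if "\<omega> \<in> space P" for s \<omega>
  proof -
    have f: "finite (\<omega> \<inter> W)" using config_finite[OF _ W(2)] that by (simp add: space_P)
    have "exp (enn2real (\<Sum>x\<in>\<omega> \<inter> W. p (s, x)) - enn2real (\<Sum>x\<in>\<omega> \<inter> W. n (s, x))) = exp (\<Sum>x\<in>\<omega> \<inter> W. max 0 (ln (k (s, x))) - max 0 (- ln (k (s, x))))"
    proof -
      have "(\<Sum>x\<in>\<omega> \<inter> W. p (s, x)) = ennreal (\<Sum>x\<in>\<omega> \<inter> W. max 0 (ln (k (s, x))))" unfolding p_def by (rule sum_ennreal) simp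
      moreover have "(\<Sum>x\<in>\<omega> \<inter> W. n (s, x)) = ennreal (\<Sum>x\<in>\<omega> \<inter> W. max 0 (- ln (k (s, x))))" unfolding n_def by (rule sum_ennreal) simp
      ultimately show ?thesis by (simp only: enn2real_ennreal sum_nonneg max.cobounded1 sum_subtractf)
    qed
    also have "\<dots> = exp (\<Sum>x\<in>\<omega> \<inter> W. ln (k (s, x)))" by (intro arg_cong[where f=exp] sum.cong) auto
    also have "\<dots> = (\<Prod>x\<in>\<omega> \<inter> W. k (s, x))" using f pos by (simp add: exp_sum)
    finally show ?thesis ..
  qed
  then have "(\<lambda>(s, \<omega>). \<Prod>x\<in>\<omega> \<inter> W. k (s, x)) \<in> borel_measurable (N \<Otimes>\<^sub>M P) \<longleftrightarrow>
     (\<lambda>(s, \<omega>). exp (enn2real (\<Sum>x\<in>\<omega> \<inter> W. p (s, x)) - enn2real (\<Sum>x\<in>\<omega> \<inter> W. n (s, x)))) \<in> borel_measurable (N \<Otimes>\<^sub>M P)"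
    by (intro measurable_cong) (auto simp: space_pair_measure)
  moreover have "(\<lambda>(s, \<omega>). exp (enn2real (\<Sum>x\<in>\<omega> \<inter> W. p (s, x)) - enn2real (\<Sum>x\<in>\<omega> \<inter> W. n (s, x)))) \<in> borel_measurable (N \<Otimes>\<^sub>M P)"
    by measurable
  ultimately show ?thesis by simp
qed

section \<open>The generating functional of the Poisson law\<close>

lemma emeasure_\<Lambda>_eq: "B \<in> sets \<Lambda> \<Longrightarrow> bounded B \<Longrightarrow> emeasure \<Lambda> B = ennreal (measure \<Lambda> B)"
  using emeasure_\<Lambda>_bounded[of B] by (intro emeasure_eq_ennreal_measure) auto

lemma poisson_indep:
  assumes "finite \<B>" "disjoint \<B>" "\<And>B. B \<in> \<B> \<Longrightarrow> B \<in> sets \<Lambda>" "\<And>B. B \<in> \<B> \<Longrightarrow> bounded B"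
  shows "P.indep_vars (\<lambda>_. count_space UNIV) (\<lambda>B \<omega>. card (\<omega> \<inter> B)) \<B>"
  using law assms by (simp add: poisson_law_def)

text \<open>The probability generating function of a Poisson variable, by summation of the
  exponential series.\<close>

lemma poisson_pgf:
  assumes B: "B \<in> sets \<Lambda>" "bounded B" and c: "c \<ge> 0"
  shows "(\<integral>\<^sup>+\<omega>. ennreal (c ^ card (\<omega> \<inter> B)) \<partial>P) = ennreal (exp (c * measure \<Lambda> B - measure \<Lambda> B))"
proof -
  define l where "l = measure \<Lambda> B"
  have l: "l \<ge> 0" by (simp add: l_def)
  have meas: "{\<omega> \<in> space P. card (\<omega> \<inter> B) = k} \<in> sets P" for k
    using measurable_sets[OF card_measurable[OF B], of "{k}"] by (simp add: vimage_def Int_def conj_commute)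
  have pk: "measure P {\<omega> \<in> space P. card (\<omega> \<inter> B) = k} = l ^ k / fact k * exp (- l)" for k
    using law B unfolding poisson_law_def l_def by blast
  have "(\<integral>\<^sup>+\<omega>. ennreal (c ^ card (\<omega> \<inter> B)) \<partial>P) = (\<integral>\<^sup>+\<omega>. (\<Sum>k. ennreal (c ^ k) * indicator {\<omega> \<in> space P. card (\<omega> \<inter> B) = k} \<omega>) \<partial>P)"
  proof (rule nn_integral_cong)
    fix \<omega> assume w: "\<omega> \<in> space P"
    have "(\<Sum>k. ennreal (c ^ k) * indicator {\<omega> \<in> space P. card (\<omega> \<inter> B) = k} \<omega>) = (\<Sum>k\<in>{card (\<omega> \<inter> B)}. ennreal (c ^ k) * indicator {\<omega> \<in> space P. card (\<omega> \<inter> B) = k} \<omega>)"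
      by (rule suminf_finite) auto
    then show "ennreal (c ^ card (\<omega> \<inter> B)) = (\<Sum>k. ennreal (c ^ k) * indicator {\<omega> \<in> space P. card (\<omega> \<inter> B) = k} \<omega>)" using w by simp
  qed
  also have "\<dots> = (\<Sum>k. \<integral>\<^sup>+\<omega>. ennreal (c ^ k) * indicator {\<omega> \<in> space P. card (\<omega> \<inter> B) = k} \<omega> \<partial>P)"
    using meas by (intro nn_integral_suminf) auto
  also have "\<dots> = (\<Sum>k. ennreal (exp (- l) * ((c * l) ^ k /\<^sub>R fact k)))"
  proof (rule arg_cong[where f=suminf], rule ext)
    fix k
    have "(\<integral>\<^sup>+\<omega>. ennreal (c ^ k) * indicator {\<omega> \<in> space P. card (\<omega> \<inter> B) = k} \<omega> \<partial>P) = ennreal (c ^ k) * ennreal (l ^ k / fact k * exp (- l))"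
      using meas by (simp add: nn_integral_cmult_indicator P.emeasure_eq_measure pk)
    also have "\<dots> = ennreal (exp (- l) * ((c * l) ^ k /\<^sub>R fact k))"
      using c l by (simp add: ennreal_mult[symmetric] power_mult_distrib divide_inverse mult_ac)
    finally show "(\<integral>\<^sup>+\<omega>. ennreal (c ^ k) * indicator {\<omega> \<in> space P. card (\<omega> \<inter> B) = k} \<omega> \<partial>P) = ennreal (exp (- l) * ((c * l) ^ k /\<^sub>R fact k))" .
  qed
  also have "\<dots> = ennreal (exp (- l) * exp (c * l))"
  proof -
    have s: "(\<lambda>k. exp (- l) * ((c * l) ^ k /\<^sub>R fact k)) sums (exp (- l) * exp (c * l))" by (intro sums_mult exp_converges)
    have "(\<Sum>k. ennreal (exp (- l) * ((c * l) ^ k /\<^sub>R fact k))) = ennreal (\<Sum>k. exp (- l) * ((c * l) ^ k /\<^sub>R fact k))"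
      by (rule suminf_ennreal2) (use c l s in \<open>auto simp: sums_iff\<close>)
    then show ?thesis using s by (simp add: sums_iff)
  qed
  also have "exp (- l) * exp (c * l) = exp (c * l - l)" by (simp flip: exp_add)
  finally show ?thesis by (simp add: l_def)
qed

text \<open>The level sets of \<open>v\<close> cut \<open>W\<close> into finitely many disjoint
  blocks. The product over the points becomes a product of powers of independent counts, so the
  expectation is a product of generating functions.\<close>

lemma poisson_functional_simple:
  fixes v :: "real \<times> 'u \<Rightarrow> real"
  assumes W: "W \<in> sets \<Lambda>" "bounded W" and v: "v \<in> borel_measurable \<Lambda>" "\<And>x. v x \<ge> 0" "finite (v ` W)"
  shows "(\<integral>\<^sup>+\<omega>. ennreal (\<Prod>x\<in>\<omega> \<inter> W. v x) \<partial>P) = ennreal (exp (enn2real (\<integral>\<^sup>+x. ennreal (v x) * indicator W x \<partial>\<Lambda>) - measure \<Lambda> W))"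
    and "(\<lambda>\<omega>. ennreal (\<Prod>x\<in>\<omega> \<inter> W. v x)) \<in> borel_measurable P"
proof -
  define B where "B c = W \<inter> v -` {c}" for c
  define \<B> where "\<B> = B ` v ` W"
  have Bs: "B c \<in> sets \<Lambda>" "bounded (B c)" for c
  proof -
    have "B c = W \<inter> (v -` {c} \<inter> space \<Lambda>)" using sets.sets_into_space[OF W(1)] by (auto simp: B_def)
    then show "B c \<in> sets \<Lambda>" using W v(1) by (auto intro!: measurable_sets)
    show "bounded (B c)" by (rule bounded_subset[OF W(2)]) (auto simp: B_def)
  qed
  have fin\<B>: "finite \<B>" using v(3) by (simp add: \<B>_def)
  have dis: "disjoint \<B>" by (auto simp: disjoint_def \<B>_def B_def)
  have un: "\<Union>\<B> = W" by (auto simp: \<B>_def B_def)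
  \<comment> \<open>The constant value of \<open>v\<close> on a block, read off at an arbitrary
    point of it.\<close>
  define val where "val b = v (SOME x. x \<in> b)" for b
  have val: "v x = val b" if "b \<in> \<B>" "x \<in> b" for b x
  proof -
    have "(SOME x. x \<in> b) \<in> b" using that(2) by (rule someI)
    then show ?thesis using that by (auto simp: val_def \<B>_def B_def)
  qed
  have \<B>s: "b \<in> sets \<Lambda>" "bounded b" if "b \<in> \<B>" for b using that Bs by (auto simp: \<B>_def)
  have val0: "val b \<ge> 0" for b using v(2) by (simp add: val_def)
  have prod: "(\<Prod>x\<in>\<omega> \<inter> W. v x) = (\<Prod>b\<in>\<B>. val b ^ card (\<omega> \<inter> b))" if "\<omega> \<in> space P" for \<omega>
  proof -
    have "\<omega> \<inter> W = (\<Union>b\<in>\<B>. \<omega> \<inter> b)" using un by blast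
    then have "(\<Prod>x\<in>\<omega> \<inter> W. v x) = (\<Prod>b\<in>\<B>. \<Prod>x\<in>\<omega> \<inter> b. v x)"
      using fin\<B> dis config_finite[OF _ \<B>s(2)] that by (subst prod.UNION_disjoint[symmetric]) (auto simp: disjoint_def space_P)
    also have "\<dots> = (\<Prod>b\<in>\<B>. val b ^ card (\<omega> \<inter> b))"
    proof (rule prod.cong[OF refl])
      fix b assume b: "b \<in> \<B>"
      have "(\<Prod>x\<in>\<omega> \<inter> b. v x) = (\<Prod>x\<in>\<omega> \<inter> b. val b)" using val[OF b] by (intro prod.cong) auto
      then show "(\<Prod>x\<in>\<omega> \<inter> b. v x) = val b ^ card (\<omega> \<inter> b)" by simp
    qed
    finally show ?thesis .
  qed
  have eprod: "ennreal (\<Prod>x\<in>\<omega> \<inter> W. v x) = (\<Prod>b\<in>\<B>. ennreal (val b ^ card (\<omega> \<inter> b)))" if "\<omega> \<in> space P" for \<omega>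
    unfolding prod[OF that] using val0 by (intro prod_ennreal[symmetric]) simp
  have cm: "(\<lambda>\<omega>. ennreal (val b ^ card (\<omega> \<inter> b))) \<in> borel_measurable P" if "b \<in> \<B>" for b
    by (rule measurable_compose[OF card_measurable[OF \<B>s[OF that]]]) simp
  have "(\<lambda>\<omega>. \<Prod>b\<in>\<B>. ennreal (val b ^ card (\<omega> \<inter> b))) \<in> borel_measurable P"
    by (intro borel_measurable_prod_ennreal cm)
  then show "(\<lambda>\<omega>. ennreal (\<Prod>x\<in>\<omega> \<inter> W. v x)) \<in> borel_measurable P"
    by (subst measurable_cong[OF eprod])
  have "P.indep_vars (\<lambda>_. count_space UNIV) (\<lambda>B \<omega>. card (\<omega> \<inter> B)) \<B>"
    by (rule poisson_indep[OF fin\<B> dis \<B>s])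
  from P.indep_vars_compose2[OF this, of "\<lambda>b n. ennreal (val b ^ n)" "\<lambda>_. borel"]
  have ind: "P.indep_vars (\<lambda>_. borel) (\<lambda>b \<omega>. ennreal (val b ^ card (\<omega> \<inter> b))) \<B>" by simp
  have nn: "(\<integral>\<^sup>+x. ennreal (v x) * indicator W x \<partial>\<Lambda>) = ennreal (\<Sum>b\<in>\<B>. val b * measure \<Lambda> b)"
  proof -
    have "(\<integral>\<^sup>+x. ennreal (v x) * indicator W x \<partial>\<Lambda>) = (\<integral>\<^sup>+x. (\<Sum>b\<in>\<B>. ennreal (val b) * indicator b x) \<partial>\<Lambda>)"
    proof (rule nn_integral_cong)
      fix x
      show "ennreal (v x) * indicator W x = (\<Sum>b\<in>\<B>. ennreal (val b) * indicator b x)"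
      proof (cases "x \<in> W")
        case True
        then have b: "B (v x) \<in> \<B>" "x \<in> B (v x)" by (auto simp: \<B>_def B_def)
        have "(\<Sum>b\<in>\<B>. ennreal (val b) * indicator b x) = (\<Sum>b\<in>{B (v x)}. ennreal (val b) * indicator b x)"
          using fin\<B> b dis by (intro sum.mono_neutral_right) (auto simp: disjoint_def indicator_def)
        then show ?thesis using val[OF b] b True by simp
      next
        case False
        then have "\<forall>b\<in>\<B>. x \<notin> b" using un by blast
        then show ?thesis using False by simp
      qed
    qed
    also have "\<dots> = (\<Sum>b\<in>\<B>. ennreal (val b) * emeasure \<Lambda> b)"
      using \<B>s by (subst nn_integral_sum) (auto simp: nn_integral_cmult_indicator)
    also have "\<dots> = (\<Sum>b\<in>\<B>. ennreal (val b * measure \<Lambda> b))"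
      using \<B>s val0 by (intro sum.cong refl) (simp add: ennreal_mult emeasure_\<Lambda>_eq)
    also have "\<dots> = ennreal (\<Sum>b\<in>\<B>. val b * measure \<Lambda> b)" using val0 by (intro sum_ennreal) simp
    finally show ?thesis .
  qed
  have mW: "measure \<Lambda> W = (\<Sum>b\<in>\<B>. measure \<Lambda> b)"
  proof -
    have "emeasure \<Lambda> W = (\<Sum>b\<in>\<B>. emeasure \<Lambda> b)"
    proof -
      have "(\<lambda>b. b) ` \<B> \<subseteq> sets \<Lambda>" using \<B>s(1) by auto
      moreover have "disjoint_family_on (\<lambda>b. b) \<B>" using dis by (auto simp: disjoint_family_on_def disjoint_def)
      ultimately show ?thesis using sum_emeasure[of "\<lambda>b. b" \<B> \<Lambda>] fin\<B> un by simp
    qed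
    also have "\<dots> = (\<Sum>b\<in>\<B>. ennreal (measure \<Lambda> b))"
      using \<B>s by (intro sum.cong refl) (simp add: emeasure_\<Lambda>_eq)
    also have "\<dots> = ennreal (\<Sum>b\<in>\<B>. measure \<Lambda> b)" by (intro sum_ennreal) simp
    finally show ?thesis by (simp add: measure_def sum_nonneg)
  qed
  have "(\<integral>\<^sup>+\<omega>. ennreal (\<Prod>x\<in>\<omega> \<inter> W. v x) \<partial>P) = (\<integral>\<^sup>+\<omega>. (\<Prod>b\<in>\<B>. ennreal (val b ^ card (\<omega> \<inter> b))) \<partial>P)"
    by (rule nn_integral_cong) (rule eprod)
  also have "\<dots> = (\<Prod>b\<in>\<B>. \<integral>\<^sup>+\<omega>. ennreal (val b ^ card (\<omega> \<inter> b)) \<partial>P)"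
    by (rule P.indep_vars_nn_integral[OF fin\<B> ind]) simp
  also have "\<dots> = (\<Prod>b\<in>\<B>. ennreal (exp (val b * measure \<Lambda> b - measure \<Lambda> b)))"
    by (intro prod.cong refl poisson_pgf \<B>s val0)
  also have "\<dots> = ennreal (\<Prod>b\<in>\<B>. exp (val b * measure \<Lambda> b - measure \<Lambda> b))" by (rule prod_ennreal) simp
  also have "(\<Prod>b\<in>\<B>. exp (val b * measure \<Lambda> b - measure \<Lambda> b)) = exp (\<Sum>b\<in>\<B>. val b * measure \<Lambda> b - measure \<Lambda> b)"
    using fin\<B> by (simp add: exp_sum)
  finally show "(\<integral>\<^sup>+\<omega>. ennreal (\<Prod>x\<in>\<omega> \<inter> W. v x) \<partial>P) = ennreal (exp (enn2real (\<integral>\<^sup>+x. ennreal (v x) * indicator W x \<partial>\<Lambda>) - measure \<Lambda> W))"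
    unfolding nn mW using val0 by (simp add: sum_nonneg sum_subtractf)
qed

text \<open>The exponent is the integral of \<open>v - 1\<close> over \<open>W\<close>. Simple
  functions increasing to \<open>v\<close> give increasing products, since all factors are
  nonnegative, and both sides pass to the limit; finiteness of the integral allows it to be read as
  a real number.\<close>

lemma poisson_functional:
  fixes v :: "real \<times> 'u \<Rightarrow> real"
  assumes W: "W \<in> sets \<Lambda>" "bounded W" and v[measurable]: "v \<in> borel_measurable \<Lambda>" and v0: "\<And>x. v x \<ge> 0"
    and fin: "(\<integral>\<^sup>+x. ennreal (v x) * indicator W x \<partial>\<Lambda>) < \<infinity>"
  shows "(\<integral>\<^sup>+\<omega>. ennreal (\<Prod>x\<in>\<omega> \<inter> W. v x) \<partial>P) = ennreal (exp (enn2real (\<integral>\<^sup>+x. ennreal (v x) * indicator W x \<partial>\<Lambda>) - measure \<Lambda> W))"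
proof -
  have vm: "(\<lambda>x. ennreal (v x)) \<in> borel_measurable \<Lambda>" by measurable
  obtain F where F: "\<And>i. simple_function \<Lambda> (F i)" "incseq F" "\<And>i x. F i x < top" "\<And>x. (SUP i. F i x) = ennreal (v x)"
    using borel_measurable_implies_simple_function_sequence'[OF vm] by metis
  define f where "f i x = enn2real (F i x)" for i x
  have Ff: "F i x = ennreal (f i x)" for i x using F(3)[of i x] by (simp add: f_def)
  have f0: "f i x \<ge> 0" for i x by (simp add: f_def)
  have Fle: "F i x \<le> F j x" if "i \<le> j" for i j x using incseqD[OF F(2) that] by (rule le_funD)
  have Flim: "(\<lambda>i. F i x) \<longlonglongrightarrow> ennreal (v x)" for x
    using LIMSEQ_SUP[of "\<lambda>i. F i x"] Fle by (simp add: F(4) incseq_def)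
  then have flim: "(\<lambda>i. f i x) \<longlonglongrightarrow> v x" for x
    unfolding Ff by (rule iffD1[OF tendsto_ennreal_iff, rotated 2]) (auto simp: f0 v0)
  have finc: "f i x \<le> f j x" if "i \<le> j" for i j x
    unfolding f_def by (intro enn2real_mono F(3) Fle that)
  have fm: "f i \<in> borel_measurable \<Lambda>" for i unfolding f_def using borel_measurable_simple_function[OF F(1)] by measurable
  have ffin: "finite (f i ` W)" for i
  proof -
    have "finite (F i ` space \<Lambda>)" using F(1) by (rule simple_functionD)
    then have "finite (enn2real ` F i ` space \<Lambda>)" by simp
    then show ?thesis by (rule finite_subset[rotated]) (use sets.sets_into_space[OF W(1)] in \<open>auto simp: f_def\<close>)
  qed
  note simp1 = poisson_functional_simple[OF W fm f0 ffin]
  have "(\<lambda>i. \<integral>\<^sup>+\<omega>. ennreal (\<Prod>x\<in>\<omega> \<inter> W. f i x) \<partial>P) \<longlonglongrightarrow> (\<integral>\<^sup>+\<omega>. ennreal (\<Prod>x\<in>\<omega> \<inter> W. v x) \<partial>P)"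
  proof (rule nn_integral_LIMSEQ)
    show "incseq (\<lambda>i \<omega>. ennreal (\<Prod>x\<in>\<omega> \<inter> W. f i x))"
      unfolding incseq_def le_fun_def by (intro allI impI ennreal_leI prod_mono conjI f0 finc)
    show "(\<lambda>i. ennreal (\<Prod>x\<in>\<omega> \<inter> W. f i x)) \<longlonglongrightarrow> ennreal (\<Prod>x\<in>\<omega> \<inter> W. v x)" for \<omega>
      by (intro tendsto_ennrealI tendsto_prod flim)
  qed (rule simp1(2))
  moreover have "(\<lambda>i. ennreal (exp (enn2real (\<integral>\<^sup>+x. ennreal (f i x) * indicator W x \<partial>\<Lambda>) - measure \<Lambda> W))) \<longlonglongrightarrow>
     ennreal (exp (enn2real (\<integral>\<^sup>+x. ennreal (v x) * indicator W x \<partial>\<Lambda>) - measure \<Lambda> W))"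
  proof (intro tendsto_ennrealI tendsto_exp tendsto_diff tendsto_const)
    have lim: "(\<lambda>i. \<integral>\<^sup>+x. ennreal (f i x) * indicator W x \<partial>\<Lambda>) \<longlonglongrightarrow> (\<integral>\<^sup>+x. ennreal (v x) * indicator W x \<partial>\<Lambda>)"
    proof (rule nn_integral_LIMSEQ)
      show "incseq (\<lambda>i x. ennreal (f i x) * indicator W x)"
        unfolding incseq_def le_fun_def by (intro allI impI mult_right_mono ennreal_leI finc) auto
      show "(\<lambda>x. ennreal (f i x) * indicator W x) \<in> borel_measurable \<Lambda>" for i using fm[of i] W by measurable
      show "(\<lambda>i. ennreal (f i x) * indicator W x) \<longlonglongrightarrow> ennreal (v x) * indicator W x" for x
        using tendsto_ennrealI[OF flim[of x]] by (cases "x \<in> W") auto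
    qed
    show "(\<lambda>i. enn2real (\<integral>\<^sup>+x. ennreal (f i x) * indicator W x \<partial>\<Lambda>)) \<longlonglongrightarrow> enn2real (\<integral>\<^sup>+x. ennreal (v x) * indicator W x \<partial>\<Lambda>)"
    proof -
      obtain l where l: "l \<ge> 0" "(\<integral>\<^sup>+x. ennreal (v x) * indicator W x \<partial>\<Lambda>) = ennreal l"
        using fin by (cases "\<integral>\<^sup>+x. ennreal (v x) * indicator W x \<partial>\<Lambda>") auto
      show ?thesis using tendsto_enn2real[OF lim[unfolded l(2)] l(1)] l by simp
    qed
  qed
  ultimately show ?thesis unfolding simp1(1) by (rule LIMSEQ_unique)
qed

end

section \<open>The action of the grid\<close>

text \<open>An essential bound of \<open>h\<close> on the half-line is a Lipschitz constant of its
  primitive \<open>J h\<close>.\<close>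

lemma J_lipschitz:
  assumes h: "h \<in> H0"
  shows "\<exists>C. \<forall>x\<ge>0. \<forall>y\<ge>0. \<bar>J h x - J h y\<bar> \<le> C * \<bar>x - y\<bar>"
proof -
  define k where "k s = indicator {0..} s * h s" for s
  have km[measurable]: "k \<in> borel_measurable borel"
    using h unfolding H0_def set_borel_measurable_def k_def[abs_def] by simp
  obtain C where C: "AE t in lborel. t \<ge> 0 \<longrightarrow> \<bar>h t\<bar> \<le> C" using h by (auto simp: H0_def)
  define C' where "C' = \<bar>C\<bar>"
  have kC: "AE t in lborel. \<bar>k t\<bar> \<le> C'" using C by eventually_elim (auto simp: k_def C'_def indicator_def)
  have ki: "integrable lborel (\<lambda>s. indicator {x..y} s * k s)" for x y :: real
  proof (rule Bochner_Integration.integrable_bound)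
    show "integrable lborel (\<lambda>s. C' * indicator {x..y} s)" by (intro integrable_mult_right integrable_real_indicator) (auto simp: emeasure_lborel_Icc_eq)
    show "AE s in lborel. norm (indicator {x..y} s * k s) \<le> norm (C' * indicator {x..y} s)"
      using kC by eventually_elim (auto simp: indicator_def C'_def)
  qed measurable
  have J: "J h x = (\<integral>s. indicator {0..x} s * k s \<partial>lborel)" for x
    unfolding J_def set_lebesgue_integral_def by (intro Bochner_Integration.integral_cong) (auto simp: k_def indicator_def)
  have le: "\<bar>J h y - J h x\<bar> \<le> C' * (y - x)" if xy: "0 \<le> x" "x \<le> y" for x y
  proof -
    have "J h y - J h x = (\<integral>s. indicator {0..y} s * k s - indicator {0..x} s * k s \<partial>lborel)" using ki by (simp add: J)
    also have "\<bar>\<dots>\<bar> \<le> (\<integral>s. C' * indicator {x..y} s \<partial>lborel)"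
    proof (rule order_trans[OF integral_abs_bound], rule integral_mono_AE)
      show "AE s in lborel. \<bar>indicator {0..y} s * k s - indicator {0..x} s * k s\<bar> \<le> C' * indicator {x..y} s"
        using kC by eventually_elim (use xy in \<open>auto simp: indicator_def C'_def\<close>)
      show "integrable lborel (\<lambda>s. C' * indicator {x..y} s)" by (intro integrable_mult_right integrable_real_indicator) (auto simp: emeasure_lborel_Icc_eq)
    qed (use ki in auto)
    also have "\<dots> = C' * (y - x)" using xy by simp
    finally show ?thesis .
  qed
  show ?thesis
  proof (intro exI[of _ C'] allI impI)
    fix x y :: real assume "0 \<le> x" "0 \<le> y"
    then show "\<bar>J h x - J h y\<bar> \<le> C' * \<bar>x - y\<bar>"
      using le[of x y] le[of y x] by (cases "x \<le> y") (auto simp: abs_minus_commute)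
  qed
qed

locale grid_flow = poisson_config \<mu> P C for \<mu> :: "'u::metric_space measure" and P C +
  fixes a b :: "'m::finite \<Rightarrow> real" and h :: "'m \<Rightarrow> real \<Rightarrow> real" and \<Gamma> :: "'m \<Rightarrow> 'u set"
  assumes grid: "differential_grid a b h \<Gamma>"
begin

lemma grid_H0: "h i \<in> H0" and grid_\<Gamma>: "\<Gamma> i \<in> sets borel" "bounded (\<Gamma> i)"
  and grid_sub: "{a i..<b i} \<subseteq> {0..}"
  and grid_disj: "i \<noteq> j \<Longrightarrow> ({a i..<b i} \<times> \<Gamma> i) \<inter> ({a j..<b j} \<times> \<Gamma> j) = {}"
  and grid_pos: "a i < t \<Longrightarrow> t < b i \<Longrightarrow> J (h i) t > 0"
  and grid_zero: "t \<ge> 0 \<Longrightarrow> t \<le> a i \<or> b i \<le> t \<Longrightarrow> J (h i) t = 0"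
proof -
  have A: "\<forall>i. {a i..<b i} \<subseteq> {0..} \<and> h i \<in> H0 \<and> \<Gamma> i \<in> U_fin"
    and B: "\<forall>i j. i \<noteq> j \<longrightarrow> ({a i..<b i} \<times> \<Gamma> i) \<inter> ({a j..<b j} \<times> \<Gamma> j) = {}"
    and D: "\<forall>i. (\<forall>t\<in>{a i<..<b i}. J (h i) t > 0) \<and> (\<forall>t\<in>{0..} - {a i<..<b i}. J (h i) t = 0)"
    using grid unfolding differential_grid_def by simp_all
  show "h i \<in> H0" "{a i..<b i} \<subseteq> {0..}" using spec[OF A, of i] by simp_all
  show "\<Gamma> i \<in> sets borel" "bounded (\<Gamma> i)" using spec[OF A, of i] by (simp_all add: U_fin_def)
  show "i \<noteq> j \<Longrightarrow> ({a i..<b i} \<times> \<Gamma> i) \<inter> ({a j..<b j} \<times> \<Gamma> j) = {}" using spec[OF spec[OF B], of i j] by simp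
  show "a i < t \<Longrightarrow> t < b i \<Longrightarrow> J (h i) t > 0" using bspec[OF conjunct1[OF spec[OF D]], of t i] by simp
  show "t \<ge> 0 \<Longrightarrow> t \<le> a i \<or> b i \<le> t \<Longrightarrow> J (h i) t = 0" using bspec[OF conjunct2[OF spec[OF D]], of t i] by auto
qed

section \<open>The one-dimensional flows of the grid\<close>

definition Lip :: "'m \<Rightarrow> real" where
  "Lip i = (SOME C. \<forall>x\<ge>0. \<forall>y\<ge>0. \<bar>J (h i) x - J (h i) y\<bar> \<le> C * \<bar>x - y\<bar>)"

lemma Lip: "x \<ge> 0 \<Longrightarrow> y \<ge> 0 \<Longrightarrow> \<bar>J (h i) x - J (h i) y\<bar> \<le> Lip i * \<bar>x - y\<bar>"
  using someI_ex[OF J_lipschitz[OF grid_H0[of i]]] unfolding Lip_def by blast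

lemma Lip_nonneg: "Lip i \<ge> 0"
  proof -
  have "\<bar>J (h i) 1 - J (h i) 0\<bar> \<le> Lip i * \<bar>1 - 0\<bar>" by (rule Lip) auto
  then show ?thesis by simp
qed

lemma interval_flow: "a i < b i \<Longrightarrow> interval_flow (J (h i)) (a i) (b i) (Lip i)"
  by unfold_locales (use grid_sub[of i] Lip grid_pos grid_zero in auto)

definition \<psi> :: "'m \<Rightarrow> real \<Rightarrow> real \<Rightarrow> real" where "\<psi> i t x = (if a i < b i then interval_flow.flow (J (h i)) (a i) (b i) t x else x)"
definition \<kappa> :: "'m \<Rightarrow> real \<Rightarrow> real \<Rightarrow> real" where "\<kappa> i t x = (if a i < b i then interval_flow.jac (J (h i)) (a i) (b i) t x else 1)"

lemma \<psi>_outside: "\<not> (a i < x \<and> x < b i) \<Longrightarrow> \<psi> i t x = x" "\<not> (a i < x \<and> x < b i) \<Longrightarrow> \<kappa> i t x = 1"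
  using interval_flow.flow_def[OF interval_flow] interval_flow.jac_def[OF interval_flow] by (auto simp: \<psi>_def \<kappa>_def)

lemma \<psi>_mem: "a i < \<psi> i t x \<and> \<psi> i t x < b i \<longleftrightarrow> a i < x \<and> x < b i"
  using interval_flow.flow_mem[OF interval_flow, of i t x] by (auto simp: \<psi>_def)

lemma \<psi>_0: "\<psi> i 0 x = x" by (simp add: \<psi>_def interval_flow.flow_0[OF interval_flow])

lemma \<psi>_add: "\<psi> i (s + t) x = \<psi> i s (\<psi> i t x)" by (simp add: \<psi>_def interval_flow.flow_add[OF interval_flow])

lemma \<psi>_nonneg: "x \<ge> 0 \<Longrightarrow> \<psi> i t x \<ge> 0" by (simp add: \<psi>_def interval_flow.flow_nonneg[OF interval_flow])

lemma \<kappa>_pos: "\<kappa> i t x > 0" by (simp add: \<kappa>_def interval_flow.jac_pos[OF interval_flow])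

lemma \<kappa>_lower: "exp (- (Lip i * \<bar>t\<bar>)) \<le> \<kappa> i t x"
  using interval_flow.jac_lower[OF interval_flow, of i t x] Lip_nonneg[of i] by (auto simp: \<kappa>_def)

lemma \<kappa>_upper: "\<kappa> i t x \<le> exp (Lip i * \<bar>t\<bar>)"
  using interval_flow.jac_upper[OF interval_flow, of i t x] Lip_nonneg[of i] by (auto simp: \<kappa>_def)

lemma \<psi>_meas: "(\<lambda>(t, x). \<psi> i t x) \<in> borel_measurable (borel \<Otimes>\<^sub>M borel)"
  by (cases "a i < b i") (use interval_flow.flow_meas[OF interval_flow, of i] in \<open>simp_all add: \<psi>_def\<close>)

lemma \<kappa>_meas: "(\<lambda>(t, x). \<kappa> i t x) \<in> borel_measurable (borel \<Otimes>\<^sub>M borel)"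
  by (cases "a i < b i") (use interval_flow.jac_meas[OF interval_flow, of i] in \<open>simp_all add: \<kappa>_def\<close>)

lemma nn_integral_\<psi>:
  fixes f :: "real \<Rightarrow> ennreal"
  assumes "f \<in> borel_measurable borel"
  shows "(\<integral>\<^sup>+x. f (\<psi> i t x) * ennreal (\<kappa> i t x) * indicator {a i<..<b i} x \<partial>lborel) = (\<integral>\<^sup>+x. f x * indicator {a i<..<b i} x \<partial>lborel)"
proof (cases "a i < b i")
  case True then show ?thesis using interval_flow.nn_integral_flow[OF interval_flow assms, of i t] by (simp add: \<psi>_def \<kappa>_def)
next
  case False then have "{a i<..<b i} = {}" by auto
  then show ?thesis by simp
qed

lemma J_scale: "J (\<lambda>t. c * h i t) x = c * J (h i) x"
  unfolding J_def set_lebesgue_integral_def by (simp add: mult.left_commute)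

text \<open>The definite description is resolved by exhibiting \<open>\<psi> i (s * c) x\<close> as
  a solution, while \<open>ode_gronwall\<close> with equal initial values gives uniqueness.\<close>

lemma stretch_eq:
  assumes x: "x \<ge> 0"
  shows "stretch (\<lambda>t. c * h i t) x = \<psi> i c x"
  unfolding stretch_def J_scale
proof (rule the_equality)
  have lip: "\<bar>J (h i) u - J (h i) w\<bar> \<le> Lip i * \<bar>u - w\<bar>" if "0 \<le> u" "0 \<le> w" for u w using Lip[OF that] .
  define z0 where "z0 s = \<psi> i (s * c) x" for s
  have z0: "z0 0 = x" "z0 1 = \<psi> i c x" "\<And>s. z0 s \<ge> 0" by (simp_all add: z0_def \<psi>_0 \<psi>_nonneg x)
  have d0: "(z0 has_real_derivative c * J (h i) (z0 s)) (at s within {0..1})" for s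
  proof (cases "a i < b i")
    case True
    then show ?thesis using interval_flow.flow_ode[OF interval_flow[OF True] x, of c s]
      by (auto simp: z0_def[abs_def] \<psi>_def intro: has_field_derivative_at_within)
  next
    case False
    then have "J (h i) x = 0" using x by (intro grid_zero) auto
    then show ?thesis using False by (simp add: z0_def[abs_def] \<psi>_def)
  qed
  show "\<exists>z. z 0 = x \<and> z 1 = \<psi> i c x \<and> (\<forall>s\<in>{0..1}. z s \<ge> 0 \<and> (z has_real_derivative c * J (h i) (z s)) (at s within {0..1}))"
    using z0 d0 by (intro exI[of _ z0]) auto
  fix y assume "\<exists>z. z 0 = x \<and> z 1 = y \<and> (\<forall>s\<in>{0..1}. z s \<ge> 0 \<and> (z has_real_derivative c * J (h i) (z s)) (at s within {0..1}))"
  then obtain z where z: "z 0 = x" "z 1 = y" "\<And>s. s \<in> {0..1} \<Longrightarrow> z s \<ge> 0" "\<And>s. s \<in> {0..1} \<Longrightarrow> (z has_real_derivative c * J (h i) (z s)) (at s within {0..1})" by blast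
  have "\<bar>z 1 - z0 1\<bar> \<le> exp (Lip i * \<bar>c\<bar>) * \<bar>z 0 - z0 0\<bar>"
    by (rule ode_gronwall[OF lip]) (use z z0 d0 in auto)
  then show "y = \<psi> i c x" using z z0 by simp
qed

text \<open>The interval is open on both sides because its end points are zeros of the field; the
  flow moves only interior points and keeps them inside.\<close>

definition cell :: "'m \<Rightarrow> (real \<times> 'u) set" where "cell i = {a i<..<b i} \<times> \<Gamma> i"
definition W :: "(real \<times> 'u) set" where "W = (\<Union>i. cell i)"

text \<open>The sign matches \<^const>\<open>config_stretch\<close>, which moves points by \<open>T\<^sub>-\<^sub>h\<close>. The summands vanish
  off the respective cells.\<close>

definition \<Theta> :: "real^'m \<Rightarrow> real \<times> 'u \<Rightarrow> real \<times> 'u" where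
  "\<Theta> s x = (fst x + (\<Sum>i\<in>UNIV. (if snd x \<in> \<Gamma> i then \<psi> i (- s $ i) (fst x) - fst x else 0)), snd x)"

text \<open>The Jacobian of \<open>\<Theta> s\<close> with respect to the intensity. At any point at
  most the factor of one cell differs from \<open>1\<close>.\<close>

definition K :: "real^'m \<Rightarrow> real \<times> 'u \<Rightarrow> real" where
  "K s x = (\<Prod>i\<in>UNIV. if snd x \<in> \<Gamma> i then \<kappa> i (- s $ i) (fst x) else 1)"

lemma cell_disj: "i \<noteq> j \<Longrightarrow> cell i \<inter> cell j = {}"
  using Int_mono[of "cell i" "{a i..<b i} \<times> \<Gamma> i" "cell j" "{a j..<b j} \<times> \<Gamma> j"] grid_disj[of i j] by (force simp: cell_def)

lemma cell_sets: "cell i \<in> sets \<Lambda>" "bounded (cell i)"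
proof -
  have "{a i<..<b i} \<subseteq> {0..}" using grid_sub[of i] by force
  then show "cell i \<in> sets \<Lambda>" unfolding cell_def by (intro rect_in_\<Lambda> grid_\<Gamma>) auto
  show "bounded (cell i)" unfolding cell_def
    by (intro bounded_Times grid_\<Gamma> bounded_subset[OF bounded_closed_interval[of "a i" "b i"]]) auto
qed

lemma W_sets: "W \<in> sets \<Lambda>" "bounded W"
  unfolding W_def using cell_sets by (auto intro!: sets.finite_UN)

lemma \<Theta>_cell: "x \<in> cell i \<Longrightarrow> \<Theta> s x = (\<psi> i (- s $ i) (fst x), snd x)"
proof -
  assume x: "x \<in> cell i"
  have "(\<Sum>j\<in>UNIV. (if snd x \<in> \<Gamma> j then \<psi> j (- s $ j) (fst x) - fst x else 0)) = (\<Sum>j\<in>{i}. (if snd x \<in> \<Gamma> j then \<psi> j (- s $ j) (fst x) - fst x else 0))"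
  proof (rule sum.mono_neutral_right)
    show "\<forall>j\<in>UNIV - {i}. (if snd x \<in> \<Gamma> j then \<psi> j (- s $ j) (fst x) - fst x else 0) = 0"
    proof
      fix j assume "j \<in> UNIV - {i}"
      then have "x \<notin> cell j" using x cell_disj[of i j] by blast
      then show "(if snd x \<in> \<Gamma> j then \<psi> j (- s $ j) (fst x) - fst x else 0) = 0"
        using \<psi>_outside(1)[of j "fst x" "- s $ j"] by (cases x) (auto simp: cell_def indicator_def)
    qed
  qed auto
  then show ?thesis using x by (auto simp: \<Theta>_def cell_def)
qed

lemma \<Theta>_outside: "x \<notin> W \<Longrightarrow> \<Theta> s x = x"
proof -
  assume "x \<notin> W"
  then have "(if snd x \<in> \<Gamma> j then \<psi> j (- s $ j) (fst x) - fst x else 0) = 0" for j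
    using \<psi>_outside(1)[of j "fst x" "- s $ j"] by (cases x) (auto simp: W_def cell_def indicator_def)
  then show ?thesis by (simp add: \<Theta>_def)
qed

lemma K_cell: "x \<in> cell i \<Longrightarrow> K s x = \<kappa> i (- s $ i) (fst x)"
proof -
  assume x: "x \<in> cell i"
  have "K s x = (\<Prod>j\<in>{i}. if snd x \<in> \<Gamma> j then \<kappa> j (- s $ j) (fst x) else 1)"
    unfolding K_def
  proof (rule prod.mono_neutral_right)
    show "\<forall>j\<in>UNIV - {i}. (if snd x \<in> \<Gamma> j then \<kappa> j (- s $ j) (fst x) else 1) = 1"
    proof
      fix j assume "j \<in> UNIV - {i}"
      then have "x \<notin> cell j" using x cell_disj[of i j] by blast
      then show "(if snd x \<in> \<Gamma> j then \<kappa> j (- s $ j) (fst x) else 1) = 1"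
        using \<psi>_outside(2)[of j "fst x" "- s $ j"] by (cases x) (auto simp: cell_def)
    qed
  qed auto
  then show ?thesis using x by (auto simp: cell_def)
qed

lemma K_outside: "x \<notin> W \<Longrightarrow> K s x = 1"
proof -
  assume "x \<notin> W"
  then have "(if snd x \<in> \<Gamma> j then \<kappa> j (- s $ j) (fst x) else 1) = 1" for j
    using \<psi>_outside(2)[of j "fst x" "- s $ j"] by (cases x) (auto simp: W_def cell_def)
  then show ?thesis by (simp add: K_def)
qed

lemma K_pos: "K s x > 0" unfolding K_def by (intro prod_pos) (auto simp: \<kappa>_pos)

definition Lip_sum :: real where "Lip_sum = (\<Sum>i\<in>UNIV. Lip i)"

lemma Lip_bound: "Lip i * \<bar>- s $ i\<bar> \<le> Lip_sum * norm s"
proof -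
  have "Lip i \<le> Lip_sum" unfolding Lip_sum_def by (rule member_le_sum) (auto simp: Lip_nonneg)
  then show ?thesis using component_le_norm_cart[of s i] Lip_nonneg[of i] by (intro mult_mono) auto
qed

lemma Lip_sum_nonneg: "Lip_sum \<ge> 0" unfolding Lip_sum_def by (intro sum_nonneg Lip_nonneg)

lemma K_bounds: "exp (- (Lip_sum * norm s)) \<le> K s x" "K s x \<le> exp (Lip_sum * norm s)"
proof -
  have "exp (- (Lip_sum * norm s)) \<le> K s x \<and> K s x \<le> exp (Lip_sum * norm s)"
  proof (cases "x \<in> W")
    case True
    then obtain i where i: "x \<in> cell i" by (auto simp: W_def)
    have "exp (- (Lip_sum * norm s)) \<le> exp (- (Lip i * \<bar>- s $ i\<bar>))" "exp (Lip i * \<bar>- s $ i\<bar>) \<le> exp (Lip_sum * norm s)"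
      using Lip_bound[of i s] by auto
    then show ?thesis using \<kappa>_lower[of i "- s $ i" "fst x"] \<kappa>_upper[of i "- s $ i" "fst x"] unfolding K_cell[OF i] by linarith
  qed (use Lip_sum_nonneg in \<open>simp add: K_outside\<close>)
  then show "exp (- (Lip_sum * norm s)) \<le> K s x" "K s x \<le> exp (Lip_sum * norm s)" by auto
qed

lemma \<Theta>_mem_cell: "\<Theta> s x \<in> cell i \<longleftrightarrow> x \<in> cell i"
proof (cases "x \<in> W")
  case True
  then obtain j where j: "x \<in> cell j" by (auto simp: W_def)
  have "\<Theta> s x \<in> cell j" using j \<psi>_mem[of j "- s $ j" "fst x"] unfolding \<Theta>_cell[OF j] by (cases x) (auto simp: cell_def)
  with j show ?thesis using cell_disj[of i j] by (cases "i = j") auto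
qed (simp add: \<Theta>_outside)

lemma \<Theta>_add: "\<Theta> (s + t) x = \<Theta> s (\<Theta> t x)"
proof (cases "x \<in> W")
  case True
  then obtain i where i: "x \<in> cell i" by (auto simp: W_def)
  then have i': "\<Theta> t x \<in> cell i" by (simp add: \<Theta>_mem_cell)
  show ?thesis using \<psi>_add[of i "- s $ i" "- t $ i" "fst x"]
    unfolding \<Theta>_cell[OF i'] by (simp add: \<Theta>_cell[OF i])
qed (simp add: \<Theta>_outside)

lemma \<Theta>_0: "\<Theta> 0 x = x"
  by (simp add: \<Theta>_def \<psi>_0 cong: if_cong)

lemma snd_\<Theta>: "snd (\<Theta> s x) = snd x" by (simp add: \<Theta>_def)

lemma \<Theta>_space: "x \<in> {0..} \<times> UNIV \<Longrightarrow> \<Theta> s x \<in> {0..} \<times> UNIV"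
proof (cases "x \<in> W")
  case True
  assume "x \<in> {0..} \<times> UNIV"
  obtain i where i: "x \<in> cell i" using True by (auto simp: W_def)
  then show ?thesis using \<psi>_nonneg[of "fst x" i "- s $ i"] \<open>x \<in> {0..} \<times> UNIV\<close> by (auto simp: \<Theta>_cell)
qed (simp add: \<Theta>_outside)

lemma \<Theta>_axis:
  assumes "fst x \<ge> 0"
  shows "\<Theta> (\<epsilon> *\<^sub>R axis i 1) x = (if snd x \<in> \<Gamma> i then stretch (\<lambda>t. - (\<epsilon> * h i t)) (fst x) else fst x, snd x)"
proof -
  have "stretch (\<lambda>t. - (\<epsilon> * h i t)) (fst x) = \<psi> i (- \<epsilon>) (fst x)" using stretch_eq[OF assms, of "- \<epsilon>" i] by simp
  moreover have "(\<Sum>j\<in>UNIV. (if snd x \<in> \<Gamma> j then \<psi> j (- (\<epsilon> *\<^sub>R axis i 1 :: real^'m) $ j) (fst x) - fst x else 0)) =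
     (\<Sum>j\<in>{i}. (if snd x \<in> \<Gamma> j then \<psi> j (- (\<epsilon> *\<^sub>R axis i 1 :: real^'m) $ j) (fst x) - fst x else 0))"
    by (rule sum.mono_neutral_right) (auto simp: axis_nth axis_def \<psi>_0 cong: if_cong)
  ultimately show ?thesis unfolding \<Theta>_def by (auto simp: axis_nth)
qed

lemma config_stretch_eq: "\<omega> \<in> configs \<Longrightarrow> config_stretch (\<lambda>t. \<epsilon> * h i t) (\<Gamma> i) \<omega> = \<Theta> (\<epsilon> *\<^sub>R axis i 1) ` \<omega>"
proof -
  assume w: "\<omega> \<in> configs"
  have "(\<lambda>(\<tau>, u). (if u \<in> \<Gamma> i then stretch (\<lambda>t. - (\<epsilon> * h i t)) \<tau> else \<tau>, u)) x = \<Theta> (\<epsilon> *\<^sub>R axis i 1) x" if "x \<in> \<omega>" for x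
    using w that by (subst \<Theta>_axis) (auto simp: configs_def split_beta)
  then show ?thesis unfolding config_stretch_def by (intro image_cong) auto
qed

text \<open>Points outside \<open>W\<close> are fixed, so a point carried into \<open>B\<close>
  comes from \<open>W\<close> or was in \<open>B\<close> already. Questions about the image in a
  bounded set thus involve finitely many points.\<close>

lemma \<Theta>_vimage_bounded: "\<Theta> s x \<in> B \<Longrightarrow> x \<in> W \<union> B"
  using \<Theta>_outside[of x s] by (cases "x \<in> W") auto

lemma \<Theta>_configs: "\<omega> \<in> configs \<Longrightarrow> \<Theta> s ` \<omega> \<in> configs"
proof -
  assume w: "\<omega> \<in> configs"
  have "finite (\<Theta> s ` \<omega> \<inter> B)" if "bounded B" for B
  proof -
    have "\<Theta> s ` \<omega> \<inter> B \<subseteq> \<Theta> s ` (\<omega> \<inter> (W \<union> B))" using \<Theta>_vimage_bounded by blast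
    moreover have "finite (\<omega> \<inter> (W \<union> B))" using w that W_sets(2) by (intro config_finite) auto
    ultimately show ?thesis by (meson finite_imageI finite_subset)
  qed
  moreover have "\<Theta> s ` \<omega> \<subseteq> {0..} \<times> UNIV"
    using w by (intro image_subsetI \<Theta>_space) (auto simp: configs_def)
  ultimately show ?thesis by (simp add: configs_def)
qed

lemma \<Theta>_conf0: "\<omega> \<in> conf0 \<Longrightarrow> \<Theta> s ` \<omega> \<in> conf0"
proof -
  assume w: "\<omega> \<in> conf0"
  then have c: "\<Theta> s ` \<omega> \<in> configs" using conf0_configs by (intro \<Theta>_configs) auto
  have "\<Theta> s x \<in> {0..} \<times> closure C" if "x \<in> \<omega>" for x
  proof -
    have "x \<in> {0..} \<times> closure C" using w that by (auto simp: conf0_def)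
    then show ?thesis using \<Theta>_space[of x s] snd_\<Theta>[of s x] by (auto simp: mem_Times_iff)
  qed
  then have "\<Theta> s ` \<omega> \<subseteq> {0..} \<times> closure C" by blast
  then show ?thesis using c by (simp add: conf0_def)
qed

section \<open>Measurability and change of variables for the action on points\<close>

lemma fst_meas: "fst \<in> borel_measurable \<Lambda>"
  unfolding intensity_def by (rule measurable_compose[OF measurable_fst]) (auto intro!: measurable_restrict_space1)

lemma snd_meas: "snd \<in> \<Lambda> \<rightarrow>\<^sub>M borel"
  using measurable_snd[of "restrict_space lborel {0::real..}" \<mu>] measurable_cong_sets[OF refl sets_\<mu>] unfolding intensity_def by blast

lemma K_meas: "(\<lambda>(s, x). K s x) \<in> borel_measurable (borel \<Otimes>\<^sub>M \<Lambda>)"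
proof -
  note [measurable] = fst_meas snd_meas grid_\<Gamma>(1)
  have c: "(\<lambda>s :: real^'m. - s $ i) \<in> borel_measurable borel" for i by (intro borel_measurable_continuous_onI linear_continuous_on bounded_linear_compose[OF bounded_linear_vec_nth] bounded_linear_minus bounded_linear_ident)
  have "(\<lambda>p. \<kappa> i (- fst p $ i) (fst (snd p))) \<in> borel_measurable (borel \<Otimes>\<^sub>M \<Lambda>)" for i
    using measurable_compose[OF measurable_Pair[OF measurable_compose[OF measurable_fst c] measurable_compose[OF measurable_snd fst_meas]] \<kappa>_meas, of i i] by (simp add: split_beta')
  note [measurable] = this
  show ?thesis unfolding K_def split_beta' by measurable
qed

lemma \<Theta>_meas: "(\<lambda>(s, x). \<Theta> s x) \<in> borel \<Otimes>\<^sub>M \<Lambda> \<rightarrow>\<^sub>M \<Lambda>"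
proof -
  note [measurable] = fst_meas snd_meas grid_\<Gamma>(1)
  have c: "(\<lambda>s :: real^'m. - s $ i) \<in> borel_measurable borel" for i by (intro borel_measurable_continuous_onI linear_continuous_on bounded_linear_compose[OF bounded_linear_vec_nth] bounded_linear_minus bounded_linear_ident)
  have "(\<lambda>p. \<psi> i (- fst p $ i) (fst (snd p))) \<in> borel_measurable (borel \<Otimes>\<^sub>M \<Lambda>)" for i
    using measurable_compose[OF measurable_Pair[OF measurable_compose[OF measurable_fst c] measurable_compose[OF measurable_snd fst_meas]] \<psi>_meas, of i i] by (simp add: split_beta')
  note [measurable] = this
  have f: "(\<lambda>p. fst (\<Theta> (fst p) (snd p))) \<in> borel \<Otimes>\<^sub>M \<Lambda> \<rightarrow>\<^sub>M restrict_space lborel {0..}"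
  proof (rule measurable_restrict_space2)
    show "(\<lambda>p. fst (\<Theta> (fst p) (snd p))) \<in> space (borel \<Otimes>\<^sub>M \<Lambda>) \<rightarrow> {0..}"
    proof
      fix p :: "(real^'m) \<times> real \<times> 'u" assume "p \<in> space (borel \<Otimes>\<^sub>M \<Lambda>)"
      then have "snd p \<in> {0..} \<times> UNIV" by (auto simp: space_pair_measure space_\<Lambda>)
      from \<Theta>_space[OF this, of "fst p"] show "fst (\<Theta> (fst p) (snd p)) \<in> {0..}" by (auto simp: mem_Times_iff)
    qed
    have "(\<lambda>p. fst (\<Theta> (fst p) (snd p))) \<in> borel_measurable (borel \<Otimes>\<^sub>M \<Lambda>)" unfolding \<Theta>_def fst_conv by measurable
    then show "(\<lambda>p. fst (\<Theta> (fst p) (snd p))) \<in> borel \<Otimes>\<^sub>M \<Lambda> \<rightarrow>\<^sub>M lborel" by simp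
  qed
  have "(\<lambda>p. snd (\<Theta> (fst p) (snd p))) \<in> borel \<Otimes>\<^sub>M \<Lambda> \<rightarrow>\<^sub>M borel" unfolding snd_\<Theta> by measurable
  then have "(\<lambda>p. snd (\<Theta> (fst p) (snd p))) \<in> borel \<Otimes>\<^sub>M \<Lambda> \<rightarrow>\<^sub>M \<mu>" using measurable_cong_sets[OF refl sets_\<mu>] by blast
  from measurable_Pair[OF f this] show ?thesis unfolding intensity_def[symmetric] by (simp add: split_beta')
qed

lemma \<Theta>_meas1: "\<Theta> s \<in> \<Lambda> \<rightarrow>\<^sub>M \<Lambda>"
  using measurable_compose[OF measurable_Pair1' \<Theta>_meas, of s] by simp

lemma K_meas1: "K s \<in> borel_measurable \<Lambda>"
  using measurable_compose[OF measurable_Pair1' K_meas, of s] by simp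

text \<open>For a fixed mark in \<open>\<Gamma> i\<close> this is the one-dimensional substitution
  \<open>nn_integral_\<psi>\<close>; for other marks both sides vanish. Fubini joins the
  marks.\<close>

lemma nn_integral_cell:
  fixes f :: "real \<times> 'u \<Rightarrow> ennreal"
  assumes f[measurable]: "f \<in> borel_measurable \<Lambda>"
  shows "(\<integral>\<^sup>+x. f (\<Theta> s x) * ennreal (K s x) * indicator (cell i) x \<partial>\<Lambda>) = (\<integral>\<^sup>+x. f x * indicator (cell i) x \<partial>\<Lambda>)"
proof -
  note [measurable] = \<Theta>_meas1 K_meas1 cell_sets(1)
  have lhsm: "(\<lambda>x. f (\<Theta> s x) * ennreal (K s x) * indicator (cell i) x) \<in> borel_measurable \<Lambda>"
    and rhsm: "(\<lambda>x. f x * indicator (cell i) x) \<in> borel_measurable \<Lambda>" by measurable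
  have sub: "{a i<..<b i} \<subseteq> {0..}" using grid_sub[of i] by force
  have inner: "(\<integral>\<^sup>+t. f (\<Theta> s (t, u)) * ennreal (K s (t, u)) * indicator (cell i) (t, u) \<partial>restrict_space lborel {0..})
     = (\<integral>\<^sup>+t. f (t, u) * indicator (cell i) (t, u) \<partial>restrict_space lborel {0..})" for u
  proof (cases "u \<in> \<Gamma> i")
    case True
    \<comment> \<open>Extension by zero to negative times, since the one-dimensional formula is
      stated on the whole line; the interval of the cell lies in the half-line, so nothing
      changes.\<close>
    define g where "g t = (if t \<in> {0..} then f (t, u) else 0)" for t
    have "(\<lambda>t. f (t, u)) \<in> borel_measurable (restrict_space lborel {0..})"
      using measurable_compose[OF measurable_Pair2' f[unfolded intensity_def], of u] by (simp add: space_\<mu>)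
    then have gm: "g \<in> borel_measurable borel"
      unfolding g_def by (subst (asm) measurable_restrict_space_iff[of _ _ 0]) (auto simp: cong: measurable_cong_sets)
    have "(\<integral>\<^sup>+t. f (\<Theta> s (t, u)) * ennreal (K s (t, u)) * indicator (cell i) (t, u) \<partial>restrict_space lborel {0..})
       = (\<integral>\<^sup>+t. g (\<psi> i (- s $ i) t) * ennreal (\<kappa> i (- s $ i) t) * indicator {a i<..<b i} t \<partial>lborel)"
    proof (subst nn_integral_restrict_space, simp, rule nn_integral_cong)
      fix t
      show "f (\<Theta> s (t, u)) * ennreal (K s (t, u)) * indicator (cell i) (t, u) * indicator {0..} t = g (\<psi> i (- s $ i) t) * ennreal (\<kappa> i (- s $ i) t) * indicator {a i<..<b i} t"
      proof (cases "a i < t \<and> t < b i")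
        case ct: True
        then have "(t, u) \<in> cell i" "t \<ge> 0" using True sub by (auto simp: cell_def)
        moreover have "\<psi> i (- s $ i) t \<ge> 0" using \<psi>_nonneg \<open>t \<ge> 0\<close> by blast
        ultimately show ?thesis using ct by (simp add: \<Theta>_cell K_cell g_def)
      next
        case False
        then show ?thesis by (simp only: cell_def indicator_def) auto
      qed
    qed
    also have "\<dots> = (\<integral>\<^sup>+t. g t * indicator {a i<..<b i} t \<partial>lborel)" by (rule nn_integral_\<psi>[OF gm])
    also have "\<dots> = (\<integral>\<^sup>+t. f (t, u) * indicator (cell i) (t, u) \<partial>restrict_space lborel {0..})"
      by (subst nn_integral_restrict_space, simp, rule nn_integral_cong) (use True sub in \<open>auto simp: g_def cell_def indicator_def\<close>)
    finally show ?thesis .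
  qed (simp add: cell_def)
  show ?thesis
    unfolding intensity_def
    by (subst (1 2) T\<mu>.nn_integral_snd[symmetric]) (use lhsm rhsm in \<open>simp_all add: intensity_def[symmetric] inner\<close>)
qed

lemma nn_integral_\<Theta>:
  fixes f :: "real \<times> 'u \<Rightarrow> ennreal"
  assumes f[measurable]: "f \<in> borel_measurable \<Lambda>" and V[measurable]: "V \<in> sets \<Lambda>" and WV: "W \<subseteq> V"
  shows "(\<integral>\<^sup>+x. f (\<Theta> s x) * ennreal (K s x) * indicator V x \<partial>\<Lambda>) = (\<integral>\<^sup>+x. f x * indicator V x \<partial>\<Lambda>)"
proof -
  note [measurable] = \<Theta>_meas1 K_meas1 cell_sets(1) W_sets(1)
  have ind: "(indicator V x :: ennreal) = indicator (V - W) x + (\<Sum>i\<in>UNIV. indicator (cell i) x)" for x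
  proof (cases "x \<in> W")
    case True
    then obtain i where i: "x \<in> cell i" by (auto simp: W_def)
    have "(\<Sum>j\<in>UNIV. indicator (cell j) x :: ennreal) = (\<Sum>j\<in>{i}. indicator (cell j) x)"
      using i cell_disj by (intro sum.mono_neutral_right) (auto simp: indicator_def)
    then show ?thesis using True WV i by auto
  next
    case False
    then have "\<forall>i. x \<notin> cell i" by (auto simp: W_def)
    then show ?thesis using False by (simp add: indicator_def)
  qed
  have "(\<integral>\<^sup>+x. f (\<Theta> s x) * ennreal (K s x) * indicator V x \<partial>\<Lambda>) =
     (\<integral>\<^sup>+x. f (\<Theta> s x) * ennreal (K s x) * indicator (V - W) x \<partial>\<Lambda>) + (\<Sum>i\<in>UNIV. \<integral>\<^sup>+x. f (\<Theta> s x) * ennreal (K s x) * indicator (cell i) x \<partial>\<Lambda>)"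
    unfolding ind distrib_left sum_distrib_left by (subst nn_integral_add, measurable, subst nn_integral_sum, measurable)
  also have "(\<integral>\<^sup>+x. f (\<Theta> s x) * ennreal (K s x) * indicator (V - W) x \<partial>\<Lambda>) = (\<integral>\<^sup>+x. f x * indicator (V - W) x \<partial>\<Lambda>)"
    by (rule nn_integral_cong) (auto simp: indicator_def \<Theta>_outside K_outside)
  also have "(\<integral>\<^sup>+x. f x * indicator (V - W) x \<partial>\<Lambda>) + (\<Sum>i\<in>UNIV. \<integral>\<^sup>+x. f (\<Theta> s x) * ennreal (K s x) * indicator (cell i) x \<partial>\<Lambda>)
    = (\<integral>\<^sup>+x. f x * indicator V x \<partial>\<Lambda>)"
    unfolding nn_integral_cell[OF f] ind distrib_left sum_distrib_left by (subst nn_integral_add, measurable, subst nn_integral_sum, measurable)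
  finally show ?thesis .
qed

text \<open>Off the almost sure set \<^const>\<open>conf0\<close> the action is trivial, because there measurability of the image
  configuration is not available.\<close>

definition \<theta> :: "real^'m \<Rightarrow> 'u config \<Rightarrow> 'u config" where
  "\<theta> s \<omega> = (if \<omega> \<in> conf0 then \<Theta> s ` \<omega> else \<omega>)"

text \<open>The density relating two Poisson laws usually carries an exponential of the difference
  of total intensities. Here \<open>K s\<close> has over \<open>W\<close> the same integral as
  \<open>1\<close>, by the change of variables, so that factor is \<open>1\<close> and only the
  product remains.\<close>

definition \<rho> :: "real^'m \<Rightarrow> 'u config \<Rightarrow> real" where
  "\<rho> s \<omega> = (if \<omega> \<in> conf0 then \<Prod>x\<in>\<omega> \<inter> W. K s x else 1)"

text \<open>The image avoids \<open>B\<close> exactly if the number of points of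
  \<open>W \<union> B\<close> carried into \<open>B\<close> is zero, and this number is a sum over a
  bounded set that depends measurably on parameter and configuration.\<close>

lemma \<Theta>_void_measurable:
  assumes B: "B \<in> sets \<Lambda>" "bounded B"
  shows "{p \<in> space (borel \<Otimes>\<^sub>M P). \<Theta> (fst p) ` snd p \<in> void B} \<in> sets (borel \<Otimes>\<^sub>M P)"
proof -
  note [measurable] = \<Theta>_meas B(1)
  have V: "W \<union> B \<in> sets \<Lambda>" "bounded (W \<union> B)" using B W_sets by auto
  have "(\<lambda>(s, x). indicator B (\<Theta> s x) :: ennreal) \<in> borel_measurable (borel \<Otimes>\<^sub>M \<Lambda>)"
    using measurable_compose[OF \<Theta>_meas borel_measurable_indicator[OF B(1)]] by (simp add: split_beta')
  from config_sum_measurable[OF V this]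
  have m: "(\<lambda>p. \<Sum>x\<in>snd p \<inter> (W \<union> B). indicator B (\<Theta> (fst p) x) :: ennreal) \<in> borel_measurable (borel \<Otimes>\<^sub>M P)"
    by (simp add: split_beta')
  have "\<Theta> s ` \<omega> \<in> void B \<longleftrightarrow> (\<Sum>x\<in>\<omega> \<inter> (W \<union> B). indicator B (\<Theta> s x) :: ennreal) = 0" if w: "\<omega> \<in> configs" for s \<omega>
  proof -
    have "finite (\<omega> \<inter> (W \<union> B))" using config_finite[OF w V(2)] .
    then have "(\<Sum>x\<in>\<omega> \<inter> (W \<union> B). indicator B (\<Theta> s x) :: ennreal) = 0 \<longleftrightarrow> (\<forall>x\<in>\<omega> \<inter> (W \<union> B). \<Theta> s x \<notin> B)"
      by (subst sum_eq_0_iff) (auto simp: indicator_def)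
    also have "\<dots> \<longleftrightarrow> \<Theta> s ` \<omega> \<inter> B = {}" using \<Theta>_vimage_bounded[of s _ B] by blast
    finally show ?thesis using \<Theta>_configs[OF w] by (simp add: void_def)
  qed
  then have "{p \<in> space (borel \<Otimes>\<^sub>M P). \<Theta> (fst p) ` snd p \<in> void B} =
    {p \<in> space (borel \<Otimes>\<^sub>M P). (\<Sum>x\<in>snd p \<inter> (W \<union> B). indicator B (\<Theta> (fst p) x) :: ennreal) = 0}"
    by (auto simp: space_pair_measure space_P)
  also have "\<dots> \<in> sets (borel \<Otimes>\<^sub>M P)" using m by measurable
  finally show ?thesis .
qed

lemma \<theta>_measurable: "(\<lambda>(s, \<omega>). \<theta> s \<omega>) \<in> borel \<Otimes>\<^sub>M P \<rightarrow>\<^sub>M P"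
proof (rule measurableI)
  fix p :: "(real^'m) \<times> 'u config" assume "p \<in> space (borel \<Otimes>\<^sub>M P)"
  then show "(case p of (s, \<omega>) \<Rightarrow> \<theta> s \<omega>) \<in> space P"
    using \<Theta>_configs by (auto simp: space_pair_measure space_P \<theta>_def)
next
  fix S assume S: "S \<in> sets P"
  \<comment> \<open>On \<open>E\<close> the image stays in \<open>conf0\<close> and void events
    suffice; off \<open>E\<close> the action is the identity, and the preimage is a
    rectangle.\<close>
  define E where "E = (UNIV :: (real^'m) set) \<times> conf0"
  have E: "E \<in> sets (borel \<Otimes>\<^sub>M P)" unfolding E_def by (intro pair_measureI conf0_sets) auto
  have "{p \<in> E. \<Theta> (fst p) ` snd p \<in> S} \<in> sets (borel \<Otimes>\<^sub>M P)"
  proof (rule preimage_measurable[OF _ \<Theta>_void_measurable E _ S])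
    show "\<Theta> (fst p) ` snd p \<in> configs" if "p \<in> space (borel \<Otimes>\<^sub>M P)" for p :: "(real^'m) \<times> 'u config"
      using that \<Theta>_configs by (auto simp: space_pair_measure space_P)
    show "\<Theta> (fst p) ` snd p \<in> conf0" if "p \<in> E" for p using that \<Theta>_conf0 by (auto simp: E_def)
  qed
  moreover have "(UNIV :: (real^'m) set) \<times> (S - conf0) \<in> sets (borel \<Otimes>\<^sub>M P)" using S conf0_sets by (intro pair_measureI) auto
  moreover have "(\<lambda>(s, \<omega>). \<theta> s \<omega>) -` S \<inter> space (borel \<Otimes>\<^sub>M P) = {p \<in> E. \<Theta> (fst p) ` snd p \<in> S} \<union> (UNIV :: (real^'m) set) \<times> (S - conf0)"
    using sets.sets_into_space[OF S] sets.sets_into_space[OF conf0_sets]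
    by (auto simp: E_def \<theta>_def space_pair_measure split: if_splits)
  ultimately show "(\<lambda>(s, \<omega>). \<theta> s \<omega>) -` S \<inter> space (borel \<Otimes>\<^sub>M P) \<in> sets (borel \<Otimes>\<^sub>M P)" by simp
qed

lemma \<rho>_measurable: "(\<lambda>(s, \<omega>). \<rho> s \<omega>) \<in> borel_measurable (borel \<Otimes>\<^sub>M P)"
proof -
  note [measurable] = conf0_sets
  have "(\<lambda>(s, \<omega>). \<Prod>x\<in>\<omega> \<inter> W. (case (s, x) of (s, x) \<Rightarrow> K s x)) \<in> borel_measurable (borel \<Otimes>\<^sub>M P)"
    by (rule config_prod_measurable[OF W_sets K_meas]) (auto simp: K_pos split: prod.split)
  then have [measurable]: "(\<lambda>p. \<Prod>x\<in>snd p \<inter> W. K (fst p) x) \<in> borel_measurable (borel \<Otimes>\<^sub>M P)"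
    by (simp add: split_beta')
  show ?thesis unfolding \<rho>_def split_beta' by measurable
qed

section \<open>Quasi-invariance of the Poisson law\<close>

lemma \<theta>_plus: "\<theta> (s + t) \<omega> = \<theta> s (\<theta> t \<omega>)"
  by (auto simp: \<theta>_def \<Theta>_conf0 image_image \<Theta>_add)

lemma \<rho>_bounded_below: "\<exists>c>0. \<forall>s. norm s \<le> R \<longrightarrow> c \<le> \<rho> s \<omega>"
proof (intro exI conjI allI impI)
  \<comment> \<open>Each of the finitely many factors over \<open>W\<close> is at least
    \<open>exp (- (Lip_sum * R))\<close>. The minimum with \<open>1\<close> accounts for
    configurations off \<open>conf0\<close>, where the density is \<open>1\<close>.\<close>
  define q where "q = exp (- (Lip_sum * R)) ^ card (\<omega> \<inter> W)"
  show "min 1 q > 0" by (simp add: q_def)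
  fix s :: "real^'m" assume s: "norm s \<le> R"
  have "Lip_sum * norm s \<le> Lip_sum * R" using s Lip_sum_nonneg by (rule mult_left_mono)
  then have "exp (- (Lip_sum * R)) \<le> K s x" for x using K_bounds(1)[of s x] by (meson exp_le_cancel_iff neg_le_iff_le order_trans)
  then have "(\<Prod>x\<in>\<omega> \<inter> W. exp (- (Lip_sum * R))) \<le> (\<Prod>x\<in>\<omega> \<inter> W. K s x)" by (intro prod_mono) auto
  then show "min 1 q \<le> \<rho> s \<omega>" by (auto simp: \<rho>_def q_def)
qed

lemma \<theta>_measurable1: "\<theta> s \<in> P \<rightarrow>\<^sub>M P"
  using measurable_compose[OF measurable_Pair1' \<theta>_measurable, of s] by simp

lemma \<rho>_measurable1: "\<rho> s \<in> borel_measurable P"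
  using measurable_compose[OF measurable_Pair1' \<rho>_measurable, of s] by simp

text \<open>The integrand is a product over the points in \<open>W \<union> B\<close>, so the
  generating functional applies. By the change of variables its exponent is the intensity of
  \<open>V - B\<close> minus that of \<open>V\<close>, which is minus the intensity of
  \<open>B\<close>.\<close>

lemma void_integral:
  assumes B: "B \<in> sets \<Lambda>" "bounded B"
  shows "(\<integral>\<^sup>+\<omega>. ennreal (\<rho> s \<omega>) * indicator (void B) (\<theta> s \<omega>) \<partial>P) = emeasure P (void B)"
proof -
  note [measurable] = \<Theta>_meas1 K_meas1 B(1) W_sets(1)
  define V where "V = W \<union> B"
  have V[measurable]: "V \<in> sets \<Lambda>" and Vb: "bounded V" using B W_sets by (auto simp: V_def)
  \<comment> \<open>A factor zero for each point carried into \<open>B\<close> encodes the void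
    event of the image; otherwise the factors are those of the density, equal to \<open>1\<close>
    outside \<open>W\<close>.\<close>
  define v where "v x = (if \<Theta> s x \<in> B then 0 else K s x)" for x
  have vm: "v \<in> borel_measurable \<Lambda>" unfolding v_def by measurable
  have eq: "\<rho> s \<omega> * indicator (void B) (\<theta> s \<omega>) = (\<Prod>x\<in>\<omega> \<inter> V. v x)" if w: "\<omega> \<in> conf0" for \<omega>
  proof -
    have wc: "\<omega> \<in> configs" using w conf0_configs by blast
    have fin: "finite (\<omega> \<inter> V)" using config_finite[OF wc Vb] .
    show ?thesis
    proof (cases "\<Theta> s ` \<omega> \<inter> B = {}")
      case True
      then have "\<theta> s \<omega> \<in> void B" using w \<Theta>_configs[OF wc] by (simp add: \<theta>_def void_def)
      moreover have "(\<Prod>x\<in>\<omega> \<inter> V. v x) = (\<Prod>x\<in>\<omega> \<inter> V. K s x)"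
        by (rule prod.cong) (use True in \<open>auto simp: v_def\<close>)
      moreover have "\<dots> = (\<Prod>x\<in>\<omega> \<inter> W. K s x)"
        by (rule prod.mono_neutral_right[OF fin]) (auto simp: V_def K_outside)
      ultimately show ?thesis using w by (simp add: \<rho>_def)
    next
      case False
      then have "\<theta> s \<omega> \<notin> void B" using w by (simp add: \<theta>_def void_def)
      moreover obtain x where x: "x \<in> \<omega>" "\<Theta> s x \<in> B" using False by blast
      then have "x \<in> \<omega> \<inter> V" using \<Theta>_vimage_bounded[of s x B] by (simp add: V_def)
      then have "(\<Prod>x\<in>\<omega> \<inter> V. v x) = 0" using fin x by (intro prod_zero) (auto simp: v_def)
      ultimately show ?thesis by simp
    qed
  qed
  have "(\<integral>\<^sup>+\<omega>. ennreal (\<rho> s \<omega>) * indicator (void B) (\<theta> s \<omega>) \<partial>P) = (\<integral>\<^sup>+\<omega>. ennreal (\<Prod>x\<in>\<omega> \<inter> V. v x) \<partial>P)"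
  proof (rule nn_integral_cong_AE)
    show "AE \<omega> in P. ennreal (\<rho> s \<omega>) * indicator (void B) (\<theta> s \<omega>) = ennreal (\<Prod>x\<in>\<omega> \<inter> V. v x)"
      using AE_conf0 by eventually_elim (auto simp flip: eq simp: indicator_def)
  qed
  also have I: "(\<integral>\<^sup>+x. ennreal (v x) * indicator V x \<partial>\<Lambda>) = emeasure \<Lambda> (V - B)"
  proof -
    have "(\<integral>\<^sup>+x. ennreal (v x) * indicator V x \<partial>\<Lambda>) = (\<integral>\<^sup>+x. (if \<Theta> s x \<in> B then 0 else 1) * ennreal (K s x) * indicator V x \<partial>\<Lambda>)"
      by (rule nn_integral_cong) (auto simp: v_def)
    also have "\<dots> = (\<integral>\<^sup>+x. (if x \<in> B then 0 else 1) * indicator V x \<partial>\<Lambda>)"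
      by (rule nn_integral_\<Theta>[of "\<lambda>x. if x \<in> B then 0 else 1"]) (measurable, auto simp: V_def)
    also have "\<dots> = (\<integral>\<^sup>+x. indicator (V - B) x \<partial>\<Lambda>)" by (rule nn_integral_cong) (auto simp: indicator_def)
    also have "\<dots> = emeasure \<Lambda> (V - B)" by (rule nn_integral_indicator) measurable
    finally show ?thesis .
  qed
  have fin: "emeasure \<Lambda> (V - B) < \<infinity>" by (rule emeasure_\<Lambda>_bounded) (use Vb in \<open>auto intro: bounded_subset\<close>)
  have "(\<integral>\<^sup>+\<omega>. ennreal (\<Prod>x\<in>\<omega> \<inter> V. v x) \<partial>P) = ennreal (exp (measure \<Lambda> (V - B) - measure \<Lambda> V))"
    using poisson_functional[OF V Vb vm] fin unfolding I measure_def by (simp add: v_def less_imp_le K_pos)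
  also have "measure \<Lambda> (V - B) - measure \<Lambda> V = - measure \<Lambda> B"
    using measure_Diff[of \<Lambda> V B] emeasure_\<Lambda>_bounded[OF Vb V] B by (simp add: V_def)
  also have "ennreal (exp (- measure \<Lambda> B)) = emeasure P (void B)"
    using void_prob[OF B] by (simp add: P.emeasure_eq_measure)
  finally show ?thesis by (simp add: I)
qed

text \<open>The image \<open>Q\<close> under \<open>\<theta> s\<close> of the measure with density
  \<open>\<rho> s\<close> has the void probabilities of \<open>P\<close> by
  \<open>void_integral\<close> and is carried by \<open>conf0\<close>; hence it equals
  \<open>P\<close>.\<close>

lemma quasi_invariance:
  fixes Z :: "'u config \<Rightarrow> ennreal"
  assumes Z: "Z \<in> borel_measurable P"
  shows "(\<integral>\<^sup>+\<omega>. Z (\<theta> s \<omega>) * ennreal (\<rho> s \<omega>) \<partial>P) = (\<integral>\<^sup>+\<omega>. Z \<omega> \<partial>P)"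
proof -
  note [measurable] = \<theta>_measurable1 \<rho>_measurable1 conf0_sets
  define Q where "Q = distr (density P (\<lambda>\<omega>. ennreal (\<rho> s \<omega>))) P (\<theta> s)"
  have int: "(\<integral>\<^sup>+\<omega>. Y \<omega> \<partial>Q) = (\<integral>\<^sup>+\<omega>. ennreal (\<rho> s \<omega>) * Y (\<theta> s \<omega>) \<partial>P)" if [measurable]: "Y \<in> borel_measurable P" for Y :: "'u config \<Rightarrow> ennreal"
    unfolding Q_def by (subst nn_integral_distr, measurable, subst nn_integral_density, measurable)
  have Qv: "emeasure Q (void B) = emeasure P (void B)" if "B \<in> sets \<Lambda>" "bounded B" for B
    using void_integral[OF that, of s] int[of "indicator (void B)"] void_sets[OF that] by (simp add: Q_def)
  have "void {} = space P" by (simp add: void_def space_P)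
  then have "emeasure Q (space Q) = 1" using Qv[of "{}"] by (simp add: Q_def P.emeasure_space_1)
  then have fin: "finite_measure Q" by (intro finite_measureI) simp
  have "Q = P"
  proof (rule measure_eqI_void[OF fin _ _ _ _ AE_conf0 Qv])
    show "finite_measure P" by unfold_locales
    have "AE \<omega> in P. ennreal (\<rho> s \<omega>) > 0 \<longrightarrow> \<theta> s \<omega> \<in> conf0"
      using AE_conf0 by eventually_elim (simp add: \<theta>_def \<Theta>_conf0)
    then show "AE \<omega> in Q. \<omega> \<in> conf0" unfolding Q_def
      by (subst AE_distr_iff, measurable, subst AE_density, measurable)
  qed (auto simp: Q_def)
  then show ?thesis using int[OF Z] by (simp add: mult.commute)
qed

sublocale flow: qi_flow P \<theta> \<rho>
  by unfold_locales (use \<theta>_measurable \<theta>_plus \<rho>_measurable \<rho>_bounded_below quasi_invariance in auto)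

end

section \<open>Convergence in variation\<close>

lemma powr_card: "m \<ge> 1 \<Longrightarrow> \<bar>x :: real\<bar> powr real m = \<bar>x\<bar> ^ m"
  by (rule powr_realpow') auto

lemma Lp_power:
  assumes m: "m \<ge> 1" and f: "f \<in> Lp M (real m)"
  shows "f \<in> borel_measurable M" "integrable M (\<lambda>x. \<bar>f x\<bar> ^ m)" "(\<integral>\<^sup>+x. ennreal (\<bar>f x\<bar> ^ m) \<partial>M) < \<infinity>"
proof -
  show "f \<in> borel_measurable M" and i: "integrable M (\<lambda>x. \<bar>f x\<bar> ^ m)" using f by (auto simp: Lp_def powr_card[OF m])
  show "(\<integral>\<^sup>+x. ennreal (\<bar>f x\<bar> ^ m) \<partial>M) < \<infinity>" by (subst nn_integral_eq_integral[OF i]) auto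
qed

lemma abs_diff_power_le: "\<bar>x - y\<bar> ^ m \<le> 2 ^ m * (\<bar>x\<bar> ^ m + \<bar>y\<bar> ^ m)" for x y :: real
proof -
  have "\<bar>x - y\<bar> ^ m \<le> (2 * max \<bar>x\<bar> \<bar>y\<bar>) ^ m" by (intro power_mono) auto
  also have "\<dots> = 2 ^ m * max \<bar>x\<bar> \<bar>y\<bar> ^ m" by (rule power_mult_distrib)
  also have "max \<bar>x\<bar> \<bar>y\<bar> ^ m \<le> \<bar>x\<bar> ^ m + \<bar>y\<bar> ^ m" by (cases "\<bar>x\<bar> \<le> \<bar>y\<bar>") (auto simp: max_def)
  finally show ?thesis by simp
qed

lemma Lp_tendsto_power:
  assumes m: "m \<ge> 1" and X: "Lp_tendsto M (real m) X g F"
  shows "((\<lambda>i. \<integral>\<^sup>+x. ennreal (\<bar>X i x - g x\<bar> ^ m) \<partial>M) \<longlongrightarrow> 0) F"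
proof -
  have g: "g \<in> Lp M (real m)" and Xi: "\<forall>\<^sub>F i in F. X i \<in> Lp M (real m)"
    and lim: "((\<lambda>i. Lp_norm M (real m) (\<lambda>x. X i x - g x)) \<longlongrightarrow> 0) F" using X by (auto simp: Lp_tendsto_def)
  have eq: "(\<integral>\<^sup>+x. ennreal (\<bar>Y x - g x\<bar> ^ m) \<partial>M) = ennreal (Lp_norm M (real m) (\<lambda>x. Y x - g x) ^ m)"
    if Y: "Y \<in> Lp M (real m)" for Y
  proof -
    note [measurable] = Lp_power(1)[OF m g] Lp_power(1)[OF m Y]
    have i: "integrable M (\<lambda>x. \<bar>Y x - g x\<bar> ^ m)"
    proof (rule Bochner_Integration.integrable_bound)
      show "integrable M (\<lambda>x. 2 ^ m * (\<bar>Y x\<bar> ^ m + \<bar>g x\<bar> ^ m))" using Lp_power(2)[OF m g] Lp_power(2)[OF m Y] by auto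
      show "AE x in M. norm (\<bar>Y x - g x\<bar> ^ m) \<le> norm (2 ^ m * (\<bar>Y x\<bar> ^ m + \<bar>g x\<bar> ^ m))"
        using abs_diff_power_le by (intro AE_I2) simp
    qed measurable
    define I where "I = (\<integral>x. \<bar>Y x - g x\<bar> ^ m \<partial>M)"
    have I0: "I \<ge> 0" unfolding I_def by simp
    have "Lp_norm M (real m) (\<lambda>x. Y x - g x) ^ m = (I powr (1 / real m)) ^ m" by (simp add: Lp_norm_def I_def powr_card[OF m])
    also have "\<dots> = (I powr (1 / real m)) powr real m" using powr_card[OF m, of "I powr (1 / real m)"] by simp
    also have "\<dots> = I" using I0 m by (simp add: powr_powr)
    finally show ?thesis using nn_integral_eq_integral[OF i] by (simp add: I_def)
  qed
  have "((\<lambda>i. ennreal (Lp_norm M (real m) (\<lambda>x. X i x - g x) ^ m)) \<longlongrightarrow> ennreal (0 ^ m)) F"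
    by (intro tendsto_ennrealI tendsto_power lim)
  then have l: "((\<lambda>i. ennreal (Lp_norm M (real m) (\<lambda>x. X i x - g x) ^ m)) \<longlongrightarrow> 0) F" using m by (simp add: power_0_left)
  show ?thesis
    by (rule Lim_transform_eventually[OF l]) (use Xi in \<open>eventually_elim, simp add: eq\<close>)
qed

text \<open>The limit over real \<open>\<epsilon>\<close> is restricted to the sequence
  \<open>1 / (k + 1)\<close>, and on the almost sure set \<open>conf0\<close> the stretching
  \<open>config_stretch\<close> coincides with the action along the axis \<open>i\<close>.\<close>

lemma (in grid_flow) Lp_derivative_flow:
  assumes D: "has_Lp_derivative P (real CARD('m)) (h i) (\<Gamma> i) f g"
  shows "flow.flow_deriv i f g"
proof -
  have m: "CARD('m) \<ge> 1" by (simp add: Suc_leI)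
  have f: "f \<in> Lp P (real CARD('m))"
    and T: "Lp_tendsto P (real CARD('m)) (\<lambda>\<epsilon> \<omega>. (f (config_stretch (\<lambda>t. \<epsilon> * h i t) (\<Gamma> i) \<omega>) - f \<omega>) / \<epsilon>) g (at 0)"
    using D by (auto simp: has_Lp_derivative_def)
  then have g: "g \<in> Lp P (real CARD('m))" by (simp add: Lp_tendsto_def)
  define \<epsilon> where "\<epsilon> k = inverse (real (Suc k))" for k
  have \<epsilon>: "\<epsilon> \<longlonglongrightarrow> 0" "\<And>k. \<epsilon> k \<noteq> 0" unfolding \<epsilon>_def by (rule LIMSEQ_inverse_real_of_nat) simp
  then have "filterlim \<epsilon> (at 0) sequentially" by (intro filterlim_atI) auto
  from filterlim_compose[OF Lp_tendsto_power[OF m T] this]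
  have "(\<lambda>k. \<integral>\<^sup>+\<omega>. ennreal (\<bar>(f (config_stretch (\<lambda>t. \<epsilon> k * h i t) (\<Gamma> i) \<omega>) - f \<omega>) / \<epsilon> k - g \<omega>\<bar> ^ CARD('m)) \<partial>P) \<longlonglongrightarrow> 0" .
  also have "(\<lambda>k. \<integral>\<^sup>+\<omega>. ennreal (\<bar>(f (config_stretch (\<lambda>t. \<epsilon> k * h i t) (\<Gamma> i) \<omega>) - f \<omega>) / \<epsilon> k - g \<omega>\<bar> ^ CARD('m)) \<partial>P)
    = (\<lambda>k. \<integral>\<^sup>+\<omega>. ennreal (\<bar>(f (\<theta> (\<epsilon> k *\<^sub>R axis i 1) \<omega>) - f \<omega>) / \<epsilon> k - g \<omega>\<bar> ^ CARD('m)) \<partial>P)"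
  proof (intro ext nn_integral_cong_AE)
    fix k
    show "AE \<omega> in P. ennreal (\<bar>(f (config_stretch (\<lambda>t. \<epsilon> k * h i t) (\<Gamma> i) \<omega>) - f \<omega>) / \<epsilon> k - g \<omega>\<bar> ^ CARD('m))
      = ennreal (\<bar>(f (\<theta> (\<epsilon> k *\<^sub>R axis i 1) \<omega>) - f \<omega>) / \<epsilon> k - g \<omega>\<bar> ^ CARD('m))"
      using AE_conf0
    proof eventually_elim
      case (elim \<omega>)
      then have "config_stretch (\<lambda>t. \<epsilon> k * h i t) (\<Gamma> i) \<omega> = \<theta> (\<epsilon> k *\<^sub>R axis i 1) \<omega>"
        using conf0_configs by (subst config_stretch_eq) (auto simp: \<theta>_def)
      then show ?case by simp
    qed
  qed
  finally show ?thesis unfolding flow.flow_deriv_def using \<epsilon> Lp_power[OF m f] Lp_power[OF m g] by blast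
qed

text \<open>A nearly optimal finite family of disjoint sets yields the step function
  \<open>\<phi>\<close> with values \<open>sgn (\<sigma> B)\<close>, bounded by \<open>1\<close>
  because of disjointness, whose integrals give the sum of the
  \<open>\<bar>\<sigma> B\<bar>\<close>. It is then smoothed in mean with respect to the laws of
  both \<open>F\<close> and \<open>F'\<close>.\<close>

lemma variation_norm_C1:
  fixes F F' :: "'w \<Rightarrow> real^'m"
  assumes P: "prob_space P" and F[measurable]: "F \<in> borel_measurable P" "F' \<in> borel_measurable P"
    and A[measurable]: "A \<in> sets P" and e: "e > 0"
  shows "\<exists>\<psi> g B. C1 \<psi> g \<and> (\<forall>x. \<bar>\<psi> x\<bar> \<le> 1) \<and> (\<forall>x. norm (g x) \<le> B) \<and>
    variation_norm (\<lambda>B. image_on P A F B - image_on P A F' B)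
      \<le> ennreal ((\<integral>\<omega>. indicator A \<omega> * (\<psi> (F \<omega>) - \<psi> (F' \<omega>)) \<partial>P) + e)"
proof -
  interpret P: prob_space P by fact
  define \<sigma> where "\<sigma> B = image_on P A F B - image_on P A F' B" for B
  define \<PP> where "\<PP> = {\<P> :: (real^'m) set set. finite \<P> \<and> disjoint \<P> \<and> \<P> \<subseteq> sets borel}"
  define \<phi> where "\<phi> \<P> x = (\<Sum>B\<in>\<P>. sgn (\<sigma> B) * indicator B x)" for \<P> x
  have intP: "integrable P Y" if "Y \<in> borel_measurable P" "\<And>\<omega>. \<bar>Y \<omega>\<bar> \<le> c" for Y :: "'w \<Rightarrow> real" and c
    using that by (intro P.integrable_const_bound[of _ c]) auto
  have \<phi>_le: "\<bar>\<phi> \<P> x\<bar> \<le> 1" if "\<P> \<in> \<PP>" for \<P> x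
  proof -
    have fin: "finite \<P>" and dis: "disjoint \<P>" using that by (auto simp: \<PP>_def)
    show ?thesis
    proof (cases "\<exists>B\<in>\<P>. x \<in> B")
      case True
      then obtain B where B: "B \<in> \<P>" "x \<in> B" by blast
      have "\<phi> \<P> x = (\<Sum>B\<in>{B}. sgn (\<sigma> B) * indicator B x)" unfolding \<phi>_def
        by (rule sum.mono_neutral_right[OF fin]) (use B dis in \<open>auto simp: disjoint_def indicator_def\<close>)
      then show ?thesis using B by (simp add: abs_sgn_eq)
    next
      case False
      then have "\<phi> \<P> x = 0" unfolding \<phi>_def by (intro sum.neutral) (auto simp: indicator_def)
      then show ?thesis by simp
    qed
  qed
  have \<phi>_meas: "\<phi> \<P> \<in> borel_measurable borel" if "\<P> \<in> \<PP>" for \<P>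
    unfolding \<phi>_def by (intro borel_measurable_sum borel_measurable_times borel_measurable_const borel_measurable_indicator) (use that in \<open>auto simp: \<PP>_def\<close>)
  have img: "image_on P A H B = (\<integral>\<omega>. indicator A \<omega> * indicator B (H \<omega>) \<partial>P)"
    if [measurable]: "H \<in> borel_measurable P" "B \<in> sets borel" for H :: "'w \<Rightarrow> real^'m" and B
  proof -
    have s: "A \<inter> {\<omega> \<in> space P. H \<omega> \<in> B} \<in> sets P" by measurable
    have "(\<integral>\<omega>. indicator A \<omega> * indicat_real B (H \<omega>) \<partial>P) = (\<integral>\<omega>. indicator (A \<inter> {\<omega> \<in> space P. H \<omega> \<in> B}) \<omega> \<partial>P)"
      by (intro Bochner_Integration.integral_cong) (auto simp: indicator_inter_arith split: split_indicator)
    also have "\<dots> = image_on P A H B" using s by (simp add: image_on_def sets.Int_space_eq2)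
    finally show ?thesis by simp
  qed
  have sum_eq: "(\<Sum>B\<in>\<P>. \<bar>\<sigma> B\<bar>) = (\<integral>\<omega>. indicator A \<omega> * (\<phi> \<P> (F \<omega>) - \<phi> \<P> (F' \<omega>)) \<partial>P)" if p: "\<P> \<in> \<PP>" for \<P>
  proof -
    have B: "B \<in> sets borel" if "B \<in> \<P>" for B using p that by (auto simp: \<PP>_def)
    have i: "integrable P (\<lambda>\<omega>. indicator A \<omega> * indicator B (H \<omega>) :: real)"
      if [measurable]: "H \<in> borel_measurable P" "B \<in> sets borel" for H :: "'w \<Rightarrow> real^'m" and B
      by (rule intP[of _ 1]) (auto simp: indicator_def)
    have "(\<Sum>B\<in>\<P>. \<bar>\<sigma> B\<bar>) = (\<Sum>B\<in>\<P>. \<integral>\<omega>. sgn (\<sigma> B) * (indicator A \<omega> * indicator B (F \<omega>) - indicator A \<omega> * indicator B (F' \<omega>)) \<partial>P)"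
    proof (rule sum.cong)
      fix B assume "B \<in> \<P>"
      then have b: "B \<in> sets borel" by (rule B)
      have "\<bar>\<sigma> B\<bar> = sgn (\<sigma> B) * (image_on P A F B - image_on P A F' B)" using sgn_mult_abs[of "\<sigma> B"] by (simp add: \<sigma>_def[symmetric] abs_sgn mult.commute)
      then show "\<bar>\<sigma> B\<bar> = (\<integral>\<omega>. sgn (\<sigma> B) * (indicator A \<omega> * indicator B (F \<omega>) - indicator A \<omega> * indicator B (F' \<omega>)) \<partial>P)"
        using i[OF F(1) b] i[OF F(2) b] by (simp add: img[OF F(1) b] img[OF F(2) b])
    qed simp
    also have "\<dots> = (\<integral>\<omega>. (\<Sum>B\<in>\<P>. sgn (\<sigma> B) * (indicator A \<omega> * indicator B (F \<omega>) - indicator A \<omega> * indicator B (F' \<omega>))) \<partial>P)"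
      by (rule Bochner_Integration.integral_sum[symmetric]) (use i[OF F(1) B] i[OF F(2) B] in auto)
    also have "\<dots> = (\<integral>\<omega>. indicator A \<omega> * (\<phi> \<P> (F \<omega>) - \<phi> \<P> (F' \<omega>)) \<partial>P)"
      by (intro Bochner_Integration.integral_cong refl) (simp add: \<phi>_def sum_subtractf[symmetric] sum_distrib_left algebra_simps)
    finally show ?thesis .
  qed
  \<comment> \<open>The supremum is taken among reals, which the bound \<open>2\<close> permits, so
    that a family within \<open>e / 2\<close> of it can be selected.\<close>
  define T where "T = (\<lambda>\<P>. \<Sum>B\<in>\<P>. \<bar>\<sigma> B\<bar>) ` \<PP>"
  have bdd: "(\<Sum>B\<in>\<P>. \<bar>\<sigma> B\<bar>) \<le> 2" if p: "\<P> \<in> \<PP>" for \<P>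
  proof -
    note [measurable] = \<phi>_meas[OF p]
    have b: "\<bar>indicator A \<omega> * (\<phi> \<P> (F \<omega>) - \<phi> \<P> (F' \<omega>))\<bar> \<le> 2" for \<omega>
      using \<phi>_le[OF p, of "F \<omega>"] \<phi>_le[OF p, of "F' \<omega>"] by (auto simp: indicator_def)
    have "(\<integral>\<omega>. indicator A \<omega> * (\<phi> \<P> (F \<omega>) - \<phi> \<P> (F' \<omega>)) \<partial>P) \<le> (\<integral>\<omega>. 2 \<partial>P)"
      by (intro integral_mono intP[of _ 2]) (use b in \<open>auto simp: abs_le_iff\<close>)
    then show ?thesis by (simp add: sum_eq[OF p] P.prob_space)
  qed
  have "{} \<in> \<PP>" by (simp add: \<PP>_def)
  then have Tne: "T \<noteq> {}" and Tb: "bdd_above T" by (auto simp: T_def intro!: bdd_aboveI[of _ 2] bdd)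
  define r where "r = Sup T"
  have V: "variation_norm \<sigma> \<le> ennreal r"
    unfolding variation_norm_def \<PP>_def[symmetric]
  proof (rule SUP_least)
    fix \<P> assume p: "\<P> \<in> \<PP>"
    have "(\<Sum>B\<in>\<P>. \<bar>\<sigma> B\<bar>) \<le> r" unfolding r_def by (rule cSup_upper[OF _ Tb]) (use p in \<open>auto simp: T_def\<close>)
    then show "(\<Sum>B\<in>\<P>. ennreal \<bar>\<sigma> B\<bar>) \<le> ennreal r" by (simp add: ennreal_leI)
  qed
  have "r - e / 2 < Sup T" using e by (simp add: r_def)
  then obtain \<P> where p: "\<P> \<in> \<PP>" and rp: "r - e / 2 < (\<Sum>B\<in>\<P>. \<bar>\<sigma> B\<bar>)"
    unfolding less_cSup_iff[OF Tne Tb] by (auto simp: T_def)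
  note [measurable] = \<phi>_meas[OF p]
  \<comment> \<open>Two copies of \<open>P\<close>, one mapped by \<open>F\<close> and one by
    \<open>F'\<close>: the image \<open>M\<close> is the sum of the two laws. Approximation in mean
    with respect to \<open>M\<close> controls both errors at once.\<close>
  define N where "N = count_space (UNIV :: bool set) \<Otimes>\<^sub>M P"
  define H where "H q = (if fst q then F (snd q) else F' (snd q))" for q :: "bool \<times> 'w"
  have Hm[measurable]: "H \<in> borel_measurable N" unfolding H_def N_def by measurable
  define M where "M = distr N borel H"
  have int: "(\<integral>\<^sup>+x. Y x \<partial>M) = (\<integral>\<^sup>+\<omega>. Y (F \<omega>) \<partial>P) + (\<integral>\<^sup>+\<omega>. Y (F' \<omega>) \<partial>P)"
    if [measurable]: "Y \<in> borel_measurable borel" for Y :: "real^'m \<Rightarrow> ennreal"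
  proof -
    have "(\<integral>\<^sup>+x. Y x \<partial>M) = (\<integral>\<^sup>+q. Y (H q) \<partial>N)" unfolding M_def by (rule nn_integral_distr) measurable
    also have "\<dots> = (\<integral>\<^sup>+b. \<integral>\<^sup>+\<omega>. Y (H (b, \<omega>)) \<partial>P \<partial>count_space UNIV)" unfolding N_def
      by (rule P.nn_integral_fst[symmetric]) (use Hm in \<open>simp add: N_def\<close>)
    also have "\<dots> = (\<integral>\<^sup>+\<omega>. Y (F \<omega>) \<partial>P) + (\<integral>\<^sup>+\<omega>. Y (F' \<omega>) \<partial>P)"
      by (subst nn_integral_count_space_finite) (simp_all add: UNIV_bool H_def add.commute)
    finally show ?thesis .
  qed
  have "emeasure M (space M) = 2" using int[of "\<lambda>_. 1"] by (simp add: P.emeasure_space_1)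
  then have Mf: "finite_measure M" by (intro finite_measureI) simp
  have "sets M = sets borel" by (simp add: M_def)
  from L1_approx_C1[OF Mf this \<phi>_meas[OF p] \<phi>_le[OF p], of "e / 2"] e
  obtain \<psi> g B where \<psi>: "C1 \<psi> g" "\<And>x. \<bar>\<psi> x\<bar> \<le> 1" "\<And>x. norm (g x) \<le> B" and ap: "(\<integral>x. \<bar>\<phi> \<P> x - \<psi> x\<bar> \<partial>M) < e / 2" by auto
  note [measurable] = C1_measurable(1)[OF \<psi>(1)]
  have db: "\<bar>\<phi> \<P> x - \<psi> x\<bar> \<le> 2" for x using \<phi>_le[OF p, of x] \<psi>(2)[of x] by linarith
  have iM: "integrable M (\<lambda>x. \<bar>\<phi> \<P> x - \<psi> x\<bar>)"
    by (rule finite_measure.integrable_const_bound[OF Mf, of _ 2]) (use db in \<open>auto simp: M_def\<close>)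
  have iP: "integrable P (\<lambda>\<omega>. \<bar>\<phi> \<P> (F \<omega>) - \<psi> (F \<omega>)\<bar>)" "integrable P (\<lambda>\<omega>. \<bar>\<phi> \<P> (F' \<omega>) - \<psi> (F' \<omega>)\<bar>)"
    by (rule intP[of _ 2]; use db in simp)+
  have "ennreal (\<integral>x. \<bar>\<phi> \<P> x - \<psi> x\<bar> \<partial>M) = ennreal ((\<integral>\<omega>. \<bar>\<phi> \<P> (F \<omega>) - \<psi> (F \<omega>)\<bar> \<partial>P) + (\<integral>\<omega>. \<bar>\<phi> \<P> (F' \<omega>) - \<psi> (F' \<omega>)\<bar> \<partial>P))"
    using int[of "\<lambda>x. ennreal \<bar>\<phi> \<P> x - \<psi> x\<bar>"] nn_integral_eq_integral[OF iM] nn_integral_eq_integral[OF iP(1)] nn_integral_eq_integral[OF iP(2)]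
    by (simp add: ennreal_plus)
  then have small: "(\<integral>\<omega>. \<bar>\<phi> \<P> (F \<omega>) - \<psi> (F \<omega>)\<bar> \<partial>P) + (\<integral>\<omega>. \<bar>\<phi> \<P> (F' \<omega>) - \<psi> (F' \<omega>)\<bar> \<partial>P) < e / 2"
    using ap by (subst (asm) ennreal_inj) auto
  have "(\<integral>\<omega>. indicator A \<omega> * (\<phi> \<P> (F \<omega>) - \<phi> \<P> (F' \<omega>)) \<partial>P)
    \<le> (\<integral>\<omega>. indicator A \<omega> * (\<psi> (F \<omega>) - \<psi> (F' \<omega>)) + \<bar>\<phi> \<P> (F \<omega>) - \<psi> (F \<omega>)\<bar> + \<bar>\<phi> \<P> (F' \<omega>) - \<psi> (F' \<omega>)\<bar> \<partial>P)"
  proof (rule integral_mono)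
    have "\<bar>indicator A \<omega> * (\<phi> \<P> (F \<omega>) - \<phi> \<P> (F' \<omega>))\<bar> \<le> 2" for \<omega>
      using \<phi>_le[OF p, of "F \<omega>"] \<phi>_le[OF p, of "F' \<omega>"] by (auto simp: indicator_def)
    then show "integrable P (\<lambda>\<omega>. indicator A \<omega> * (\<phi> \<P> (F \<omega>) - \<phi> \<P> (F' \<omega>)))" by (intro intP) auto
    have "\<bar>indicator A \<omega> * (\<psi> (F \<omega>) - \<psi> (F' \<omega>)) + \<bar>\<phi> \<P> (F \<omega>) - \<psi> (F \<omega>)\<bar> + \<bar>\<phi> \<P> (F' \<omega>) - \<psi> (F' \<omega>)\<bar>\<bar> \<le> 6" for \<omega>
      using \<psi>(2)[of "F \<omega>"] \<psi>(2)[of "F' \<omega>"] db[of "F \<omega>"] db[of "F' \<omega>"] by (auto simp: indicator_def)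
    then show "integrable P (\<lambda>\<omega>. indicator A \<omega> * (\<psi> (F \<omega>) - \<psi> (F' \<omega>)) + \<bar>\<phi> \<P> (F \<omega>) - \<psi> (F \<omega>)\<bar> + \<bar>\<phi> \<P> (F' \<omega>) - \<psi> (F' \<omega>)\<bar>)"
      by (intro intP) auto
  qed (auto simp: indicator_def)
  also have "\<dots> = (\<integral>\<omega>. indicator A \<omega> * (\<psi> (F \<omega>) - \<psi> (F' \<omega>)) \<partial>P) + (\<integral>\<omega>. \<bar>\<phi> \<P> (F \<omega>) - \<psi> (F \<omega>)\<bar> \<partial>P) + (\<integral>\<omega>. \<bar>\<phi> \<P> (F' \<omega>) - \<psi> (F' \<omega>)\<bar> \<partial>P)"
  proof -
    have "\<bar>indicator A \<omega> * (\<psi> (F \<omega>) - \<psi> (F' \<omega>))\<bar> \<le> 2" for \<omega>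
      using \<psi>(2)[of "F \<omega>"] \<psi>(2)[of "F' \<omega>"] by (auto simp: indicator_def)
    then have "integrable P (\<lambda>\<omega>. indicator A \<omega> * (\<psi> (F \<omega>) - \<psi> (F' \<omega>)))" by (intro intP) auto
    then show ?thesis using iP by (subst Bochner_Integration.integral_add, simp_all)+
  qed
  finally have "r \<le> (\<integral>\<omega>. indicator A \<omega> * (\<psi> (F \<omega>) - \<psi> (F' \<omega>)) \<partial>P) + e"
    using rp small unfolding sum_eq[OF p] by linarith
  then have "variation_norm \<sigma> \<le> ennreal ((\<integral>\<omega>. indicator A \<omega> * (\<psi> (F \<omega>) - \<psi> (F' \<omega>)) \<partial>P) + e)"
    using V by (meson ennreal_leI order_trans)
  then show ?thesis using \<psi> unfolding \<sigma>_def by blast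
qed

theorem theorem2p2:
  fixes \<mu> :: "'u::metric_space measure"
    and P :: "'u config measure"
    and a b :: "'m::finite \<Rightarrow> real"
    and h :: "'m \<Rightarrow> real \<Rightarrow> real"
    and \<Gamma> :: "'m \<Rightarrow> 'u set"
    and fn :: "nat \<Rightarrow> 'u config \<Rightarrow> real ^ 'm"
    and f :: "'u config \<Rightarrow> real ^ 'm"
    and Dfn :: "nat \<Rightarrow> 'm \<Rightarrow> 'm \<Rightarrow> 'u config \<Rightarrow> real"
    and Df :: "'m \<Rightarrow> 'm \<Rightarrow> 'u config \<Rightarrow> real"
  assumes "locally compact (UNIV :: 'u set)"
    and "mark_measure \<mu>"
    and "separably_supported \<mu>"
    and "poisson_law \<mu> P"
    and "differential_grid a b h \<Gamma>"
    and "\<And>n i j. has_Lp_derivative P (real CARD('m)) (h i) (\<Gamma> i) (\<lambda>\<omega>. fn n \<omega> $ j) (Dfn n i j)"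
    and "\<And>i j. has_Lp_derivative P (real CARD('m)) (h i) (\<Gamma> i) (\<lambda>\<omega>. f \<omega> $ j) (Df i j)"
    and "\<And>j. Lp_tendsto P (real CARD('m)) (\<lambda>n \<omega>. fn n \<omega> $ j) (\<lambda>\<omega>. f \<omega> $ j) sequentially"
    and "\<And>i j. Lp_tendsto P (real CARD('m)) (\<lambda>n. Dfn n i j) (Df i j) sequentially"
    and "A \<in> sets P"
    and "A \<subseteq> nondegenerate_set P Df"
  shows "tendsto_in_variation (\<lambda>n. image_on P A (fn n)) (image_on P A f)"
proof -
  obtain C where C: "countable C" "AE u in \<mu>. u \<in> closure C" using assms(3) by (auto simp: separably_supported_def)
  interpret grid_flow \<mu> P C a b h \<Gamma> by unfold_locales fact+
  have m: "CARD('m) \<ge> 1" by (simp add: Suc_leI)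
  \<comment> \<open>The indices are exchanged against the matrix of the statement, since row
    \<open>j\<close> of a Jacobian matrix here is the gradient of component \<open>j\<close>;
    invertibility is unaffected by transposition.\<close>
  define Gn :: "nat \<Rightarrow> 'u config \<Rightarrow> real^'m^'m" where "Gn n \<omega> = (\<chi> j i. Dfn n i j \<omega>)" for n \<omega>
  define G :: "'u config \<Rightarrow> real^'m^'m" where "G \<omega> = (\<chi> j i. Df i j \<omega>)" for \<omega>
  have Sn: "flow.flow_sobolev (fn n) (Gn n)" for n
    unfolding flow.flow_sobolev_def Gn_def using Lp_derivative_flow[OF assms(6)] by simp
  have S: "flow.flow_sobolev f G"
    unfolding flow.flow_sobolev_def G_def using Lp_derivative_flow[OF assms(7)] by simp
  have meas: "F \<in> borel_measurable P" if "flow.flow_sobolev F G'" for F G'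
  proof -
    have "(\<lambda>\<omega>. F \<omega> $ j) \<in> borel_measurable P" for j
      using that by (auto simp: flow.flow_sobolev_def flow.flow_deriv_def)
    then show ?thesis by (subst borel_measurable_euclidean_space) (auto simp: Basis_vec_def inner_axis)
  qed
  have limf: "(\<lambda>n. \<integral>\<^sup>+\<omega>. ennreal (\<bar>fn n \<omega> $ j - f \<omega> $ j\<bar> ^ CARD('m)) \<partial>P) \<longlonglongrightarrow> 0" for j
    by (rule Lp_tendsto_power[OF m assms(8)])
  have limG: "(\<lambda>n. \<integral>\<^sup>+\<omega>. ennreal (\<bar>Gn n \<omega> $ j $ i - G \<omega> $ j $ i\<bar> ^ CARD('m)) \<partial>P) \<longlonglongrightarrow> 0" for i j
    using Lp_tendsto_power[OF m assms(9)[of i j]] by (simp add: Gn_def G_def)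
  have det: "det (G \<omega>) \<noteq> 0" if "\<omega> \<in> A" for \<omega>
  proof -
    have "invertible ((\<chi> i j. Df i j \<omega>) :: real^'m^'m)" using that assms(11) by (auto simp: nondegenerate_set_def)
    moreover have "(\<chi> i j. Df i j \<omega>) = transpose (G \<omega>)" by (simp add: transpose_def G_def)
    ultimately show ?thesis by (simp add: invertible_det_nz det_transpose)
  qed
  \<comment> \<open>For every \<open>n\<close> a test function is chosen that attains the variation
    norm up to \<open>1 / (n + 1)\<close>. Convergence in variation is thus reduced to one sequence
    of integrals with varying test functions, the situation of
    \<open>flow_variation\<close>.\<close>
  define R where "R n \<psi> g B \<longleftrightarrow> C1 \<psi> g \<and> (\<forall>x. \<bar>\<psi> x\<bar> \<le> 1) \<and> (\<forall>x. norm (g x) \<le> B) \<and>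
    variation_norm (\<lambda>B. image_on P A (fn n) B - image_on P A f B)
      \<le> ennreal ((\<integral>\<omega>. indicator A \<omega> * (\<psi> (fn n \<omega>) - \<psi> (f \<omega>)) \<partial>P) + inverse (real (Suc n)))"
    for n \<psi> and g :: "real^'m \<Rightarrow> real^'m" and B
  have "\<exists>\<psi> g B. R n \<psi> g B" for n
    unfolding R_def by (intro variation_norm_C1 P.prob_space_axioms meas[OF Sn] meas[OF S] assms(10)) simp
  then obtain \<psi> g B where R: "\<And>n. R n (\<psi> n) (g n) (B n)" by metis
  then have \<psi>: "\<And>n. C1 (\<psi> n) (g n)" "\<And>n x. \<bar>\<psi> n x\<bar> \<le> 1" "\<And>n x. norm (g n x) \<le> B n"
    and V: "\<And>n. variation_norm (\<lambda>B. image_on P A (fn n) B - image_on P A f B)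
      \<le> ennreal ((\<integral>\<omega>. indicator A \<omega> * (\<psi> n (fn n \<omega>) - \<psi> n (f \<omega>)) \<partial>P) + inverse (real (Suc n)))"
    by (simp_all add: R_def)
  have "(\<lambda>n. \<integral>\<omega>. indicator A \<omega> * (\<psi> n (fn n \<omega>) - \<psi> n (f \<omega>)) \<partial>P) \<longlonglongrightarrow> 0"
    by (rule flow.flow_variation[OF Sn S limf limG \<psi> assms(10) det])
  from tendsto_add[OF this LIMSEQ_inverse_real_of_nat]
  have l: "(\<lambda>n. ennreal ((\<integral>\<omega>. indicator A \<omega> * (\<psi> n (fn n \<omega>) - \<psi> n (f \<omega>)) \<partial>P) + inverse (real (Suc n)))) \<longlonglongrightarrow> 0"
    by (simp add: tendsto_ennrealI[where x=0, simplified])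
  show ?thesis unfolding tendsto_in_variation_def
    by (rule tendsto_sandwich[OF _ _ tendsto_const l]) (use V in \<open>auto intro!: always_eventually simp del: of_nat_Suc\<close>)
qed

end
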